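(* Let $\Psi$ be a piecewise linear concave function on the complete fan $\Sigma$ in $N_{\mathbb R}$ with integral slopes and let $g_0$ be a smooth Green function for $\Psi$ on $N_\Sigma$ with $\theta=c_1(\Psi,g_0)$. Then any $\theta$-psh function on $N_\Sigma$ is the pointwise limit of a decreasing sequence of smooth $\theta$-psh functions.
   Context: Tropical toric varieties. $N$ is a free abelian group of finite rank $n$, $M=\mathrm{Hom}(N,\mathbb Z)$, $N_{\mathbb R}=N\otimes\mathbb R$, $\mathbb R_{-\infty}=\mathbb R\cup\{-\infty\}$. A fan $\Sigma$ is a finite polyhedral complex of strictly convex rational polyhedral cones in $N_{\mathbb R}$; complete means support $N_{\mathbb R}$. $N_\Sigma=\coprod_{\sigma\in\Sigma}N(\sigma)$, $N(\sigma)=N_{\mathbb R}/\langle\sigma\rangle_{\mathbb R}$, with quotient maps $\pi_\sigma:N_{\mathbb R}\to N(\sigma)$, $\pi_{\sigma,\tau}:N(\tau)\to N(\sigma)$ for faces $\tau\prec\sigma$; a basis of open neighbourhoods of $p\in N(\sigma)$ is given by $\coprod_{\tau\prec\sigma}\pi_\tau(\Omega+\sigma)$, $\Omega$ bounded open convex in $N_{\mathbb R}$ with $p\in\pi_\sigma(\Omega)$. Lagerberg forms and currents (on open $U\subset N_\Sigma$). On open $W\subset N(\sigma)$, $A^{p,q}(W)=C^\infty(W)\otimes\Lambda^pN(\sigma)^*\otimes\Lambda^qN(\sigma)^*$ with elements $\sum f_{IJ}d'u_I\wedge d''u_J$ and differentials $d',d''$; $J$ is the algebra involution exchanging $d'u,d''u$.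 $A^{p,q}(U)$ consists of families $\alpha_\sigma\in A^{p,q}(U\cap N(\sigma))$ constant towards the boundary: each $x\in U\cap N(\sigma)$ has an open neighbourhood $W$ with $W\cap N(\tau)=(\pi_{\sigma,\tau}|_{W\cap N(\tau)})^{-1}(W\cap N(\sigma))$ and $\alpha_\tau=\pi_{\sigma,\tau}^*\alpha_\sigma$ on $W\cap N(\tau)$ for $\tau\prec\sigma$; smooth functions are elements of $A^{0,0}(U)$. Forms in $A_c^{n,n}(U)$ have compact support in $U\cap N_{\mathbb R}$; $\int f\,d'u_1\wedge d''u_1\wedge\cdots\wedge d'u_n\wedge d''u_n=\int f\,d\lambda$ ($u_i$ a basis of $M$, $N$ of covolume 1). $D^{p,q}(U)$ is the topological dual of $A_c^{n-p,n-q}(U)$. A $(p,p)$-form is positive if it is a finite sum $\sum_j(-1)^{p(p-1)/2}f_j\alpha_j\wedge J(\alpha_j)$, $f_j\ge0$, $\alpha_j$ of type $(p,0)$; $T\in D^{p,p}(U)$ is positive if $T(J\omega)=(-1)^{n-p}T(\omega)$ and $T\ge0$ on positive forms in $A_c^{n-p,n-p}(U)$. A locally integrable $f$ on $U\cap N_{\mathbb R}$ gives $[f]\in D^{0,0}(U)$. Green functions, $\theta$-psh functions. $\Psi$ piecewise linear on $\Sigma$ with integral slopes: for each $\sigma\in\Sigma$ there is $m_\sigma\in M$ with $\Psi|_\sigma=m_\sigma|_\sigma$. A smooth Green function for $\Psi$ on $N_\Sigma$ is $g_0:N_{\mathbb R}\to\mathbb R$ such that for each $\sigma$ and $m_\sigma$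 there are an open neighbourhood $\Omega_\sigma$ of $N(\sigma)$ in $N_\Sigma$ and a smooth function $h_\sigma:\Omega_\sigma\to\mathbb R$ extending $(g_0+m_\sigma)|_{\Omega_\sigma\cap N_{\mathbb R}}$; $c_1(\Psi,g_0)\in D^{1,1}(N_\Sigma)$ equals $d'd''[g_0+m_\sigma]$ on $\Omega_\sigma$. $\varphi:N_\Sigma\to\mathbb R_{-\infty}$ is $\theta$-psh if it is strongly upper semicontinuous (i.e. $\varphi(a)=\limsup_{x\to a,x\notin E}\varphi(x)$ for all $a$ and all $E$ with $E\cap N_{\mathbb R}$ Lebesgue null) and either $\varphi\equiv-\infty$, or $\varphi$ is real-valued and locally integrable on $N_{\mathbb R}$ with $d'd''[\varphi]+\theta$ a positive Lagerberg current on $N_\Sigma$. *)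

theory Defs
  imports "HOL-Analysis.Analysis"
begin

text \<open>
  A basis of the lattice is fixed: $N = \mathbb{Z}^n$ and $N_{\mathbb R} = \mathbb{R}^n$ is the type
  \<open>real ^ 'n\<close> with \<open>n = CARD('n)\<close>.  The dual lattice $M$ is $\mathbb{Z}^n$ too, acting
  through the inner product, and Lebesgue measure gives $N$ covolume 1.
\<close>

definition lattice :: "(real^'n) set" where
  "lattice = {x. \<forall>i. x $ i \<in> \<int>}"

section \<open>Fans\<close>

definition rational_cone :: "(real^'n) set \<Rightarrow> bool" where
  "rational_cone \<sigma> \<longleftrightarrow> (\<exists>S. finite S \<and> S \<subseteq> lattice \<and> \<sigma> = convex_cone hull S)"

definition strictly_convex :: "(real^'n) set \<Rightarrow> bool" where
  "strictly_convex \<sigma> \<longleftrightarrow> (\<forall>x. x \<in> \<sigma> \<and> - x \<in> \<sigma> \<longrightarrow> x = 0)"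

text \<open>The library relation \<open>face_of\<close> also admits the empty face, which is not a face of a cone.\<close>

definition fan :: "(real^'n) set set \<Rightarrow> bool" where
  "fan \<Sigma> \<longleftrightarrow> finite \<Sigma> \<and>
     (\<forall>\<sigma>\<in>\<Sigma>. rational_cone \<sigma> \<and> strictly_convex \<sigma>) \<and>
     (\<forall>\<sigma>\<in>\<Sigma>. \<forall>\<tau>. \<tau> face_of \<sigma> \<and> \<tau> \<noteq> {} \<longrightarrow> \<tau> \<in> \<Sigma>) \<and>
     (\<forall>\<sigma>\<in>\<Sigma>. \<forall>\<tau>\<in>\<Sigma>. (\<sigma> \<inter> \<tau>) face_of \<sigma> \<and> (\<sigma> \<inter> \<tau>) face_of \<tau>)"

definition complete_fan :: "(real^'n) set set \<Rightarrow> bool" where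
  "complete_fan \<Sigma> \<longleftrightarrow> fan \<Sigma> \<and> \<Union>\<Sigma> = UNIV"

section \<open>The tropical toric variety\<close>

text \<open>
  A point of $N(\sigma) = N_{\mathbb R}/\langle\sigma\rangle$ is a coset of the span of \<open>\<sigma>\<close>.
  The points of $N_\Sigma$ carry the cone as a tag, since different cones may have the same span.
  The open stratum $N_{\mathbb R}$ is $N(\{0\})$.
\<close>

type_synonym 'n pt = "(real^'n) set \<times> (real^'n) set"

definition coset :: "(real^'n) set \<Rightarrow> real^'n \<Rightarrow> (real^'n) set" where
  "coset \<sigma> x = (\<lambda>v. x + v) ` span \<sigma>"

definition quot_map :: "(real^'n) set \<Rightarrow> (real^'n) set \<Rightarrow> (real^'n) set" where
  "quot_map \<sigma> D = {x + v |x v. x \<in> D \<and> v \<in> span \<sigma>}"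

definition trop_var :: "(real^'n) set set \<Rightarrow> 'n pt set" where
  "trop_var \<Sigma> = {(\<sigma>, coset \<sigma> x) |\<sigma> x. \<sigma> \<in> \<Sigma>}"

definition emb :: "real^'n \<Rightarrow> 'n pt" where
  "emb x = ({0}, coset {0} x)"

definition basic_nbhd :: "(real^'n) set set \<Rightarrow> (real^'n) set \<Rightarrow> (real^'n) set \<Rightarrow> 'n pt set" where
  "basic_nbhd \<Sigma> \<sigma> \<Omega> = {(\<tau>, coset \<tau> (w + s)) |\<tau> w s. \<tau> \<in> \<Sigma> \<and> \<tau> face_of \<sigma> \<and> w \<in> \<Omega> \<and> s \<in> \<sigma>}"

definition trop_topology :: "(real^'n) set set \<Rightarrow> 'n pt topology" where
  "trop_topology \<Sigma> = topology_generated_by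
     {basic_nbhd \<Sigma> \<sigma> \<Omega> |\<sigma> \<Omega>. \<sigma> \<in> \<Sigma> \<and> bounded \<Omega> \<and> open \<Omega> \<and> convex \<Omega>}"

section \<open>Lagerberg forms\<close>

text \<open>
  An element of $\Lambda^p N(\sigma)^* \otimes \Lambda^q N(\sigma)^*$ is a function of a list of
  \<open>p\<close> and a list of \<open>q\<close> vectors, multilinear and alternating in each list.  The space
  $N(\sigma)^*$ is the annihilator of the span of \<open>\<sigma>\<close> in the dual of $N_{\mathbb R}$, so
  covectors live on $N_{\mathbb R}$, vanish on the span, and pullback along quotient maps does not
  change them.  The element $d'u_I \wedge d''u_J$, with all $d'$ in front of all $d''$, is the
  product of $\det (u_i(v_k))_{i \in I, k}$ and $\det (u_j(w_k))_{j \in J, k}$.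
\<close>

type_synonym 'n covec = "(real^'n) list \<Rightarrow> (real^'n) list \<Rightarrow> real"
type_synonym 'n form = "'n pt \<Rightarrow> 'n covec"

definition covector :: "nat \<Rightarrow> nat \<Rightarrow> (real^'n) set \<Rightarrow> 'n covec \<Rightarrow> bool" where
  "covector p q \<sigma> a \<longleftrightarrow>
     (\<forall>vs ws. length vs \<noteq> p \<or> length ws \<noteq> q \<longrightarrow> a vs ws = 0) \<and>
     (\<forall>vs ws k. k < length vs \<longrightarrow> linear (\<lambda>v. a (vs[k := v]) ws)) \<and>
     (\<forall>vs ws k. k < length ws \<longrightarrow> linear (\<lambda>w. a vs (ws[k := w]))) \<and>
     (\<forall>vs ws. \<not> distinct vs \<or> \<not> distinct ws \<longrightarrow> a vs ws = 0) \<and>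
     (\<forall>vs ws. (set vs \<union> set ws) \<inter> span \<sigma> \<noteq> {} \<longrightarrow> a vs ws = 0)"

fun iter_deriv :: "(real^'n) list \<Rightarrow> (real^'n \<Rightarrow> real) \<Rightarrow> real^'n \<Rightarrow> real" where
  "iter_deriv [] f x = f x"
| "iter_deriv (u # us) f x = frechet_derivative (iter_deriv us f) (at x) u"

text \<open>Meant for open sets \<open>S\<close>.\<close>

definition smooth_on :: "(real^'n) set \<Rightarrow> (real^'n \<Rightarrow> real) \<Rightarrow> bool" where
  "smooth_on S f \<longleftrightarrow> (\<forall>us. \<forall>x\<in>S. iter_deriv us f differentiable (at x))"

text \<open>
  The two conditions on the neighbourhood \<open>W\<close> of a point of $N(\sigma)$: on each stratum
  $N(\tau)$, $\tau \prec \sigma$, it is mapped into itself by $\pi_{\sigma,\tau}$, and there the form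
  is the pullback of its restriction to $N(\sigma)$.
\<close>

definition const_towards ::
    "(real^'n) set set \<Rightarrow> (real^'n) set \<Rightarrow> 'n pt set \<Rightarrow> 'n form \<Rightarrow> bool" where
  "const_towards \<Sigma> \<sigma> W \<alpha> \<longleftrightarrow> (\<forall>\<tau>\<in>\<Sigma>. \<tau> face_of \<sigma> \<longrightarrow>
     (\<forall>D. (\<tau>, D) \<in> W \<longrightarrow> (\<sigma>, quot_map \<sigma> D) \<in> W \<and> \<alpha> (\<tau>, D) = \<alpha> (\<sigma>, quot_map \<sigma> D)))"

text \<open>
  Forms on \<open>U\<close> are extended by zero to all points.  A function on an open part of $N(\sigma)$ is
  smooth iff its pullback to $N_{\mathbb R}$ is.
\<close>

definition lagerberg_forms ::
    "(real^'n) set set \<Rightarrow> 'n pt set \<Rightarrow> nat \<Rightarrow> nat \<Rightarrow> 'n form set" where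
  "lagerberg_forms \<Sigma> U p q = {\<alpha>.
     (\<forall>P. P \<notin> U \<longrightarrow> \<alpha> P = (\<lambda>vs ws. 0)) \<and>
     (\<forall>\<sigma> D. (\<sigma>, D) \<in> U \<longrightarrow> covector p q \<sigma> (\<alpha> (\<sigma>, D))) \<and>
     (\<forall>\<sigma>\<in>\<Sigma>. \<forall>vs ws. smooth_on {x. (\<sigma>, coset \<sigma> x) \<in> U} (\<lambda>x. \<alpha> (\<sigma>, coset \<sigma> x) vs ws)) \<and>
     (\<forall>\<sigma> D. (\<sigma>, D) \<in> U \<longrightarrow>
        (\<exists>W. openin (trop_topology \<Sigma>) W \<and> (\<sigma>, D) \<in> W \<and> W \<subseteq> U \<and> const_towards \<Sigma> \<sigma> W \<alpha>))}"

definition smooth_function :: "(real^'n) set set \<Rightarrow> 'n pt set \<Rightarrow> ('n pt \<Rightarrow> real) \<Rightarrow> bool" where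
  "smooth_function \<Sigma> U h \<longleftrightarrow>
     (\<lambda>P vs ws. if P \<in> U \<and> vs = [] \<and> ws = [] then h P else 0) \<in> lagerberg_forms \<Sigma> U 0 0"

definition supported_in :: "'n form \<Rightarrow> 'n pt set \<Rightarrow> bool" where
  "supported_in \<alpha> K \<longleftrightarrow> (\<forall>P. P \<notin> K \<longrightarrow> \<alpha> P = (\<lambda>vs ws. 0))"

definition test_forms ::
    "(real^'n) set set \<Rightarrow> 'n pt set \<Rightarrow> nat \<Rightarrow> nat \<Rightarrow> 'n form set" where
  "test_forms \<Sigma> U p q = {\<alpha> \<in> lagerberg_forms \<Sigma> U p q.
     \<exists>K. compactin (trop_topology \<Sigma>) K \<and> K \<subseteq> U \<and> supported_in \<alpha> K}"

text \<open>
  Derivative of the coefficients in the direction \<open>v\<close>, computed on the pullback to $N_{\mathbb R}$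
  at any representative of the point.
\<close>

definition dir_deriv :: "real^'n \<Rightarrow> 'n form \<Rightarrow> 'n form" where
  "dir_deriv v \<alpha> = (\<lambda>(\<sigma>, D) vs ws.
     frechet_derivative (\<lambda>x. \<alpha> (\<sigma>, coset \<sigma> x) vs ws) (at (SOME x. x \<in> D)) v)"

definition omit :: "nat \<Rightarrow> 'a list \<Rightarrow> 'a list" where
  "omit k xs = take k xs @ drop (Suc k) xs"

text \<open>The sign $(-1)^p$ in \<open>d''\<close> comes from moving $d''u_i$ past the \<open>p\<close> factors $d'u_I$.\<close>

definition d1 :: "('n::finite) pt set \<Rightarrow> 'n form \<Rightarrow> 'n form" where
  "d1 U \<alpha> = (\<lambda>P vs ws. if P \<in> U
     then \<Sum>k<length vs. (-1) ^ k * dir_deriv (vs ! k) \<alpha> P (omit k vs) ws else 0)"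

definition d2 :: "('n::finite) pt set \<Rightarrow> 'n form \<Rightarrow> 'n form" where
  "d2 U \<alpha> = (\<lambda>P vs ws. if P \<in> U
     then (-1) ^ length vs * (\<Sum>k<length ws. (-1) ^ k * dir_deriv (ws ! k) \<alpha> P vs (omit k ws))
     else 0)"

text \<open>The sign is that of $d''u_I \wedge d'u_J = (-1)^{pq}\, d'u_J \wedge d''u_I$.\<close>

definition form_J :: "('n::finite) form \<Rightarrow> 'n form" where
  "form_J \<alpha> = (\<lambda>P vs ws. (-1) ^ (length vs * length ws) * \<alpha> P ws vs)"

text \<open>Wedge product of a form of type \<open>(p, 0)\<close> with a form of type \<open>(0, q)\<close>.\<close>

definition wedge_pure :: "('n::finite) form \<Rightarrow> 'n form \<Rightarrow> 'n form" where
  "wedge_pure \<alpha> \<beta> = (\<lambda>P vs ws. \<alpha> P vs [] * \<beta> P [] ws)"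

definition positive_form ::
    "(real^'n) set set \<Rightarrow> 'n pt set \<Rightarrow> nat \<Rightarrow> 'n form \<Rightarrow> bool" where
  "positive_form \<Sigma> U p \<omega> \<longleftrightarrow> \<omega> \<in> lagerberg_forms \<Sigma> U p p \<and>
     (\<exists>(m::nat) f \<alpha>.
        (\<forall>j<m. smooth_function \<Sigma> U (f j) \<and> (\<forall>P\<in>U. 0 \<le> f j P) \<and>
               \<alpha> j \<in> lagerberg_forms \<Sigma> U p 0) \<and>
        \<omega> = (\<lambda>P vs ws. \<Sum>j<m. (-1) ^ (p * (p - 1) div 2) * f j P *
                              wedge_pure (\<alpha> j) (form_J (\<alpha> j)) P vs ws))"

section \<open>Integration and currents\<close>

definition basis_list :: "(real^'n) list" where
  "basis_list = (SOME es. distinct es \<and> set es = Basis)"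

text \<open>
  Integral over $N_{\mathbb R}$ of a form of type \<open>(n, n)\<close>.  The sign reorders
  $d'u_1 \wedge d''u_1 \wedge \dots \wedge d'u_n \wedge d''u_n$ into
  $d'u_1 \wedge \dots \wedge d'u_n \wedge d''u_1 \wedge \dots \wedge d''u_n$.  The order chosen in
  \<open>basis_list\<close> is irrelevant, because it enters in both arguments.
\<close>

definition form_integral :: "(real^'n \<Rightarrow> 'n covec) \<Rightarrow> real" where
  "form_integral \<eta> =
     (-1) ^ (CARD('n) * (CARD('n) - 1) div 2) * (LINT x|lebesgue. \<eta> x basis_list basis_list)"

type_synonym 'n functional = "'n form \<Rightarrow> real"

text \<open>
  The space of test forms is the locally convex inductive limit of the Frechet spaces of forms which
  are supported in a fixed compact set and are constant towards the boundary on a fixed system of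
  neighbourhoods, with the topology of uniform convergence of all derivatives of the coefficients.
  (It suffices to control these on the dense stratum $N_{\mathbb R}$.)  Hence a linear functional is
  continuous iff it is sequentially continuous at 0 on each of these steps.
\<close>

definition null_sequence ::
    "(real^'n) set set \<Rightarrow> 'n pt set \<Rightarrow> nat \<Rightarrow> nat \<Rightarrow> (nat \<Rightarrow> 'n form) \<Rightarrow> bool" where
  "null_sequence \<Sigma> U p q \<omega> \<longleftrightarrow>
     (\<forall>k. \<omega> k \<in> lagerberg_forms \<Sigma> U p q) \<and>
     (\<exists>K. compactin (trop_topology \<Sigma>) K \<and> K \<subseteq> U \<and> (\<forall>k. supported_in (\<omega> k) K)) \<and>
     (\<forall>\<sigma> D. (\<sigma>, D) \<in> U \<longrightarrow>
        (\<exists>W. openin (trop_topology \<Sigma>) W \<and> (\<sigma>, D) \<in> W \<and> W \<subseteq> U \<and>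
             (\<forall>k. const_towards \<Sigma> \<sigma> W (\<omega> k)))) \<and>
     (\<forall>us vs ws. uniform_limit UNIV
        (\<lambda>k. iter_deriv us (\<lambda>x. \<omega> k (emb x) vs ws)) (\<lambda>x. 0) sequentially)"

text \<open>
  \<open>current \<Sigma> U p q T\<close> says that \<open>T\<close> lies in $D^{p,q}(U)$.  Only the values on test
  forms on \<open>U\<close> matter; as these are extended by zero, restricting \<open>T\<close> to a smaller open set
  does not change the function.
\<close>

definition current ::
    "(real^'n) set set \<Rightarrow> 'n pt set \<Rightarrow> nat \<Rightarrow> nat \<Rightarrow> 'n functional \<Rightarrow> bool" where
  "current \<Sigma> U p q T \<longleftrightarrow> p \<le> CARD('n) \<and> q \<le> CARD('n) \<and>
     (\<forall>\<omega> \<in> test_forms \<Sigma> U (CARD('n) - p) (CARD('n) - q).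
      \<forall>\<eta> \<in> test_forms \<Sigma> U (CARD('n) - p) (CARD('n) - q). \<forall>a b.
        T (\<lambda>P vs ws. a * \<omega> P vs ws + b * \<eta> P vs ws) = a * T \<omega> + b * T \<eta>) \<and>
     (\<forall>\<omega>. null_sequence \<Sigma> U (CARD('n) - p) (CARD('n) - q) \<omega> \<longrightarrow> (\<lambda>k. T (\<omega> k)) \<longlonglongrightarrow> 0)"

definition positive_current ::
    "(real^'n) set set \<Rightarrow> 'n pt set \<Rightarrow> nat \<Rightarrow> 'n functional \<Rightarrow> bool" where
  "positive_current \<Sigma> U p T \<longleftrightarrow> current \<Sigma> U p p T \<and>
     (\<forall>\<omega> \<in> test_forms \<Sigma> U (CARD('n) - p) (CARD('n) - p).
        T (form_J \<omega>) = (-1) ^ (CARD('n) - p) * T \<omega> \<and>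
        (positive_form \<Sigma> U (CARD('n) - p) \<omega> \<longrightarrow> 0 \<le> T \<omega>))"

definition function_current :: "(real^'n \<Rightarrow> real) \<Rightarrow> 'n functional" where
  "function_current f \<omega> = form_integral (\<lambda>x vs ws. f x * \<omega> (emb x) vs ws)"

text \<open>Differentials of a current of type \<open>(p, q)\<close>, extending those of forms.\<close>

definition current_d1 :: "('n::finite) pt set \<Rightarrow> nat \<Rightarrow> nat \<Rightarrow> 'n functional \<Rightarrow> 'n functional" where
  "current_d1 U p q T = (\<lambda>\<omega>. (-1) ^ (p + q + 1) * T (d1 U \<omega>))"

definition current_d2 :: "('n::finite) pt set \<Rightarrow> nat \<Rightarrow> nat \<Rightarrow> 'n functional \<Rightarrow> 'n functional" where
  "current_d2 U p q T = (\<lambda>\<omega>. (-1) ^ (p + q + 1) * T (d2 U \<omega>))"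

definition ddc :: "'n pt set \<Rightarrow> (real^'n \<Rightarrow> real) \<Rightarrow> 'n functional" where
  "ddc U f = current_d1 U 0 1 (current_d2 U 0 0 (function_current f))"

section \<open>Green functions\<close>

definition slope_on :: "(real^'n \<Rightarrow> real) \<Rightarrow> (real^'n) set \<Rightarrow> real^'n \<Rightarrow> bool" where
  "slope_on \<Psi> \<sigma> m \<longleftrightarrow> m \<in> lattice \<and> (\<forall>x\<in>\<sigma>. \<Psi> x = m \<bullet> x)"

definition piecewise_linear :: "(real^'n) set set \<Rightarrow> (real^'n \<Rightarrow> real) \<Rightarrow> bool" where
  "piecewise_linear \<Sigma> \<Psi> \<longleftrightarrow> (\<forall>\<sigma>\<in>\<Sigma>. \<exists>m. slope_on \<Psi> \<sigma> m)"

definition green_extension ::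
    "(real^'n) set set \<Rightarrow> (real^'n \<Rightarrow> real) \<Rightarrow> (real^'n) set \<Rightarrow> real^'n \<Rightarrow>
     'n pt set \<Rightarrow> ('n pt \<Rightarrow> real) \<Rightarrow> bool" where
  "green_extension \<Sigma> g \<sigma> m \<Omega> h \<longleftrightarrow>
     openin (trop_topology \<Sigma>) \<Omega> \<and> (\<forall>x. (\<sigma>, coset \<sigma> x) \<in> \<Omega>) \<and>
     smooth_function \<Sigma> \<Omega> h \<and> (\<forall>x. emb x \<in> \<Omega> \<longrightarrow> h (emb x) = g x + m \<bullet> x)"

definition smooth_green ::
    "(real^'n) set set \<Rightarrow> (real^'n \<Rightarrow> real) \<Rightarrow> (real^'n \<Rightarrow> real) \<Rightarrow> bool" where
  "smooth_green \<Sigma> \<Psi> g \<longleftrightarrow>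
     (\<forall>\<sigma>\<in>\<Sigma>. \<forall>m. slope_on \<Psi> \<sigma> m \<longrightarrow> (\<exists>\<Omega> h. green_extension \<Sigma> g \<sigma> m \<Omega> h))"

text \<open>
  The defining property of $\theta = c_1(\Psi, g)$, which determines the values of \<open>\<theta>\<close> on
  test forms; equality of currents on \<open>\<Omega>\<close> is equality on test forms on \<open>\<Omega>\<close>.
\<close>

definition is_c1 ::
    "(real^'n) set set \<Rightarrow> (real^'n \<Rightarrow> real) \<Rightarrow> (real^'n \<Rightarrow> real) \<Rightarrow> 'n functional \<Rightarrow> bool" where
  "is_c1 \<Sigma> \<Psi> g \<theta> \<longleftrightarrow> current \<Sigma> (trop_var \<Sigma>) 1 1 \<theta> \<and>
     (\<forall>\<sigma>\<in>\<Sigma>. \<forall>m \<Omega> h. slope_on \<Psi> \<sigma> m \<and> green_extension \<Sigma> g \<sigma> m \<Omega> h \<longrightarrow>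
        (\<forall>\<omega> \<in> test_forms \<Sigma> \<Omega> (CARD('n) - 1) (CARD('n) - 1).
           \<theta> \<omega> = ddc \<Omega> (\<lambda>x. g x + m \<bullet> x) \<omega>))"

section \<open>Plurisubharmonic functions\<close>

text \<open>
  Functions to $\mathbb{R}_{-\infty}$ are \<open>ereal\<close>-valued functions avoiding \<open>\<infinity>\<close> on
  $N_\Sigma$.
\<close>

definition strongly_usc :: "(real^'n) set set \<Rightarrow> ('n pt \<Rightarrow> ereal) \<Rightarrow> bool" where
  "strongly_usc \<Sigma> \<phi> \<longleftrightarrow>
     (\<forall>a \<in> trop_var \<Sigma>. \<forall>E. {x. emb x \<in> E} \<in> null_sets lebesgue \<longrightarrow>
        \<phi> a = Limsup (inf (nhdsin (trop_topology \<Sigma>) a) (principal (- E))) \<phi>)"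

definition locally_integrable :: "(real^'n \<Rightarrow> real) \<Rightarrow> bool" where
  "locally_integrable f \<longleftrightarrow> (\<forall>K. compact K \<longrightarrow> set_integrable lebesgue K f)"

definition theta_psh ::
    "(real^'n) set set \<Rightarrow> 'n functional \<Rightarrow> ('n pt \<Rightarrow> ereal) \<Rightarrow> bool" where
  "theta_psh \<Sigma> \<theta> \<phi> \<longleftrightarrow>
     (\<forall>P \<in> trop_var \<Sigma>. \<phi> P \<noteq> \<infinity>) \<and> strongly_usc \<Sigma> \<phi> \<and>
     ((\<forall>P \<in> trop_var \<Sigma>. \<phi> P = -\<infinity>) \<or>
      (\<forall>x. \<phi> (emb x) \<noteq> -\<infinity>) \<and>
      locally_integrable (\<lambda>x. real_of_ereal (\<phi> (emb x))) \<and>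
      positive_current \<Sigma> (trop_var \<Sigma>) 1
        (\<lambda>\<omega>. ddc (trop_var \<Sigma>) (\<lambda>x. real_of_ereal (\<phi> (emb x))) \<omega> + \<theta> \<omega>))"

end

theory Submission
  imports Defs "HOL-Computational_Algebra.Polynomial"
begin

text \<open>
  Put \<open>u = \<phi> + g0\<close> on $N_{\mathbb R}$ and \<open>H = - \<Psi>\<close>, a convex function that is linear on each cone and
  hence sublinear.  Up to the addition of the Green function, a \<open>\<theta>\<close>-psh function is a convex
  function \<open>u\<close> on $N_{\mathbb R}$ with \<open>u (x + s) \<le> u x + H s\<close>, and such functions are easy to regularise.

  From \<open>\<theta>\<close>-psh to convex (\<open>u_convex\<close>, \<open>u_le\<close>).  Testing positivity on $\alpha \wedge J\alpha$ with
  \<open>\<alpha> = \<kappa> \<cdot> \<iota>\<close>, where \<open>\<iota>\<close> is the contraction of the volume form with a vector \<open>v\<close>, shows that the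
  second distributional derivative of \<open>u\<close> in direction \<open>v\<close> is nonnegative on squares \<open>\<kappa>\<^sup>2\<close>.  Hence
  convolutions of \<open>u\<close> with squares, then means of \<open>u\<close> over boxes, are convex, and by Lebesgue
  differentiation \<open>u\<close> is convex off a null set.  Strong upper semicontinuity removes the null set.
  Upper semicontinuity at the boundary points bounds \<open>\<phi>\<close> from above along each cone, so \<open>u\<close> grows
  there at most like \<open>H\<close>; a convex function with this growth satisfies the inequality above.

  From convex to \<open>\<theta>\<close>-psh (\<open>theta_psh_of_convex\<close>).  On test forms \<open>\<omega>\<close> of bidegree $(n-1,n-1)$ the current
  \<open>\<theta>\<close> is integration of the Hessian of \<open>g0\<close> against \<open>\<omega>\<close> over $N_{\mathbb R}$ (\<open>theta_hess\<close>).  By bump functions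
  on $N_\Sigma$ this is a local statement; locally it is integration by parts (\<open>ddc_eq_hess\<close>).  No
  boundary terms occur, although compact subsets of $N_\Sigma$ may be unbounded in $N_{\mathbb R}$: near a boundary
  stratum all forms come from a quotient of smaller dimension, so a form of degree \<open>n\<close> in the
  \<open>d'\<close> or in the \<open>d''\<close> variables vanishes (\<open>wedge1_top_zero\<close>, \<open>bounded_trace\<close>).  If \<open>w\<close> is smooth and
  convex and \<open>w - g0\<close> is eventually invariant under each cone, then \<open>w - g0\<close> extends to a smooth
  function on $N_\Sigma$, and its current plus \<open>\<theta>\<close> is given by the positive semidefinite Hessian of \<open>w\<close>.

  Regularisation (\<open>approximation\<close>).  The infimal convolution \<open>v k\<close> of \<open>H\<close> with the restriction of \<open>u\<close> to the
  ball of radius \<open>k\<close> is convex, decreases with \<open>k\<close>, agrees with \<open>u\<close> on that ball, and differs from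
  \<open>H\<close> by a function that is eventually invariant under each cone.  Mollification at scale \<open>2\<^sup>-\<^sup>k\<close>,
  corrected by a constant of order \<open>2\<^sup>-\<^sup>k\<close> to keep the sequence decreasing, makes it smooth.
  The function \<open>v k\<close> so modified, minus \<open>g0\<close>, extends to the \<open>k\<close>-th approximant.  Its
  convergence at a boundary point of the stratum of \<open>\<sigma>\<close> follows from that on $N_{\mathbb R}$, because the
  approximants do not increase far along \<open>\<sigma>\<close> and \<open>\<phi>\<close> is strongly upper semicontinuous.
\<close>

section \<open>Smooth functions on Euclidean space\<close>

abbreviation smooth :: "(real^'n \<Rightarrow> real) \<Rightarrow> bool" where
  "smooth \<equiv> smooth_on UNIV"

definition dirv :: "real^'n \<Rightarrow> (real^'n \<Rightarrow> real) \<Rightarrow> real^'n \<Rightarrow> real" where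
  "dirv u f = (\<lambda>x. frechet_derivative f (at x) u)"

lemma iter_deriv_Cons: "iter_deriv (u # us) f = dirv u (iter_deriv us f)"
  by (simp add: dirv_def fun_eq_iff)

lemma iter_deriv_Nil: "iter_deriv [] f = f"
  by (simp add: fun_eq_iff)

lemma iter_deriv_snoc: "iter_deriv (us @ [u]) f = iter_deriv us (dirv u f)"
  by (induction us) (simp_all add: iter_deriv_Cons iter_deriv_Nil del: iter_deriv.simps)

text \<open>
  Iterated derivatives never have to be computed: smoothness is the greatest property that implies
  differentiability and is inherited by directional derivatives.
\<close>

lemma smooth_coinduct:
  assumes "f \<in> F" and "\<And>f x. f \<in> F \<Longrightarrow> f differentiable (at x)"
    and "\<And>f u. f \<in> F \<Longrightarrow> dirv u f \<in> F"
  shows "smooth f"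
proof -
  have "iter_deriv us f \<in> F" for us
    by (induction us) (use assms(1,3) in \<open>simp_all add: iter_deriv_Cons iter_deriv_Nil del: iter_deriv.simps\<close>)
  then show ?thesis
    using assms(2) by (auto simp: smooth_on_def)
qed

lemma smooth_dirv: "smooth f \<Longrightarrow> smooth (dirv u f)"
  unfolding smooth_on_def by (metis iter_deriv_snoc)

lemma smooth_differentiable: "smooth f \<Longrightarrow> f differentiable (at x)"
  unfolding smooth_on_def by (metis UNIV_I iter_deriv_Nil)

lemma smooth_has_derivative: "smooth f \<Longrightarrow> (f has_derivative (\<lambda>u. dirv u f x)) (at x)"
  unfolding dirv_def by (metis frechet_derivative_works smooth_differentiable eta_contract_eq)

lemma dirv_eqI: "(f has_derivative f') (at x) \<Longrightarrow> dirv u f x = f' u"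
  unfolding dirv_def using frechet_derivative_at by metis

lemma smooth_continuous: "smooth f \<Longrightarrow> continuous_on A f"
  by (meson continuous_at_imp_continuous_on differentiable_imp_continuous_within smooth_differentiable)

lemma smooth_on_subset: "smooth_on T f \<Longrightarrow> S \<subseteq> T \<Longrightarrow> smooth_on S f"
  unfolding smooth_on_def by blast

lemma linear_dirv: "smooth f \<Longrightarrow> linear (\<lambda>u. dirv u f x)"
  using smooth_has_derivative has_derivative_linear by blast

text \<open>
  The closure of the smooth functions under sums, products and composition with one-variable functions is
  stable under directional derivatives. Coinduction therefore gives all these closure properties at once,
  without higher Leibniz and chain rules. A smooth function of one variable is given with its derivatives:
  \<open>D k\<close> is the \<open>k\<close>-th derivative of \<open>D 0\<close>.
\<close>

inductive_set smooth_algebra :: "(real^'n \<Rightarrow> real) set" where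
  base: "smooth f \<Longrightarrow> f \<in> smooth_algebra"
| add: "f \<in> smooth_algebra \<Longrightarrow> g \<in> smooth_algebra \<Longrightarrow> (\<lambda>x. f x + g x) \<in> smooth_algebra"
| mult: "f \<in> smooth_algebra \<Longrightarrow> g \<in> smooth_algebra \<Longrightarrow> (\<lambda>x. f x * g x) \<in> smooth_algebra"
| comp: "smooth f \<Longrightarrow> (\<And>k t. ((D::nat \<Rightarrow> real \<Rightarrow> real) k has_real_derivative D (Suc k) t) (at t)) \<Longrightarrow>
    (\<lambda>x. D k (f x)) \<in> smooth_algebra"

lemma smooth_algebra_derivative:
  "f \<in> smooth_algebra \<Longrightarrow> \<exists>f'. (\<forall>u. (\<lambda>x. f' x u) \<in> smooth_algebra) \<and> (\<forall>x. (f has_derivative f' x) (at x))"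
proof (induction rule: smooth_algebra.induct)
  case (base f)
  then show ?case
    by (intro exI[of _ "\<lambda>x u. dirv u f x"])
       (auto intro!: smooth_has_derivative smooth_algebra.base smooth_dirv)
next
  case (add f g)
  then obtain f' g' where
    "\<forall>u. (\<lambda>x. f' x u) \<in> smooth_algebra" "\<forall>x. (f has_derivative f' x) (at x)"
    "\<forall>u. (\<lambda>x. g' x u) \<in> smooth_algebra" "\<forall>x. (g has_derivative g' x) (at x)" by blast
  then show ?case
    by (intro exI[of _ "\<lambda>x u. f' x u + g' x u"])
       (auto intro!: smooth_algebra.add has_derivative_add)
next
  case (mult f g)
  then obtain f' g' where
    "\<forall>u. (\<lambda>x. f' x u) \<in> smooth_algebra" "\<forall>x. (f has_derivative f' x) (at x)"
    "\<forall>u. (\<lambda>x. g' x u) \<in> smooth_algebra" "\<forall>x. (g has_derivative g' x) (at x)" by blast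
  with mult.hyps show ?case
    by (intro exI[of _ "\<lambda>x u. f x * g' x u + f' x u * g x"])
       (auto intro!: smooth_algebra.add smooth_algebra.mult has_derivative_mult)
next
  case (comp f D k)
  have "((\<lambda>x. D k (f x)) has_derivative (\<lambda>u. D (Suc k) (f x) * dirv u f x)) (at x)" for x
    using has_derivative_compose[OF smooth_has_derivative[OF comp(1)]
        comp(2)[unfolded has_field_derivative_def]] .
  with comp show ?case
    by (intro exI[of _ "\<lambda>x u. D (Suc k) (f x) * dirv u f x"] conjI allI
          smooth_algebra.mult smooth_algebra.comp[of f D "Suc k"] smooth_algebra.base smooth_dirv) auto
qed

lemma smooth_algebra_smooth: "f \<in> smooth_algebra \<Longrightarrow> smooth f"
proof (erule smooth_coinduct)
  fix f :: "real^'n \<Rightarrow> real" and x u assume "f \<in> smooth_algebra"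
  then obtain f' where f': "\<forall>u. (\<lambda>x. f' x u) \<in> smooth_algebra" "\<forall>x. (f has_derivative f' x) (at x)"
    using smooth_algebra_derivative by blast
  then show "f differentiable (at x)" by (auto simp: differentiable_def)
  have "dirv u f = (\<lambda>x. f' x u)" using f' by (auto simp: dirv_eqI fun_eq_iff)
  then show "dirv u f \<in> smooth_algebra" using f' by simp
qed

lemma smooth_add: "smooth f \<Longrightarrow> smooth g \<Longrightarrow> smooth (\<lambda>x. f x + g x)"
  and smooth_mult: "smooth f \<Longrightarrow> smooth g \<Longrightarrow> smooth (\<lambda>x. f x * g x)"
  by (simp_all add: smooth_algebra.intros smooth_algebra_smooth)

lemma smooth_comp:
  assumes "smooth f" and "\<And>k t. ((D::nat \<Rightarrow> real \<Rightarrow> real) k has_real_derivative D (Suc k) t) (at t)"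
  shows "smooth (\<lambda>x. D k (f x))"
  by (rule smooth_algebra_smooth, rule smooth_algebra.comp[of f D k]) (use assms in auto)

lemma smooth_const: "smooth (\<lambda>x. c)"
proof (rule smooth_coinduct[where F = "range (\<lambda>c x. c)"])
  show "dirv u f \<in> range (\<lambda>c x. c)" if "f \<in> range (\<lambda>c x. c)" for f :: "real^'n \<Rightarrow> real" and u
  proof -
    obtain c where "f = (\<lambda>x. c)" using \<open>f \<in> _\<close> by blast
    then have "dirv u f = (\<lambda>x. 0)"
      using dirv_eqI[OF has_derivative_const, of u c] by auto
    then show ?thesis by simp
  qed
qed auto

lemma smooth_linear:
  assumes "linear f" shows "smooth f"
proof (rule smooth_coinduct[where F = "insert f {f. smooth f}"])
  have d: "(f has_derivative f) (at x)" for x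
    using assms linear_conv_bounded_linear bounded_linear_imp_has_derivative by blast
  show "g differentiable (at x)" if "g \<in> insert f {f. smooth f}" for g x
    using that d smooth_differentiable by (auto simp: differentiable_def)
  show "dirv u g \<in> insert f {f. smooth f}" if "g \<in> insert f {f. smooth f}" for g u
  proof (cases "g = f")
    case True
    have "dirv u f = (\<lambda>x. f u)" by (simp add: dirv_eqI[OF d] fun_eq_iff)
    then show ?thesis using True smooth_const by auto
  next
    case False
    with that show ?thesis by (simp add: smooth_dirv)
  qed
qed simp

lemma smooth_cmult: "smooth f \<Longrightarrow> smooth (\<lambda>x. c * f x)"
  by (rule smooth_mult[OF smooth_const])

lemma smooth_diff: "smooth f \<Longrightarrow> smooth g \<Longrightarrow> smooth (\<lambda>x. f x - g x)"
  using smooth_add[OF _ smooth_cmult[of g "-1"], of f] by simp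

lemma smooth_sum: "(\<And>i. i \<in> I \<Longrightarrow> smooth (f i)) \<Longrightarrow> smooth (\<lambda>x. \<Sum>i\<in>I. f i x)"
  by (induction I rule: infinite_finite_induct) (auto intro: smooth_const smooth_add)

lemma smooth_prod: "(\<And>i. i \<in> I \<Longrightarrow> smooth (f i)) \<Longrightarrow> smooth (\<lambda>x. \<Prod>i\<in>I. f i x)"
  by (induction I rule: infinite_finite_induct) (auto intro: smooth_const smooth_mult)

lemma smooth_inner: "smooth (\<lambda>x. m \<bullet> x)"
  by (rule smooth_linear) (simp add: bounded_linear.linear bounded_linear_inner_right)

lemma smooth_component: "smooth (\<lambda>x. x $ i)"
  by (rule smooth_linear) (simp add: linear_iff)

lemma dirv_reflect:
  assumes "smooth f"
  shows "dirv u (\<lambda>x. f (c - x)) x = - dirv u f (c - x)"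
proof -
  have "((\<lambda>x. c - x) has_derivative (\<lambda>u. - u)) (at x)"
    by (auto intro!: derivative_eq_intros)
  from has_derivative_compose[OF this smooth_has_derivative[OF assms]]
  have "((\<lambda>x. f (c - x)) has_derivative (\<lambda>u. dirv (- u) f (c - x))) (at x)" .
  then show ?thesis
    using linear_neg[OF linear_dirv[OF assms]] by (simp add: dirv_eqI)
qed

lemma smooth_reflect:
  fixes f :: "real^'n \<Rightarrow> real"
  assumes "smooth f"
  shows "smooth (\<lambda>x. f (c - x))"
proof (rule smooth_coinduct[where F = "{\<lambda>x. f (c - x) |f. smooth f}"])
  fix g :: "real^'n \<Rightarrow> real" and x u :: "real^'n"
  assume "g \<in> {\<lambda>x. f (c - x) |f. smooth f}"
  then obtain f where g: "g = (\<lambda>x. f (c - x))" and f: "smooth f" by blast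
  show "g differentiable (at x)"
    unfolding g by (rule differentiable_compose[of f])
      (use f smooth_differentiable in \<open>auto intro!: derivative_intros\<close>)
  have "dirv u g = (\<lambda>x. (\<lambda>y. - 1 * dirv u f y) (c - x))"
    unfolding g using dirv_reflect[OF f] by (simp add: fun_eq_iff)
  then show "dirv u g \<in> {\<lambda>x. f (c - x) |f. smooth f}"
    using smooth_cmult[OF smooth_dirv[OF f], where c = "-1"]
    by (intro CollectI exI[of _ "\<lambda>y. - 1 * dirv u f y"]) simp
qed (use assms in blast)

lemma dirv_add: "smooth f \<Longrightarrow> smooth g \<Longrightarrow> dirv u (\<lambda>x. f x + g x) x = dirv u f x + dirv u g x"
  by (rule dirv_eqI) (auto intro!: has_derivative_add smooth_has_derivative)

lemma dirv_mult:
  "smooth f \<Longrightarrow> smooth g \<Longrightarrow> dirv u (\<lambda>x. f x * g x) x = f x * dirv u g x + dirv u f x * g x"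
  using dirv_eqI[OF has_derivative_mult[OF smooth_has_derivative smooth_has_derivative]] by blast

lemma dirv_cmult: "smooth f \<Longrightarrow> dirv u (\<lambda>x. c * f x) x = c * dirv u f x"
  by (rule dirv_eqI) (auto intro!: has_derivative_mult_right smooth_has_derivative)

lemma dirv_diff: "smooth f \<Longrightarrow> smooth g \<Longrightarrow> dirv u (\<lambda>x. f x - g x) x = dirv u f x - dirv u g x"
  by (rule dirv_eqI) (auto intro!: has_derivative_diff smooth_has_derivative)

lemma dirv_const: "dirv u (\<lambda>x. c) x = 0"
  by (rule dirv_eqI[OF has_derivative_const])

lemma dirv_sum:
  "finite I \<Longrightarrow> (\<And>i. i \<in> I \<Longrightarrow> smooth (f i)) \<Longrightarrow> dirv u (\<lambda>x. \<Sum>i\<in>I. f i x) x = (\<Sum>i\<in>I. dirv u (f i) x)"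
  by (induction I rule: finite_induct) (auto simp: dirv_const dirv_add smooth_sum)

lemma dirv_local:
  assumes "open S" "x \<in> S" "\<And>y. y \<in> S \<Longrightarrow> f y = g y"
  shows "dirv u f x = dirv u g x"
proof -
  have "(f has_derivative D) (at x) \<longleftrightarrow> (g has_derivative D) (at x)" for D
    using has_derivative_transform_within_open[OF _ assms(1,2)] assms(3) by metis
  then show ?thesis by (simp add: dirv_def frechet_derivative_def)
qed

lemma dirv_expand: "smooth f \<Longrightarrow> dirv u f x = (\<Sum>b\<in>Basis. (u \<bullet> b) * dirv b f x)"
  using linear_sum[OF linear_dirv, of f "\<lambda>b. (u \<bullet> b) *\<^sub>R b" Basis x]
  by (simp add: euclidean_representation linear_cmul[OF linear_dirv])

lemma line_derivative:
  assumes "smooth f"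
  shows "((\<lambda>t. f (x + t *\<^sub>R v)) has_real_derivative dirv v f (x + t *\<^sub>R v)) (at t)"
proof -
  have "((\<lambda>t. x + t *\<^sub>R v) has_derivative (\<lambda>h. h *\<^sub>R v)) (at t)"
    by (auto intro!: derivative_eq_intros)
  from has_derivative_compose[OF this smooth_has_derivative[OF assms]]
  show ?thesis
    by (simp add: has_field_derivative_def linear_cmul[OF linear_dirv[OF assms]] mult.commute[of _ "dirv _ _ _"])
qed

lemma mean_value_line:
  assumes "smooth f"
  shows "\<exists>t. 0 < t \<and> t < 1 \<and> f (x + v) - f x = dirv v f (x + t *\<^sub>R v)"
proof -
  have "\<exists>z. 0 < z \<and> z < 1 \<and> f (x + 1 *\<^sub>R v) - f (x + 0 *\<^sub>R v) = (1 - 0) * dirv v f (x + z *\<^sub>R v)"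
    by (rule MVT2) (use line_derivative[OF assms] in auto)
  then show ?thesis by simp
qed

text \<open>
  The second difference quotient is symmetric in the two directions, and by the mean value theorem, applied
  once in each direction, it converges to either mixed derivative.
\<close>

lemma dirv_commute:
  assumes f: "smooth f"
  shows "dirv u (dirv v f) x = dirv v (dirv u f) x"
proof -
  have diffq: "\<exists>a b. 0 < a \<and> a < 1 \<and> 0 < b \<and> b < 1 \<and>
      f (x + h *\<^sub>R p + h *\<^sub>R q) - f (x + h *\<^sub>R p) - f (x + h *\<^sub>R q) + f x
        = h * h * dirv q (dirv p f) (x + (a * h) *\<^sub>R p + (b * h) *\<^sub>R q)" for p q h
  proof -
    define g where "g y = f (y + h *\<^sub>R q) - f y" for y
    have fs: "smooth (\<lambda>y. f (y + h *\<^sub>R q))"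
      using smooth_reflect[OF smooth_reflect[OF f, of "h *\<^sub>R q"], of 0] by (simp add: add.commute)
    have shift: "dirv w (\<lambda>y. f (y + h *\<^sub>R q)) y = dirv w f (y + h *\<^sub>R q)" for w y
    proof (rule dirv_eqI)
      have "((\<lambda>y. y + h *\<^sub>R q) has_derivative (\<lambda>w. w)) (at y)"
        by (auto intro!: derivative_eq_intros)
      from has_derivative_compose[OF this smooth_has_derivative[OF f]]
      show "((\<lambda>y. f (y + h *\<^sub>R q)) has_derivative (\<lambda>w. dirv w f (y + h *\<^sub>R q))) (at y)" .
    qed
    have g: "smooth g" unfolding g_def using fs f by (rule smooth_diff)
    obtain a where a: "0 < a" "a < 1" "g (x + h *\<^sub>R p) - g x = dirv (h *\<^sub>R p) g (x + a *\<^sub>R h *\<^sub>R p)"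
      using mean_value_line[OF g] by blast
    let ?y = "x + (a * h) *\<^sub>R p"
    have "dirv (h *\<^sub>R p) g ?y = h * (dirv p f (?y + h *\<^sub>R q) - dirv p f ?y)"
      unfolding linear_cmul[OF linear_dirv[OF g]]
      using dirv_diff[OF fs f, of p ?y] shift[of p ?y] by (simp add: g_def[abs_def])
    moreover obtain b where "0 < b" "b < 1"
      "dirv p f (?y + h *\<^sub>R q) - dirv p f ?y = dirv (h *\<^sub>R q) (dirv p f) (?y + b *\<^sub>R h *\<^sub>R q)"
      using mean_value_line[OF smooth_dirv[OF f]] by blast
    ultimately show ?thesis
      using a by (intro exI[of _ a] exI[of _ b])
        (simp add: g_def linear_cmul[OF linear_dirv[OF smooth_dirv[OF f]]])
  qed
  have lim: "\<exists>d. (\<lambda>n. d n) \<longlonglongrightarrow> dirv q (dirv p f) x \<and> (\<forall>n. d n =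
      (f (x + (1/real (Suc n)) *\<^sub>R p + (1/real (Suc n)) *\<^sub>R q) - f (x + (1/real (Suc n)) *\<^sub>R p)
        - f (x + (1/real (Suc n)) *\<^sub>R q) + f x) * (real (Suc n))\<^sup>2)" for p q
  proof -
    let ?h = "\<lambda>n. 1 / real (Suc n)"
    from diffq[of "?h _" p q] obtain a b where ab: "\<And>n. 0 < a n \<and> a n < 1 \<and> 0 < b n \<and> b n < 1 \<and>
      f (x + ?h n *\<^sub>R p + ?h n *\<^sub>R q) - f (x + ?h n *\<^sub>R p) - f (x + ?h n *\<^sub>R q) + f x
        = ?h n * ?h n * dirv q (dirv p f) (x + (a n * ?h n) *\<^sub>R p + (b n * ?h n) *\<^sub>R q)"
      by metis
    have h0: "?h \<longlonglongrightarrow> 0"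
      using LIMSEQ_inverse_real_of_nat by (simp add: inverse_eq_divide)
    have a0: "(\<lambda>n. a n * ?h n) \<longlonglongrightarrow> 0" "(\<lambda>n. b n * ?h n) \<longlonglongrightarrow> 0"
      using ab by (auto intro!: Lim_null_comparison[OF _ h0] always_eventually divide_right_mono
          simp: abs_mult abs_of_pos less_imp_le simp del: of_nat_Suc)
    have "(\<lambda>n. x + (a n * ?h n) *\<^sub>R p + (b n * ?h n) *\<^sub>R q) \<longlonglongrightarrow> x + 0 *\<^sub>R p + 0 *\<^sub>R q"
      by (intro tendsto_intros a0)
    then have "(\<lambda>n. dirv q (dirv p f) (x + (a n * ?h n) *\<^sub>R p + (b n * ?h n) *\<^sub>R q)) \<longlonglongrightarrow> dirv q (dirv p f) x"
      using smooth_continuous[OF smooth_dirv[OF smooth_dirv[OF f]], of UNIV]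
      by (auto simp: continuous_on_eq_continuous_at isCont_def intro: isCont_tendsto_compose)
    then show ?thesis
      using ab by (intro exI[of _ "\<lambda>n. dirv q (dirv p f) (x + (a n * ?h n) *\<^sub>R p + (b n * ?h n) *\<^sub>R q)"])
        (auto simp: power2_eq_square simp del: of_nat_Suc)
  qed
  obtain d e where d: "d \<longlonglongrightarrow> dirv u (dirv v f) x" and e: "e \<longlonglongrightarrow> dirv v (dirv u f) x" and "\<forall>n. d n = e n"
    using lim[of u v] lim[of v u] by (force simp: add_ac)
  then have "d = e" by auto
  with d e show ?thesis using LIMSEQ_unique by blast
qed

lemma smooth_shift: "smooth f \<Longrightarrow> smooth (\<lambda>x. f (x + c))"
  using smooth_reflect[OF smooth_reflect[of f c], of 0] by (simp add: add.commute)

text \<open>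
  Needed for functions on a boundary stratum, which are described near each point by a formula that depends
  on the point.
\<close>

lemma smooth_local:
  fixes f :: "real^'n \<Rightarrow> real"
  assumes "\<And>x. \<exists>S g. open S \<and> x \<in> S \<and> smooth g \<and> (\<forall>y\<in>S. f y = g y)"
  shows "smooth f"
proof (rule smooth_coinduct[where F = "{f. \<forall>x. \<exists>S g. open S \<and> x \<in> S \<and> smooth g \<and> (\<forall>y\<in>S. f y = g y)}"])
  fix f :: "real^'n \<Rightarrow> real" and x u :: "real^'n"
  assume "f \<in> {f. \<forall>x. \<exists>S g. open S \<and> x \<in> S \<and> smooth g \<and> (\<forall>y\<in>S. f y = g y)}"
  then have f: "\<And>x. \<exists>S g. open S \<and> x \<in> S \<and> smooth g \<and> (\<forall>y\<in>S. f y = g y)" by blast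
  obtain S g where S: "open S" "x \<in> S" "smooth g" "\<forall>y\<in>S. f y = g y" using f[of x] by blast
  have "(f has_derivative (\<lambda>u. dirv u g x)) (at x)"
    by (rule has_derivative_transform_within_open[OF smooth_has_derivative[OF S(3)] S(1,2)]) (use S(4) in simp)
  then show "f differentiable (at x)" by (auto simp: differentiable_def)
  have "\<exists>S g. open S \<and> x \<in> S \<and> smooth g \<and> (\<forall>y\<in>S. dirv u f y = g y)" for x
  proof -
    obtain S g where S: "open S" "x \<in> S" "smooth g" "\<forall>y\<in>S. f y = g y" using f[of x] by blast
    have "dirv u f y = dirv u g y" if "y \<in> S" for y
      by (rule dirv_local[OF S(1) that]) (use S(4) in simp)
    then show ?thesis using S smooth_dirv by blast
  qed
  then show "dirv u f \<in> {f. \<forall>x. \<exists>S g. open S \<and> x \<in> S \<and> smooth g \<and> (\<forall>y\<in>S. f y = g y)}" by simp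
qed (use assms in simp)

section \<open>Test functions and convolution\<close>

text \<open>
  Functions of this form are closed under differentiation, so they contain all derivatives of \<open>exp (-
  1 / t)\<close> extended by zero.
\<close>

definition flat_poly :: "real poly \<Rightarrow> real \<Rightarrow> real" where
  "flat_poly p t = (if t \<le> 0 then 0 else poly p (1 / t) * exp (- (1 / t)))"

lemma poly_exp_tendsto_0: "((\<lambda>x. poly p x * exp (- x)) \<longlongrightarrow> (0::real)) at_top"
proof -
  have "((\<lambda>x. \<Sum>i\<le>degree p. coeff p i * (x ^ i / exp x)) \<longlongrightarrow> (\<Sum>i\<le>degree p. coeff p i * 0)) at_top"
    by (intro tendsto_intros tendsto_power_div_exp_0)
  then show ?thesis
    by (simp add: poly_altdef sum_distrib_right exp_minus divide_inverse mult.assoc)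
qed

lemma flat_poly_derivative:
  "(flat_poly p has_real_derivative flat_poly ([:0, 0, 1:] * (p - pderiv p)) t) (at t)"
proof -
  consider "t < 0" | "t > 0" | "t = 0" by linarith
  then show ?thesis
  proof cases
    case 1
    have "((\<lambda>t. 0::real) has_real_derivative 0) (at t)" by simp
    then have "(flat_poly p has_real_derivative 0) (at t)"
      by (rule has_field_derivative_transform_within_open[of _ _ _ "{..<0}"])
         (use 1 in \<open>auto simp: flat_poly_def\<close>)
    with 1 show ?thesis by (simp add: flat_poly_def)
  next
    case 2
    have "((\<lambda>t. poly p (1 / t) * exp (- (1 / t))) has_real_derivative
        (poly (pderiv p) (1/t) * (- 1 / t\<^sup>2)) * exp (- (1/t)) + (exp (- (1/t)) * (1 / t\<^sup>2)) * poly p (1/t)) (at t)"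
      using 2 by (auto intro!: derivative_eq_intros DERIV_chain2[OF poly_DERIV] simp: power2_eq_square)
    also have "(poly (pderiv p) (1/t) * (- 1 / t\<^sup>2)) * exp (- (1/t)) + (exp (- (1/t)) * (1 / t\<^sup>2)) * poly p (1/t)
        = flat_poly ([:0, 0, 1:] * (p - pderiv p)) t"
      using 2 by (simp add: flat_poly_def field_simps power2_eq_square)
    finally show ?thesis
      by (rule has_field_derivative_transform_within_open[of _ _ _ "{0<..}"])
         (use 2 in \<open>auto simp: flat_poly_def\<close>)
  next
    case 3
    have "((\<lambda>h. flat_poly p h / h) \<longlongrightarrow> 0) (at_left 0)"
      by (rule tendsto_eventually)
         (auto simp: flat_poly_def eventually_at_filter)
    \<comment> \<open>The extra factor \<open>1 / h\<close> of the difference quotient is absorbed by the polynomial.\<close>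
    moreover have "((\<lambda>h. flat_poly p h / h) \<longlongrightarrow> 0) (at_right 0)"
    proof -
      have "((\<lambda>h. poly ([:0,1:] * p) (inverse h) * exp (- inverse h)) \<longlongrightarrow> (0::real)) (at_right 0)"
        using filterlim_compose[OF poly_exp_tendsto_0 filterlim_inverse_at_top_right] .
      then show ?thesis
        by (rule Lim_transform_eventually)
           (auto simp: flat_poly_def eventually_at_filter field_simps)
    qed
    ultimately have "((\<lambda>h. flat_poly p h / h) \<longlongrightarrow> 0) (at 0)"
      using filterlim_at_split by blast
    with 3 show ?thesis by (simp add: DERIV_def flat_poly_def)
  qed
qed

definition flat :: "real \<Rightarrow> real" where
  "flat t = (if t \<le> 0 then 0 else exp (- (1 / t)))"

lemma flat_nonneg: "0 \<le> flat t" and flat_pos: "0 < t \<Longrightarrow> 0 < flat t"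
  and flat_le_1: "flat t \<le> 1" and flat_zero: "t \<le> 0 \<Longrightarrow> flat t = 0"
  by (auto simp: flat_def)

lemma smooth_flat:
  assumes "smooth f" shows "smooth (\<lambda>x. flat (f x))"
proof -
  define D where "D = (\<lambda>k::nat. flat_poly (((\<lambda>p. [:0, 0, 1:] * (p - pderiv p)) ^^ k) 1))"
  have "(D k has_real_derivative D (Suc k) t) (at t)" for k t
    using flat_poly_derivative by (simp add: D_def)
  then have "smooth (\<lambda>x. D 0 (f x))" by (rule smooth_comp[OF assms])
  moreover have "D 0 = flat" by (simp add: D_def flat_def flat_poly_def fun_eq_iff)
  ultimately show ?thesis by simp
qed

text \<open>
  Boundedness of the set where \<open>f\<close> does not vanish is compactness of the support.
\<close>

definition test_fun :: "(real^'n \<Rightarrow> real) \<Rightarrow> bool" where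
  "test_fun f \<longleftrightarrow> smooth f \<and> bounded {x. f x \<noteq> 0}"

lemma test_fun_smooth: "test_fun f \<Longrightarrow> smooth f"
  by (simp add: test_fun_def)

lemma test_fun_zero_outside: "test_fun f \<Longrightarrow> \<exists>R>0. \<forall>x. f x \<noteq> 0 \<longrightarrow> norm x < R"
  unfolding test_fun_def by (auto simp: bounded_pos_less)

lemma dirv_nonzero_subset: "{x. dirv u f x \<noteq> 0} \<subseteq> closure {x. f x \<noteq> 0}"
proof
  fix x assume "x \<in> {x. dirv u f x \<noteq> 0}"
  moreover have "dirv u f x = 0" if "x \<notin> closure {x. f x \<noteq> 0}"
  proof -
    have "dirv u f x = dirv u (\<lambda>_. 0) x"
      by (rule dirv_local[of "- closure {x. f x \<noteq> 0}"])
         (use that closure_subset[of "{x. f x \<noteq> 0}"] in auto)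
    then show ?thesis by (simp add: dirv_const)
  qed
  ultimately show "x \<in> closure {x. f x \<noteq> 0}" by auto
qed

lemma test_fun_dirv: "test_fun f \<Longrightarrow> test_fun (dirv u f)"
  unfolding test_fun_def
  using bounded_subset[OF bounded_closure dirv_nonzero_subset] smooth_dirv by blast

lemma test_fun_mult: "test_fun f \<Longrightarrow> smooth g \<Longrightarrow> test_fun (\<lambda>x. f x * g x)"
  unfolding test_fun_def by (auto intro!: smooth_mult elim!: bounded_subset)

lemma test_fun_bounded:
  assumes "test_fun f" shows "\<exists>B. \<forall>x. \<bar>f x\<bar> \<le> B"
proof -
  obtain R where R: "\<forall>x. f x \<noteq> 0 \<longrightarrow> norm x < R" using test_fun_zero_outside[OF assms] by blast
  have "bounded (f ` cball 0 R)"
    by (intro compact_imp_bounded compact_continuous_image smooth_continuous test_fun_smooth[OF assms]) auto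
  then obtain B where B: "\<forall>x\<in>cball 0 R. \<bar>f x\<bar> \<le> B" by (auto simp: bounded_iff)
  have "\<bar>f x\<bar> \<le> max B 0" for x
    using B R by (cases "f x = 0") (auto simp: le_max_iff_disj less_imp_le)
  then show ?thesis by blast
qed

lemma dirv_norm_bound:
  assumes "smooth f" and "\<And>b. b \<in> Basis \<Longrightarrow> \<bar>dirv b f x\<bar> \<le> B b"
  shows "\<bar>dirv v f x\<bar> \<le> norm v * (\<Sum>b\<in>Basis. B b)"
proof -
  have "\<bar>dirv v f x\<bar> \<le> (\<Sum>b\<in>Basis. \<bar>(v \<bullet> b) * dirv b f x\<bar>)"
    unfolding dirv_expand[OF assms(1), of v] by (rule sum_abs)
  also have "\<dots> \<le> (\<Sum>b\<in>Basis. norm v * B b)"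
    by (intro sum_mono) (auto simp: abs_mult intro!: mult_mono assms(2) Basis_le_norm)
  finally show ?thesis by (simp add: sum_distrib_left)
qed

lemma test_fun_lipschitz:
  assumes "test_fun f" shows "\<exists>B\<ge>0. \<forall>x y. \<bar>f x - f y\<bar> \<le> B * norm (x - y)"
proof -
  have "\<forall>b. \<exists>B. \<forall>x. \<bar>dirv b f x\<bar> \<le> B" using test_fun_bounded[OF test_fun_dirv[OF assms]] by blast
  then obtain B where B: "\<And>b x. \<bar>dirv b f x\<bar> \<le> B b" by metis
  have "\<bar>f x - f y\<bar> \<le> (\<Sum>b\<in>Basis. B b) * norm (x - y)" for x y
  proof -
    obtain t where "f (y + (x - y)) - f y = dirv (x - y) f (y + t *\<^sub>R (x - y))"
      using mean_value_line[OF test_fun_smooth[OF assms]] by blast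
    then show ?thesis
      using dirv_norm_bound[OF test_fun_smooth[OF assms] B, of "x - y" "y + t *\<^sub>R (x - y)"] by (simp add: mult.commute)
  qed
  moreover have "0 \<le> (\<Sum>b\<in>Basis. B b)" by (rule sum_nonneg) (rule order_trans[OF abs_ge_zero B])
  ultimately show ?thesis by blast
qed

text \<open>
  The derivatives of a test function are Lipschitz, so the linear approximation has an error that is
  quadratic uniformly in the point; this uniformity permits differentiation under the integral.
\<close>

lemma test_fun_taylor:
  fixes f :: "real^'n \<Rightarrow> real"
  assumes "test_fun f" shows "\<exists>C\<ge>0. \<forall>x h. \<bar>f (x + h) - f x - dirv h f x\<bar> \<le> C * (norm h)\<^sup>2"
proof -
  have "\<forall>b. \<exists>B\<ge>0. \<forall>x y. \<bar>dirv b f x - dirv b f y\<bar> \<le> B * norm (x - y)"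
    using test_fun_lipschitz[OF test_fun_dirv[OF assms]] by blast
  then obtain B where B: "\<And>b. B b \<ge> 0" "\<And>b x y. \<bar>dirv b f x - dirv b f y\<bar> \<le> B b * norm (x - y)" by metis
  have s: "smooth f" using assms by (rule test_fun_smooth)
  have "\<bar>f (x + h) - f x - dirv h f x\<bar> \<le> (\<Sum>b\<in>Basis. B b) * (norm h)\<^sup>2" for x h
  proof -
    obtain t where t: "0 < t" "t < 1" "f (x + h) - f x = dirv h f (x + t *\<^sub>R h)"
      using mean_value_line[OF s] by blast
    have "dirv h f (x + t *\<^sub>R h) - dirv h f x = (\<Sum>b\<in>Basis. (h \<bullet> b) * (dirv b f (x + t *\<^sub>R h) - dirv b f x))"
      unfolding dirv_expand[OF s, of h] by (simp add: sum_subtractf right_diff_distrib)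
    also have "\<bar>\<dots>\<bar> \<le> (\<Sum>b\<in>Basis. \<bar>(h \<bullet> b) * (dirv b f (x + t *\<^sub>R h) - dirv b f x)\<bar>)" by (rule sum_abs)
    also have "\<dots> \<le> (\<Sum>b\<in>Basis. norm h * (B b * norm h))"
    proof (intro sum_mono)
      fix b :: "real^'n" assume b: "b \<in> Basis"
      have "\<bar>dirv b f (x + t *\<^sub>R h) - dirv b f x\<bar> \<le> B b * (\<bar>t\<bar> * norm h)" using B(2)[of b "x + t *\<^sub>R h" x] by simp
      also have "\<dots> \<le> B b * norm h" using t B(1)[of b] by (intro mult_left_mono) (auto intro: mult_left_le_one_le)
      finally show "\<bar>(h \<bullet> b) * (dirv b f (x + t *\<^sub>R h) - dirv b f x)\<bar> \<le> norm h * (B b * norm h)"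
        by (auto simp: abs_mult intro!: mult_mono Basis_le_norm b)
    qed
    finally show ?thesis using t by (simp add: power2_eq_square sum_distrib_left sum_distrib_right mult_ac)
  qed
  moreover have "0 \<le> (\<Sum>b\<in>Basis. B b)" by (rule sum_nonneg) (rule B(1))
  ultimately show ?thesis by blast
qed

lemma continuous_lebesgue_measurable:
  "continuous_on UNIV (g::real^'n \<Rightarrow> real) \<Longrightarrow> g \<in> borel_measurable lebesgue"
  by (rule measurable_completion) (simp add: borel_measurable_continuous_onI)

lemma integrable_mult_bounded_support:
  assumes u: "locally_integrable u" and g: "g \<in> borel_measurable lebesgue" "\<And>x. \<bar>g x\<bar> \<le> B"
    and z: "\<And>x. norm x > R \<Longrightarrow> g x = 0"
  shows "integrable lebesgue (\<lambda>x. u x * g x)"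
    and "\<bar>LINT x|lebesgue. u x * g x\<bar> \<le> B * (LINT x|lebesgue. indicator (cball 0 R) x * \<bar>u x\<bar>)"
proof -
  have ui: "integrable lebesgue (\<lambda>x. indicator (cball 0 R) x * u x)"
    using u unfolding locally_integrable_def set_integrable_def by simp
  then have ua: "integrable lebesgue (\<lambda>x. indicator (cball 0 R) x * \<bar>u x\<bar>)"
    using integrable_abs[OF ui] by (simp add: abs_mult)
  have eq: "u x * g x = indicator (cball 0 R) x * u x * g x" for x
    using z[of x] by (auto simp: indicator_def)
  have bd: "\<bar>u x * g x\<bar> \<le> B * (indicator (cball 0 R) x * \<bar>u x\<bar>)" for x
    using z[of x] mult_left_mono[OF g(2)[of x], of "\<bar>u x\<bar>"]
    by (auto simp: indicator_def abs_mult mult_ac)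
  have "(\<lambda>x. indicator (cball 0 R) x * u x * g x) \<in> borel_measurable lebesgue"
    by (rule borel_measurable_times[OF borel_measurable_integrable[OF ui] g(1)])
  then have m: "(\<lambda>x. u x * g x) \<in> borel_measurable lebesgue" by (simp flip: eq)
  show i: "integrable lebesgue (\<lambda>x. u x * g x)"
    by (rule Bochner_Integration.integrable_bound[OF integrable_mult_right[OF ua, of B] m])
       (use bd in \<open>auto intro: order_trans[OF _ abs_ge_self]\<close>)
  have "\<bar>LINT x|lebesgue. u x * g x\<bar> \<le> (LINT x|lebesgue. B * (indicator (cball 0 R) x * \<bar>u x\<bar>))"
    by (rule order_trans[OF integral_abs_bound integral_mono])
       (use i ua bd in auto)
  then show "\<bar>LINT x|lebesgue. u x * g x\<bar> \<le> B * (LINT x|lebesgue. indicator (cball 0 R) x * \<bar>u x\<bar>)"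
    by simp
qed

lemma integrable_mult_test_fun:
  assumes "locally_integrable u" "test_fun f"
  shows "integrable lebesgue (\<lambda>x. u x * f (y - x))" and "integrable lebesgue (\<lambda>x. u x * f x)"
proof -
  obtain B where B: "\<forall>x. \<bar>f x\<bar> \<le> B" using test_fun_bounded[OF assms(2)] by blast
  obtain R where R: "\<forall>x. f x \<noteq> 0 \<longrightarrow> norm x < R" using test_fun_zero_outside[OF assms(2)] by blast
  have c: "continuous_on UNIV f" by (rule smooth_continuous[OF test_fun_smooth[OF assms(2)]])
  show "integrable lebesgue (\<lambda>x. u x * f x)"
    by (rule integrable_mult_bounded_support(1)[OF assms(1), of _ B R])
       (use B R c continuous_lebesgue_measurable[OF c] in \<open>auto dest: less_asym\<close>)
  have "continuous_on UNIV (\<lambda>x. f (y - x))"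
    by (rule continuous_on_compose2[OF c]) (auto intro!: continuous_intros)
  moreover have "f (y - x) = 0" if "norm x > R + norm y" for x
    using R[rule_format, of "y - x"] that norm_triangle_ineq2[of x y] by (force simp: norm_minus_commute)
  ultimately show "integrable lebesgue (\<lambda>x. u x * f (y - x))"
    by (intro integrable_mult_bounded_support(1)[OF assms(1), of _ B "R + norm y"])
       (use B in \<open>auto intro: continuous_lebesgue_measurable\<close>)
qed

definition conv :: "(real^'n \<Rightarrow> real) \<Rightarrow> (real^'n \<Rightarrow> real) \<Rightarrow> real^'n \<Rightarrow> real" where
  "conv u f y = (LINT x|lebesgue. u x * f (y - x))"

text \<open>
  The derivative falls on the test function \<open>f\<close>, so \<open>u\<close> need only be locally
  integrable. Integrating the uniform Taylor estimate of \<open>f\<close> against \<open>u\<close> over a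
  fixed ball bounds the error by \<open>M (norm h)\<^sup>2\<close>.
\<close>

lemma conv_has_derivative:
  fixes u f :: "real^'n \<Rightarrow> real"
  assumes u: "locally_integrable u" and f: "test_fun f"
  shows "(conv u f has_derivative (\<lambda>v. conv u (dirv v f) y)) (at y)"
proof -
  have s: "smooth f" using f by (rule test_fun_smooth)
  note int = integrable_mult_test_fun(1)[OF u f] integrable_mult_test_fun(1)[OF u test_fun_dirv[OF f]]
  obtain C where C: "C \<ge> 0" "\<And>x h. \<bar>f (x + h) - f x - dirv h f x\<bar> \<le> C * (norm h)\<^sup>2"
    using test_fun_taylor[OF f] by blast
  obtain R where R: "\<forall>x. f x \<noteq> 0 \<longrightarrow> norm x < R" using test_fun_zero_outside[OF f] by blast
  have dR: "dirv h f x = 0" if "norm x > R" for h x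
  proof -
    have "closure {x. f x \<noteq> 0} \<subseteq> cball 0 R"
      by (rule closure_minimal) (use R in auto)
    then show ?thesis using dirv_nonzero_subset[of h f] that by auto
  qed
  define M where "M = C * (LINT x|lebesgue. indicator (cball 0 (R + 1 + norm y)) x * \<bar>u x\<bar>)"
  have lin: "linear (\<lambda>v. conv u (dirv v f) y)"
    by (rule linearI)
       (simp_all add: conv_def linear_add[OF linear_dirv[OF s]] linear_cmul[OF linear_dirv[OF s]]
         distrib_left int mult.left_commute[of "u _"])
  have est: "\<bar>conv u f (y + h) - conv u f y - conv u (dirv h f) y\<bar> \<le> M * (norm h)\<^sup>2" if h: "norm h \<le> 1" for h
  proof -
    let ?g = "\<lambda>x. f (y + h - x) - f (y - x) - dirv h f (y - x)"
    have ge: "?g x = f ((y - x) + h) - f (y - x) - dirv h f (y - x)" for x by (simp add: algebra_simps)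
    have "conv u f (y + h) - conv u f y - conv u (dirv h f) y = (LINT x|lebesgue. u x * ?g x)"
      by (simp add: conv_def right_diff_distrib int)
    also have "\<bar>\<dots>\<bar> \<le> C * (norm h)\<^sup>2 * (LINT x|lebesgue. indicator (cball 0 (R + 1 + norm y)) x * \<bar>u x\<bar>)"
    proof (rule integrable_mult_bounded_support(2)[OF u])
      have "continuous_on UNIV ?g"
        by (intro continuous_intros continuous_on_compose2[OF smooth_continuous[OF s, of UNIV]]
            continuous_on_compose2[OF smooth_continuous[OF smooth_dirv[OF s], of UNIV]]) auto
      then show "?g \<in> borel_measurable lebesgue" by (rule continuous_lebesgue_measurable)
      show "\<bar>?g x\<bar> \<le> C * (norm h)\<^sup>2" for x using C(2)[of "y - x" h] ge by simp
      show "?g x = 0" if x: "R + 1 + norm y < norm x" for x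
      proof -
        have "norm (y - x) > R + 1" using x norm_triangle_ineq2[of x y] by (simp add: norm_minus_commute)
        moreover from this have "norm (y - x + h) > R" using h norm_triangle_ineq2[of "y - x" "- h"] by simp
        ultimately have "f (y - x) = 0" "f (y - x + h) = 0" "dirv h f (y - x) = 0"
          using R dR by (force, force, auto)
        then show ?thesis unfolding ge by simp
      qed
    qed
    finally show ?thesis by (simp add: M_def mult_ac)
  qed
  have "((\<lambda>h. norm (conv u f (y + h) - conv u f y - conv u (dirv h f) y) / norm h) \<longlongrightarrow> 0) (at 0)"
  proof (rule Lim_null_comparison)
    show "\<forall>\<^sub>F h in at 0. norm (norm (conv u f (y + h) - conv u f y - conv u (dirv h f) y) / norm h) \<le> M * norm h"
      unfolding eventually_at
    proof (intro exI[of _ 1] conjI ballI impI; clarsimp)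
      fix h :: "real^'n" assume "h \<noteq> 0" "norm h < 1"
      then show "\<bar>conv u f (y + h) - conv u f y - conv u (dirv h f) y\<bar> / norm h \<le> M * norm h"
        using est[of h] by (simp add: field_simps power2_eq_square)
    qed
    show "((\<lambda>h. M * norm h) \<longlongrightarrow> 0) (at 0)"
      by (rule tendsto_eq_intros refl tendsto_norm_zero tendsto_ident_at | simp)+
  qed
  with lin show ?thesis by (simp add: has_derivative_at linear_conv_bounded_linear)
qed

lemma dirv_conv: "locally_integrable u \<Longrightarrow> test_fun f \<Longrightarrow> dirv v (conv u f) = conv u (dirv v f)"
  by (rule ext, rule dirv_eqI[OF conv_has_derivative])

lemma smooth_conv:
  assumes "locally_integrable u" "test_fun f" shows "smooth (conv u f)"
proof (rule smooth_coinduct[where F = "{conv u f |f. test_fun f}"])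
  show "g differentiable (at x)" if "g \<in> {conv u f |f. test_fun f}" for g x
    using that conv_has_derivative[OF assms(1)] by (auto simp: differentiable_def)
  show "dirv v g \<in> {conv u f |f. test_fun f}" if "g \<in> {conv u f |f. test_fun f}" for g v
    using that dirv_conv[OF assms(1)] test_fun_dirv by blast
qed (use assms in blast)

lemma continuous_locally_integrable:
  fixes u :: "real^'n \<Rightarrow> real" assumes "continuous_on UNIV u" shows "locally_integrable u"
  unfolding locally_integrable_def
proof (intro allI impI)
  fix K :: "(real^'n) set" assume "compact K"
  then show "set_integrable lebesgue K u"
  proof -
    obtain a where a: "K \<subseteq> cbox (- a) a"
      using bounded_subset_cbox_symmetric[OF compact_imp_bounded[OF \<open>compact K\<close>]] by blast
    have "set_integrable lebesgue (cbox (- a) a) u"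
      by (rule absolutely_integrable_continuous) (rule continuous_on_subset[OF assms subset_UNIV])
    then show ?thesis
      by (rule set_integrable_subset) (use a \<open>compact K\<close> in \<open>auto intro: lmeasurable_compact fmeasurableD\<close>)
  qed
qed

text \<open>
  The affine map \<open>x \<mapsto> y - x\<close> scales each coordinate by \<open>-1\<close>, whose
  absolute value is 1.
\<close>

lemma lborel_reflect: "lborel = distr lborel borel (\<lambda>x. y - x :: real^'n)"
proof -
  have "lborel = density (distr lborel borel (\<lambda>x. y + (\<Sum>j\<in>Basis. ((-1) * (x \<bullet> j)) *\<^sub>R j))) (\<lambda>_. (\<Prod>j\<in>(Basis::(real^'n) set). \<bar>-1::real\<bar>))"
    by (rule lborel_affine_euclidean) auto
  moreover have "(\<Sum>j\<in>Basis. ((-1) * (x \<bullet> j)) *\<^sub>R j) = - x" for x :: "real^'n"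
    by (simp add: sum_negf euclidean_representation)
  ultimately show ?thesis by (simp add: density_1)
qed

lemma integral_reflect:
  fixes g :: "real^'n \<Rightarrow> real" assumes "g \<in> borel_measurable borel"
  shows "(LINT x|lebesgue. g (y - x)) = (LINT x|lebesgue. g x)"
    and "integrable lebesgue g \<Longrightarrow> integrable lebesgue (\<lambda>x. g (y - x))"
proof -
  have m: "(\<lambda>x. g (y - x)) \<in> borel_measurable borel"
    by (rule measurable_compose[OF _ assms]) simp
  have "(LINT x|lborel. g x) = (LINT x|distr lborel borel (\<lambda>x. y - x :: real^'n). g x)"
    by (simp flip: lborel_reflect)
  also have "\<dots> = (LINT x|lborel. g (y - x))" by (rule integral_distr) (use assms in auto)
  finally show "(LINT x|lebesgue. g (y - x)) = (LINT x|lebesgue. g x)"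
    using assms m by (simp add: integral_completion)
  have "integrable lborel g \<longleftrightarrow> integrable (distr lborel borel (\<lambda>x. y - x :: real^'n)) g"
    by (simp flip: lborel_reflect)
  also have "\<dots> \<longleftrightarrow> integrable lborel (\<lambda>x. g (y - x))" by (rule integrable_distr_eq) (use assms in auto)
  finally show "integrable lebesgue g \<Longrightarrow> integrable lebesgue (\<lambda>x. g (y - x))"
    using assms m by (simp add: integrable_completion)
qed

text \<open>
  Convolution with the constant 1 is the constant function \<open>\<integral> f\<close>; differentiating it
  puts the derivative on \<open>f\<close>.
\<close>

lemma integral_dirv_test_fun:
  assumes "test_fun f" shows "(LINT x|lebesgue. dirv v f x) = 0"
proof -
  have m: "g \<in> borel_measurable borel" if "test_fun g" for g
    using that by (intro borel_measurable_continuous_onI smooth_continuous test_fun_smooth)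
  have c: "conv (\<lambda>x. 1) g y = (LINT x|lebesgue. g x)" if "test_fun g" for g y
    using integral_reflect(1)[OF m[OF that]] by (simp add: conv_def)
  have "(LINT x|lebesgue. dirv v f x) = dirv v (conv (\<lambda>x. 1) f) 0"
    by (simp add: dirv_conv[OF continuous_locally_integrable assms] c[OF test_fun_dirv[OF assms]])
  also have "conv (\<lambda>x. 1) f = (\<lambda>y. LINT x|lebesgue. f x)" using c[OF assms] by auto
  finally show ?thesis by (simp add: dirv_const)
qed

section \<open>Mollifiers\<close>

definition mollifier :: "real \<Rightarrow> (real^'n \<Rightarrow> real) \<Rightarrow> bool" where
  "mollifier e \<rho> \<longleftrightarrow> test_fun \<rho> \<and> (\<forall>x. 0 \<le> \<rho> x) \<and> (\<forall>x. norm x \<ge> e \<longrightarrow> \<rho> x = 0) \<and> (LINT x|lebesgue. \<rho> x) = 1"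

lemma mollifier_exists:
  assumes "0 < e"
  shows "\<exists>\<rho>::real^'n \<Rightarrow> real. mollifier e \<rho>"
proof -
  define g :: "real^'n \<Rightarrow> real" where "g x = flat (e\<^sup>2 - (\<Sum>i\<in>UNIV. x $ i * x $ i))" for x
  have nsq: "(\<Sum>i\<in>UNIV. x $ i * x $ i) = (norm x)\<^sup>2" for x :: "real^'n"
    by (simp add: power2_norm_eq_inner inner_vec_def)
  have z: "g x = 0" if "norm x \<ge> e" for x
    using that assms by (auto simp: g_def nsq intro!: flat_zero power_mono)
  have "smooth g" unfolding g_def
    by (intro smooth_flat smooth_diff smooth_const smooth_sum smooth_mult smooth_component)
  moreover have "{x. g x \<noteq> 0} \<subseteq> ball 0 e" using z by (force simp: not_less)
  ultimately have t: "test_fun g" unfolding test_fun_def by (meson bounded_ball bounded_subset)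
  have n: "0 \<le> g x" for x by (simp add: g_def flat_nonneg)
  have i: "integrable lebesgue g"
    using integrable_mult_test_fun(2)[OF continuous_locally_integrable t, of "\<lambda>x. 1"] by simp
  \<comment> \<open>The integrand is nonnegative, and positive on a ball of positive measure.\<close>
  have "(LINT x|lebesgue. g x) \<noteq> 0"
  proof
    assume "(LINT x|lebesgue. g x) = 0"
    then have "AE x in lebesgue. g x = 0" using integral_nonneg_eq_0_iff_AE[OF i] n by simp
    then obtain N where N: "\<And>x. x \<in> space lebesgue - N \<Longrightarrow> g x = 0" "N \<in> null_sets lebesgue"
      using AE_E3 by blast
    have "g x \<noteq> 0" if "norm x < e" for x
    proof -
      have "(norm x)\<^sup>2 < e\<^sup>2" using that by (intro power_strict_mono) auto
      then show ?thesis using flat_pos[of "e\<^sup>2 - (norm x)\<^sup>2"] by (simp add: g_def nsq)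
    qed
    then have "ball 0 e \<subseteq> N" using N(1) by force
    then have "negligible (ball (0::real^'n) e)"
      using N(2) negligible_iff_null_sets negligible_subset by blast
    then show False using assms open_not_negligible[of "ball (0::real^'n) e"] by simp
  qed
  then have p: "(LINT x|lebesgue. g x) > 0" using n by (simp add: less_le)
  define c where "c = 1 / (LINT x|lebesgue. g x)"
  have "test_fun (\<lambda>x. g x * c)" by (rule test_fun_mult[OF t smooth_const])
  moreover have "(LINT x|lebesgue. g x * c) = 1" using p by (simp add: c_def)
  ultimately show ?thesis using z n p by (intro exI[of _ "\<lambda>x. g x * c"]) (auto simp: c_def mollifier_def)
qed

text \<open>
  With the mollifier as the weight of a fixed measure, pointwise inequalities and identities for
  \<open>u\<close> on balls pass to the convolution; the next lemmas record this.
\<close>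

lemma conv_alt:
  fixes u \<rho> :: "real^'n \<Rightarrow> real"
  assumes "u \<in> borel_measurable borel" "locally_integrable u" "test_fun \<rho>"
  shows "conv u \<rho> y = (LINT x|lebesgue. u (y - x) * \<rho> x)"
    and "integrable lebesgue (\<lambda>x. u (y - x) * \<rho> x)"
proof -
  have m: "\<rho> \<in> borel_measurable borel"
    using assms(3) by (intro borel_measurable_continuous_onI smooth_continuous test_fun_smooth)
  have "(\<lambda>x. \<rho> (y - x)) \<in> borel_measurable (borel :: (real^'n) measure)"
    by (rule measurable_compose[OF _ m]) simp
  then have b: "(\<lambda>x. u x * \<rho> (y - x)) \<in> borel_measurable borel"
    using assms(1) by (intro borel_measurable_times) auto
  show "conv u \<rho> y = (LINT x|lebesgue. u (y - x) * \<rho> x)"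
    using integral_reflect(1)[OF b, of y] by (simp add: conv_def)
  show "integrable lebesgue (\<lambda>x. u (y - x) * \<rho> x)"
    using integral_reflect(2)[OF b integrable_mult_test_fun(1)[OF assms(2,3)], of y] by simp
qed

lemma mollifier_integrable: "mollifier e \<rho> \<Longrightarrow> integrable lebesgue \<rho>"
  using integrable_mult_test_fun(2)[OF continuous_locally_integrable, of "\<lambda>x. 1" \<rho>]
  by (simp add: mollifier_def)

lemma conv_le:
  fixes u \<rho> :: "real^'n \<Rightarrow> real"
  assumes "u \<in> borel_measurable borel" "locally_integrable u" "mollifier e \<rho>"
    and "\<And>x. norm x < e \<Longrightarrow> u (z + x) \<le> u (z' + x) + c"
  shows "conv u \<rho> z \<le> conv u \<rho> z' + c"
proof -
  have t: "test_fun \<rho>" and z: "\<And>x. norm x \<ge> e \<Longrightarrow> \<rho> x = 0" and 1: "(LINT x|lebesgue. \<rho> x) = 1"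
    and p: "\<And>x. 0 \<le> \<rho> x"
    using assms(3) by (auto simp: mollifier_def)
  note alt = conv_alt[OF assms(1,2) t]
  note i = mollifier_integrable[OF assms(3)]
  have le: "u (z - x) * \<rho> x \<le> u (z' - x) * \<rho> x + c * \<rho> x" for x
    using mult_right_mono[OF assms(4)[of "-x"] p[of x]] z[of x]
    by (cases "norm x < e") (auto simp: distrib_right)
  have "conv u \<rho> z \<le> (LINT x|lebesgue. u (z' - x) * \<rho> x + c * \<rho> x)"
    unfolding alt by (rule integral_mono) (use alt(2) i le in auto)
  also have "\<dots> = conv u \<rho> z' + c" using alt i 1 by simp
  finally show ?thesis .
qed

lemma conv_bounds:
  fixes u \<rho> :: "real^'n \<Rightarrow> real"
  assumes "u \<in> borel_measurable borel" "locally_integrable u" "mollifier e \<rho>"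
  shows "(\<And>x. norm x < e \<Longrightarrow> u (z + x) \<le> d) \<Longrightarrow> conv u \<rho> z \<le> d"
    and "(\<And>x. norm x < e \<Longrightarrow> d \<le> u (z + x)) \<Longrightarrow> d \<le> conv u \<rho> z"
proof -
  have t: "test_fun \<rho>" and z: "\<And>x. norm x \<ge> e \<Longrightarrow> \<rho> x = 0" and 1: "(LINT x|lebesgue. \<rho> x) = 1"
    and p: "\<And>x. 0 \<le> \<rho> x"
    using assms(3) by (auto simp: mollifier_def)
  note alt = conv_alt[OF assms(1,2) t]
  note i = mollifier_integrable[OF assms(3)]
  show "conv u \<rho> z \<le> d" if d: "\<And>x. norm x < e \<Longrightarrow> u (z + x) \<le> d"
  proof -
    have le: "u (z - x) * \<rho> x \<le> d * \<rho> x" for x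
      using mult_right_mono[OF d[of "-x"] p[of x]] z[of x] by (cases "norm x < e") auto
    have "conv u \<rho> z \<le> (LINT x|lebesgue. d * \<rho> x)"
      unfolding alt by (rule integral_mono) (use alt(2) i le in auto)
    then show ?thesis using 1 by simp
  qed
  show "d \<le> conv u \<rho> z" if d: "\<And>x. norm x < e \<Longrightarrow> d \<le> u (z + x)"
  proof -
    have le: "d * \<rho> x \<le> u (z - x) * \<rho> x" for x
      using mult_right_mono[OF d[of "-x"] p[of x]] z[of x] by (cases "norm x < e") auto
    have "(LINT x|lebesgue. d * \<rho> x) \<le> conv u \<rho> z"
      unfolding alt by (rule integral_mono) (use alt(2) i le in auto)
    then show ?thesis using 1 by simp
  qed
qed

lemma conv_translate:
  fixes u \<rho> :: "real^'n \<Rightarrow> real"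
  assumes "u \<in> borel_measurable borel" "locally_integrable u" "mollifier e \<rho>"
    and "\<And>x. norm x < e \<Longrightarrow> u (z + x) = u (z' + x) + c"
  shows "conv u \<rho> z = conv u \<rho> z' + c"
  using conv_le[OF assms(1-3), of z z' c] conv_le[OF assms(1-3), of z' z "-c"] assms(4) by force

lemma conv_const:
  fixes u \<rho> :: "real^'n \<Rightarrow> real"
  assumes "u \<in> borel_measurable borel" "locally_integrable u" "mollifier e \<rho>"
    and "\<And>x. norm x < e \<Longrightarrow> u (z + x) = d"
  shows "conv u \<rho> z = d"
  using conv_bounds[OF assms(1-3), where z = z and d = d] assms(4) by force

section \<open>Cones\<close>

text \<open>
  A finitely generated cone is a polyhedron, given by inequalities \<open>a \<bullet> x \<le> b\<close>.
  Here \<open>b \<ge> 0\<close> because 0 lies in the cone, and invariance under scaling allows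
  \<open>b\<close> to be replaced by 0.
\<close>

lemma finite_cone_halfspaces:
  fixes S :: "(real^'n) set"
  assumes "finite S"
  shows "\<exists>L. finite L \<and> convex_cone hull S = {x. \<forall>l\<in>L. 0 \<le> l \<bullet> x}"
proof -
  let ?C = "convex_cone hull S"
  obtain F where F: "finite F" "?C = \<Inter>F" "\<forall>h\<in>F. \<exists>a b. h = {x. a \<bullet> x \<le> b}"
    using polyhedron_convex_cone_hull[OF assms] unfolding polyhedron_def by metis
  from F(3) obtain a b where ab: "\<And>h. h \<in> F \<Longrightarrow> h = {x. a h \<bullet> x \<le> b h}" by metis
  have b0: "0 \<le> b h" if "h \<in> F" for h
  proof -
    have "0 \<in> h" using convex_cone_hull_contains_0[of S] F(2) that by blast
    then have "0 \<in> {x. a h \<bullet> x \<le> b h}" using ab[OF that] by blast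
    then show ?thesis by simp
  qed
  have neg: "a h \<bullet> x \<le> 0" if "h \<in> F" "x \<in> ?C" for h x
  proof (rule ccontr)
    assume "\<not> a h \<bullet> x \<le> 0"
    then have pos: "0 < a h \<bullet> x" by simp
    let ?t = "(b h + 1) / (a h \<bullet> x)"
    have "?t *\<^sub>R x \<in> ?C" using b0[OF that(1)] pos by (intro convex_cone_hull_mul that(2)) auto
    then have "a h \<bullet> (?t *\<^sub>R x) \<le> b h" using F(2) ab[OF that(1)] that(1) by blast
    then show False using pos by simp
  qed
  have "?C = {x. \<forall>l\<in>(\<lambda>h. - a h) ` F. 0 \<le> l \<bullet> x}"
  proof (intro equalityI subsetI CollectI ballI)
    fix x l assume "x \<in> ?C" "l \<in> (\<lambda>h. - a h) ` F"
    then show "0 \<le> l \<bullet> x" using neg by auto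
  next
    fix x assume x: "x \<in> {x. \<forall>l\<in>(\<lambda>h. - a h) ` F. 0 \<le> l \<bullet> x}"
    have "x \<in> h" if "h \<in> F" for h
    proof -
      have "a h \<bullet> x \<le> 0" using x that by simp
      then have "a h \<bullet> x \<le> b h" using b0[OF that] by linarith
      then show ?thesis using ab[OF that] by blast
    qed
    then show "x \<in> ?C" using F(2) by blast
  qed
  with F(1) show ?thesis by (intro exI[of _ "(\<lambda>h. - a h) ` F"]) simp
qed

text \<open>
  The segment from \<open>x\<close> to \<open>t0\<close> can be prolonged inside \<open>\<tau>\<close>
  beyond \<open>t0\<close>; if \<open>l\<close> vanished at \<open>t0\<close> it would be negative on the
  prolongation.
\<close>

lemma pos_on_rel_interior:
  assumes "convex \<tau>" "t0 \<in> rel_interior \<tau>" "\<And>x. x \<in> \<tau> \<Longrightarrow> 0 \<le> l \<bullet> x" "x \<in> \<tau>" "0 < l \<bullet> (x::real^'n)"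
  shows "0 < l \<bullet> t0"
proof -
  obtain e where e: "e > 1" "(1 - e) *\<^sub>R x + e *\<^sub>R t0 \<in> \<tau>"
    using convex_rel_interior_iff[OF assms(1), of t0] assms(2,4) by blast
  have "0 \<le> (1 - e) * (l \<bullet> x) + e * (l \<bullet> t0)"
    using assms(3)[OF e(2)] by (simp add: inner_add_right)
  moreover have "(1 - e) * (l \<bullet> x) < 0" using e(1) assms(5) by (intro mult_neg_pos) auto
  ultimately have "0 < e * (l \<bullet> t0)" by linarith
  then show ?thesis using e(1) by (simp add: zero_less_mult_iff)
qed

lemma span_cone:
  assumes "convex_cone \<sigma>" shows "span \<sigma> = {s - t |s t. s \<in> \<sigma> \<and> t \<in> \<sigma>}"
proof
  have "subspace {s - t |s t. s \<in> \<sigma> \<and> t \<in> \<sigma>}"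
  proof (rule subspaceI)
    show "0 \<in> {s - t |s t. s \<in> \<sigma> \<and> t \<in> \<sigma>}"
      using convex_cone_contains_0[OF assms] by (intro CollectI exI[of _ 0]) auto
    fix x y assume "x \<in> {s - t |s t. s \<in> \<sigma> \<and> t \<in> \<sigma>}" "y \<in> {s - t |s t. s \<in> \<sigma> \<and> t \<in> \<sigma>}"
    then obtain s t s' t' where "x = s - t" "y = s' - t'" "s \<in> \<sigma>" "t \<in> \<sigma>" "s' \<in> \<sigma>" "t' \<in> \<sigma>" by blast
    then show "x + y \<in> {s - t |s t. s \<in> \<sigma> \<and> t \<in> \<sigma>}"
      using convex_cone_add[OF assms] by (intro CollectI exI[of _ "s + s'"] exI[of _ "t + t'"]) auto
  next
    fix c :: real and x assume "x \<in> {s - t |s t. s \<in> \<sigma> \<and> t \<in> \<sigma>}"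
    then obtain s t where x: "x = s - t" "s \<in> \<sigma>" "t \<in> \<sigma>" by blast
    show "c *\<^sub>R x \<in> {s - t |s t. s \<in> \<sigma> \<and> t \<in> \<sigma>}"
    proof (cases "c \<ge> 0")
      case True
      then show ?thesis using x convex_cone_scaleR[OF assms]
        by (intro CollectI exI[of _ "c *\<^sub>R s"] exI[of _ "c *\<^sub>R t"]) (auto simp: scaleR_diff_right)
    next
      case False
      then show ?thesis using x convex_cone_scaleR[OF assms, of "-c"]
        by (intro CollectI exI[of _ "(-c) *\<^sub>R t"] exI[of _ "(-c) *\<^sub>R s"]) (auto simp: algebra_simps)
    qed
  qed
  moreover have "\<sigma> \<subseteq> {s - t |s t. s \<in> \<sigma> \<and> t \<in> \<sigma>}"
  proof
    fix x assume "x \<in> \<sigma>"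
    then show "x \<in> {s - t |s t. s \<in> \<sigma> \<and> t \<in> \<sigma>}"
      using convex_cone_contains_0[OF assms] by (intro CollectI exI[of _ x] exI[of _ 0]) auto
  qed
  ultimately show "span \<sigma> \<subseteq> {s - t |s t. s \<in> \<sigma> \<and> t \<in> \<sigma>}" by (rule span_minimal[rotated])
  show "{s - t |s t. s \<in> \<sigma> \<and> t \<in> \<sigma>} \<subseteq> span \<sigma>" by (auto intro: span_diff span_base)
qed

section \<open>Cosets\<close>

lemma coset_eq_iff: "coset \<sigma> x = coset \<sigma> y \<longleftrightarrow> x - y \<in> span \<sigma>"
proof
  assume "coset \<sigma> x = coset \<sigma> y"
  moreover have "x \<in> coset \<sigma> x" unfolding coset_def by (auto intro!: image_eqI[of _ _ 0] span_zero)
  ultimately have "x \<in> coset \<sigma> y" by simp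
  then show "x - y \<in> span \<sigma>" unfolding coset_def by auto
next
  assume *: "x - y \<in> span \<sigma>"
  show "coset \<sigma> x = coset \<sigma> y"
    unfolding coset_def
  proof (intro equalityI subsetI)
    fix z assume "z \<in> (+) x ` span \<sigma>"
    then obtain v where "z = x + v" "v \<in> span \<sigma>" by blast
    then show "z \<in> (+) y ` span \<sigma>"
      using span_add[OF *] by (auto intro!: image_eqI[of _ _ "x - y + v"])
  next
    fix z assume "z \<in> (+) y ` span \<sigma>"
    then obtain v where "z = y + v" "v \<in> span \<sigma>" by blast
    then show "z \<in> (+) x ` span \<sigma>"
      using span_diff[OF _ *] by (auto intro!: image_eqI[of _ _ "v - (x - y)"])
  qed
qed

lemma coset_zero: "coset {0} x = {x}"
  by (simp add: coset_def span_insert_0)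

lemma emb_eq: "emb x = ({0}, {x})"
  by (simp add: emb_def coset_zero)

lemma coset_shift: "v \<in> span \<sigma> \<Longrightarrow> coset \<sigma> (x + v) = coset \<sigma> x"
  by (simp add: coset_eq_iff)

lemma quot_map_coset:
  assumes "\<tau> \<subseteq> \<sigma>" shows "quot_map \<sigma> (coset \<tau> x) = coset \<sigma> x"
proof -
  have s: "span \<tau> \<subseteq> span \<sigma>" using assms by (rule span_mono)
  show ?thesis
    unfolding quot_map_def coset_def
  proof (intro equalityI subsetI)
    fix z assume "z \<in> {y + v |y v. y \<in> (+) x ` span \<tau> \<and> v \<in> span \<sigma>}"
    then obtain w v where "z = x + (w + v)" "w \<in> span \<tau>" "v \<in> span \<sigma>" by (auto simp: add.assoc)
    then show "z \<in> (+) x ` span \<sigma>" using s span_add by blast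
  next
    fix z assume "z \<in> (+) x ` span \<sigma>"
    then obtain v where "z = x + v" "v \<in> span \<sigma>" by blast
    then show "z \<in> {y + v |y v. y \<in> (+) x ` span \<tau> \<and> v \<in> span \<sigma>}"
      by (intro CollectI exI[of _ x] exI[of _ v]) (auto intro!: image_eqI[of _ _ 0] span_zero)
  qed
qed

section \<open>Neighbourhoods of boundary points\<close>

text \<open>
  The trace on $N_{\mathbb R}$ of the neighbourhood filter of the point of $N(\sigma)$ represented by
  \<open>x\<close>. A basic neighbourhood meets $N_{\mathbb R}$ in $\Omega + \sigma$; as
  \<open>\<Omega>\<close> need only contain a representative of the point, the ball may be centred at
  \<open>x + s0\<close> for any \<open>s0 \<in> \<sigma>\<close>.
\<close>

definition near :: "(real^'n) set \<Rightarrow> real^'n \<Rightarrow> (real^'n) filter" where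
  "near \<sigma> x = (INF p\<in>\<sigma> \<times> {0<..}. principal {y + s |y s. y \<in> ball (x + fst p) (snd p) \<and> s \<in> \<sigma>})"

lemma eventually_near:
  assumes "convex_cone \<sigma>"
  shows "eventually P (near \<sigma> x) \<longleftrightarrow>
    (\<exists>s0\<in>\<sigma>. \<exists>r>0. \<forall>y\<in>ball (x + s0) r. \<forall>s\<in>\<sigma>. P (y + s))"
proof -
  have "eventually P (near \<sigma> x) \<longleftrightarrow> (\<exists>p\<in>\<sigma> \<times> {0<..}. eventually P
      (principal {y + s |y s. y \<in> ball (x + fst p) (snd p) \<and> s \<in> \<sigma>}))"
    unfolding near_def
  proof (rule eventually_INF_base)
    show "\<sigma> \<times> {0::real<..} \<noteq> {}" using convex_cone_nonempty[OF assms] by (auto intro: gt_ex)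
    fix p q assume "p \<in> \<sigma> \<times> {0::real<..}" "q \<in> \<sigma> \<times> {0::real<..}"
    then obtain s r s' r' where pq: "p = (s, r)" "q = (s', r')" "s \<in> \<sigma>" "s' \<in> \<sigma>" "0 < r" "0 < r'" by auto
    \<comment> \<open>The sets belonging to \<open>(s, r)\<close> and \<open>(s', r')\<close> both contain the one belonging to \<open>(s + s', min r r')\<close>.\<close>
    have sub: "{y + t |y t. y \<in> ball (x + (a + b)) (min r r') \<and> t \<in> \<sigma>} \<subseteq> {y + t |y t. y \<in> ball (x + a) c \<and> t \<in> \<sigma>}"
      if "b \<in> \<sigma>" "min r r' \<le> c" for a b c
    proof
      fix z assume "z \<in> {y + t |y t. y \<in> ball (x + (a + b)) (min r r') \<and> t \<in> \<sigma>}"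
      then obtain y t where "z = y + t" "y \<in> ball (x + (a + b)) (min r r')" "t \<in> \<sigma>" by blast
      then have "z = (y - b) + (b + t)" "y - b \<in> ball (x + a) c" "b + t \<in> \<sigma>"
        using that convex_cone_add[OF assms] by (auto simp: dist_norm algebra_simps)
      then show "z \<in> {y + t |y t. y \<in> ball (x + a) c \<and> t \<in> \<sigma>}" by blast
    qed
    show "\<exists>p'\<in>\<sigma> \<times> {0<..}. principal {y + s |y s. y \<in> ball (x + fst p') (snd p') \<and> s \<in> \<sigma>}
        \<le> inf (principal {y + s |y s. y \<in> ball (x + fst p) (snd p) \<and> s \<in> \<sigma>})
          (principal {y + s |y s. y \<in> ball (x + fst q) (snd q) \<and> s \<in> \<sigma>})"
      using pq sub[of s' r s] sub[of s r' s'] convex_cone_add[OF assms]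
      by (intro bexI[of _ "(s + s', min r r')"]) (auto simp: add.commute[of s s'])
  qed
  also have "\<dots> \<longleftrightarrow> (\<exists>s0\<in>\<sigma>. \<exists>r>0. \<forall>y\<in>ball (x + s0) r. \<forall>s\<in>\<sigma>. P (y + s))"
    unfolding eventually_principal bex_simps Ball_def mem_Collect_eq by (simp add: Bex_def) metis
  finally show ?thesis .
qed

lemma eventually_near_zero: "eventually P (near {0} x) \<longleftrightarrow> eventually P (nhds x)"
  unfolding eventually_near[OF convex_cone_singleton] eventually_nhds_metric
  by (simp add: Ball_def dist_commute)

text \<open>
  The filter has a base of sets that are stable under translation by \<open>\<sigma>\<close>.
\<close>

lemma near_eventually_translates:
  assumes "convex_cone \<sigma>" "eventually P (near \<sigma> x)"
  shows "eventually (\<lambda>z. \<forall>s\<in>\<sigma>. P (z + s)) (near \<sigma> x)"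
proof -
  obtain s0 r where *: "s0 \<in> \<sigma>" "r > 0" "\<And>y s. y \<in> ball (x + s0) r \<Longrightarrow> s \<in> \<sigma> \<Longrightarrow> P (y + s)"
    using assms(2) unfolding eventually_near[OF assms(1)] by blast
  show ?thesis unfolding eventually_near[OF assms(1)]
    using * convex_cone_add[OF assms(1)]
    by (intro bexI[of _ s0] exI[of _ r]) (auto simp: add.assoc)
qed

lemma near_eventually_witness:
  assumes "convex_cone \<sigma>" "eventually P (near \<sigma> x)"
  shows "\<exists>s0\<in>\<sigma>. \<forall>s\<in>\<sigma>. P (x + s0 + s)"
proof -
  obtain s0 r where *: "s0 \<in> \<sigma>" "r > 0" "\<And>y s. y \<in> ball (x + s0) r \<Longrightarrow> s \<in> \<sigma> \<Longrightarrow> P (y + s)"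
    using assms(2) unfolding eventually_near[OF assms(1)] by blast
  then show ?thesis by (intro bexI[of _ s0] ballI *(3)) auto
qed

section \<open>Fans\<close>

locale tropical_variety =
  fixes \<Sigma> :: "(real^'n) set set"
  assumes complete: "complete_fan \<Sigma>"
begin

lemma is_fan: "fan \<Sigma>" using complete by (simp add: complete_fan_def)

lemma finite_fan: "finite \<Sigma>" using is_fan by (simp add: fan_def)

lemma cone_generators: "\<sigma> \<in> \<Sigma> \<Longrightarrow> \<exists>S. finite S \<and> \<sigma> = convex_cone hull S"
  using is_fan by (auto simp: fan_def rational_cone_def)

lemma cone: "\<sigma> \<in> \<Sigma> \<Longrightarrow> convex_cone \<sigma>"
  using cone_generators convex_cone_convex_cone_hull by metis

lemma cone_zero: "\<sigma> \<in> \<Sigma> \<Longrightarrow> 0 \<in> \<sigma>"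
  using cone convex_cone_contains_0 by blast

lemma cone_convex: "\<sigma> \<in> \<Sigma> \<Longrightarrow> convex \<sigma>"
  using cone by (auto simp: convex_cone_def)

lemma cone_add: "\<sigma> \<in> \<Sigma> \<Longrightarrow> s \<in> \<sigma> \<Longrightarrow> t \<in> \<sigma> \<Longrightarrow> s + t \<in> \<sigma>"
  using cone convex_cone_add by blast

lemma cone_scale: "\<sigma> \<in> \<Sigma> \<Longrightarrow> s \<in> \<sigma> \<Longrightarrow> 0 \<le> c \<Longrightarrow> c *\<^sub>R s \<in> \<sigma>"
  using cone convex_cone_scaleR by blast

lemma face_self: "\<sigma> \<in> \<Sigma> \<Longrightarrow> \<sigma> face_of \<sigma>"
  using cone_convex face_of_refl by blast

lemma complete_cover: "\<exists>\<sigma>\<in>\<Sigma>. x \<in> \<sigma>"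
  using complete unfolding complete_fan_def by blast

lemma zero_face: "\<sigma> \<in> \<Sigma> \<Longrightarrow> {0} face_of \<sigma>"
proof -
  assume s: "\<sigma> \<in> \<Sigma>"
  then have sc: "strictly_convex \<sigma>" using is_fan by (auto simp: fan_def)
  have "a = 0 \<and> b = 0" if ab: "a \<in> \<sigma>" "b \<in> \<sigma>" "0 \<in> open_segment a b" for a b
  proof -
    obtain u where u: "0 < u" "u < 1" "0 = (1 - u) *\<^sub>R a + u *\<^sub>R b" using ab(3) by (auto simp: in_segment)
    then have "- (u *\<^sub>R b) = (1 - u) *\<^sub>R a" by (simp add: neg_eq_iff_add_eq_0 add.commute)
    then have "u *\<^sub>R b \<in> \<sigma>" "- (u *\<^sub>R b) \<in> \<sigma>"
      using cone_scale[OF s ab(1), of "1 - u"] cone_scale[OF s ab(2), of u] u by auto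
    then have "u *\<^sub>R b = 0" using sc unfolding strictly_convex_def by blast
    then show ?thesis using u by auto
  qed
  then show ?thesis using cone_zero[OF s] by (auto simp: face_of_def)
qed

lemma zero_cone: "{0} \<in> \<Sigma>"
proof -
  obtain \<sigma> where "\<sigma> \<in> \<Sigma>" using complete_cover by blast
  then show ?thesis using zero_face[of \<sigma>] is_fan unfolding fan_def by blast
qed

lemma face_of_zero: "\<tau> \<in> \<Sigma> \<Longrightarrow> \<tau> face_of {0} \<Longrightarrow> \<tau> = {0}"
  using face_of_imp_subset cone_zero by blast

lemma face_subset: "\<tau> face_of \<sigma> \<Longrightarrow> \<tau> \<subseteq> \<sigma>"
  by (rule face_of_imp_subset)

lemma subset_face:
  assumes "\<tau> \<in> \<Sigma>" "\<sigma> \<in> \<Sigma>" "\<tau> \<subseteq> \<sigma>" shows "\<tau> face_of \<sigma>"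
proof -
  have "\<tau> = \<sigma> \<inter> \<tau>" using assms by blast
  then show ?thesis using is_fan assms unfolding fan_def by metis
qed

text \<open>
  The cone \<open>\<sigma> - \<tau>\<close> is finitely generated, hence an intersection of half-spaces, and
  it does not contain \<open>t\<close>: if \<open>t = x - y\<close>, then the midpoint \<open>x / 2\<close>
  of \<open>t\<close> and \<open>y\<close> lies in the face \<open>\<sigma> \<inter> \<tau>\<close> of
  \<open>\<tau>\<close>, so that \<open>t\<close> would lie in that face too.
\<close>

lemma separation:
  assumes "\<sigma> \<in> \<Sigma>" "\<tau> \<in> \<Sigma>" "t \<in> \<tau>" "t \<notin> \<sigma>"
  shows "\<exists>l. (\<forall>x\<in>\<sigma>. 0 \<le> l \<bullet> x) \<and> (\<forall>x\<in>\<tau>. l \<bullet> x \<le> 0) \<and> l \<bullet> t < 0"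
proof -
  obtain S T where S: "finite S" "\<sigma> = convex_cone hull S" and T: "finite T" "\<tau> = convex_cone hull T"
    using cone_generators assms(1,2) by metis
  let ?C = "convex_cone hull (S \<union> uminus ` T)"
  have "linear (uminus :: real^'n \<Rightarrow> real^'n)" by (simp add: linear_iff)
  then have C: "?C = (\<Union>x\<in>\<sigma>. \<Union>y\<in>uminus ` \<tau>. {x + y})"
    unfolding convex_cone_hull_Un by (simp add: convex_cone_hull_linear_image S T)
  obtain L where L: "finite L" "?C = {x. \<forall>l\<in>L. 0 \<le> l \<bullet> x}"
    using finite_cone_halfspaces[of "S \<union> uminus ` T"] S T by auto
  have "t \<notin> ?C"
  proof
    assume "t \<in> ?C"
    then obtain x y where xy: "x \<in> \<sigma>" "y \<in> \<tau>" "t = x - y" unfolding C by auto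
    have f: "(\<sigma> \<inter> \<tau>) face_of \<tau>" using is_fan assms(1,2) unfolding fan_def by blast
    show False
    proof (cases "t = y")
      case True
      then have "2 *\<^sub>R t = x" using xy(3) by (simp add: scaleR_2)
      then have "t = (1/2) *\<^sub>R x" by auto
      then show False using cone_scale[OF assms(1) xy(1), of "1/2"] assms(4) by auto
    next
      case False
      have h: "(1/2) *\<^sub>R x = (1/2) *\<^sub>R t + (1/2) *\<^sub>R y" using xy(3) by (simp add: scaleR_diff_right)
      then have "(1/2) *\<^sub>R x \<in> \<sigma> \<inter> \<tau>"
        using cone_scale[OF assms(1) xy(1), of "1/2"] cone_add[OF assms(2) cone_scale[OF assms(2,3)] cone_scale[OF assms(2) xy(2)], of "1/2" "1/2"]
        by auto
      moreover have "(1/2) *\<^sub>R x \<in> open_segment t y"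
        unfolding in_segment using False h by (intro conjI exI[of _ "1/2"]) auto
      ultimately have "t \<in> \<sigma> \<inter> \<tau>" using face_ofD[OF f] assms(3) xy(2) by blast
      then show False using assms(4) by blast
    qed
  qed
  then obtain l where l: "l \<in> L" "l \<bullet> t < 0" using L by (auto simp: not_le)
  have "x \<in> ?C" if "x \<in> \<sigma>" for x
    using that cone_zero[OF assms(2)] unfolding C by (intro UN_I[of x] UN_I[of 0]) auto
  moreover have "- x \<in> ?C" if "x \<in> \<tau>" for x
    using that cone_zero[OF assms(1)] unfolding C by (intro UN_I[of 0] UN_I[of "-x"]) auto
  ultimately have "\<forall>x\<in>\<sigma>. 0 \<le> l \<bullet> x" "\<forall>x\<in>\<tau>. 0 \<le> l \<bullet> (- x)" using L l(1) by blast+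
  with l show ?thesis by auto
qed

lemma rel_interior_point: "\<sigma> \<in> \<Sigma> \<Longrightarrow> \<exists>t0. t0 \<in> rel_interior \<sigma> \<and> t0 \<in> \<sigma>"
proof -
  assume s: "\<sigma> \<in> \<Sigma>"
  then have "rel_interior \<sigma> \<noteq> {}" using rel_interior_eq_empty[OF cone_convex[OF s]] cone_zero[OF s] by auto
  then show ?thesis using rel_interior_subset[of \<sigma>] by auto
qed

lemma rel_interior_subset_cone:
  assumes "\<sigma> \<in> \<Sigma>" "\<tau> \<in> \<Sigma>" "t0 \<in> rel_interior \<sigma>" "t0 \<in> \<tau>" shows "\<sigma> \<subseteq> \<tau>"
proof -
  have "(\<sigma> \<inter> \<tau>) face_of \<sigma>" using is_fan assms unfolding fan_def by blast
  moreover have "t0 \<in> \<sigma>" using assms(3) rel_interior_subset by blast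
  ultimately have "\<sigma> \<subseteq> \<sigma> \<inter> \<tau>" using subset_of_face_of[of "\<sigma> \<inter> \<tau>" \<sigma> \<sigma>] assms by blast
  then show ?thesis by blast
qed

text \<open>
  A functional that separates \<open>\<sigma>\<close> from \<open>\<tau>\<close> becomes as negative as
  desired far along \<open>t\<close>, and moving on inside \<open>\<tau>\<close> does not increase it.
\<close>

lemma avoid_cone:
  assumes "\<sigma> \<in> \<Sigma>" "\<tau> \<in> \<Sigma>" "t \<in> \<tau>" "t \<notin> \<sigma>"
  shows "\<exists>s0\<in>\<tau>. \<forall>z s. norm z \<le> R \<longrightarrow> s \<in> \<tau> \<longrightarrow> z + s0 + s \<notin> \<sigma>"
proof -
  obtain l where l: "\<forall>x\<in>\<sigma>. 0 \<le> l \<bullet> x" "\<forall>x\<in>\<tau>. l \<bullet> x \<le> 0" "l \<bullet> t < 0"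
    using separation[OF assms] by blast
  \<comment> \<open>With this multiple of \<open>t\<close> the functional is negative whatever \<open>z\<close> in the ball of radius \<open>R\<close> is added.\<close>
  define c where "c = (norm l * \<bar>R\<bar> + 1) / (- (l \<bullet> t))"
  have "c \<ge> 0" unfolding c_def using l(3) by (intro divide_nonneg_pos) auto
  moreover have "c * (l \<bullet> t) = - (norm l * \<bar>R\<bar> + 1)" using l(3) by (simp add: c_def)
  ultimately have c: "c \<ge> 0" "c * (l \<bullet> t) = - (norm l * \<bar>R\<bar> + 1)" by auto
  have "z + c *\<^sub>R t + s \<notin> \<sigma>" if "norm z \<le> R" "s \<in> \<tau>" for z s
  proof
    assume "z + c *\<^sub>R t + s \<in> \<sigma>"
    then have "0 \<le> l \<bullet> z + c * (l \<bullet> t) + l \<bullet> s" using l(1) by (metis inner_add_right inner_scaleR_right)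
    moreover have "l \<bullet> z \<le> norm l * \<bar>R\<bar>"
    proof -
      have "norm z \<le> \<bar>R\<bar>" using that(1) by linarith
      then show ?thesis
        using norm_cauchy_schwarz[of l z] mult_left_mono[of "norm z" "\<bar>R\<bar>" "norm l"] by simp
    qed
    moreover have "l \<bullet> s \<le> 0" using l(2) that by blast
    ultimately show False using c(2) by linarith
  qed
  then show ?thesis using cone_scale[OF assms(2,3) c(1)] by blast
qed

text \<open>
  Far along \<open>\<sigma>\<close> only the cones of the star of \<open>\<sigma>\<close> are met, uniformly
  on balls. Each of the finitely many other cones is avoided after a translation by a vector of
  \<open>\<sigma>\<close>, and the sum of these vectors avoids all of them, since further translations
  inside \<open>\<sigma>\<close> do no harm.
\<close>

lemma deep_point:
  assumes "\<sigma> \<in> \<Sigma>"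
  shows "\<exists>s0\<in>\<sigma>. \<forall>z. norm z \<le> R \<longrightarrow> (\<exists>\<tau>\<in>\<Sigma>. \<sigma> \<subseteq> \<tau> \<and> z + s0 \<in> \<tau>)"
proof -
  obtain t0 where t0: "t0 \<in> rel_interior \<sigma>" "t0 \<in> \<sigma>" using rel_interior_point[OF assms] by blast
  let ?B = "{\<tau>\<in>\<Sigma>. \<not> \<sigma> \<subseteq> \<tau>}"
  have "\<exists>s0\<in>\<sigma>. \<forall>z s. norm z \<le> R \<longrightarrow> s \<in> \<sigma> \<longrightarrow> z + s0 + s \<notin> \<tau>" if "\<tau> \<in> ?B" for \<tau>
    using avoid_cone[of \<tau> \<sigma> t0 R] that t0 assms rel_interior_subset_cone by blast
  then have "\<forall>\<tau>\<in>?B. \<exists>s0. s0 \<in> \<sigma> \<and> (\<forall>z s. norm z \<le> R \<longrightarrow> s \<in> \<sigma> \<longrightarrow> z + s0 + s \<notin> \<tau>)"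
    by blast
  from bchoice[OF this] obtain f where "\<forall>\<tau>\<in>?B. f \<tau> \<in> \<sigma> \<and> (\<forall>z s. norm z \<le> R \<longrightarrow> s \<in> \<sigma> \<longrightarrow> z + f \<tau> + s \<notin> \<tau>)"
    by blast
  then have f: "\<And>\<tau>. \<tau> \<in> ?B \<Longrightarrow> f \<tau> \<in> \<sigma>"
    "\<And>\<tau> z s. \<tau> \<in> ?B \<Longrightarrow> norm z \<le> R \<Longrightarrow> s \<in> \<sigma> \<Longrightarrow> z + f \<tau> + s \<notin> \<tau>"
    by blast+
  have fin: "finite ?B" using finite_fan by simp
  have sums: "sum f A \<in> \<sigma>" if "A \<subseteq> ?B" for A
    using finite_subset[OF that fin] that
    by (induction A rule: finite_induct) (auto intro: cone_zero[OF assms] cone_add[OF assms] f(1))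
  show ?thesis
  proof (intro bexI[of _ "sum f ?B"] allI impI)
    fix z :: "real^'n" assume z: "norm z \<le> R"
    obtain \<tau> where \<tau>: "\<tau> \<in> \<Sigma>" "z + sum f ?B \<in> \<tau>" using complete_cover by blast
    have "\<sigma> \<subseteq> \<tau>"
    proof (rule ccontr)
      assume "\<not> \<sigma> \<subseteq> \<tau>"
      then have t: "\<tau> \<in> ?B" using \<tau> by simp
      have "z + f \<tau> + sum f (?B - {\<tau>}) \<notin> \<tau>" by (rule f(2)[OF t z sums]) blast
      moreover have "sum f ?B = f \<tau> + sum f (?B - {\<tau>})" using sum.remove[OF fin t] .
      ultimately show False using \<tau>(2) by (simp add: add.assoc)
    qed
    with \<tau> show "\<exists>\<tau>\<in>\<Sigma>. \<sigma> \<subseteq> \<tau> \<and> z + sum f ?B \<in> \<tau>" by blast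
  qed (rule sums, simp)
qed

section \<open>Topology and forms near the boundary\<close>

lemma topspace_trop: "topspace (trop_topology \<Sigma>) = trop_var \<Sigma>"
proof -
  have "(\<sigma>, coset \<sigma> x) \<in> basic_nbhd \<Sigma> \<sigma> (ball x 1)" if "\<sigma> \<in> \<Sigma>" for \<sigma> x
    unfolding basic_nbhd_def using that face_self cone_zero
    by (intro CollectI exI[of _ \<sigma>] exI[of _ x] exI[of _ 0]) auto
  then have "trop_var \<Sigma> \<subseteq> topspace (trop_topology \<Sigma>)"
    unfolding trop_topology_def topology_generated_by_topspace trop_var_def
    using bounded_ball convex_ball open_ball by fast
  moreover have "topspace (trop_topology \<Sigma>) \<subseteq> trop_var \<Sigma>"
    unfolding trop_topology_def topology_generated_by_topspace trop_var_def basic_nbhd_def by blast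
  ultimately show ?thesis by blast
qed

lemma open_basic: "\<sigma> \<in> \<Sigma> \<Longrightarrow> bounded \<Omega> \<Longrightarrow> open \<Omega> \<Longrightarrow> convex \<Omega> \<Longrightarrow> openin (trop_topology \<Sigma>) (basic_nbhd \<Sigma> \<sigma> \<Omega>)"
  unfolding trop_topology_def by (rule topology_generated_by_Basis) blast

lemma basic_near:
  assumes "\<sigma>' \<in> \<Sigma>" "open \<Omega>" "(\<sigma>, coset \<sigma> x) \<in> basic_nbhd \<Sigma> \<sigma>' \<Omega>"
  shows "eventually (\<lambda>z. \<forall>\<tau>\<in>\<Sigma>. \<tau> face_of \<sigma> \<longrightarrow> (\<tau>, coset \<tau> z) \<in> basic_nbhd \<Sigma> \<sigma>' \<Omega>) (near \<sigma> x)"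
proof -
  obtain w s where *: "\<sigma> \<in> \<Sigma>" "\<sigma> face_of \<sigma>'" "w \<in> \<Omega>" "s \<in> \<sigma>'" "coset \<sigma> x = coset \<sigma> (w + s)"
    using assms(3) unfolding basic_nbhd_def by auto
  then obtain s1 s2 where s12: "x - (w + s) = s1 - s2" "s1 \<in> \<sigma>" "s2 \<in> \<sigma>"
    using coset_eq_iff[of \<sigma> x "w + s"] span_cone[OF cone[OF *(1)]] by auto
  obtain r where r: "r > 0" "ball w r \<subseteq> \<Omega>" using assms(2) *(3) by (auto simp: open_contains_ball)
  show ?thesis
    unfolding eventually_near[OF cone[OF *(1)]]
  proof (intro bexI[of _ s2] exI[of _ r] conjI ballI impI)
    fix y t \<tau> assume y: "y \<in> ball (x + s2) r" and t: "t \<in> \<sigma>" and \<tau>: "\<tau> \<in> \<Sigma>" "\<tau> face_of \<sigma>"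
    have x: "x + s2 = w + s + s1" using s12(1) by (simp add: algebra_simps)
    have "y - (s + s1) \<in> \<Omega>" using y r(2) unfolding x by (auto simp: dist_norm algebra_simps)
    moreover have "s + s1 + t \<in> \<sigma>'"
      using *(4) s12 t face_subset[OF *(2)] cone_add[OF assms(1)] by blast
    moreover have "\<tau> face_of \<sigma>'" using \<tau>(2) *(2) face_of_trans by blast
    ultimately show "(\<tau>, coset \<tau> (y + t)) \<in> basic_nbhd \<Sigma> \<sigma>' \<Omega>"
      unfolding basic_nbhd_def using \<tau>(1)
      by (intro CollectI exI[of _ \<tau>] exI[of _ "y - (s + s1)"] exI[of _ "s + s1 + t"]) auto
  qed (use r s12 in auto)
qed

text \<open>
  With its converse \<open>near_open\<close> this reduces the topology of $N_\Sigma$ at a boundary point to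
  the filter \<open>near\<close> on $N_{\mathbb R}$.
\<close>

lemma open_near:
  assumes "openin (trop_topology \<Sigma>) W" "(\<sigma>, coset \<sigma> x) \<in> W" "\<sigma> \<in> \<Sigma>"
  shows "eventually (\<lambda>z. \<forall>\<tau>\<in>\<Sigma>. \<tau> face_of \<sigma> \<longrightarrow> (\<tau>, coset \<tau> z) \<in> W) (near \<sigma> x)"
proof -
  have "generate_topology_on {basic_nbhd \<Sigma> \<sigma> \<Omega> |\<sigma> \<Omega>. \<sigma> \<in> \<Sigma> \<and> bounded \<Omega> \<and> open \<Omega> \<and> convex \<Omega>} W"
    using assms(1) unfolding trop_topology_def by (rule openin_topology_generated_by)
  then show ?thesis using assms(2)
  proof (induction rule: generate_topology_on.induct)
    case (Int a b)
    then show ?case by (auto elim: eventually_elim2)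
  next
    case (UN K)
    then obtain k where "k \<in> K" "(\<sigma>, coset \<sigma> x) \<in> k" by blast
    with UN.IH[of k] show ?case by (auto elim!: eventually_mono)
  next
    case (Basis s)
    then show ?case using basic_near by blast
  qed simp
qed

lemma open_near_emb:
  assumes "openin (trop_topology \<Sigma>) W" "(\<sigma>, coset \<sigma> x) \<in> W" "\<sigma> \<in> \<Sigma>"
  shows "eventually (\<lambda>z. emb z \<in> W) (near \<sigma> x)"
  using open_near[OF assms] by (rule eventually_mono) (simp add: emb_def zero_cone zero_face assms(3))

lemma near_open:
  assumes "\<sigma> \<in> \<Sigma>" "eventually P (near \<sigma> x)"
  obtains R where "openin (trop_topology \<Sigma>) {(\<tau>, coset \<tau> z) |\<tau> z. \<tau> \<in> \<Sigma> \<and> \<tau> face_of \<sigma> \<and> z \<in> R}"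
    and "(\<sigma>, coset \<sigma> x) \<in> {(\<tau>, coset \<tau> z) |\<tau> z. \<tau> \<in> \<Sigma> \<and> \<tau> face_of \<sigma> \<and> z \<in> R}"
    and "\<And>z. z \<in> R \<Longrightarrow> P z" and "\<And>z s. z \<in> R \<Longrightarrow> s \<in> \<sigma> \<Longrightarrow> z + s \<in> R"
proof -
  note c = cone[OF assms(1)]
  obtain s0 r where *: "s0 \<in> \<sigma>" "r > 0" "\<And>y s. y \<in> ball (x + s0) r \<Longrightarrow> s \<in> \<sigma> \<Longrightarrow> P (y + s)"
    using assms(2) unfolding eventually_near[OF c] by blast
  let ?R = "{y + s |y s. y \<in> ball (x + s0) r \<and> s \<in> \<sigma>}"
  have eq: "{(\<tau>, coset \<tau> z) |\<tau> z. \<tau> \<in> \<Sigma> \<and> \<tau> face_of \<sigma> \<and> z \<in> ?R} = basic_nbhd \<Sigma> \<sigma> (ball (x + s0) r)"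
    unfolding basic_nbhd_def by blast
  show ?thesis
  proof (rule that[of ?R])
    show "openin (trop_topology \<Sigma>) {(\<tau>, coset \<tau> z) |\<tau> z. \<tau> \<in> \<Sigma> \<and> \<tau> face_of \<sigma> \<and> z \<in> ?R}"
      unfolding eq by (intro open_basic assms) auto
    have "coset \<sigma> x = coset \<sigma> (x + s0)" using *(1) by (simp add: coset_shift span_base)
    moreover have "x + s0 \<in> ?R" using *(2) cone_zero[OF assms(1)] by (intro CollectI exI[of _ "x + s0"] exI[of _ 0]) auto
    ultimately show "(\<sigma>, coset \<sigma> x) \<in> {(\<tau>, coset \<tau> z) |\<tau> z. \<tau> \<in> \<Sigma> \<and> \<tau> face_of \<sigma> \<and> z \<in> ?R}"
      using assms(1) face_self by blast
    show "P z" if "z \<in> ?R" for z using that *(3) by blast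
    show "z + s \<in> ?R" if zs: "z \<in> ?R" "s \<in> \<sigma>" for z s
    proof -
      obtain y t where "z = y + t" "y \<in> ball (x + s0) r" "t \<in> \<sigma>" using zs(1) by blast
      then show ?thesis using cone_add[OF assms(1) _ zs(2), of t]
        by (intro CollectI exI[of _ y] exI[of _ "t + s"]) (auto simp: add.assoc)
    qed
  qed
qed

lemma trop_var_cases:
  assumes "P \<in> trop_var \<Sigma>" obtains \<sigma> x where "\<sigma> \<in> \<Sigma>" "P = (\<sigma>, coset \<sigma> x)"
  using assms unfolding trop_var_def by blast

lemma emb_trop_var: "emb x \<in> trop_var \<Sigma>"
  unfolding trop_var_def emb_def using zero_cone by blast

lemma coset_trop_var: "\<sigma> \<in> \<Sigma> \<Longrightarrow> (\<sigma>, coset \<sigma> x) \<in> trop_var \<Sigma>"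
  unfolding trop_var_def by blast

lemma const_towards_near:
  assumes U: "openin (trop_topology \<Sigma>) U" and s: "\<sigma> \<in> \<Sigma>" and xU: "(\<sigma>, coset \<sigma> x) \<in> U"
  shows "(\<exists>W. openin (trop_topology \<Sigma>) W \<and> (\<sigma>, coset \<sigma> x) \<in> W \<and> W \<subseteq> U \<and> const_towards \<Sigma> \<sigma> W \<alpha>) \<longleftrightarrow>
    eventually (\<lambda>z. \<forall>\<tau>\<in>\<Sigma>. \<tau> face_of \<sigma> \<longrightarrow> \<alpha> (\<tau>, coset \<tau> z) = \<alpha> (\<sigma>, coset \<sigma> z)) (near \<sigma> x)"
    (is "?L \<longleftrightarrow> ?R")
proof
  assume ?L
  then obtain W where W: "openin (trop_topology \<Sigma>) W" "(\<sigma>, coset \<sigma> x) \<in> W" "const_towards \<Sigma> \<sigma> W \<alpha>" by blast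
  from open_near[OF W(1,2) s] show ?R
  proof (rule eventually_mono, intro ballI impI)
    fix z \<tau> assume "\<forall>\<tau>\<in>\<Sigma>. \<tau> face_of \<sigma> \<longrightarrow> (\<tau>, coset \<tau> z) \<in> W" "\<tau> \<in> \<Sigma>" "\<tau> face_of \<sigma>"
    then show "\<alpha> (\<tau>, coset \<tau> z) = \<alpha> (\<sigma>, coset \<sigma> z)"
      using W(3) quot_map_coset[OF face_subset, of \<tau> \<sigma> z] unfolding const_towards_def by metis
  qed
next
  assume R: ?R
  have "eventually (\<lambda>z. (\<forall>\<tau>\<in>\<Sigma>. \<tau> face_of \<sigma> \<longrightarrow> \<alpha> (\<tau>, coset \<tau> z) = \<alpha> (\<sigma>, coset \<sigma> z)) \<and>
      (\<forall>\<tau>\<in>\<Sigma>. \<tau> face_of \<sigma> \<longrightarrow> (\<tau>, coset \<tau> z) \<in> U)) (near \<sigma> x)"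
    using R open_near[OF U xU s] by (rule eventually_conj)
  then obtain Q where Q:
    "openin (trop_topology \<Sigma>) {(\<tau>, coset \<tau> z) |\<tau> z. \<tau> \<in> \<Sigma> \<and> \<tau> face_of \<sigma> \<and> z \<in> Q}"
    "(\<sigma>, coset \<sigma> x) \<in> {(\<tau>, coset \<tau> z) |\<tau> z. \<tau> \<in> \<Sigma> \<and> \<tau> face_of \<sigma> \<and> z \<in> Q}"
    "\<And>z. z \<in> Q \<Longrightarrow> (\<forall>\<tau>\<in>\<Sigma>. \<tau> face_of \<sigma> \<longrightarrow> \<alpha> (\<tau>, coset \<tau> z) = \<alpha> (\<sigma>, coset \<sigma> z)) \<and>
      (\<forall>\<tau>\<in>\<Sigma>. \<tau> face_of \<sigma> \<longrightarrow> (\<tau>, coset \<tau> z) \<in> U)"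
    by (rule near_open[OF s]) blast
  let ?W = "{(\<tau>, coset \<tau> z) |\<tau> z. \<tau> \<in> \<Sigma> \<and> \<tau> face_of \<sigma> \<and> z \<in> Q}"
  have "const_towards \<Sigma> \<sigma> ?W \<alpha>"
    unfolding const_towards_def
  proof (intro ballI impI allI)
    fix \<tau> D assume "\<tau> \<in> \<Sigma>" "\<tau> face_of \<sigma>" "(\<tau>, D) \<in> ?W"
    then obtain z where z: "D = coset \<tau> z" "z \<in> Q" "\<tau> \<in> \<Sigma>" "\<tau> face_of \<sigma>" by blast
    have q: "quot_map \<sigma> D = coset \<sigma> z" using quot_map_coset[OF face_subset[OF z(4)]] z(1) by simp
    show "(\<sigma>, quot_map \<sigma> D) \<in> ?W \<and> \<alpha> (\<tau>, D) = \<alpha> (\<sigma>, quot_map \<sigma> D)"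
    proof
      show "(\<sigma>, quot_map \<sigma> D) \<in> ?W" unfolding q using z(2) s face_self[OF s] by blast
      show "\<alpha> (\<tau>, D) = \<alpha> (\<sigma>, quot_map \<sigma> D)" unfolding q using Q(3)[OF z(2)] z by blast
    qed
  qed
  moreover have "?W \<subseteq> U" using Q(3) by blast
  ultimately show ?L using Q(1,2) by blast
qed

text \<open>
  In this form the condition at the boundary is an eventual statement, so it can be combined with others and
  inherited by sums, products and derivatives of forms.
\<close>

lemma lagerberg_forms_iff:
  assumes U: "openin (trop_topology \<Sigma>) U"
  shows "\<alpha> \<in> lagerberg_forms \<Sigma> U p q \<longleftrightarrow>
    (\<forall>P. P \<notin> U \<longrightarrow> \<alpha> P = (\<lambda>vs ws. 0)) \<and>
    (\<forall>\<sigma>\<in>\<Sigma>. \<forall>x. (\<sigma>, coset \<sigma> x) \<in> U \<longrightarrow> covector p q \<sigma> (\<alpha> (\<sigma>, coset \<sigma> x))) \<and>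
    (\<forall>\<sigma>\<in>\<Sigma>. \<forall>vs ws. smooth_on {x. (\<sigma>, coset \<sigma> x) \<in> U} (\<lambda>x. \<alpha> (\<sigma>, coset \<sigma> x) vs ws)) \<and>
    (\<forall>\<sigma>\<in>\<Sigma>. \<forall>x. (\<sigma>, coset \<sigma> x) \<in> U \<longrightarrow>
      eventually (\<lambda>z. \<forall>\<tau>\<in>\<Sigma>. \<tau> face_of \<sigma> \<longrightarrow> \<alpha> (\<tau>, coset \<tau> z) = \<alpha> (\<sigma>, coset \<sigma> z)) (near \<sigma> x))"
proof -
  have all: "(\<forall>\<sigma> D. (\<sigma>, D) \<in> U \<longrightarrow> Q \<sigma> D) \<longleftrightarrow> (\<forall>\<sigma>\<in>\<Sigma>. \<forall>x. (\<sigma>, coset \<sigma> x) \<in> U \<longrightarrow> Q \<sigma> (coset \<sigma> x))" for Q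
  proof (intro iffI allI impI ballI)
    fix \<sigma> D assume *: "\<forall>\<sigma>\<in>\<Sigma>. \<forall>x. (\<sigma>, coset \<sigma> x) \<in> U \<longrightarrow> Q \<sigma> (coset \<sigma> x)" "(\<sigma>, D) \<in> U"
    then have "(\<sigma>, D) \<in> trop_var \<Sigma>" using openin_subset[OF U] topspace_trop by blast
    then obtain x where "\<sigma> \<in> \<Sigma>" "D = coset \<sigma> x" by (auto elim: trop_var_cases)
    with * show "Q \<sigma> D" by blast
  qed blast
  show ?thesis
    unfolding lagerberg_forms_def mem_Collect_eq all
    by (intro conj_cong refl ball_cong all_cong imp_cong const_towards_near[OF U])
qed

lemma open_trop_var: "openin (trop_topology \<Sigma>) (trop_var \<Sigma>)"
  using openin_topspace topspace_trop by metis

end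

section \<open>Functions that stabilise along cones\<close>

lemma covector_zero: "covector p q \<sigma> (\<lambda>vs ws. 0)"
  by (simp add: covector_def linear_iff)

lemma linear_lincomb:
  "linear f \<Longrightarrow> linear g \<Longrightarrow> linear (\<lambda>x. c * f x + d * g x :: real)"
  by (simp add: linear_iff algebra_simps)

lemma covector_lincomb:
  fixes a b :: "'n::finite covec"
  assumes "covector p q \<sigma> a" "covector p q \<sigma> b"
  shows "covector p q \<sigma> (\<lambda>vs ws. c * a vs ws + d * b vs ws)"
  unfolding covector_def
proof (intro conjI allI impI)
  fix vs ws :: "(real^'n) list"
  show "c * a vs ws + d * b vs ws = 0" if "length vs \<noteq> p \<or> length ws \<noteq> q"
    using assms that by (simp add: covector_def)
  show "c * a vs ws + d * b vs ws = 0" if "\<not> distinct vs \<or> \<not> distinct ws"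
    using assms that by (simp add: covector_def)
  show "c * a vs ws + d * b vs ws = 0" if "(set vs \<union> set ws) \<inter> span \<sigma> \<noteq> {}"
    using assms that by (simp add: covector_def)
  fix k
  show "linear (\<lambda>v. c * a (vs[k := v]) ws + d * b (vs[k := v]) ws)" if "k < length vs"
    using assms that by (intro linear_lincomb) (simp_all add: covector_def)
  show "linear (\<lambda>w. c * a vs (ws[k := w]) + d * b vs (ws[k := w]))" if "k < length ws"
    using assms that by (intro linear_lincomb) (simp_all add: covector_def)
qed

lemma covector_scale: "covector p q \<sigma> a \<Longrightarrow> covector p q \<sigma> (\<lambda>vs ws. c * a vs ws)"
  using covector_lincomb[of p q \<sigma> a a c 0] by simp

lemma covector_degree_0: "covector 0 0 \<sigma> (\<lambda>vs ws. if vs = [] \<and> ws = [] then c else 0)"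
  by (auto simp: covector_def linear_iff)

text \<open>
  The value at a boundary point is the constant value of \<open>f\<close> on a translate \<open>x +
  \<sigma>\<close> for a sufficiently deep representative \<open>x\<close> of the point. It is unique
  because any two such translates in the same coset intersect.
\<close>

definition ext :: "(real^'n \<Rightarrow> real) \<Rightarrow> 'n pt \<Rightarrow> real" where
  "ext f P = (THE c. \<exists>x. snd P = coset (fst P) x \<and> (\<forall>s\<in>fst P. f (x + s) = c))"

lemma ext_eqI:
  assumes "convex_cone \<sigma>" "\<And>s. s \<in> \<sigma> \<Longrightarrow> f (x + s) = c"
  shows "ext f (\<sigma>, coset \<sigma> x) = c"
  unfolding ext_def fst_conv snd_conv
proof (rule the_equality)
  show "\<exists>y. coset \<sigma> x = coset \<sigma> y \<and> (\<forall>s\<in>\<sigma>. f (y + s) = c)" using assms(2) by blast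
  fix c' assume "\<exists>y. coset \<sigma> x = coset \<sigma> y \<and> (\<forall>s\<in>\<sigma>. f (y + s) = c')"
  then obtain y where y: "coset \<sigma> x = coset \<sigma> y" "\<And>s. s \<in> \<sigma> \<Longrightarrow> f (y + s) = c'" by blast
  obtain a b where ab: "x - y = a - b" "a \<in> \<sigma>" "b \<in> \<sigma>"
    using y(1) coset_eq_iff span_cone[OF assms(1)] by blast
  \<comment> \<open>A common point of \<open>x + \<sigma>\<close> and \<open>y + \<sigma>\<close>.\<close>
  have "x + b = y + a" using ab(1) by (simp add: algebra_simps)
  then show "c' = c" using y(2)[OF ab(2)] assms(2)[OF ab(3)] by simp
qed

context tropical_variety
begin

text \<open>
  The condition on a function on $N_{\mathbb R}$ under which its extension is constant towards the boundary.
\<close>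

definition tame :: "(real^'n \<Rightarrow> real) \<Rightarrow> bool" where
  "tame f \<longleftrightarrow> (\<forall>\<sigma>\<in>\<Sigma>. \<forall>x. eventually (\<lambda>z. \<forall>s\<in>\<sigma>. f (z + s) = f z) (near \<sigma> x))"

lemma ext_region:
  assumes "\<tau> \<in> \<Sigma>" "\<tau> \<subseteq> \<sigma>" "\<forall>s\<in>\<sigma>. f (z + s) = f z"
  shows "ext f (\<tau>, coset \<tau> z) = f z"
  by (rule ext_eqI[OF cone[OF assms(1)]]) (use assms in blast)

lemma ext_emb: "ext f (emb x) = f (x :: real^'n)"
  unfolding emb_def by (rule ext_region[OF zero_cone order_refl]) simp

lemma tame_near_ext:
  assumes "tame f" "\<sigma> \<in> \<Sigma>"
  shows "eventually (\<lambda>z. \<forall>\<tau>\<in>\<Sigma>. \<tau> face_of \<sigma> \<longrightarrow> ext f (\<tau>, coset \<tau> z) = f z) (near \<sigma> x)"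
proof -
  have "eventually (\<lambda>z. \<forall>s\<in>\<sigma>. f (z + s) = f z) (near \<sigma> x)" using assms by (auto simp: tame_def)
  then show ?thesis
  proof (rule eventually_mono, intro ballI impI)
    fix z \<tau> assume z: "\<forall>s\<in>\<sigma>. f (z + s) = f z" and t: "\<tau> \<in> \<Sigma>" "\<tau> face_of \<sigma>"
    show "ext f (\<tau>, coset \<tau> z) = f z" by (rule ext_region[OF t(1) face_subset[OF t(2)] z])
  qed
qed

text \<open>
  One translation by \<open>s0\<close> serves a whole neighbourhood, so on $N(\sigma)$ the extension is
  locally a translate of \<open>f\<close> and inherits its regularity.
\<close>

lemma tame_deep:
  assumes "tame f" "\<sigma> \<in> \<Sigma>"
  shows "\<exists>s0\<in>\<sigma>. \<exists>r>0. \<forall>y\<in>ball x r. \<forall>s\<in>\<sigma>. f (y + s0 + s) = ext f (\<sigma>, coset \<sigma> y)"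
proof -
  have "eventually (\<lambda>z. \<forall>\<tau>\<in>\<Sigma>. \<tau> face_of \<sigma> \<longrightarrow> ext f (\<tau>, coset \<tau> z) = f z) (near \<sigma> x)"
    by (rule tame_near_ext[OF assms])
  then obtain s0 r where *: "s0 \<in> \<sigma>" "r > 0" "\<And>y s. y \<in> ball (x + s0) r \<Longrightarrow> s \<in> \<sigma> \<Longrightarrow>
      ext f (\<sigma>, coset \<sigma> (y + s)) = f (y + s)"
    unfolding eventually_near[OF cone[OF assms(2)]] using face_self assms(2) by blast
  have "f (y + s0 + s) = ext f (\<sigma>, coset \<sigma> y)" if "y \<in> ball x r" "s \<in> \<sigma>" for y s
  proof -
    have "ext f (\<sigma>, coset \<sigma> (y + s0 + s)) = f (y + s0 + s)"
      using that by (intro *(3)) (auto simp: dist_norm)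
    then show ?thesis using *(1) that(2) by (simp add: coset_shift span_base)
  qed
  with * show ?thesis by blast
qed

lemma smooth_function_iff:
  assumes U: "openin (trop_topology \<Sigma>) U"
  shows "smooth_function \<Sigma> U h \<longleftrightarrow>
    (\<forall>\<sigma>\<in>\<Sigma>. smooth_on {x. (\<sigma>, coset \<sigma> x) \<in> U} (\<lambda>x. if (\<sigma>, coset \<sigma> x) \<in> U then h (\<sigma>, coset \<sigma> x) else 0)) \<and>
    (\<forall>\<sigma>\<in>\<Sigma>. \<forall>x. (\<sigma>, coset \<sigma> x) \<in> U \<longrightarrow>
      eventually (\<lambda>z. \<forall>\<tau>\<in>\<Sigma>. \<tau> face_of \<sigma> \<longrightarrow> h (\<tau>, coset \<tau> z) = h (\<sigma>, coset \<sigma> z)) (near \<sigma> x))"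
proof -
  let ?a = "\<lambda>P (vs :: (real^'n) list) (ws :: (real^'n) list). if P \<in> U \<and> vs = [] \<and> ws = [] then h P else 0"
  have cov: "covector 0 0 \<sigma> (?a P)" for \<sigma> P
    using covector_degree_0[of \<sigma> "h P"] covector_zero[of 0 0 \<sigma>] by (cases "P \<in> U") auto
  have sm: "(\<forall>vs ws. smooth_on {x. (\<sigma>, coset \<sigma> x) \<in> U} (\<lambda>x. ?a (\<sigma>, coset \<sigma> x) vs ws)) \<longleftrightarrow>
    smooth_on {x. (\<sigma>, coset \<sigma> x) \<in> U} (\<lambda>x. if (\<sigma>, coset \<sigma> x) \<in> U then h (\<sigma>, coset \<sigma> x) else 0)" (is "?L \<longleftrightarrow> ?R") for \<sigma>
  proof
    assume ?L
    from this[rule_format, of "[]" "[]"] show ?R by simp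
  next
    assume R: ?R
    show ?L
    proof (intro allI)
      fix vs ws :: "(real^'n) list"
      show "smooth_on {x. (\<sigma>, coset \<sigma> x) \<in> U} (\<lambda>x. ?a (\<sigma>, coset \<sigma> x) vs ws)"
        using R smooth_on_subset[OF smooth_const[of 0]] by (cases "vs = [] \<and> ws = []") auto
    qed
  qed
  have ev: "eventually (\<lambda>z. \<forall>\<tau>\<in>\<Sigma>. \<tau> face_of \<sigma> \<longrightarrow> ?a (\<tau>, coset \<tau> z) = ?a (\<sigma>, coset \<sigma> z)) (near \<sigma> x) \<longleftrightarrow>
      eventually (\<lambda>z. \<forall>\<tau>\<in>\<Sigma>. \<tau> face_of \<sigma> \<longrightarrow> h (\<tau>, coset \<tau> z) = h (\<sigma>, coset \<sigma> z)) (near \<sigma> x)"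
    if s: "\<sigma> \<in> \<Sigma>" and x: "(\<sigma>, coset \<sigma> x) \<in> U" for \<sigma> x
  proof (rule eventually_cong)
    show "eventually (\<lambda>z. \<forall>\<tau>\<in>\<Sigma>. \<tau> face_of \<sigma> \<longrightarrow> (\<tau>, coset \<tau> z) \<in> U) (near \<sigma> x)"
      by (rule open_near[OF U x s])
    fix z assume z: "\<forall>\<tau>\<in>\<Sigma>. \<tau> face_of \<sigma> \<longrightarrow> (\<tau>, coset \<tau> z) \<in> U"
    have "?a (\<tau>, coset \<tau> z) = ?a (\<sigma>, coset \<sigma> z) \<longleftrightarrow> h (\<tau>, coset \<tau> z) = h (\<sigma>, coset \<sigma> z)"
      if "\<tau> \<in> \<Sigma>" "\<tau> face_of \<sigma>" for \<tau>
      using z that s face_self[OF s] by (auto simp: fun_eq_iff)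
    then show "(\<forall>\<tau>\<in>\<Sigma>. \<tau> face_of \<sigma> \<longrightarrow> ?a (\<tau>, coset \<tau> z) = ?a (\<sigma>, coset \<sigma> z)) \<longleftrightarrow>
      (\<forall>\<tau>\<in>\<Sigma>. \<tau> face_of \<sigma> \<longrightarrow> h (\<tau>, coset \<tau> z) = h (\<sigma>, coset \<sigma> z))" by blast
  qed
  have 1: "\<forall>P. P \<notin> U \<longrightarrow> ?a P = (\<lambda>vs ws. 0)" by (simp add: fun_eq_iff)
  have 2: "\<forall>\<sigma>\<in>\<Sigma>. \<forall>x. (\<sigma>, coset \<sigma> x) \<in> U \<longrightarrow> covector 0 0 \<sigma> (?a (\<sigma>, coset \<sigma> x))"
    using cov by blast
  have 3: "(\<forall>\<sigma>\<in>\<Sigma>. \<forall>vs ws. smooth_on {x. (\<sigma>, coset \<sigma> x) \<in> U} (\<lambda>x. ?a (\<sigma>, coset \<sigma> x) vs ws)) \<longleftrightarrow>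
    (\<forall>\<sigma>\<in>\<Sigma>. smooth_on {x. (\<sigma>, coset \<sigma> x) \<in> U} (\<lambda>x. if (\<sigma>, coset \<sigma> x) \<in> U then h (\<sigma>, coset \<sigma> x) else 0))"
    by (intro ball_cong refl sm)
  have 4: "(\<forall>\<sigma>\<in>\<Sigma>. \<forall>x. (\<sigma>, coset \<sigma> x) \<in> U \<longrightarrow>
      eventually (\<lambda>z. \<forall>\<tau>\<in>\<Sigma>. \<tau> face_of \<sigma> \<longrightarrow> ?a (\<tau>, coset \<tau> z) = ?a (\<sigma>, coset \<sigma> z)) (near \<sigma> x)) \<longleftrightarrow>
    (\<forall>\<sigma>\<in>\<Sigma>. \<forall>x. (\<sigma>, coset \<sigma> x) \<in> U \<longrightarrow>
      eventually (\<lambda>z. \<forall>\<tau>\<in>\<Sigma>. \<tau> face_of \<sigma> \<longrightarrow> h (\<tau>, coset \<tau> z) = h (\<sigma>, coset \<sigma> z)) (near \<sigma> x))"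
    by (intro ball_cong refl all_cong imp_cong ev)
  show ?thesis
    unfolding smooth_function_def lagerberg_forms_iff[OF U] 3 4
    using 1 2 by (intro iffI conjI) (elim conjE, assumption)+
qed

lemma ext_smooth:
  assumes "tame f" "smooth f" shows "smooth_function \<Sigma> (trop_var \<Sigma>) (ext f)"
  unfolding smooth_function_iff[OF open_trop_var]
proof (intro conjI ballI allI impI)
  fix \<sigma> assume s: "\<sigma> \<in> \<Sigma>"
  have "smooth (\<lambda>x. ext f (\<sigma>, coset \<sigma> x))"
  proof (rule smooth_local)
    fix x
    obtain s0 r where *: "s0 \<in> \<sigma>" "r > 0" "\<forall>y\<in>ball x r. \<forall>s\<in>\<sigma>. f (y + s0 + s) = ext f (\<sigma>, coset \<sigma> y)"
      using tame_deep[OF assms(1) s] by blast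
    then have "\<forall>y\<in>ball x r. ext f (\<sigma>, coset \<sigma> y) = f (y + s0)" using cone_zero[OF s] by fastforce
    then show "\<exists>S g. open S \<and> x \<in> S \<and> smooth g \<and> (\<forall>y\<in>S. ext f (\<sigma>, coset \<sigma> y) = g y)"
      using *(2) smooth_shift[OF assms(2), of s0]
      by (intro exI[of _ "ball x r"] exI[of _ "\<lambda>y. f (y + s0)"]) auto
  qed
  then show "smooth_on {x. (\<sigma>, coset \<sigma> x) \<in> trop_var \<Sigma>} (\<lambda>x. if (\<sigma>, coset \<sigma> x) \<in> trop_var \<Sigma> then ext f (\<sigma>, coset \<sigma> x) else 0)"
    using coset_trop_var[OF s] by simp
  fix x
  show "\<forall>\<^sub>F z in near \<sigma> x. \<forall>\<tau>\<in>\<Sigma>. \<tau> face_of \<sigma> \<longrightarrow> ext f (\<tau>, coset \<tau> z) = ext f (\<sigma>, coset \<sigma> z)"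
    using tame_near_ext[OF assms(1) s, of x]
    by (rule eventually_mono) (simp add: s face_self)
qed

lemma smooth_function_smooth_open_stratum:
  assumes "smooth_function \<Sigma> U h" "openin (trop_topology \<Sigma>) U" "\<And>x. emb x \<in> U"
  shows "smooth (\<lambda>x. h (emb x))"
  using assms zero_cone unfolding smooth_function_iff[OF assms(2)] emb_def by auto

lemma smooth_function_near:
  assumes "smooth_function \<Sigma> U h" "openin (trop_topology \<Sigma>) U" "(\<sigma>, coset \<sigma> x) \<in> U" "\<sigma> \<in> \<Sigma>"
  shows "eventually (\<lambda>z. \<forall>s\<in>\<sigma>. h (emb (z + s)) = h (emb z)) (near \<sigma> x)"
proof -
  have "eventually (\<lambda>z. \<forall>\<tau>\<in>\<Sigma>. \<tau> face_of \<sigma> \<longrightarrow> h (\<tau>, coset \<tau> z) = h (\<sigma>, coset \<sigma> z)) (near \<sigma> x)"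
    using assms unfolding smooth_function_iff[OF assms(2)] by blast
  then have "eventually (\<lambda>z. h (emb z) = h (\<sigma>, coset \<sigma> z)) (near \<sigma> x)"
    by (rule eventually_mono) (simp add: emb_def zero_cone zero_face assms(4))
  from near_eventually_translates[OF cone[OF assms(4)] this] show ?thesis
    by (rule eventually_mono) (metis add.right_neutral cone_zero[OF assms(4)] coset_shift span_base)
qed

lemma near_ext_close:
  assumes "tame f" "continuous_on UNIV f" "\<sigma> \<in> \<Sigma>" "0 < e"
  shows "eventually (\<lambda>z. \<bar>f z - ext f (\<sigma>, coset \<sigma> x)\<bar> < e) (near \<sigma> x)"
proof -
  obtain s0 r where *: "s0 \<in> \<sigma>" "r > 0" "\<And>y s. y \<in> ball x r \<Longrightarrow> s \<in> \<sigma> \<Longrightarrow> f (y + s0 + s) = ext f (\<sigma>, coset \<sigma> y)"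
    using tame_deep[OF assms(1,3)] by blast
  have inv: "f (y + s0 + s) = f (y + s0)" if "y \<in> ball x r" "s \<in> \<sigma>" for y s
    using *(3)[OF that] *(3)[OF that(1) cone_zero[OF assms(3)]] by simp
  have x0: "ext f (\<sigma>, coset \<sigma> x) = f (x + s0)" using *(3)[of x 0] *(2) cone_zero[OF assms(3)] by simp
  obtain d where d: "d > 0" "\<And>y. dist y (x + s0) < d \<Longrightarrow> \<bar>f y - f (x + s0)\<bar> < e"
    using assms(2,4) unfolding continuous_on_iff dist_real_def by (metis UNIV_I)
  show ?thesis unfolding eventually_near[OF cone[OF assms(3)]] x0
  proof (intro bexI[of _ s0] exI[of _ "min r d"] conjI ballI *(1))
    fix y s assume y: "y \<in> ball (x + s0) (min r d)" and s: "s \<in> \<sigma>"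
    have "f ((y - s0) + s0 + s) = f ((y - s0) + s0)"
      by (rule inv[OF _ s]) (use y in \<open>auto simp: dist_norm algebra_simps\<close>)
    then show "\<bar>f (y + s) - f (x + s0)\<bar> < e" using d(2)[of y] y by (simp add: dist_commute)
  qed (use * d in auto)
qed

lemma ext_continuous:
  assumes "tame f" "continuous_on UNIV f" "P \<in> trop_var \<Sigma>" "0 < e"
  shows "\<exists>W. openin (trop_topology \<Sigma>) W \<and> P \<in> W \<and> (\<forall>Q\<in>W. \<bar>ext f Q - ext f P\<bar> < e)"
proof -
  obtain \<sigma> x where P: "\<sigma> \<in> \<Sigma>" "P = (\<sigma>, coset \<sigma> x)" using assms(3) by (rule trop_var_cases)
  have "eventually (\<lambda>z. \<bar>f z - ext f P\<bar> < e \<and> (\<forall>\<tau>\<in>\<Sigma>. \<tau> face_of \<sigma> \<longrightarrow> ext f (\<tau>, coset \<tau> z) = f z)) (near \<sigma> x)"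
    unfolding P(2) using near_ext_close[OF assms(1,2) P(1) assms(4)] tame_near_ext[OF assms(1) P(1)]
    by (rule eventually_conj)
  then obtain R where R:
    "openin (trop_topology \<Sigma>) {(\<tau>, coset \<tau> z) |\<tau> z. \<tau> \<in> \<Sigma> \<and> \<tau> face_of \<sigma> \<and> z \<in> R}"
    "(\<sigma>, coset \<sigma> x) \<in> {(\<tau>, coset \<tau> z) |\<tau> z. \<tau> \<in> \<Sigma> \<and> \<tau> face_of \<sigma> \<and> z \<in> R}"
    "\<And>z. z \<in> R \<Longrightarrow> \<bar>f z - ext f P\<bar> < e \<and> (\<forall>\<tau>\<in>\<Sigma>. \<tau> face_of \<sigma> \<longrightarrow> ext f (\<tau>, coset \<tau> z) = f z)"
    by (rule near_open[OF P(1)]) blast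
  show ?thesis
  proof (intro exI conjI ballI)
    fix Q assume "Q \<in> {(\<tau>, coset \<tau> z) |\<tau> z. \<tau> \<in> \<Sigma> \<and> \<tau> face_of \<sigma> \<and> z \<in> R}"
    then obtain \<tau> z where "Q = (\<tau>, coset \<tau> z)" "\<tau> \<in> \<Sigma>" "\<tau> face_of \<sigma>" "z \<in> R" by blast
    with R(3) show "\<bar>ext f Q - ext f P\<bar> < e" by metis
  qed (use R(1,2) P(2) in auto)
qed

lemma closed_superlevel:
  assumes "tame f" "continuous_on UNIV f"
  shows "closedin (trop_topology \<Sigma>) {P \<in> trop_var \<Sigma>. c \<le> ext f P}"
proof -
  have "openin (trop_topology \<Sigma>) (trop_var \<Sigma> - {P \<in> trop_var \<Sigma>. c \<le> ext f P})"
    unfolding openin_subopen[of _ "trop_var \<Sigma> - _"]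
  proof
    fix P assume "P \<in> trop_var \<Sigma> - {P \<in> trop_var \<Sigma>. c \<le> ext f P}"
    then have P: "P \<in> trop_var \<Sigma>" "ext f P < c" by auto
    then obtain W where W: "openin (trop_topology \<Sigma>) W" "P \<in> W" "\<forall>Q\<in>W. \<bar>ext f Q - ext f P\<bar> < c - ext f P"
      using ext_continuous[OF assms P(1), of "c - ext f P"] by auto
    have "W \<subseteq> trop_var \<Sigma>" using openin_subset[OF W(1)] topspace_trop by simp
    then have "W \<subseteq> trop_var \<Sigma> - {P \<in> trop_var \<Sigma>. c \<le> ext f P}" using W(3) by fastforce
    then show "\<exists>T. openin (trop_topology \<Sigma>) T \<and> P \<in> T \<and> T \<subseteq> trop_var \<Sigma> - {P \<in> trop_var \<Sigma>. c \<le> ext f P}"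
      using W by blast
  qed
  then show ?thesis by (auto simp: closedin_def topspace_trop)
qed

section \<open>Forms on the open stratum\<close>

lemma form_emb:
  assumes "\<alpha> \<in> lagerberg_forms \<Sigma> (trop_var \<Sigma>) p q"
  shows "covector p q {0} (\<alpha> (emb x))" and "smooth (\<lambda>x. \<alpha> (emb x) vs ws)"
proof -
  note f = assms[unfolded lagerberg_forms_iff[OF open_trop_var]]
  show "covector p q {0} (\<alpha> (emb x))"
    using f zero_cone coset_trop_var[OF zero_cone] unfolding emb_def by blast
  have "smooth_on {x. ({0}, coset {0} x) \<in> trop_var \<Sigma>} (\<lambda>x. \<alpha> ({0}, coset {0} x) vs ws)"
    using f zero_cone by blast
  then show "smooth (\<lambda>x. \<alpha> (emb x) vs ws)" using coset_trop_var[OF zero_cone] by (simp add: emb_def)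
qed

lemma form_near:
  assumes "\<alpha> \<in> lagerberg_forms \<Sigma> (trop_var \<Sigma>) p q" "\<sigma> \<in> \<Sigma>"
  shows "eventually (\<lambda>z. covector p q \<sigma> (\<alpha> (emb z)) \<and> (\<forall>s\<in>\<sigma>. \<alpha> (emb (z + s)) = \<alpha> (emb z))) (near \<sigma> x)"
proof -
  note f = assms(1)[unfolded lagerberg_forms_iff[OF open_trop_var]]
  have "eventually (\<lambda>z. \<forall>\<tau>\<in>\<Sigma>. \<tau> face_of \<sigma> \<longrightarrow> \<alpha> (\<tau>, coset \<tau> z) = \<alpha> (\<sigma>, coset \<sigma> z)) (near \<sigma> x)"
    using f assms(2) coset_trop_var[OF assms(2)] by blast
  then have "eventually (\<lambda>z. \<alpha> (emb z) = \<alpha> (\<sigma>, coset \<sigma> z)) (near \<sigma> x)"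
    by (rule eventually_mono) (simp add: emb_def zero_cone zero_face assms(2))
  from near_eventually_translates[OF cone[OF assms(2)] this] show ?thesis
  proof (rule eventually_mono)
    fix z assume *: "\<forall>s\<in>\<sigma>. \<alpha> (emb (z + s)) = \<alpha> (\<sigma>, coset \<sigma> (z + s))"
    have "\<alpha> (emb (z + s)) = \<alpha> (\<sigma>, coset \<sigma> z)" if "s \<in> \<sigma>" for s
      using * that by (simp add: coset_shift span_base)
    moreover from this[of 0] have "\<alpha> (emb z) = \<alpha> (\<sigma>, coset \<sigma> z)" using cone_zero[OF assms(2)] by simp
    ultimately show "covector p q \<sigma> (\<alpha> (emb z)) \<and> (\<forall>s\<in>\<sigma>. \<alpha> (emb (z + s)) = \<alpha> (emb z))"
      using f assms(2) coset_trop_var[OF assms(2)] by simp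
  qed
qed

lemma form_lincomb:
  assumes "\<alpha> \<in> lagerberg_forms \<Sigma> (trop_var \<Sigma>) p q" "\<beta> \<in> lagerberg_forms \<Sigma> (trop_var \<Sigma>) p q"
  shows "(\<lambda>P vs ws. a * \<alpha> P vs ws + b * \<beta> P vs ws) \<in> lagerberg_forms \<Sigma> (trop_var \<Sigma>) p q"
proof -
  note f = assms(1)[unfolded lagerberg_forms_iff[OF open_trop_var]]
  note g = assms(2)[unfolded lagerberg_forms_iff[OF open_trop_var]]
  show ?thesis
    unfolding lagerberg_forms_iff[OF open_trop_var]
  proof (intro conjI ballI allI impI)
    fix \<sigma> x assume s: "\<sigma> \<in> \<Sigma>"
    show "covector p q \<sigma> (\<lambda>vs ws. a * \<alpha> (\<sigma>, coset \<sigma> x) vs ws + b * \<beta> (\<sigma>, coset \<sigma> x) vs ws)"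
      using f g s coset_trop_var[OF s] by (intro covector_lincomb) blast+
    have "\<forall>\<^sub>F z in near \<sigma> x. \<forall>\<tau>\<in>\<Sigma>. \<tau> face_of \<sigma> \<longrightarrow> \<alpha> (\<tau>, coset \<tau> z) = \<alpha> (\<sigma>, coset \<sigma> z)"
      "\<forall>\<^sub>F z in near \<sigma> x. \<forall>\<tau>\<in>\<Sigma>. \<tau> face_of \<sigma> \<longrightarrow> \<beta> (\<tau>, coset \<tau> z) = \<beta> (\<sigma>, coset \<sigma> z)"
      using f g s coset_trop_var[OF s] by blast+
    then show "\<forall>\<^sub>F z in near \<sigma> x. \<forall>\<tau>\<in>\<Sigma>. \<tau> face_of \<sigma> \<longrightarrow>
       (\<lambda>vs ws. a * \<alpha> (\<tau>, coset \<tau> z) vs ws + b * \<beta> (\<tau>, coset \<tau> z) vs ws) =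
       (\<lambda>vs ws. a * \<alpha> (\<sigma>, coset \<sigma> z) vs ws + b * \<beta> (\<sigma>, coset \<sigma> z) vs ws)"
      by eventually_elim simp
  next
    fix \<sigma> and vs ws :: "(real^'n) list" assume s: "\<sigma> \<in> \<Sigma>"
    have "smooth_on {x. (\<sigma>, coset \<sigma> x) \<in> trop_var \<Sigma>} (\<lambda>x. \<alpha> (\<sigma>, coset \<sigma> x) vs ws)"
      "smooth_on {x. (\<sigma>, coset \<sigma> x) \<in> trop_var \<Sigma>} (\<lambda>x. \<beta> (\<sigma>, coset \<sigma> x) vs ws)" using f g s by blast+
    then show "smooth_on {x. (\<sigma>, coset \<sigma> x) \<in> trop_var \<Sigma>}
        (\<lambda>x. a * \<alpha> (\<sigma>, coset \<sigma> x) vs ws + b * \<beta> (\<sigma>, coset \<sigma> x) vs ws)"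
      using coset_trop_var[OF s] by (simp add: smooth_add smooth_cmult)
  next
    fix P assume "P \<notin> trop_var \<Sigma>"
    then have "\<alpha> P = (\<lambda>vs ws. 0)" "\<beta> P = (\<lambda>vs ws. 0)" using f g by blast+
    then show "(\<lambda>vs ws. a * \<alpha> P vs ws + b * \<beta> P vs ws) = (\<lambda>vs ws. 0)" by simp
  qed
qed

lemma form_mult:
  assumes "smooth_function \<Sigma> (trop_var \<Sigma>) h" "\<beta> \<in> lagerberg_forms \<Sigma> (trop_var \<Sigma>) p q"
  shows "(\<lambda>P vs ws. h P * \<beta> P vs ws) \<in> lagerberg_forms \<Sigma> (trop_var \<Sigma>) p q"
proof -
  note f = assms(1)[unfolded smooth_function_iff[OF open_trop_var]]
  note g = assms(2)[unfolded lagerberg_forms_iff[OF open_trop_var]]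
  show ?thesis
    unfolding lagerberg_forms_iff[OF open_trop_var]
  proof (intro conjI ballI allI impI)
    fix \<sigma> x assume s: "\<sigma> \<in> \<Sigma>"
    show "covector p q \<sigma> (\<lambda>vs ws. h (\<sigma>, coset \<sigma> x) * \<beta> (\<sigma>, coset \<sigma> x) vs ws)"
      using g s coset_trop_var[OF s] by (intro covector_scale) blast
    have "\<forall>\<^sub>F z in near \<sigma> x. \<forall>\<tau>\<in>\<Sigma>. \<tau> face_of \<sigma> \<longrightarrow> h (\<tau>, coset \<tau> z) = h (\<sigma>, coset \<sigma> z)"
      "\<forall>\<^sub>F z in near \<sigma> x. \<forall>\<tau>\<in>\<Sigma>. \<tau> face_of \<sigma> \<longrightarrow> \<beta> (\<tau>, coset \<tau> z) = \<beta> (\<sigma>, coset \<sigma> z)"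
      using f g s coset_trop_var[OF s] by blast+
    then show "\<forall>\<^sub>F z in near \<sigma> x. \<forall>\<tau>\<in>\<Sigma>. \<tau> face_of \<sigma> \<longrightarrow>
       (\<lambda>vs ws. h (\<tau>, coset \<tau> z) * \<beta> (\<tau>, coset \<tau> z) vs ws) =
       (\<lambda>vs ws. h (\<sigma>, coset \<sigma> z) * \<beta> (\<sigma>, coset \<sigma> z) vs ws)"
      by eventually_elim simp
  next
    fix \<sigma> and vs ws :: "(real^'n) list" assume s: "\<sigma> \<in> \<Sigma>"
    have "smooth_on {x. (\<sigma>, coset \<sigma> x) \<in> trop_var \<Sigma>} (\<lambda>x. if (\<sigma>, coset \<sigma> x) \<in> trop_var \<Sigma> then h (\<sigma>, coset \<sigma> x) else 0)"
      using f s by blast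
    then have "smooth (\<lambda>x. h (\<sigma>, coset \<sigma> x))" using coset_trop_var[OF s] by simp
    moreover have "smooth_on {x. (\<sigma>, coset \<sigma> x) \<in> trop_var \<Sigma>} (\<lambda>x. \<beta> (\<sigma>, coset \<sigma> x) vs ws)" using g s by blast
    ultimately show "smooth_on {x. (\<sigma>, coset \<sigma> x) \<in> trop_var \<Sigma>} (\<lambda>x. h (\<sigma>, coset \<sigma> x) * \<beta> (\<sigma>, coset \<sigma> x) vs ws)"
      using coset_trop_var[OF s] by (simp add: smooth_mult)
  next
    fix P assume "P \<notin> trop_var \<Sigma>"
    then have "\<beta> P = (\<lambda>vs ws. 0)" using g by blast
    then show "(\<lambda>vs ws. h P * \<beta> P vs ws) = (\<lambda>vs ws. 0)" by simp
  qed
qed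

lemma form_restrict:
  assumes "\<alpha> \<in> lagerberg_forms \<Sigma> (trop_var \<Sigma>) p q" "openin (trop_topology \<Sigma>) U" "\<And>P. P \<notin> U \<Longrightarrow> \<alpha> P = (\<lambda>vs ws. 0)"
  shows "\<alpha> \<in> lagerberg_forms \<Sigma> U p q"
proof -
  have sub: "U \<subseteq> trop_var \<Sigma>" using openin_subset[OF assms(2)] topspace_trop by simp
  note f = assms(1)[unfolded lagerberg_forms_iff[OF open_trop_var]]
  show ?thesis unfolding lagerberg_forms_iff[OF assms(2)]
  proof (intro conjI ballI allI impI)
    fix \<sigma> and vs ws :: "(real^'n) list" assume s: "\<sigma> \<in> \<Sigma>"
    have "smooth_on {x. (\<sigma>, coset \<sigma> x) \<in> trop_var \<Sigma>} (\<lambda>x. \<alpha> (\<sigma>, coset \<sigma> x) vs ws)" using f s by blast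
    then show "smooth_on {x. (\<sigma>, coset \<sigma> x) \<in> U} (\<lambda>x. \<alpha> (\<sigma>, coset \<sigma> x) vs ws)"
      by (rule smooth_on_subset) (use sub in blast)
  qed (use f sub assms(3) coset_trop_var in blast)+
qed

text \<open>
  The trace on $N_{\mathbb R}$ of a compact subset \<open>K\<close> of $N_\Sigma$ may be unbounded if
  \<open>K\<close> meets the boundary. A subset of the trace that stays away from the boundary points of
  \<open>K\<close> is bounded: each point of \<open>K\<close> has a neighbourhood whose trace on the subset
  is bounded, and finitely many of them cover \<open>K\<close>. This gives the compact supports needed for
  integration by parts.
\<close>

lemma bounded_trace:
  assumes K: "compactin (trop_topology \<Sigma>) K" and Z: "\<And>z. z \<in> Z \<Longrightarrow> emb z \<in> K"
    and away: "\<And>\<sigma> x. \<sigma> \<in> \<Sigma> \<Longrightarrow> \<sigma> \<noteq> {0} \<Longrightarrow> (\<sigma>, coset \<sigma> x) \<in> K \<Longrightarrow> eventually (\<lambda>z. z \<notin> Z) (near \<sigma> x)"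
  shows "bounded Z"
proof -
  define \<U> where "\<U> = {W. openin (trop_topology \<Sigma>) W \<and> bounded {z\<in>Z. emb z \<in> W}}"
  have "K \<subseteq> \<Union>\<U>"
  proof
    fix P assume PK: "P \<in> K"
    then have "P \<in> trop_var \<Sigma>" using K topspace_trop by (auto simp: compactin_def)
    then obtain \<sigma> x where P: "\<sigma> \<in> \<Sigma>" "P = (\<sigma>, coset \<sigma> x)" by (rule trop_var_cases)
    have "eventually (\<lambda>z. z \<in> Z \<longrightarrow> z \<in> ball x 1) (near \<sigma> x)"
    proof (cases "\<sigma> = {0}")
      case True
      have "eventually (\<lambda>z. z \<in> ball x 1) (nhds x)" by (rule eventually_nhds_in_open) auto
      then show ?thesis unfolding True eventually_near_zero by (rule eventually_mono) simp
    next
      case False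
      from away[OF P(1) this] PK P(2) have "eventually (\<lambda>z. z \<notin> Z) (near \<sigma> x)" by simp
      then show ?thesis by (rule eventually_mono) simp
    qed
    then obtain R where R:
      "openin (trop_topology \<Sigma>) {(\<tau>, coset \<tau> z) |\<tau> z. \<tau> \<in> \<Sigma> \<and> \<tau> face_of \<sigma> \<and> z \<in> R}"
      "(\<sigma>, coset \<sigma> x) \<in> {(\<tau>, coset \<tau> z) |\<tau> z. \<tau> \<in> \<Sigma> \<and> \<tau> face_of \<sigma> \<and> z \<in> R}"
      "\<And>z. z \<in> R \<Longrightarrow> z \<in> Z \<longrightarrow> z \<in> ball x 1"
      by (rule near_open[OF P(1)]) blast
    let ?W = "{(\<tau>, coset \<tau> z) |\<tau> z. \<tau> \<in> \<Sigma> \<and> \<tau> face_of \<sigma> \<and> z \<in> R}"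
    have "z \<in> R" if ez: "emb z \<in> ?W" for z
    proof -
      obtain y where "{z} = coset {0} y" "y \<in> R" using ez unfolding emb_eq by auto
      then show ?thesis by (simp add: coset_zero)
    qed
    then have "{z\<in>Z. emb z \<in> ?W} \<subseteq> ball x 1" using R(3) by blast
    then have "?W \<in> \<U>" unfolding \<U>_def using R(1) bounded_subset[OF bounded_ball] by blast
    then show "P \<in> \<Union>\<U>" using R(2) P(2) by blast
  qed
  then obtain F where F: "finite F" "F \<subseteq> \<U>" "K \<subseteq> \<Union>F"
    using K[unfolded compactin_def, THEN conjunct2, rule_format, of \<U>] by (auto simp: \<U>_def)
  have "bounded (\<Union>W\<in>F. {z\<in>Z. emb z \<in> W})" using F(1,2) by (intro bounded_UN) (auto simp: \<U>_def)
  moreover have "Z \<subseteq> (\<Union>W\<in>F. {z\<in>Z. emb z \<in> W})" using Z F(3) by blast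
  ultimately show ?thesis by (rule bounded_subset)
qed

text \<open>
  The version of \<open>tame\<close> that is uniform on balls. It survives convolution with a mollifier,
  which averages over a ball.
\<close>

definition strongly_tame :: "(real^'n \<Rightarrow> real) \<Rightarrow> bool" where
  "strongly_tame f \<longleftrightarrow> (\<forall>\<sigma>\<in>\<Sigma>. \<forall>R. \<exists>s0\<in>\<sigma>. \<forall>z s. norm z \<le> R \<longrightarrow> s \<in> \<sigma> \<longrightarrow> f (z + s0 + s) = f (z + s0))"

lemma near_of_deep:
  assumes "\<sigma> \<in> \<Sigma>" "\<And>R. \<exists>s0\<in>\<sigma>. \<forall>z s. norm z \<le> R \<longrightarrow> s \<in> \<sigma> \<longrightarrow> P (z + s0 + s)"
  shows "eventually P (near \<sigma> x)"
proof -
  obtain s0 where s0: "s0 \<in> \<sigma>" "\<And>z s. norm z \<le> norm x + 1 \<Longrightarrow> s \<in> \<sigma> \<Longrightarrow> P (z + s0 + s)"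
    using assms(2) by blast
  show ?thesis unfolding eventually_near[OF cone[OF assms(1)]]
  proof (intro bexI[of _ s0] exI[of _ 1] conjI ballI s0(1))
    fix y s assume y: "y \<in> ball (x + s0) 1" and s: "s \<in> \<sigma>"
    have "norm (y - s0 - x) < 1" using y by (simp add: dist_norm norm_minus_commute algebra_simps)
    then have "norm (y - s0) \<le> norm x + 1" using norm_triangle_ineq2[of "y - s0" x] by linarith
    from s0(2)[OF this s] show "P (y + s)" by simp
  qed simp
qed

lemma strongly_tame_near:
  assumes "\<sigma> \<in> \<Sigma>" "\<And>R. \<exists>s0\<in>\<sigma>. \<forall>z s. norm z \<le> R \<longrightarrow> s \<in> \<sigma> \<longrightarrow> f (z + s0 + s) = f (z + s0)"
  shows "eventually (\<lambda>z. \<forall>s\<in>\<sigma>. f (z + s) = f z) (near \<sigma> x)"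
proof (rule near_of_deep[OF assms(1)])
  fix R
  obtain s0 where s0: "s0 \<in> \<sigma>" "\<And>z s. norm z \<le> R \<Longrightarrow> s \<in> \<sigma> \<Longrightarrow> f (z + s0 + s) = f (z + s0)"
    using assms(2) by blast
  have "f (z + s0 + s + t) = f (z + s0 + s)" if "norm z \<le> R" "s \<in> \<sigma>" "t \<in> \<sigma>" for z s t
    using s0(2)[OF that(1,2)] s0(2)[OF that(1) cone_add[OF assms(1) that(2,3)]] by (simp add: add.assoc)
  with s0(1) show "\<exists>s0\<in>\<sigma>. \<forall>z s. norm z \<le> R \<longrightarrow> s \<in> \<sigma> \<longrightarrow> (\<forall>t\<in>\<sigma>. f (z + s0 + s + t) = f (z + s0 + s))" by blast
qed

lemma strongly_tame_tame: "strongly_tame f \<Longrightarrow> tame f"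
  unfolding tame_def strongly_tame_def by (intro ballI allI strongly_tame_near) auto

section \<open>Bump functions\<close>

text \<open>
  The trace on $N_{\mathbb R}$ of a basic neighbourhood of a point of $N(\sigma)$; its smoothed indicator
  function is a bump function on $N_\Sigma$.
\<close>

definition thick :: "(real^'n) set \<Rightarrow> real^'n \<Rightarrow> real \<Rightarrow> (real^'n) set" where
  "thick \<sigma> c r = {y + s |y s. y \<in> ball c r \<and> s \<in> \<sigma>}"

lemma open_thick: "open (thick \<sigma> c r)"
proof -
  have "thick \<sigma> c r = (\<Union>s\<in>\<sigma>. ball (c + s) r)"
  proof (intro equalityI subsetI)
    fix z assume "z \<in> thick \<sigma> c r"
    then obtain y s where "z = y + s" "y \<in> ball c r" "s \<in> \<sigma>" unfolding thick_def by blast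
    then show "z \<in> (\<Union>s\<in>\<sigma>. ball (c + s) r)" by (intro UN_I[of s]) (auto simp: dist_norm)
  next
    fix z assume "z \<in> (\<Union>s\<in>\<sigma>. ball (c + s) r)"
    then obtain s where "s \<in> \<sigma>" "z \<in> ball (c + s) r" by blast
    then show "z \<in> thick \<sigma> c r" unfolding thick_def
      by (intro CollectI exI[of _ "z - s"] exI[of _ s]) (auto simp: dist_norm algebra_simps)
  qed
  then show ?thesis by auto
qed

lemma thick_translate: "z \<in> thick \<sigma> c r \<Longrightarrow> norm x \<le> e \<Longrightarrow> z + x \<in> thick \<sigma> c (r + e)"
proof -
  assume "z \<in> thick \<sigma> c r" and x: "norm x \<le> e"
  then obtain y s where z: "z = y + s" "y \<in> ball c r" "s \<in> \<sigma>" unfolding thick_def by blast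
  have "dist c (y + x) < r + e" using z(2) x norm_triangle_ineq4[of "c - y" x] by (auto simp: dist_norm algebra_simps)
  then show "z + x \<in> thick \<sigma> c (r + e)" unfolding thick_def using z
    by (intro CollectI exI[of _ "y + x"] exI[of _ s]) (auto simp: algebra_simps)
qed

text \<open>
  Translation far along a face \<open>\<tau>\<close> of \<open>\<sigma>\<close> makes all inequalities of
  \<open>\<sigma>\<close> true except those that are equalities on \<open>\<tau>\<close>, and the latter do
  not change under further translation by \<open>t \<in> \<tau>\<close>. So membership in
  \<open>thick\<close> no longer depends on \<open>t\<close>.
\<close>

lemma thick_deep_face:
  assumes "\<sigma> \<in> \<Sigma>" "\<tau> \<in> \<Sigma>" "\<tau> \<subseteq> \<sigma>"
  shows "\<exists>t0\<in>\<tau>. \<forall>z t. norm z \<le> R \<longrightarrow> t \<in> \<tau> \<longrightarrow> (z + t0 + t \<in> thick \<sigma> c r \<longleftrightarrow> z + t0 \<in> thick \<sigma> c r)"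
proof -
  obtain S where S: "finite S" "\<sigma> = convex_cone hull S" using cone_generators[OF assms(1)] by blast
  obtain L where L: "finite L" "\<sigma> = {x. \<forall>l\<in>L. 0 \<le> l \<bullet> x}"
    using finite_cone_halfspaces[OF S(1)] S(2) by blast
  obtain t1 where t1: "t1 \<in> rel_interior \<tau>" "t1 \<in> \<tau>" using rel_interior_point[OF assms(2)] by blast
  let ?L = "{l\<in>L. 0 < l \<bullet> t1}"
  define R' where "R' = \<bar>R\<bar> + norm c + \<bar>r\<bar>"
  \<comment> \<open>A multiple of \<open>t1\<close> at which each \<open>l \<in> ?L\<close> dominates its values on the ball of radius \<open>R'\<close>.\<close>
  define k where "k = (\<Sum>l\<in>?L. norm l * R' / (l \<bullet> t1))"
  have R'0: "0 \<le> R'" by (simp add: R'_def)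
  have k0: "0 \<le> k" unfolding k_def by (intro sum_nonneg) (auto simp: R'0)
  have k: "norm l * R' \<le> k * (l \<bullet> t1)" if "l \<in> ?L" for l
  proof -
    have "norm l * R' / (l \<bullet> t1) \<le> k"
      unfolding k_def by (rule member_le_sum[OF that]) (use L(1) R'0 in auto)
    then show ?thesis using that by (simp add: field_simps)
  qed
  let ?t0 = "k *\<^sub>R t1"
  have zero: "l \<bullet> t = 0" if "l \<in> L" "\<not> 0 < l \<bullet> t1" "t \<in> \<tau>" for l t
  proof -
    have nn: "0 \<le> l \<bullet> x" if "x \<in> \<tau>" for x using L(2) assms(3) \<open>l \<in> L\<close> that by blast
    show ?thesis using pos_on_rel_interior[OF cone_convex[OF assms(2)] t1(1), of l t] nn that by fastforce
  qed
  have "z + ?t0 \<in> thick \<sigma> c r" if z: "norm z \<le> R" and t: "t \<in> \<tau>" and th: "z + ?t0 + t \<in> thick \<sigma> c r" for z t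
  proof -
    obtain w s where w: "z + ?t0 + t = w + s" "w \<in> ball c r" "s \<in> \<sigma>" using th unfolding thick_def by blast
    have "norm w \<le> norm c + \<bar>r\<bar>" using w(2) norm_triangle_ineq2[of w c] by (auto simp: dist_norm norm_minus_commute)
    then have n: "norm (z - w) \<le> R'" using z norm_triangle_ineq4[of z w] unfolding R'_def by linarith
    have "z - w + ?t0 \<in> \<sigma>"
      unfolding L(2)
    proof (intro CollectI ballI)
      fix l assume l: "l \<in> L"
      show "0 \<le> l \<bullet> (z - w + ?t0)"
      proof (cases "0 < l \<bullet> t1")
        case True
        have "- (l \<bullet> (z - w)) \<le> norm l * norm (z - w)" using Cauchy_Schwarz_ineq2[of l "z - w"] by linarith
        also have "\<dots> \<le> norm l * R'" using n by (intro mult_left_mono) auto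
        also have "\<dots> \<le> k * (l \<bullet> t1)" using k True l by blast
        finally show ?thesis by (simp add: inner_add_right)
      next
        case False
        have "z - w + ?t0 = s - t" using w(1) by (simp add: algebra_simps)
        moreover have "0 \<le> l \<bullet> s" using w(3) l L(2) by blast
        ultimately show ?thesis using zero[OF l False t] by (simp add: inner_diff_right)
      qed
    qed
    then show ?thesis unfolding thick_def using w(2)
      by (intro CollectI exI[of _ w] exI[of _ "z - w + ?t0"]) auto
  qed
  moreover have "z + ?t0 + t \<in> thick \<sigma> c r" if t: "t \<in> \<tau>" and th: "z + ?t0 \<in> thick \<sigma> c r" for z t
  proof -
    obtain w s where w: "z + ?t0 = w + s" "w \<in> ball c r" "s \<in> \<sigma>" using th unfolding thick_def by blast
    then show ?thesis unfolding thick_def using t assms cone_add[OF assms(1), of s t]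
      by (intro CollectI exI[of _ w] exI[of _ "s + t"]) (auto simp: add.assoc)
  qed
  ultimately show ?thesis using cone_scale[OF assms(2) t1(2) k0] by blast
qed

lemma thick_deep_nonface:
  assumes "\<sigma> \<in> \<Sigma>" "\<tau> \<in> \<Sigma>" "\<not> \<tau> \<subseteq> \<sigma>"
  shows "\<exists>t0\<in>\<tau>. \<forall>z t. norm z \<le> R \<longrightarrow> t \<in> \<tau> \<longrightarrow> z + t0 + t \<notin> thick \<sigma> c r"
proof -
  obtain t where t: "t \<in> \<tau>" "t \<notin> \<sigma>" using assms(3) by blast
  define R' where "R' = \<bar>R\<bar> + norm c + \<bar>r\<bar>"
  obtain t0 where t0: "t0 \<in> \<tau>" "\<And>z s. norm z \<le> R' \<Longrightarrow> s \<in> \<tau> \<Longrightarrow> z + t0 + s \<notin> \<sigma>"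
    using avoid_cone[OF assms(1,2) t, of R'] by blast
  have "z + t0 + t \<notin> thick \<sigma> c r" if z: "norm z \<le> R" and t: "t \<in> \<tau>" for z t
  proof
    assume "z + t0 + t \<in> thick \<sigma> c r"
    then obtain w s where w: "z + t0 + t = w + s" "w \<in> ball c r" "s \<in> \<sigma>" unfolding thick_def by blast
    have "norm w \<le> norm c + \<bar>r\<bar>" using w(2) norm_triangle_ineq2[of w c] by (auto simp: dist_norm norm_minus_commute)
    then have n: "norm (z - w) \<le> R'" using z norm_triangle_ineq4[of z w] unfolding R'_def by linarith
    have "z - w + t0 + t = s" using w(1) by (simp add: algebra_simps)
    then show False using t0(2)[OF n t] w(3) by simp
  qed
  with t0(1) show ?thesis by blast
qed

definition bump :: "(real^'n) set \<Rightarrow> real^'n \<Rightarrow> real \<Rightarrow> (real^'n \<Rightarrow> real) \<Rightarrow> real^'n \<Rightarrow> real" where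
  "bump \<sigma> c r \<rho> = conv (indicator (thick \<sigma> c r)) \<rho>"

lemma indicator_thick:
  "indicat_real (thick \<sigma> c r) \<in> borel_measurable borel" "locally_integrable (indicat_real (thick \<sigma> c r))"
proof -
  show m: "indicat_real (thick \<sigma> c r) \<in> borel_measurable borel"
    using open_thick by (simp add: borel_measurable_indicator)
  show "locally_integrable (indicat_real (thick \<sigma> c r))"
    unfolding locally_integrable_def
  proof (intro allI impI)
    fix K :: "(real^'n) set" assume K: "compact K"
    have "K \<inter> thick \<sigma> c r \<in> lmeasurable"
      using lmeasurable_compact[OF K] open_thick by (intro fmeasurable_Int_fmeasurable) auto
    then have "K \<inter> thick \<sigma> c r \<in> sets lebesgue" "emeasure lebesgue (K \<inter> thick \<sigma> c r) < \<infinity>"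
      using fmeasurableD fmeasurableD2 by (blast, simp only: infinity_ennreal_def less_top[symmetric])
    then have "integrable lebesgue (indicat_real (K \<inter> thick \<sigma> c r))" by (rule integrable_real_indicator)
    then show "set_integrable lebesgue K (indicat_real (thick \<sigma> c r))"
      unfolding set_integrable_def by (simp flip: indicator_inter_arith)
  qed
qed

context
  fixes \<sigma> :: "(real^'n) set" and \<rho> :: "real^'n \<Rightarrow> real" and \<eta> :: real
  assumes s: "\<sigma> \<in> \<Sigma>" and \<rho>: "mollifier \<eta> \<rho>" and \<eta>: "0 < \<eta>"
begin

lemma bump_smooth: "smooth (bump \<sigma> c r \<rho>)"
  unfolding bump_def using smooth_conv[OF indicator_thick(2)] \<rho> by (simp add: mollifier_def)

lemma bump_one: "z \<in> thick \<sigma> c r \<Longrightarrow> bump \<sigma> c (r + \<eta>) \<rho> z = 1"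
  unfolding bump_def using thick_translate[of z \<sigma> c r _ \<eta>]
  by (intro conv_const[OF indicator_thick \<rho>]) auto

lemma bump_zero: "bump \<sigma> c r \<rho> z \<noteq> 0 \<Longrightarrow> z \<in> thick \<sigma> c (r + \<eta>)"
proof (rule ccontr)
  assume b: "bump \<sigma> c r \<rho> z \<noteq> 0" and z: "z \<notin> thick \<sigma> c (r + \<eta>)"
  have "bump \<sigma> c r \<rho> z = 0"
    unfolding bump_def
  proof (rule conv_const[OF indicator_thick \<rho>])
    fix x :: "real^'n" assume "norm x < \<eta>"
    then show "indicat_real (thick \<sigma> c r) (z + x) = 0"
      using thick_translate[of "z + x" \<sigma> c r "-x" \<eta>] z by (auto simp: indicator_def)
  qed
  with b show False by simp
qed

text \<open>
  Far along a face of \<open>\<sigma>\<close> the set \<open>thick\<close> is invariant, and far along any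
  other cone it is empty; the radius is enlarged by \<open>\<eta>\<close> to absorb the convolution.
\<close>

lemma bump_strongly_tame: "strongly_tame (bump \<sigma> c r \<rho>)"
  unfolding strongly_tame_def
proof (intro ballI allI)
  fix \<tau> R assume t: "\<tau> \<in> \<Sigma>"
  have "\<exists>t0\<in>\<tau>. \<forall>z t. norm z \<le> R + \<eta> \<longrightarrow> t \<in> \<tau> \<longrightarrow> (z + t0 + t \<in> thick \<sigma> c r \<longleftrightarrow> z + t0 \<in> thick \<sigma> c r)"
  proof (cases "\<tau> \<subseteq> \<sigma>")
    case True
    then show ?thesis by (rule thick_deep_face[OF s t])
  next
    case False
    obtain t0 where "t0 \<in> \<tau>" "\<And>z t. norm z \<le> R + \<eta> \<Longrightarrow> t \<in> \<tau> \<Longrightarrow> z + t0 + t \<notin> thick \<sigma> c r"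
      using thick_deep_nonface[OF s t False] by blast
    moreover from this(2)[OF _ cone_zero[OF t]] have "\<And>z. norm z \<le> R + \<eta> \<Longrightarrow> z + t0 \<notin> thick \<sigma> c r" by simp
    ultimately show ?thesis by blast
  qed
  then obtain t0 where t0: "t0 \<in> \<tau>"
    "\<And>z t. norm z \<le> R + \<eta> \<Longrightarrow> t \<in> \<tau> \<Longrightarrow> (z + t0 + t \<in> thick \<sigma> c r \<longleftrightarrow> z + t0 \<in> thick \<sigma> c r)" by blast
  have "bump \<sigma> c r \<rho> (z + t0 + t) = bump \<sigma> c r \<rho> (z + t0) + 0" if z: "norm z \<le> R" and t: "t \<in> \<tau>" for z t
    unfolding bump_def
  proof (rule conv_translate[OF indicator_thick \<rho>])
    fix x :: "real^'n" assume "norm x < \<eta>"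
    then have "norm (z + x) \<le> R + \<eta>" using z norm_triangle_ineq[of z x] by linarith
    from t0(2)[OF this t] show "indicat_real (thick \<sigma> c r) (z + t0 + t + x) = indicat_real (thick \<sigma> c r) (z + t0 + x) + 0"
      by (simp add: indicator_def algebra_simps)
  qed
  then show "\<exists>t0\<in>\<tau>. \<forall>z t. norm z \<le> R \<longrightarrow> t \<in> \<tau> \<longrightarrow> bump \<sigma> c r \<rho> (z + t0 + t) = bump \<sigma> c r \<rho> (z + t0)"
    using t0(1) by auto
qed

lemma bump_support:
  assumes P: "P \<in> trop_var \<Sigma>" "ext (bump \<sigma> c r \<rho>) P \<noteq> 0"
  shows "\<exists>\<tau> z. \<tau> \<in> \<Sigma> \<and> \<tau> face_of \<sigma> \<and> P = (\<tau>, coset \<tau> z) \<and> z \<in> thick \<sigma> c (r + \<eta>)"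
proof -
  obtain \<tau> x where t: "\<tau> \<in> \<Sigma>" "P = (\<tau>, coset \<tau> x)" using P(1) by (rule trop_var_cases)
  obtain t0 r' where t0: "t0 \<in> \<tau>" "r' > 0" "\<forall>y\<in>ball x r'. \<forall>s\<in>\<tau>. bump \<sigma> c r \<rho> (y + t0 + s) = ext (bump \<sigma> c r \<rho>) (\<tau>, coset \<tau> y)"
    using tame_deep[OF strongly_tame_tame[OF bump_strongly_tame] t(1)] by blast
  have val: "bump \<sigma> c r \<rho> (x + t0 + s) \<noteq> 0" if "s \<in> \<tau>" for s
    using t0(2,3) that P(2) t(2) by simp
  have th: "x + t0 + s \<in> thick \<sigma> c (r + \<eta>)" if "s \<in> \<tau>" for s
    by (rule bump_zero[OF val[OF that]])
  have sub: "\<tau> \<subseteq> \<sigma>"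
  proof (rule ccontr)
    assume "\<not> \<tau> \<subseteq> \<sigma>"
    from thick_deep_nonface[OF s t(1) this, of "norm (x + t0)" c "r + \<eta>"] obtain t1 where
      "t1 \<in> \<tau>" "x + t0 + t1 + 0 \<notin> thick \<sigma> c (r + \<eta>)" using cone_zero[OF t(1)] by blast
    with th show False by simp
  qed
  have "P = (\<tau>, coset \<tau> (x + t0))" using t(2) t0(1) by (simp add: coset_shift span_base)
  with th[OF cone_zero[OF t(1)]] t(1) subset_face[OF t(1) s sub] show ?thesis by auto
qed

end

text \<open>
  The support condition is expressed through a closed set \<open>C\<close> of $N_\Sigma$, because the
  product of a test form with the bump function must again have compact support, now inside
  \<open>W\<close>.
\<close>

lemma bump_exists:
  assumes "openin (trop_topology \<Sigma>) W" "P \<in> W"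
  obtains b C V where "smooth_function \<Sigma> (trop_var \<Sigma>) b"
    and "closedin (trop_topology \<Sigma>) C" and "C \<subseteq> W" "\<And>Q. Q \<in> trop_var \<Sigma> \<Longrightarrow> Q \<notin> C \<Longrightarrow> b Q = 0"
    and "openin (trop_topology \<Sigma>) V" "P \<in> V" "\<And>Q. Q \<in> V \<Longrightarrow> b Q = 1"
proof -
  have "P \<in> trop_var \<Sigma>" using openin_subset[OF assms(1)] assms(2) topspace_trop by auto
  then obtain \<sigma> x where P: "\<sigma> \<in> \<Sigma>" "P = (\<sigma>, coset \<sigma> x)" by (rule trop_var_cases)
  obtain s0 r where r: "s0 \<in> \<sigma>" "r > 0"
    "\<And>y s \<tau>. y \<in> ball (x + s0) r \<Longrightarrow> s \<in> \<sigma> \<Longrightarrow> \<tau> \<in> \<Sigma> \<Longrightarrow> \<tau> face_of \<sigma> \<Longrightarrow> (\<tau>, coset \<tau> (y + s)) \<in> W"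
    using open_near[OF assms(1) assms(2)[unfolded P(2)] P(1)]
    unfolding eventually_near[OF cone[OF P(1)]] by blast
  let ?c = "x + s0"
  \<comment> \<open>The function \<open>b\<close> is 1 on the neighbourhood of radius \<open>\<eta>\<close> and supported in that of radius \<open>3 \<eta>\<close>, where \<open>b'\<close> is 1;
    \<open>b'\<close> is supported in that of radius \<open>5 \<eta> = r\<close>.  So a superlevel set of \<open>b'\<close> is a closed set between the two.\<close>
  define \<eta> where "\<eta> = r / 5"
  have \<eta>: "\<eta> > 0" using r(2) by (simp add: \<eta>_def)
  obtain \<rho> :: "real^'n \<Rightarrow> real" where \<rho>: "mollifier \<eta> \<rho>" using mollifier_exists[OF \<eta>] by blast
  define b where "b = bump \<sigma> ?c (2 * \<eta>) \<rho>"
  define b' where "b' = bump \<sigma> ?c (4 * \<eta>) \<rho>"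
  have tb: "tame b" "smooth b" unfolding b_def
    using strongly_tame_tame[OF bump_strongly_tame[OF P(1) \<rho> \<eta>]] bump_smooth[OF P(1) \<rho> \<eta>] by auto
  have tb': "tame b'" "smooth b'" unfolding b'_def
    using strongly_tame_tame[OF bump_strongly_tame[OF P(1) \<rho> \<eta>]] bump_smooth[OF P(1) \<rho> \<eta>] by auto
  have bb': "b' z = 1" if "b z \<noteq> 0" for z
    using bump_one[OF P(1) \<rho> \<eta> bump_zero[OF P(1) \<rho> \<eta>, of ?c "2 * \<eta>" z]] that by (simp add: b_def b'_def)
  let ?C = "{Q \<in> trop_var \<Sigma>. 1/2 \<le> ext b' Q}"
  have C: "closedin (trop_topology \<Sigma>) ?C" by (rule closed_superlevel[OF tb'(1) smooth_continuous[OF tb'(2)]])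
  have CW: "?C \<subseteq> W"
  proof
    fix Q assume "Q \<in> ?C"
    then have "Q \<in> trop_var \<Sigma>" "ext b' Q \<noteq> 0" by auto
    then obtain \<tau> z where "\<tau> \<in> \<Sigma>" "\<tau> face_of \<sigma>" "Q = (\<tau>, coset \<tau> z)" "z \<in> thick \<sigma> ?c r"
      using bump_support[OF P(1) \<rho> \<eta>, of Q ?c "4 * \<eta>"] by (auto simp: b'_def \<eta>_def)
    then show "Q \<in> W" using r(3) unfolding thick_def by blast
  qed
  have bC: "ext b Q = 0" if Q: "Q \<in> trop_var \<Sigma>" "Q \<notin> ?C" for Q
  proof (rule ccontr)
    assume nz: "ext b Q \<noteq> 0"
    obtain \<tau> y where t: "\<tau> \<in> \<Sigma>" "Q = (\<tau>, coset \<tau> y)" using Q(1) by (rule trop_var_cases)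
    \<comment> \<open>Both extensions are attained at one common point of the open stratum.\<close>
    have "\<forall>\<^sub>F z in near \<tau> y. (\<forall>\<tau>'\<in>\<Sigma>. \<tau>' face_of \<tau> \<longrightarrow> ext b (\<tau>', coset \<tau>' z) = b z) \<and>
       (\<forall>\<tau>'\<in>\<Sigma>. \<tau>' face_of \<tau> \<longrightarrow> ext b' (\<tau>', coset \<tau>' z) = b' z)"
      by (intro eventually_conj tame_near_ext tb tb' t)
    from near_eventually_witness[OF cone[OF t(1)] this] obtain t0 where t0: "t0 \<in> \<tau>"
      "ext b (\<tau>, coset \<tau> (y + t0)) = b (y + t0)" "ext b' (\<tau>, coset \<tau> (y + t0)) = b' (y + t0)"
      using cone_zero[OF t(1)] face_self[OF t(1)] t(1) by (metis add.right_neutral)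
    then have "ext b Q = b (y + t0)" "ext b' Q = b' (y + t0)"
      using t(2) by (simp_all add: coset_shift span_base)
    then show False using nz bb' Q by simp
  qed
  have "eventually (\<lambda>z. z \<in> thick \<sigma> ?c \<eta>) (near \<sigma> x)"
    unfolding eventually_near[OF cone[OF P(1)]] thick_def using r(1) \<eta> by blast
  then have "eventually (\<lambda>z. b z = 1) (near \<sigma> x)"
    by (rule eventually_mono) (use bump_one[OF P(1) \<rho> \<eta>, of _ ?c \<eta>] in \<open>simp add: b_def\<close>)
  then obtain R where R: "openin (trop_topology \<Sigma>) {(\<tau>, coset \<tau> z) |\<tau> z. \<tau> \<in> \<Sigma> \<and> \<tau> face_of \<sigma> \<and> z \<in> R}"
    "(\<sigma>, coset \<sigma> x) \<in> {(\<tau>, coset \<tau> z) |\<tau> z. \<tau> \<in> \<Sigma> \<and> \<tau> face_of \<sigma> \<and> z \<in> R}"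
    "\<And>z. z \<in> R \<Longrightarrow> b z = 1" "\<And>z s. z \<in> R \<Longrightarrow> s \<in> \<sigma> \<Longrightarrow> z + s \<in> R"
    by (rule near_open[OF P(1)]) blast
  have b1: "ext b Q = 1" if Q: "Q \<in> {(\<tau>, coset \<tau> z) |\<tau> z. \<tau> \<in> \<Sigma> \<and> \<tau> face_of \<sigma> \<and> z \<in> R}" for Q
  proof -
    obtain \<tau> z where t: "Q = (\<tau>, coset \<tau> z)" "\<tau> \<in> \<Sigma>" "\<tau> face_of \<sigma>" "z \<in> R" using Q by blast
    have "b (z + s) = 1" if "s \<in> \<tau>" for s using R(3,4) t(4) that face_subset[OF t(3)] by blast
    then show ?thesis unfolding t(1) by (rule ext_eqI[OF cone[OF t(2)]])
  qed
  show ?thesis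
    by (rule that[OF ext_smooth[OF tb] C CW bC R(1) _ b1]) (use R(2) P(2) in auto)
qed

end

section \<open>Alternating functions of lists\<close>

definition alternating :: "nat \<Rightarrow> ((real^'n) list \<Rightarrow> real) \<Rightarrow> bool" where
  "alternating m F \<longleftrightarrow>
    (\<forall>vs k. length vs = m \<longrightarrow> k < m \<longrightarrow> linear (\<lambda>v. F (vs[k := v]))) \<and>
    (\<forall>vs. length vs = m \<longrightarrow> \<not> distinct vs \<longrightarrow> F vs = 0)"

lemma alternating_linear:
  assumes "alternating m F" "length xs + length zs + 1 = m"
  shows "linear (\<lambda>v. F (xs @ v # zs))"
proof -
  have "linear (\<lambda>v. F ((xs @ 0 # zs)[length xs := v]))"
    using assms(1)[unfolded alternating_def, THEN conjunct1, rule_format, of "xs @ 0 # zs" "length xs"] assms(2) by simp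
  then show ?thesis by (simp add: list_update_append)
qed

lemma alternating_swap:
  assumes F: "alternating m F" and l: "length xs + length zs + 2 = m"
  shows "F (xs @ u # v # zs) = - F (xs @ v # u # zs)"
proof -
  have l1: "linear (\<lambda>w. F (xs @ w # a # zs))" for a by (rule alternating_linear[OF F]) (use l in simp)
  have l2: "linear (\<lambda>w. F (xs @ a # w # zs))" for a
    using alternating_linear[OF F, of "xs @ [a]" zs] l by simp
  have z: "F (xs @ a # a # zs) = 0" for a
  proof -
    have "\<not> distinct (xs @ a # a # zs)" by simp
    then show ?thesis using F l unfolding alternating_def by simp
  qed
  have "F (xs @ (u + v) # (u + v) # zs) = F (xs @ u # u # zs) + F (xs @ u # v # zs) + (F (xs @ v # u # zs) + F (xs @ v # v # zs))"
    by (simp add: linear_add[OF l1] linear_add[OF l2])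
  then show ?thesis by (simp add: z)
qed

lemma alternating_move:
  assumes "alternating m F" "length xs + length ys + length zs + 1 = m"
  shows "F (xs @ v # ys @ zs) = (-1) ^ length ys * F (xs @ ys @ v # zs)"
  using assms(2)
proof (induction ys arbitrary: xs)
  case (Cons y ys)
  have "F (xs @ v # (y # ys) @ zs) = - F (xs @ y # v # ys @ zs)"
    using alternating_swap[OF assms(1), of xs "ys @ zs" v y] Cons.prems by simp
  also have "\<dots> = - ((-1) ^ length ys * F ((xs @ [y]) @ ys @ v # zs))"
    using Cons.IH[of "xs @ [y]"] Cons.prems by simp
  finally show ?case by simp
qed simp

lemma length_omit: "k < length vs \<Longrightarrow> length (omit k vs) = length vs - 1"
  by (simp add: omit_def)

lemma omit_nth:
  "k < length vs \<Longrightarrow> i < length vs \<Longrightarrow> i \<noteq> k \<Longrightarrow> omit k vs ! (if i < k then i else i - 1) = vs ! i"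
  by (auto simp: omit_def nth_append)

lemma omit_update:
  assumes "k < length vs" "j < length vs"
  shows "omit k (vs[j := v]) = (if j = k then omit k vs else (omit k vs)[(if j < k then j else j - 1) := v])"
proof -
  consider "j = k" | "j < k" | "k < j" by linarith
  then show ?thesis
  proof cases
    case 1
    then show ?thesis by (simp add: omit_def)
  next
    case 2
    then show ?thesis using assms by (simp add: omit_def take_update_swap list_update_append)
  next
    case 3
    then obtain d where "j = Suc (k + d)" using less_iff_Suc_add by blast
    then show ?thesis using assms by (simp add: omit_def drop_update_swap list_update_append)
  qed
qed

text \<open>
  For \<open>G v vs = \<lambda> v * \<beta> vs\<close> this is the wedge product of the covector
  \<open>\<lambda>\<close> with the form \<open>\<beta>\<close>, and for \<open>G v\<close> the derivative
  of \<open>\<beta>\<close> in direction \<open>v\<close> it is the exterior derivative of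
  \<open>\<beta>\<close>.
\<close>

definition wedge1 :: "(real^'n \<Rightarrow> (real^'n) list \<Rightarrow> real) \<Rightarrow> (real^'n) list \<Rightarrow> real" where
  "wedge1 G vs = (\<Sum>k<length vs. (-1) ^ k * G (vs ! k) (omit k vs))"

lemma alternating_wedge1:
  fixes G :: "real^'n \<Rightarrow> (real^'n) list \<Rightarrow> real"
  assumes lin: "\<And>vs. length vs = m \<Longrightarrow> linear (\<lambda>v. G v vs)" and alt: "\<And>v. alternating m (G v)"
  shows "alternating (Suc m) (wedge1 G)"
  unfolding alternating_def
proof (intro conjI allI impI)
  fix vs :: "(real^'n) list" and j assume l: "length vs = Suc m" and j: "j < Suc m"
  have "linear (\<lambda>v. (-1) ^ k * G (vs[j := v] ! k) (omit k (vs[j := v])))" if k: "k < Suc m" for k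
  proof (cases "j = k")
    case True
    have "linear (\<lambda>v. G v (omit k vs))" by (rule lin) (use l k in \<open>simp add: length_omit\<close>)
    then show ?thesis using True k l j by (simp add: omit_update linear_iff algebra_simps)
  next
    case False
    have len: "length (omit k vs) = m" using l k by (simp add: length_omit)
    have "linear (\<lambda>v. G (vs ! k) ((omit k vs)[(if j < k then j else j - 1) := v]))"
      using alt[of "vs ! k"] len j k False unfolding alternating_def by auto
    then show ?thesis using False k l j by (simp add: omit_update linear_iff algebra_simps)
  qed
  then have "linear (\<lambda>v. \<Sum>k<Suc m. (-1) ^ k * G (vs[j := v] ! k) (omit k (vs[j := v])))"
    by (intro linear_compose_sum) auto
  then show "linear (\<lambda>v. wedge1 G (vs[j := v]))" by (simp add: wedge1_def l)
next
  fix vs :: "(real^'n) list" assume l: "length vs = Suc m" and nd: "\<not> distinct vs"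
  from not_distinct_decomp[OF nd] obtain xs ys zs v where vs: "vs = xs @ v # ys @ v # zs" by auto
  let ?i = "length xs" and ?j = "length xs + length ys + 1"
  let ?t = "\<lambda>k. (-1) ^ k * G (vs ! k) (omit k vs)"
  have ij: "?i < length vs" "?j < length vs" "?i \<noteq> ?j" by (simp_all add: vs)
  have vi: "vs ! ?i = v" "vs ! ?j = v" by (simp_all add: vs nth_append)
  \<comment> \<open>Omitting any other vector leaves both copies of \<open>v\<close> in the list.\<close>
  have other: "?t k = 0" if k: "k < length vs" "k \<noteq> ?i" "k \<noteq> ?j" for k
  proof -
    let ?f = "\<lambda>i. if i < k then i else i - 1"
    have "omit k vs ! ?f ?i = omit k vs ! ?f ?j" using omit_nth[OF k(1)] ij k vi by metis
    moreover have "?f ?i \<noteq> ?f ?j" "?f ?i < length (omit k vs)" "?f ?j < length (omit k vs)"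
      using k ij by (auto simp: length_omit vs split: if_splits)
    ultimately have "\<not> distinct (omit k vs)" using nth_eq_iff_index_eq by blast
    then show ?thesis using alt[of "vs ! k"] l k(1) by (simp add: alternating_def length_omit)
  qed
  have oi: "omit ?i vs = xs @ ys @ v # zs" by (simp add: omit_def vs)
  have oj: "omit ?j vs = xs @ v # ys @ zs" by (simp add: omit_def vs)
  have "G v (omit ?j vs) = (-1) ^ length ys * G v (omit ?i vs)"
    unfolding oi oj using alternating_move[OF alt[of v], of xs ys zs v] l by (simp add: vs)
  then have "?t ?i + ?t ?j = ((-1) ^ length xs + (-1) ^ (length xs + length ys + 1) * (-1) ^ length ys) * G v (omit ?i vs)"
    using vi by (simp add: algebra_simps)
  also have "(-1::real) ^ length xs + (-1) ^ (length xs + length ys + 1) * (-1) ^ length ys = 0"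
    by (simp add: power_add mult.assoc flip: power_mult_distrib)
  finally have tij: "?t ?i + ?t ?j = 0" by simp
  have "wedge1 G vs = (\<Sum>k\<in>{?i, ?j}. ?t k)"
    unfolding wedge1_def using other ij by (intro sum.mono_neutral_right) auto
  also have "\<dots> = 0" using ij(3) tij by simp
  finally show "wedge1 G vs = 0" .
qed

lemma basis_list: "distinct (basis_list :: (real^'n) list)" "set (basis_list :: (real^'n) list) = Basis"
  "length (basis_list :: (real^'n) list) = CARD('n)"
proof -
  have "\<exists>es :: (real^'n) list. distinct es \<and> set es = Basis" using finite_distinct_list[OF finite_Basis] by blast
  then have "distinct (basis_list :: (real^'n) list) \<and> set (basis_list :: (real^'n) list) = Basis"
    unfolding basis_list_def by (rule someI_ex)
  then show *: "distinct (basis_list :: (real^'n) list)" "set (basis_list :: (real^'n) list) = Basis" by auto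
  then show "length (basis_list :: (real^'n) list) = CARD('n)" using distinct_card by fastforce
qed

text \<open>
  Expanding \<open>s\<close> in the basis, every term but one repeats a basis vector.
\<close>

lemma alternating_expand_basis:
  fixes F :: "(real^'n) list \<Rightarrow> real"
  assumes F: "alternating CARD('n) F" and j: "j < CARD('n)"
  shows "F (basis_list[j := s]) = (s \<bullet> (basis_list ! j)) * F basis_list"
proof -
  let ?e = "basis_list ! j :: real^'n"
  have lin: "linear (\<lambda>v. F (basis_list[j := v]))" using F j basis_list(3) unfolding alternating_def by blast
  have e: "?e \<in> Basis" using basis_list j nth_mem by metis
  have "F (basis_list[j := s]) = F (basis_list[j := (\<Sum>b\<in>Basis. (s \<bullet> b) *\<^sub>R b)])"
    by (simp add: euclidean_representation)
  also have "\<dots> = (\<Sum>b\<in>Basis. (s \<bullet> b) * F (basis_list[j := b]))"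
    by (simp add: linear_sum[OF lin] linear_cmul[OF lin])
  also have "\<dots> = (\<Sum>b\<in>{?e}. (s \<bullet> b) * F (basis_list[j := b]))"
  proof (rule sum.mono_neutral_right)
    show "\<forall>b\<in>Basis - {?e}. (s \<bullet> b) * F (basis_list[j := b]) = 0"
    proof
      fix b :: "real^'n" assume b: "b \<in> Basis - {?e}"
      then obtain i where i: "i < CARD('n)" "basis_list ! i = b" using basis_list by (metis DiffD1 in_set_conv_nth)
      with b have "i \<noteq> j" by auto
      then have "basis_list[j := b] ! i = basis_list[j := b] ! j" using i j by (simp add: basis_list(3))
      then have "\<not> distinct (basis_list[j := b])"
        using \<open>i \<noteq> j\<close> i j basis_list(3) nth_eq_iff_index_eq by (metis length_list_update)
      then show "(s \<bullet> b) * F (basis_list[j := b]) = 0"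
        using F basis_list(3)[where 'n = 'n] unfolding alternating_def by simp
    qed
  qed (use e in auto)
  finally show ?thesis by simp
qed

text \<open>
  A form of top degree whose contraction with some vector \<open>s \<noteq> 0\<close> vanishes is zero. Near
  the stratum of a nonzero cone \<open>\<sigma>\<close> this applies with \<open>s \<in> \<sigma>\<close> to
  everything pulled back from $N(\sigma)$; hence all integrals below extend over bounded sets only.
\<close>

lemma wedge1_top_zero:
  fixes G :: "real^'n \<Rightarrow> (real^'n) list \<Rightarrow> real"
  assumes lin: "\<And>vs. length vs = CARD('n) - 1 \<Longrightarrow> linear (\<lambda>v. G v vs)" and alt: "\<And>v. alternating (CARD('n) - 1) (G v)"
    and s: "s \<noteq> 0" "\<And>vs. length vs = CARD('n) - 1 \<Longrightarrow> G s vs = 0"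
    "\<And>v vs. length vs = CARD('n) - 1 \<Longrightarrow> s \<in> set vs \<Longrightarrow> G v vs = 0"
  shows "wedge1 G basis_list = 0"
proof -
  have n: "Suc (CARD('n) - 1) = CARD('n)" by simp
  have A: "alternating CARD('n) (wedge1 G)" using alternating_wedge1[OF lin alt] n by simp
  obtain b where "b \<in> Basis" "s \<bullet> b \<noteq> 0" using s(1) euclidean_all_zero_iff by blast
  then obtain j where j: "j < CARD('n)" "s \<bullet> (basis_list ! j) \<noteq> 0" using basis_list by (metis in_set_conv_nth)
  have "wedge1 G (basis_list[j := s]) = 0"
    unfolding wedge1_def
  proof (rule sum.neutral, intro ballI)
    fix k assume "k \<in> {..<length (basis_list[j := s])}"
    then have k: "k < CARD('n)" by (simp add: basis_list(3))
    have len: "length (omit k (basis_list[j := s])) = CARD('n) - 1" using k by (simp add: length_omit basis_list(3))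
    show "(-1) ^ k * G (basis_list[j := s] ! k) (omit k (basis_list[j := s])) = 0"
    proof (cases "k = j")
      case True
      then show ?thesis using s(2)[OF len] j by (simp add: basis_list(3))
    next
      case False
      have "omit k (basis_list[j := s]) ! (if j < k then j else j - 1) = s"
        using omit_nth[of k "basis_list[j := s]" j] j k False by (simp add: basis_list(3))
      moreover have "(if j < k then j else j - 1) < length (omit k (basis_list[j := s]))"
        using j k False by (simp add: length_omit basis_list(3)) arith
      ultimately have "s \<in> set (omit k (basis_list[j := s]))" by (metis nth_mem)
      then show ?thesis using s(3)[OF len] by simp
    qed
  qed
  then show ?thesis using alternating_expand_basis[OF A j(1), of s] j(2) by simp
qed

section \<open>Pairing a Hessian with a form\<close>

lemma supported_zero: "supported_in \<omega> K \<Longrightarrow> P \<notin> K \<Longrightarrow> \<omega> P vs ws = 0"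
  unfolding supported_in_def by metis

abbreviation bvec :: "nat \<Rightarrow> real^'n" where "bvec k \<equiv> basis_list ! k"

text \<open>
  The coefficients of a form of bidegree $(n-1,n-1)$, indexed by the basis vectors left out.
\<close>

definition cf :: "'n::finite covec \<Rightarrow> nat \<Rightarrow> nat \<Rightarrow> real" where
  "cf a k l = a (omit k basis_list) (omit l basis_list)"

text \<open>
  Up to sign the coefficient of \<open>d'd''f \<and> \<omega>\<close> with respect to the standard basis.
\<close>

definition hess :: "(real^'n \<Rightarrow> real) \<Rightarrow> 'n form \<Rightarrow> real^'n \<Rightarrow> real" where
  "hess f \<omega> x = (\<Sum>k<CARD('n). \<Sum>l<CARD('n).
     (-1) ^ (k + l) * dirv (bvec k) (dirv (bvec l) f) x * cf (\<omega> (emb x)) k l)"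

text \<open>
  The product of three signs: the reordering in \<open>form_integral\<close>, the factor $(-1)^n$ by which
  \<open>d''\<close> passes the \<open>n\<close> factors of type \<open>d'\<close>, and $-1$ from the signs
  with which \<open>d'\<close> and \<open>d''\<close> are extended to currents.
\<close>

definition sgn_top :: "'n::finite itself \<Rightarrow> real" where
  "sgn_top _ = - ((-1) ^ (CARD('n) * (CARD('n) - 1) div 2) * (-1) ^ CARD('n))"

lemma near_nhds:
  assumes "convex_cone \<sigma>" "eventually P (near \<sigma> x)"
  shows "eventually (\<lambda>z. eventually P (nhds z)) (near \<sigma> x)"
proof -
  obtain s0 r where *: "s0 \<in> \<sigma>" "r > 0" "\<And>y s. y \<in> ball (x + s0) r \<Longrightarrow> s \<in> \<sigma> \<Longrightarrow> P (y + s)"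
    using assms(2) unfolding eventually_near[OF assms(1)] by blast
  have "eventually P (nhds (y + s))" if y: "y \<in> ball (x + s0) r" and s: "s \<in> \<sigma>" for y s
  proof -
    have "y + s \<in> ball (x + s0 + s) r" using y by (simp add: dist_norm)
    then have "eventually (\<lambda>z. z \<in> ball (x + s0 + s) r) (nhds (y + s))"
      by (intro eventually_nhds_in_open) auto
    then show ?thesis
    proof (rule eventually_mono)
      fix z assume "z \<in> ball (x + s0 + s) r"
      then have "P ((z - s) + s)" by (intro *(3) s) (auto simp: dist_norm algebra_simps)
      then show "P z" by simp
    qed
  qed
  then show ?thesis unfolding eventually_near[OF assms(1)] using *(1,2) by blast
qed

lemma dirv_nhds:
  assumes "eventually (\<lambda>y. f y = g y) (nhds x)" shows "dirv u f x = dirv u g x"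
proof -
  obtain S where "open S" "x \<in> S" "\<forall>y\<in>S. f y = g y" using assms unfolding eventually_nhds by blast
  then show ?thesis by (intro dirv_local[of S]) auto
qed

text \<open>
  Invariance is available only for translations by \<open>\<sigma>\<close>, that is for \<open>t \<ge>
  0\<close> in direction \<open>s\<close>; for \<open>t < 0\<close> it is used at the base point \<open>x +
  t s\<close>, which stays in the neighbourhood.
\<close>

lemma dirv_invariant:
  assumes "smooth f" "convex_cone \<sigma>" "s \<in> \<sigma>" "eventually (\<lambda>y. \<forall>s\<in>\<sigma>. f (y + s) = f y) (nhds x)"
  shows "dirv s f x = 0"
proof -
  obtain r where r: "r > 0" "\<And>y s. y \<in> ball x r \<Longrightarrow> s \<in> \<sigma> \<Longrightarrow> f (y + s) = f y"
    using assms(4) unfolding eventually_nhds_metric by (auto simp: dist_commute)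
  have "((\<lambda>t. f (x + t *\<^sub>R s)) has_real_derivative dirv s f (x + 0 *\<^sub>R s)) (at 0)"
    by (rule line_derivative[OF assms(1)])
  moreover have "f (x + t *\<^sub>R s) = f (x + 0 *\<^sub>R s)" if t: "\<bar>t\<bar> < r / (norm s + 1)" for t
  proof (cases "t \<ge> 0")
    case True
    then show ?thesis using r(2)[of x "t *\<^sub>R s"] r(1) convex_cone_scaleR[OF assms(2) _ assms(3)] by simp
  next
    case False
    have "\<bar>t\<bar> * norm s \<le> \<bar>t\<bar> * (norm s + 1)" by (simp add: algebra_simps)
    also have "\<dots> < r" using t by (simp add: field_simps pos_less_divide_eq add_pos_nonneg)
    finally have "x + t *\<^sub>R s \<in> ball x r" by (simp add: dist_norm)
    then have "f (x + t *\<^sub>R s + (- t) *\<^sub>R s) = f (x + t *\<^sub>R s)"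
      using False by (intro r(2) convex_cone_scaleR[OF assms(2) _ assms(3)]) auto
    then show ?thesis by simp
  qed
  ultimately have "dirv s f (x + 0 *\<^sub>R s) = 0"
    by (intro DERIV_local_const[where d = "r / (norm s + 1)"]) (use r(1) in \<open>auto simp: add_nonneg_pos\<close>)
  then show ?thesis by simp
qed

lemma covector_alternating:
  assumes "covector p q \<sigma> a"
  shows "alternating p (\<lambda>vs. a vs ws)" "alternating q (a vs)"
  using assms by (auto simp: covector_def alternating_def)

lemma alternating_cmult: "alternating m F \<Longrightarrow> alternating m (\<lambda>vs. c * F vs)"
  by (auto simp: alternating_def linear_iff algebra_simps)

text \<open>
  For fixed \<open>k\<close> the inner sum is the wedge product of the covector \<open>v \<mapsto> D\<^sub>v
  D\<^sub>e f\<close>, with \<open>e\<close> the \<open>k\<close>-th basis vector, and a form; both are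
  killed by \<open>s\<close>.
\<close>

lemma hess_zero:
  fixes \<omega> :: "'n::finite form" and z :: "real^'n"
  assumes f: "smooth f" and cov: "covector (CARD('n) - 1) (CARD('n) - 1) \<sigma> (\<omega> (emb z))"
    and s: "s \<in> \<sigma>" "s \<noteq> 0" and z: "\<And>e. dirv s (dirv e f) z = 0"
  shows "hess f \<omega> z = 0"
proof -
  have "(\<Sum>l<CARD('n). (-1) ^ l * (dirv (bvec l) (dirv (bvec k) f) z * cf (\<omega> (emb z)) k l)) = 0" for k
  proof -
    let ?G = "\<lambda>v vs. dirv v (dirv (bvec k) f) z * \<omega> (emb z) (omit k basis_list) vs"
    have "wedge1 ?G basis_list = 0"
    proof (rule wedge1_top_zero[OF _ _ s(2)])
      show "linear (\<lambda>v. ?G v vs)" for vs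
        using linear_dirv[OF smooth_dirv[OF f]] by (simp add: linear_iff algebra_simps)
      show "alternating (CARD('n) - 1) (?G v)" for v
        by (rule alternating_cmult[OF covector_alternating(2)[OF cov]])
      show "?G s vs = 0" for vs using z by simp
      show "?G v vs = 0" if "s \<in> set vs" for v vs
        using that s(1) span_base[of s \<sigma>] cov unfolding covector_def by (metis IntI UnI2 emptyE mult_zero_right)
    qed
    then show ?thesis by (simp add: wedge1_def cf_def basis_list(3))
  qed
  then have "(\<Sum>k<CARD('n). (-1) ^ k * (\<Sum>l<CARD('n). (-1) ^ l * (dirv (bvec l) (dirv (bvec k) f) z * cf (\<omega> (emb z)) k l))) = 0"
    by simp
  then show ?thesis
    unfolding hess_def dirv_commute[OF f, of "bvec _" "bvec _"]
    by (simp add: sum_distrib_left power_add mult_ac dirv_commute[OF f, of "bvec _" "bvec _"])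
qed

section \<open>Integration by parts\<close>

lemma integral_by_parts:
  assumes f: "smooth f" and g: "test_fun g"
  shows "(LINT x|lebesgue. f x * dirv v g x) = - (LINT x|lebesgue. dirv v f x * g x)"
    and "integrable lebesgue (\<lambda>x. f x * dirv v g x)" "integrable lebesgue (\<lambda>x. dirv v f x * g x)"
proof -
  have i: "integrable lebesgue (\<lambda>x. h x * k x)" if "smooth h" "test_fun k" for h k :: "real^'a \<Rightarrow> real"
    using integrable_mult_test_fun(2)[OF continuous_locally_integrable[OF smooth_continuous[OF that(1)]] that(2)] .
  show i1: "integrable lebesgue (\<lambda>x. f x * dirv v g x)" by (rule i[OF f test_fun_dirv[OF g]])
  show i2: "integrable lebesgue (\<lambda>x. dirv v f x * g x)" by (rule i[OF smooth_dirv[OF f] g])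
  have t: "test_fun (\<lambda>x. f x * g x)" using test_fun_mult[OF g f] by (simp add: mult.commute)
  have "0 = (LINT x|lebesgue. dirv v (\<lambda>x. f x * g x) x)" using integral_dirv_test_fun[OF t] by simp
  also have "\<dots> = (LINT x|lebesgue. f x * dirv v g x) + (LINT x|lebesgue. dirv v f x * g x)"
    using i1 i2 by (simp add: dirv_mult[OF f test_fun_smooth[OF g]])
  finally show "(LINT x|lebesgue. f x * dirv v g x) = - (LINT x|lebesgue. dirv v f x * g x)" by simp
qed

lemma test_fun_integrable: "test_fun g \<Longrightarrow> integrable lebesgue g"
  using integrable_mult_test_fun(2)[OF continuous_locally_integrable, of "\<lambda>x. 1" g] by simp

lemma smooth_cf: "(\<And>vs ws. smooth (\<lambda>x. \<omega> (emb x) vs ws)) \<Longrightarrow> smooth (\<lambda>x. cf (\<omega> (emb x)) k l)"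
  by (simp add: cf_def)

lemma smooth_hess: "smooth f \<Longrightarrow> (\<And>vs ws. smooth (\<lambda>x. \<omega> (emb x) vs ws)) \<Longrightarrow> smooth (hess f \<omega>)"
  unfolding hess_def[abs_def] by (intro smooth_sum smooth_mult smooth_const smooth_dirv smooth_cf)

text \<open>
  The coefficient of \<open>d'\<omega>\<close>, a form of bidegree $(n,n-1)$, whose \<open>d''\<close>
  arguments omit the \<open>l\<close>-th basis vector.
\<close>

definition eta :: "'n::finite form \<Rightarrow> nat \<Rightarrow> real^'n \<Rightarrow> real" where
  "eta \<omega> l x = (\<Sum>k<CARD('n). (-1) ^ k * dirv (bvec k) (\<lambda>y. cf (\<omega> (emb y)) k l) x)"

lemma dir_deriv_emb: "dir_deriv v \<alpha> (emb x) vs ws = dirv v (\<lambda>y. \<alpha> (emb y) vs ws) x"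
  by (simp add: dir_deriv_def emb_def dirv_def coset_zero)

text \<open>
  The differentials on \<open>U\<close> are cut off outside \<open>U\<close>. As \<open>\<omega>\<close>
  vanishes near all points outside \<open>U\<close>, the cut-off has no effect.
\<close>

lemma d2_d1_emb:
  fixes \<omega> :: "'n::finite form" and x :: "real^'n"
  assumes away: "\<And>x::real^'n. emb x \<notin> U \<Longrightarrow> eventually (\<lambda>y. \<omega> (emb y) = (\<lambda>vs ws. 0)) (nhds x)"
  shows "d2 U (d1 U \<omega>) (emb x) basis_list basis_list
    = (-1) ^ CARD('n) * (\<Sum>l<CARD('n). (-1) ^ l * dirv (bvec l) (eta \<omega> l) x)"
proof -
  have zero: "dirv v (\<lambda>y. \<omega> (emb y) vs ws) x = 0" if "emb x \<notin> U" for v vs ws and x :: "real^'n"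
  proof -
    have "dirv v (\<lambda>y. \<omega> (emb y) vs ws) x = dirv v (\<lambda>y. 0) x"
      by (rule dirv_nhds) (use away[OF that] in \<open>auto elim!: eventually_mono\<close>)
    then show ?thesis by (simp add: dirv_const)
  qed
  have d1: "d1 U \<omega> (emb y) basis_list (omit l basis_list) = eta \<omega> l y" for y :: "real^'n" and l
    using zero[of y] by (cases "emb y \<in> U") (simp_all add: d1_def eta_def dir_deriv_emb cf_def basis_list(3))
  have etaz: "dirv v (eta \<omega> l) x = 0" if "emb x \<notin> U" for v l and x :: "real^'n"
  proof -
    have "eventually (\<lambda>y. eventually (\<lambda>y. \<omega> (emb y) = (\<lambda>vs ws. 0)) (nhds y)) (nhds x)"
      using away[OF that] by (simp add: eventually_eventually)
    then have "eventually (\<lambda>y. eta \<omega> l y = 0) (nhds x)"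
    proof (rule eventually_mono)
      fix y :: "real^'n" assume y: "eventually (\<lambda>y. \<omega> (emb y) = (\<lambda>vs ws. 0)) (nhds y)"
      have "dirv v (\<lambda>y. cf (\<omega> (emb y)) k l) y = 0" for v k
      proof -
        have "dirv v (\<lambda>y. cf (\<omega> (emb y)) k l) y = dirv v (\<lambda>y. 0) y"
          by (rule dirv_nhds) (use y in \<open>auto elim!: eventually_mono simp: cf_def\<close>)
        then show ?thesis by (simp add: dirv_const)
      qed
      then show "eta \<omega> l y = 0" by (simp add: eta_def)
    qed
    then have "dirv v (eta \<omega> l) x = dirv v (\<lambda>y. 0) x" by (rule dirv_nhds)
    then show ?thesis by (simp add: dirv_const)
  qed
  show ?thesis
  proof (cases "emb x \<in> U")
    case True
    then show ?thesis by (simp add: d2_def dir_deriv_emb d1 basis_list(3))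
  next
    case False
    then show ?thesis using etaz[OF False] by (simp add: d2_def)
  qed
qed

lemma ddc_formula:
  fixes \<omega> :: "'n::finite form" and f :: "real^'n \<Rightarrow> real"
  assumes away: "\<And>x::real^'n. emb x \<notin> U \<Longrightarrow> eventually (\<lambda>y. \<omega> (emb y) = (\<lambda>vs ws. 0)) (nhds x)"
  shows "ddc U f \<omega> = sgn_top TYPE('n) * (LINT x|lebesgue. f x * (\<Sum>l<CARD('n). (-1) ^ l * dirv (bvec l) (eta \<omega> l) x))"
proof -
  have "(LINT x|lebesgue. f x * d2 U (d1 U \<omega>) (emb x) basis_list basis_list)
    = (LINT x|lebesgue. (-1) ^ CARD('n) * (f x * (\<Sum>l<CARD('n). (-1) ^ l * dirv (bvec l) (eta \<omega> l) x)))"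
    by (simp add: d2_d1_emb[OF away] mult_ac)
  then show ?thesis
    by (simp add: ddc_def current_d1_def current_d2_def function_current_def form_integral_def sgn_top_def)
qed

context tropical_variety
begin

lemma nonzero_cone_vector: "\<sigma> \<in> \<Sigma> \<Longrightarrow> \<sigma> \<noteq> {0} \<Longrightarrow> \<exists>s\<in>\<sigma>. s \<noteq> 0"
  using cone_zero by blast

text \<open>
  The form of \<open>bounded_trace\<close> used for coefficients of test forms: a smooth function that
  vanishes where \<open>K\<close> does not reach and near the boundary points of \<open>K\<close> has
  compact support.
\<close>

lemma test_fun_of_trace:
  assumes g: "smooth g" and K: "compactin (trop_topology \<Sigma>) K"
    and loc: "\<And>x. eventually (\<lambda>y. emb y \<notin> K) (nhds x) \<Longrightarrow> g x = 0"
    and away: "\<And>\<sigma> x. \<sigma> \<in> \<Sigma> \<Longrightarrow> \<sigma> \<noteq> {0} \<Longrightarrow> (\<sigma>, coset \<sigma> x) \<in> K \<Longrightarrow> eventually (\<lambda>z. g z = 0) (near \<sigma> x)"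
  shows "test_fun g"
proof -
  let ?O = "{x. g x \<noteq> 0}" and ?Z = "{x. g x \<noteq> 0 \<and> emb x \<in> K}"
  have Z: "bounded ?Z"
  proof (rule bounded_trace[OF K])
    show "eventually (\<lambda>z. z \<notin> ?Z) (near \<sigma> x)" if "\<sigma> \<in> \<Sigma>" "\<sigma> \<noteq> {0}" "(\<sigma>, coset \<sigma> x) \<in> K" for \<sigma> x
      using away[OF that] by (rule eventually_mono) simp
  qed simp
  have O: "open ?O"
    using open_Collect_neq[OF smooth_continuous[OF g, of UNIV] continuous_on_const[of UNIV 0]] by simp
  have "?O \<subseteq> closure ?Z"
  proof
    fix x assume x: "x \<in> ?O"
    show "x \<in> closure ?Z"
    proof (rule ccontr)
      assume "x \<notin> closure ?Z"
      then have "eventually (\<lambda>y. y \<in> ?O \<inter> - closure ?Z) (nhds x)"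
        using x O by (intro eventually_nhds_in_open) auto
      then have "eventually (\<lambda>y. emb y \<notin> K) (nhds x)"
        by (rule eventually_mono) (use closure_subset[of ?Z] in auto)
      from loc[OF this] x show False by simp
    qed
  qed
  then have "bounded ?O" using bounded_subset[OF bounded_closure[OF Z]] by blast
  with g show ?thesis by (simp add: test_fun_def)
qed

text \<open>
  Near the stratum of \<open>\<sigma>\<close> the form \<open>d'\<omega>\<close> has degree \<open>n\<close>
  in the \<open>d'\<close> variables but is pulled back from a quotient of smaller dimension, so it
  vanishes.
\<close>

lemma eta_test_fun:
  assumes w: "\<omega> \<in> lagerberg_forms \<Sigma> (trop_var \<Sigma>) (CARD('n) - 1) (CARD('n) - 1)"
    and K: "compactin (trop_topology \<Sigma>) K" "supported_in \<omega> K"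
  shows "test_fun (eta \<omega> l)"
proof (rule test_fun_of_trace[OF _ K(1)])
  note sm = form_emb(2)[OF w]
  show "smooth (eta \<omega> l)"
    unfolding eta_def[abs_def] by (intro smooth_sum smooth_mult smooth_const smooth_dirv smooth_cf sm)
  fix x assume x: "eventually (\<lambda>y. emb y \<notin> K) (nhds x)"
  have "dirv v (\<lambda>y. cf (\<omega> (emb y)) k l) x = 0" for v k
  proof -
    have "dirv v (\<lambda>y. cf (\<omega> (emb y)) k l) x = dirv v (\<lambda>y. 0) x"
      by (rule dirv_nhds) (use x in \<open>auto elim!: eventually_mono simp: cf_def supported_zero[OF K(2)]\<close>)
    then show ?thesis by (simp add: dirv_const)
  qed
  then show "eta \<omega> l x = 0" by (simp add: eta_def)
next
  note sm = form_emb(2)[OF w]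
  fix \<sigma> x assume \<sigma>: "\<sigma> \<in> \<Sigma>" "\<sigma> \<noteq> {0}"
  obtain s where s: "s \<in> \<sigma>" "s \<noteq> 0" using nonzero_cone_vector[OF \<sigma>] by blast
  from near_nhds[OF cone[OF \<sigma>(1)] form_near[OF w \<sigma>(1)]]
  show "eventually (\<lambda>z. eta \<omega> l z = 0) (near \<sigma> x)"
  proof (rule eventually_mono)
    fix z assume z: "eventually (\<lambda>z. covector (CARD('n) - 1) (CARD('n) - 1) \<sigma> (\<omega> (emb z)) \<and>
       (\<forall>s\<in>\<sigma>. \<omega> (emb (z + s)) = \<omega> (emb z))) (nhds z)"
    let ?ws = "omit l basis_list"
    let ?G = "\<lambda>v vs. dirv v (\<lambda>y. \<omega> (emb y) vs ?ws) z"
    have "wedge1 ?G basis_list = 0"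
    proof (rule wedge1_top_zero[OF _ _ s(2)])
      show "linear (\<lambda>v. ?G v vs)" for vs by (rule linear_dirv[OF sm])
      show "alternating (CARD('n) - 1) (?G v)" for v
        unfolding alternating_def
      proof (intro conjI allI impI)
        fix vs :: "(real^'n) list" and k assume l: "length vs = CARD('n) - 1" "k < CARD('n) - 1"
        have lin: "linear (\<lambda>u. \<omega> (emb y) (vs[k := u]) ?ws)" for y
          using form_emb(1)[OF w, of y] l unfolding covector_def by simp
        show "linear (\<lambda>u. ?G v (vs[k := u]))"
        proof (rule linearI)
          show "?G v (vs[k := a + b]) = ?G v (vs[k := a]) + ?G v (vs[k := b])" for a b
            unfolding linear_add[OF lin] by (rule dirv_add[OF sm sm])
          show "?G v (vs[k := c *\<^sub>R a]) = c *\<^sub>R ?G v (vs[k := a])" for c a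
            unfolding linear_cmul[OF lin] real_scaleR_def by (rule dirv_cmult[OF sm])
        qed
      next
        fix vs :: "(real^'n) list" assume "\<not> distinct vs"
        then have "\<omega> (emb y) vs ?ws = 0" for y using form_emb(1)[OF w, of y] unfolding covector_def by blast
        then show "?G v vs = 0" by (simp add: dirv_const)
      qed
      show "?G s vs = 0" for vs
        by (rule dirv_invariant[OF sm cone[OF \<sigma>(1)] s(1)]) (use z in \<open>auto elim!: eventually_mono\<close>)
      show "?G v vs = 0" if "s \<in> set vs" for v vs
      proof -
        have "\<omega> (emb y) vs ?ws = 0" if "covector (CARD('n) - 1) (CARD('n) - 1) \<sigma> (\<omega> (emb y))" for y
          using that \<open>s \<in> set vs\<close> s(1) span_base[of s \<sigma>] unfolding covector_def by blast
        then have "?G v vs = dirv v (\<lambda>y. 0) z"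
          by (intro dirv_nhds) (use z in \<open>auto elim!: eventually_mono\<close>)
        then show ?thesis by (simp add: dirv_const)
      qed
    qed
    then show "eta \<omega> l z = 0" by (simp add: wedge1_def eta_def cf_def basis_list(3))
  qed
qed

text \<open>
  Local invariance along cones up to a linear function. It holds for Green functions, and it makes the
  Hessian degenerate in the directions of the cone.
\<close>

definition hess_tame :: "(real^'n \<Rightarrow> real) \<Rightarrow> bool" where
  "hess_tame f \<longleftrightarrow> smooth f \<and> (\<forall>\<sigma>\<in>\<Sigma>. \<forall>x. \<exists>m. eventually (\<lambda>z. \<forall>s\<in>\<sigma>. f (z + s) + m \<bullet> (z + s) = f z + m \<bullet> z) (near \<sigma> x))"

lemma dirv_dirv_inner: "smooth f \<Longrightarrow> dirv u (dirv v (\<lambda>x. f x + m \<bullet> x)) x = dirv u (dirv v f) x"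
proof -
  assume f: "smooth f"
  have lin: "dirv v (\<lambda>x. m \<bullet> x) y = m \<bullet> v" for y
    by (rule dirv_eqI) (simp add: bounded_linear_imp_has_derivative bounded_linear_inner_right)
  have "dirv v (\<lambda>x. f x + m \<bullet> x) = (\<lambda>x. dirv v f x + m \<bullet> v)"
    by (simp add: fun_eq_iff dirv_add[OF f smooth_inner] lin)
  then show ?thesis by (simp add: dirv_add[OF smooth_dirv[OF f] smooth_const] dirv_const)
qed

lemma hess_tame_near:
  assumes "hess_tame f" "\<sigma> \<in> \<Sigma>"
  shows "eventually (\<lambda>z. \<forall>s\<in>\<sigma>. \<forall>e. dirv s (dirv e f) z = 0) (near \<sigma> x)"
proof -
  have f: "smooth f" using assms(1) by (simp add: hess_tame_def)
  obtain m where m: "eventually (\<lambda>z. \<forall>s\<in>\<sigma>. f (z + s) + m \<bullet> (z + s) = f z + m \<bullet> z) (near \<sigma> x)"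
    using assms unfolding hess_tame_def by blast
  let ?f = "\<lambda>x. f x + m \<bullet> x"
  have sf: "smooth ?f" by (rule smooth_add[OF f smooth_inner])
  have "eventually (\<lambda>z. \<forall>s\<in>\<sigma>. dirv s ?f z = 0) (near \<sigma> x)"
    using near_nhds[OF cone[OF assms(2)] m]
    by (rule eventually_mono) (use dirv_invariant[OF sf cone[OF assms(2)]] in blast)
  from near_nhds[OF cone[OF assms(2)] this] show ?thesis
  proof (rule eventually_mono, intro ballI allI)
    fix z s e assume z: "eventually (\<lambda>z. \<forall>s\<in>\<sigma>. dirv s ?f z = 0) (nhds z)" and s: "s \<in> \<sigma>"
    have "dirv s (dirv e f) z = dirv s (dirv e ?f) z" by (rule dirv_dirv_inner[OF f, symmetric])
    also have "\<dots> = dirv e (dirv s ?f) z" by (rule dirv_commute[OF sf])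
    also have "\<dots> = dirv e (\<lambda>y. 0) z" by (rule dirv_nhds) (use z s in \<open>auto elim!: eventually_mono\<close>)
    finally show "dirv s (dirv e f) z = 0" by (simp add: dirv_const)
  qed
qed

lemma hess_test_fun:
  assumes f: "hess_tame f"
    and w: "\<omega> \<in> lagerberg_forms \<Sigma> (trop_var \<Sigma>) (CARD('n) - 1) (CARD('n) - 1)"
    and K: "compactin (trop_topology \<Sigma>) K" "supported_in \<omega> K"
  shows "test_fun (hess f \<omega>)"
proof (rule test_fun_of_trace[OF _ K(1)])
  have sf: "smooth f" using f by (simp add: hess_tame_def)
  show "smooth (hess f \<omega>)" by (rule smooth_hess[OF sf form_emb(2)[OF w]])
  fix x assume "eventually (\<lambda>y. emb y \<notin> K) (nhds x)"
  then have "emb x \<notin> K" by (rule eventually_nhds_x_imp_x)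
  then show "hess f \<omega> x = 0" by (simp add: hess_def cf_def supported_zero[OF K(2)])
next
  have sf: "smooth f" using f by (simp add: hess_tame_def)
  fix \<sigma> x assume \<sigma>: "\<sigma> \<in> \<Sigma>" "\<sigma> \<noteq> {0}"
  obtain s where s: "s \<in> \<sigma>" "s \<noteq> 0" using nonzero_cone_vector[OF \<sigma>] by blast
  show "eventually (\<lambda>z. hess f \<omega> z = 0) (near \<sigma> x)"
    using eventually_conj[OF form_near[OF w \<sigma>(1), of x] hess_tame_near[OF f \<sigma>(1), of x]]
  proof (rule eventually_mono, elim conjE)
    fix z assume "covector (CARD('n) - 1) (CARD('n) - 1) \<sigma> (\<omega> (emb z))" "\<forall>s\<in>\<sigma>. \<forall>e. dirv s (dirv e f) z = 0"
    then show "hess f \<omega> z = 0" using hess_zero[OF sf _ s] s(1) by blast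
  qed
qed

text \<open>
  Two integrations by parts move the derivatives from \<open>\<omega>\<close> to \<open>f\<close>, without
  boundary terms: the forms \<open>d''f \<and> \<omega>\<close> and \<open>d'\<omega>\<close> have degree
  \<open>n\<close> in one of the two sets of variables, so their coefficients are test functions on
  $N_{\mathbb R}$.
\<close>

lemma ddc_eq_hess:
  assumes f: "smooth f"
    and w: "\<omega> \<in> lagerberg_forms \<Sigma> (trop_var \<Sigma>) (CARD('n) - 1) (CARD('n) - 1)"
    and K: "compactin (trop_topology \<Sigma>) K" "supported_in \<omega> K"
    and inv: "\<And>\<sigma> x. \<sigma> \<in> \<Sigma> \<Longrightarrow> (\<sigma>, coset \<sigma> x) \<in> K \<Longrightarrow> eventually (\<lambda>z. \<forall>s\<in>\<sigma>. f (z + s) = f z) (near \<sigma> x)"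
    and away: "\<And>x::real^'n. emb x \<notin> U \<Longrightarrow> eventually (\<lambda>y. \<omega> (emb y) = (\<lambda>vs ws. 0)) (nhds x)"
  shows "ddc U f \<omega> = sgn_top TYPE('n) * (LINT x|lebesgue. hess f \<omega> x)"
proof -
  note sm = form_emb(2)[OF w]
  define c where "c k l = (\<lambda>x. cf (\<omega> (emb x)) k l)" for k l
  have sc: "smooth (c k l)" for k l unfolding c_def by (rule smooth_cf[OF sm])
  have et: "test_fun (eta \<omega> l)" for l by (rule eta_test_fun[OF w K])
  define \<zeta> where "\<zeta> k x = (\<Sum>l<CARD('n). (-1) ^ l * (dirv (bvec l) f x * c k l x))" for k x
  have zt: "test_fun (\<zeta> k)" for k
  proof (rule test_fun_of_trace[OF _ K(1)])
    show "smooth (\<zeta> k)" unfolding \<zeta>_def by (intro smooth_sum smooth_mult smooth_const smooth_dirv f sc)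
    fix x assume "eventually (\<lambda>y. emb y \<notin> K) (nhds x)"
    then have "emb x \<notin> K" by (rule eventually_nhds_x_imp_x)
    then show "\<zeta> k x = 0" by (simp add: \<zeta>_def c_def cf_def supported_zero[OF K(2)])
  next
    fix \<sigma> x assume \<sigma>: "\<sigma> \<in> \<Sigma>" "\<sigma> \<noteq> {0}" and xK: "(\<sigma>, coset \<sigma> x) \<in> K"
    obtain s where s: "s \<in> \<sigma>" "s \<noteq> 0" using nonzero_cone_vector[OF \<sigma>] by blast
    show "eventually (\<lambda>z. \<zeta> k z = 0) (near \<sigma> x)"
      using eventually_conj[OF form_near[OF w \<sigma>(1)] near_nhds[OF cone[OF \<sigma>(1)] inv[OF \<sigma>(1) xK]]]
    proof (rule eventually_mono, elim conjE)
      fix z assume cov: "covector (CARD('n) - 1) (CARD('n) - 1) \<sigma> (\<omega> (emb z))"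
        and z: "eventually (\<lambda>z. \<forall>s\<in>\<sigma>. f (z + s) = f z) (nhds z)"
      let ?G = "\<lambda>v vs. dirv v f z * \<omega> (emb z) (omit k basis_list) vs"
      have "wedge1 ?G basis_list = 0"
      proof (rule wedge1_top_zero[OF _ _ s(2)])
        show "linear (\<lambda>v. ?G v vs)" for vs
          using linear_dirv[OF f] by (simp add: linear_iff algebra_simps)
        show "alternating (CARD('n) - 1) (?G v)" for v
          by (rule alternating_cmult[OF covector_alternating(2)[OF cov]])
        show "?G s vs = 0" for vs using dirv_invariant[OF f cone[OF \<sigma>(1)] s(1) z] by simp
        show "?G v vs = 0" if "s \<in> set vs" for v vs
          using that s(1) span_base[of s \<sigma>] cov unfolding covector_def by (metis IntI UnI2 emptyE mult_zero_right)
      qed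
      then show "\<zeta> k z = 0" by (simp add: wedge1_def \<zeta>_def c_def cf_def basis_list(3))
    qed
  qed
  have dz: "dirv (bvec k) (\<zeta> k) x = (\<Sum>l<CARD('n). (-1) ^ l * (dirv (bvec l) f x * dirv (bvec k) (c k l) x
      + dirv (bvec k) (dirv (bvec l) f) x * c k l x))" for k x
    unfolding \<zeta>_def
    by (subst dirv_sum) (auto intro!: smooth_mult smooth_const smooth_dirv f sc sum.cong
        simp: dirv_cmult[OF smooth_mult[OF smooth_dirv[OF f] sc]] dirv_mult[OF smooth_dirv[OF f] sc])
  \<comment> \<open>The product rule for the exterior derivative \<open>d'\<close> of \<open>d''f \<and> \<omega>\<close>, in coefficients.\<close>
  have hess: "hess f \<omega> x = (\<Sum>k<CARD('n). (-1) ^ k * dirv (bvec k) (\<zeta> k) x)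
      - (\<Sum>l<CARD('n). (-1) ^ l * (dirv (bvec l) f x * eta \<omega> l x))" for x
  proof -
    have "(\<Sum>l<CARD('n). (-1) ^ l * (dirv (bvec l) f x * eta \<omega> l x)) =
      (\<Sum>l<CARD('n). \<Sum>k<CARD('n). (-1) ^ (k + l) * (dirv (bvec l) f x * dirv (bvec k) (c k l) x))"
      by (simp add: eta_def c_def sum_distrib_left power_add mult_ac)
    also have "\<dots> = (\<Sum>k<CARD('n). \<Sum>l<CARD('n). (-1) ^ (k + l) * (dirv (bvec l) f x * dirv (bvec k) (c k l) x))"
      by (rule sum.swap)
    finally show ?thesis
      by (simp add: dz hess_def c_def sum_distrib_left power_add algebra_simps sum.distrib)
  qed
  have i1: "integrable lebesgue (\<lambda>x. (-1) ^ k * dirv (bvec k) (\<zeta> k) x)" for k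
    by (intro integrable_mult_right test_fun_integrable test_fun_dirv zt)
  have i2: "integrable lebesgue (\<lambda>x. (-1) ^ l * (dirv (bvec l) f x * eta \<omega> l x))" for l
    by (intro integrable_mult_right integral_by_parts(3)[OF f et])
  have i3: "integrable lebesgue (\<lambda>x. (-1) ^ l * (f x * dirv (bvec l) (eta \<omega> l) x))" for l
    by (intro integrable_mult_right integral_by_parts(2)[OF f et])
  have "(LINT x|lebesgue. hess f \<omega> x) = (\<Sum>k<CARD('n). (-1) ^ k * (LINT x|lebesgue. dirv (bvec k) (\<zeta> k) x))
      - (\<Sum>l<CARD('n). (-1) ^ l * (LINT x|lebesgue. dirv (bvec l) f x * eta \<omega> l x))"
    unfolding hess using i1 i2 by (subst Bochner_Integration.integral_diff) (auto simp: integral_sum)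
  also have "\<dots> = (\<Sum>l<CARD('n). (-1) ^ l * (LINT x|lebesgue. f x * dirv (bvec l) (eta \<omega> l) x))"
    by (simp add: integral_dirv_test_fun[OF zt] integral_by_parts(1)[OF f et] sum_negf)
  also have "\<dots> = (LINT x|lebesgue. f x * (\<Sum>l<CARD('n). (-1) ^ l * dirv (bvec l) (eta \<omega> l) x))"
  proof -
    have "(LINT x|lebesgue. f x * (\<Sum>l<CARD('n). (-1) ^ l * dirv (bvec l) (eta \<omega> l) x))
      = (LINT x|lebesgue. (\<Sum>l<CARD('n). (-1) ^ l * (f x * dirv (bvec l) (eta \<omega> l) x)))"
      by (simp add: sum_distrib_left mult_ac)
    also have "\<dots> = (\<Sum>l<CARD('n). (LINT x|lebesgue. (-1) ^ l * (f x * dirv (bvec l) (eta \<omega> l) x)))"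
      by (rule Bochner_Integration.integral_sum) (rule i3)
    finally show ?thesis by simp
  qed
  finally show ?thesis by (simp add: ddc_formula[OF away])
qed

end

section \<open>Positivity of the Hessian pairing\<close>

text \<open>
  The sign in the definition of positive forms of bidegree $(n-1,n-1)$ cancels \<open>sgn_top\<close>: the
  two binomial exponents \<open>n (n - 1) / 2\<close> and \<open>(n - 1) (n - 2) / 2\<close> add up to
  \<open>(n - 1)\<^sup>2\<close>.
\<close>

lemma sgn_top_pos:
  "sgn_top TYPE('n::finite) * (-1) ^ ((CARD('n) - 1) * (CARD('n) - 1 - 1) div 2) = 1"
proof -
  obtain q where q: "CARD('n) = Suc q" using gr0_implies_Suc[of "CARD('n)"] by auto
  have "Suc q * q div 2 + q * (q - 1) div 2 = (Suc q * q + q * (q - 1)) div 2"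
    by (rule div_plus_div_distrib_dvd_left[symmetric]) simp
  also have "Suc q * q + q * (q - 1) = 2 * (q * q)" by (cases q) (auto simp: algebra_simps)
  finally have e: "Suc q * q div 2 + q * (q - 1) div 2 = q * q" by simp
  have "sgn_top TYPE('n) * (-1) ^ ((CARD('n) - 1) * (CARD('n) - 1 - 1) div 2)
      = - ((-1) ^ (Suc q * q div 2 + q * (q - 1) div 2) * (-1) ^ Suc q)"
    by (simp add: sgn_top_def q power_add)
  also have "\<dots> = (-1) ^ (q * q + q)" unfolding e by (simp add: power_add)
  also have "\<dots> = 1" by simp
  finally show ?thesis .
qed

text \<open>
  A negative second derivative would make the slope along the line strictly decreasing at \<open>x\<close>,
  whereas the tangent inequalities at two points make it increasing.
\<close>

lemma convex_second_derivative:
  assumes w: "smooth w" and c: "convex_on UNIV w"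
  shows "0 \<le> dirv v (dirv v w) x"
proof (rule ccontr)
  assume neg: "\<not> 0 \<le> dirv v (dirv v w) x"
  let ?p = "\<lambda>t. w (x + t *\<^sub>R v)"
  let ?q = "\<lambda>t. dirv v w (x + t *\<^sub>R v)"
  have dp: "(?p has_real_derivative ?q t) (at t)" for t by (rule line_derivative[OF w])
  have dq: "(?q has_real_derivative dirv v (dirv v w) (x + 0 *\<^sub>R v)) (at 0)"
    by (rule line_derivative[OF smooth_dirv[OF w]])
  have cp: "convex_on UNIV ?p"
  proof (rule convex_onI)
    fix t a b :: real assume t: "0 < t" "t < 1"
    have "w (x + ((1 - t) *\<^sub>R a + t *\<^sub>R b) *\<^sub>R v) = w ((1 - t) *\<^sub>R (x + a *\<^sub>R v) + t *\<^sub>R (x + b *\<^sub>R v))"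
      by (simp add: algebra_simps)
    also have "\<dots> \<le> (1 - t) * w (x + a *\<^sub>R v) + t * w (x + b *\<^sub>R v)"
      using convex_onD[OF c, of t] t by simp
    finally show "w (x + ((1 - t) *\<^sub>R a + t *\<^sub>R b) *\<^sub>R v) \<le> (1 - t) * w (x + a *\<^sub>R v) + t * w (x + b *\<^sub>R v)" .
  qed simp
  have tan: "?p b - ?p a \<ge> ?q a * (b - a)" for a b
    by (rule convex_on_imp_above_tangent[OF cp]) (use dp in auto)
  obtain d where d: "d > 0" "\<And>h. 0 < h \<Longrightarrow> h < d \<Longrightarrow> ?q 0 > ?q (0 + h)"
    using DERIV_neg_dec_right[OF dq] neg by auto
  have "?q 0 > ?q (d/2)" using d(2)[of "d/2"] d(1) by simp
  moreover have "?q 0 * (d/2) \<le> ?q (d/2) * (d/2)" using tan[of 0 "d/2"] tan[of "d/2" 0] by (simp add: algebra_simps)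
  ultimately show False using d(1) by (simp add: mult_le_cancel_right)
qed

lemma dirv_sum_vec:
  assumes "smooth f" "finite I"
  shows "dirv (\<Sum>i\<in>I. a i *\<^sub>R v i) f x = (\<Sum>i\<in>I. a i * dirv (v i) f x)"
  using assms by (simp add: linear_sum[OF linear_dirv] linear_cmul[OF linear_dirv])

text \<open>
  The coefficients of $\alpha \wedge J\alpha$ are the products \<open>a k * a l\<close>. The form
  \<open>\<alpha>\<close> of degree \<open>n - 1\<close> is the contraction of the volume form with the
  vector of components \<open>(-1) ^ k * a k\<close>, and pairing with the Hessian gives the second
  derivative along that vector.
\<close>

lemma hess_quadratic:
  assumes w: "smooth w"
  shows "(\<Sum>k<m. \<Sum>l<m. (-1) ^ (k + l) * dirv (bvec k) (dirv (bvec l) w) x * (a k * a l))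
    = dirv (\<Sum>k<m. ((-1) ^ k * a k) *\<^sub>R bvec k) (dirv (\<Sum>k<m. ((-1) ^ k * a k) *\<^sub>R bvec k) w) x"
proof -
  let ?c = "\<Sum>k<m. ((-1) ^ k * a k) *\<^sub>R bvec k"
  have e: "dirv ?c w = (\<lambda>x. \<Sum>l<m. ((-1) ^ l * a l) * dirv (bvec l) w x)"
    by (rule ext, rule dirv_sum_vec[OF w]) simp
  have "dirv (bvec k) (dirv ?c w) x = (\<Sum>l<m. ((-1) ^ l * a l) * dirv (bvec k) (dirv (bvec l) w) x)" for k
    unfolding e by (subst dirv_sum) (auto intro!: smooth_cmult smooth_dirv w sum.cong dirv_cmult)
  moreover have "dirv ?c (dirv ?c w) x = (\<Sum>k<m. ((-1) ^ k * a k) * dirv (bvec k) (dirv ?c w) x)"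
    by (rule dirv_sum_vec[OF smooth_dirv[OF w]]) simp
  ultimately have "dirv ?c (dirv ?c w) x = (\<Sum>k<m. ((-1) ^ k * a k) * (\<Sum>l<m. ((-1) ^ l * a l) * dirv (bvec k) (dirv (bvec l) w) x))"
    by simp
  then show ?thesis by (simp add: sum_distrib_left power_add mult_ac)
qed

lemma hess_lincomb: "hess f (\<lambda>P vs ws. a * \<omega> P vs ws + b * \<eta> P vs ws) x = a * hess f \<omega> x + b * hess f \<eta> x"
  unfolding hess_def cf_def sum_distrib_left sum.distrib[symmetric]
  by (intro sum.cong refl) (simp add: algebra_simps)

lemma hess_add:
  assumes "smooth f" "smooth g"
  shows "hess (\<lambda>x. f x + g x) \<omega> x = hess f \<omega> x + hess g \<omega> x"
proof -
  have "dirv v (\<lambda>x. f x + g x) = (\<lambda>x. dirv v f x + dirv v g x)" for v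
    by (simp add: fun_eq_iff dirv_add[OF assms])
  then show ?thesis
    unfolding hess_def sum.distrib[symmetric]
    by (intro sum.cong refl) (simp add: dirv_add[OF smooth_dirv[OF assms(1)] smooth_dirv[OF assms(2)]] algebra_simps)
qed

text \<open>
  Exchanging the arguments of \<open>\<omega>\<close> exchanges the two derivatives, which commute.
\<close>

lemma hess_form_J:
  fixes \<omega> :: "'n::finite form" and w :: "real^'n \<Rightarrow> real"
  assumes w: "smooth w"
  shows "hess w (form_J \<omega>) x = (-1) ^ (CARD('n) - 1) * hess w \<omega> x"
proof -
  have c: "cf (form_J \<omega> (emb x)) k l = (-1) ^ (CARD('n) - 1) * cf (\<omega> (emb x)) l k" if "k < CARD('n)" "l < CARD('n)" for k l
    using that by (cases "even (CARD('n) - 1)") (simp_all add: cf_def form_J_def length_omit basis_list(3))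
  have "hess w (form_J \<omega>) x = (\<Sum>k<CARD('n). \<Sum>l<CARD('n). (-1) ^ (CARD('n) - 1) *
     ((-1) ^ (l + k) * dirv (bvec l) (dirv (bvec k) w) x * cf (\<omega> (emb x)) l k))"
    unfolding hess_def
  proof (intro sum.cong refl)
    fix k l assume "k \<in> {..<CARD('n)}" "l \<in> {..<CARD('n)}"
    then show "(-1) ^ (k + l) * dirv (bvec k) (dirv (bvec l) w) x * cf (form_J \<omega> (emb x)) k l =
      (-1) ^ (CARD('n) - 1) * ((-1) ^ (l + k) * dirv (bvec l) (dirv (bvec k) w) x * cf (\<omega> (emb x)) l k)"
      by (subst dirv_commute[OF w]) (simp add: c add.commute)
  qed
  also have "\<dots> = (\<Sum>l<CARD('n). \<Sum>k<CARD('n). (-1) ^ (CARD('n) - 1) *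
     ((-1) ^ (l + k) * dirv (bvec l) (dirv (bvec k) w) x * cf (\<omega> (emb x)) l k))" by (rule sum.swap)
  finally show ?thesis by (simp add: hess_def sum_distrib_left)
qed

context tropical_variety
begin

abbreviation "TF \<equiv> test_forms \<Sigma> (trop_var \<Sigma>) (CARD('n) - 1) (CARD('n) - 1)"

lemma TF_D:
  assumes "\<omega> \<in> TF"
  shows "\<omega> \<in> lagerberg_forms \<Sigma> (trop_var \<Sigma>) (CARD('n) - 1) (CARD('n) - 1)"
    and "\<exists>K. compactin (trop_topology \<Sigma>) K \<and> supported_in \<omega> K"
  using assms by (auto simp: test_forms_def)

lemma TF_I:
  assumes "\<omega> \<in> lagerberg_forms \<Sigma> (trop_var \<Sigma>) (CARD('n) - 1) (CARD('n) - 1)"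
    and "compactin (trop_topology \<Sigma>) K" "supported_in \<omega> K"
  shows "\<omega> \<in> TF"
  using assms topspace_trop by (auto simp: test_forms_def compactin_def)

lemma TF_lincomb:
  assumes "\<omega> \<in> TF" "\<eta> \<in> TF" shows "(\<lambda>P vs ws. a * \<omega> P vs ws + b * \<eta> P vs ws) \<in> TF"
proof -
  obtain K L where K: "compactin (trop_topology \<Sigma>) K" "supported_in \<omega> K"
    and L: "compactin (trop_topology \<Sigma>) L" "supported_in \<eta> L"
    using TF_D(2) assms by blast
  have "supported_in (\<lambda>P vs ws. a * \<omega> P vs ws + b * \<eta> P vs ws) (K \<union> L)"
    unfolding supported_in_def
  proof (intro allI impI)
    fix P assume "P \<notin> K \<union> L"
    then have "\<omega> P = (\<lambda>vs ws. 0)" "\<eta> P = (\<lambda>vs ws. 0)" using K(2) L(2) unfolding supported_in_def by blast+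
    then show "(\<lambda>vs ws. a * \<omega> P vs ws + b * \<eta> P vs ws) = (\<lambda>vs ws. 0)" by simp
  qed
  with form_lincomb[OF TF_D(1)[OF assms(1)] TF_D(1)[OF assms(2)]] compactin_Un[OF K(1) L(1)]
  show ?thesis by (rule TF_I)
qed

lemma supported_mult: "supported_in \<omega> K \<Longrightarrow> supported_in (\<lambda>P vs ws. b P * \<omega> P vs ws) K"
  unfolding supported_in_def by simp

lemma TF_mult:
  assumes "smooth_function \<Sigma> (trop_var \<Sigma>) b" "\<omega> \<in> TF" shows "(\<lambda>P vs ws. b P * \<omega> P vs ws) \<in> TF"
  using TF_D[OF assms(2)] form_mult[OF assms(1)] supported_mult TF_I by blast

lemma form_J_TF:
  assumes "\<omega> \<in> TF" shows "form_J \<omega> \<in> TF"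
proof -
  obtain K where K: "compactin (trop_topology \<Sigma>) K" "supported_in \<omega> K" using TF_D(2)[OF assms] by blast
  note f = TF_D(1)[OF assms, unfolded lagerberg_forms_iff[OF open_trop_var]]
  have zero: "form_J \<omega> P = (\<lambda>vs ws. 0)" if "\<omega> P = (\<lambda>vs ws. 0)" for P
    using that by (simp add: form_J_def)
  have lin: "linear (\<lambda>v. c * h v :: real)" if "linear h" for c and h :: "real^'n \<Rightarrow> real"
    using that by (simp add: linear_iff algebra_simps)
  have cov: "covector q q \<sigma> (form_J \<omega> P)" if c: "covector q q \<sigma> (\<omega> P)" for P \<sigma> q
    unfolding covector_def
  proof (intro conjI allI impI)
    have c': "\<And>vs ws. length vs \<noteq> q \<or> length ws \<noteq> q \<Longrightarrow> \<omega> P vs ws = 0"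
      "\<And>vs ws. \<not> distinct vs \<or> \<not> distinct ws \<Longrightarrow> \<omega> P vs ws = 0"
      "\<And>vs ws. (set vs \<union> set ws) \<inter> span \<sigma> \<noteq> {} \<Longrightarrow> \<omega> P vs ws = 0"
      "\<And>vs ws k. k < length vs \<Longrightarrow> linear (\<lambda>v. \<omega> P (vs[k := v]) ws)"
      "\<And>vs ws k. k < length ws \<Longrightarrow> linear (\<lambda>w. \<omega> P vs (ws[k := w]))"
      using c unfolding covector_def by blast+
    fix vs ws :: "(real^'n) list" and k
    show "form_J \<omega> P vs ws = 0" if "length vs \<noteq> q \<or> length ws \<noteq> q"
      using c'(1)[of ws vs] that by (auto simp: form_J_def)
    show "form_J \<omega> P vs ws = 0" if "\<not> distinct vs \<or> \<not> distinct ws"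
      using c'(2)[of ws vs] that by (auto simp: form_J_def)
    show "form_J \<omega> P vs ws = 0" if "(set vs \<union> set ws) \<inter> span \<sigma> \<noteq> {}"
      using c'(3)[of ws vs] that by (simp add: form_J_def Un_commute)
    show "linear (\<lambda>v. form_J \<omega> P (vs[k := v]) ws)" if "k < length vs"
      unfolding form_J_def length_list_update by (rule lin[OF c'(5)[OF that]])
    show "linear (\<lambda>v. form_J \<omega> P vs (ws[k := v]))" if "k < length ws"
      unfolding form_J_def length_list_update by (rule lin[OF c'(4)[OF that]])
  qed
  have "form_J \<omega> \<in> lagerberg_forms \<Sigma> (trop_var \<Sigma>) (CARD('n) - 1) (CARD('n) - 1)"
    unfolding lagerberg_forms_iff[OF open_trop_var]
  proof (intro conjI ballI allI impI)
    fix P assume "P \<notin> trop_var \<Sigma>"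
    then show "form_J \<omega> P = (\<lambda>vs ws. 0)" using f zero by blast
  next
    fix \<sigma> x assume "\<sigma> \<in> \<Sigma>" "(\<sigma>, coset \<sigma> x) \<in> trop_var \<Sigma>"
    then show "covector (CARD('n) - 1) (CARD('n) - 1) \<sigma> (form_J \<omega> (\<sigma>, coset \<sigma> x))" using f cov by blast
  next
    fix \<sigma> and vs ws :: "(real^'n) list" assume s: "\<sigma> \<in> \<Sigma>"
    have "smooth_on {x. (\<sigma>, coset \<sigma> x) \<in> trop_var \<Sigma>} (\<lambda>x. \<omega> (\<sigma>, coset \<sigma> x) ws vs)" using f s by blast
    then show "smooth_on {x. (\<sigma>, coset \<sigma> x) \<in> trop_var \<Sigma>} (\<lambda>x. form_J \<omega> (\<sigma>, coset \<sigma> x) vs ws)"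
      using coset_trop_var[OF s] by (simp add: form_J_def smooth_cmult)
  next
    fix \<sigma> x assume s: "\<sigma> \<in> \<Sigma>"
    have "\<forall>\<^sub>F z in near \<sigma> x. \<forall>\<tau>\<in>\<Sigma>. \<tau> face_of \<sigma> \<longrightarrow> \<omega> (\<tau>, coset \<tau> z) = \<omega> (\<sigma>, coset \<sigma> z)"
      using f s coset_trop_var[OF s] by blast
    then show "\<forall>\<^sub>F z in near \<sigma> x. \<forall>\<tau>\<in>\<Sigma>. \<tau> face_of \<sigma> \<longrightarrow> form_J \<omega> (\<tau>, coset \<tau> z) = form_J \<omega> (\<sigma>, coset \<sigma> z)"
      by (rule eventually_mono) (simp add: form_J_def)
  qed
  moreover have "supported_in (form_J \<omega>) K" using K(2) zero unfolding supported_in_def by blast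
  ultimately show ?thesis using K(1) by (intro TF_I)
qed

lemma tame_hess_tame: "tame f \<Longrightarrow> smooth f \<Longrightarrow> hess_tame f"
  unfolding hess_tame_def tame_def by (auto intro!: exI[of _ 0])

lemma hess_integral_lincomb:
  assumes "hess_tame f" "\<omega> \<in> TF" "\<eta> \<in> TF"
  shows "(LINT x|lebesgue. hess f (\<lambda>P vs ws. a * \<omega> P vs ws + b * \<eta> P vs ws) x)
    = a * (LINT x|lebesgue. hess f \<omega> x) + b * (LINT x|lebesgue. hess f \<eta> x)"
proof -
  have i: "integrable lebesgue (hess f \<omega>)" if w: "\<omega> \<in> TF" for \<omega>
    using TF_D(2)[OF w] hess_test_fun[OF assms(1) TF_D(1)[OF w]] test_fun_integrable by blast
  show ?thesis unfolding hess_lincomb using i[OF assms(2)] i[OF assms(3)] by simp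
qed

lemma ddc_tame:
  assumes "tame f" "smooth f" "\<omega> \<in> TF"
  shows "ddc (trop_var \<Sigma>) f \<omega> = sgn_top TYPE('n) * (LINT x|lebesgue. hess f \<omega> x)"
proof -
  obtain K where K: "compactin (trop_topology \<Sigma>) K" "supported_in \<omega> K" using TF_D(2)[OF assms(3)] by blast
  show ?thesis
    by (rule ddc_eq_hess[OF assms(2) TF_D(1)[OF assms(3)] K])
       (use assms(1) emb_trop_var in \<open>auto simp: tame_def\<close>)
qed

text \<open>
  In a null sequence the forms are constant towards the boundary on common neighbourhoods, so the integrands
  vanish outside one ball. There the second derivatives of \<open>f\<close> are bounded and the coefficients
  of the forms tend to 0 uniformly.
\<close>

lemma hess_null_sequence:
  assumes f: "hess_tame f" and ns: "null_sequence \<Sigma> (trop_var \<Sigma>) (CARD('n) - 1) (CARD('n) - 1) \<omega>"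
  shows "(\<lambda>j. LINT x|lebesgue. hess f (\<omega> j) x) \<longlonglongrightarrow> 0"
proof -
  have sf: "smooth f" using f by (simp add: hess_tame_def)
  have lf: "\<omega> j \<in> lagerberg_forms \<Sigma> (trop_var \<Sigma>) (CARD('n) - 1) (CARD('n) - 1)" for j
    using ns unfolding null_sequence_def by blast
  obtain K where K: "compactin (trop_topology \<Sigma>) K" "\<And>j. supported_in (\<omega> j) K"
    using ns unfolding null_sequence_def by blast
  let ?Z = "{z. emb z \<in> K \<and> (\<exists>j. hess f (\<omega> j) z \<noteq> 0)}"
  have "bounded ?Z"
  proof (rule bounded_trace[OF K(1)])
    fix \<sigma> x assume \<sigma>: "\<sigma> \<in> \<Sigma>" "\<sigma> \<noteq> {0}"
    obtain s where s: "s \<in> \<sigma>" "s \<noteq> 0" using nonzero_cone_vector[OF \<sigma>] by blast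
    obtain W where W: "openin (trop_topology \<Sigma>) W" "(\<sigma>, coset \<sigma> x) \<in> W" "\<And>k. const_towards \<Sigma> \<sigma> W (\<omega> k)"
      using ns coset_trop_var[OF \<sigma>(1), of x] unfolding null_sequence_def by blast
    show "eventually (\<lambda>z. z \<notin> ?Z) (near \<sigma> x)"
      using eventually_conj[OF open_near_emb[OF W(1,2) \<sigma>(1)] hess_tame_near[OF f \<sigma>(1), of x]]
    proof (rule eventually_mono, elim conjE)
      fix z assume z: "emb z \<in> W" and h: "\<forall>s\<in>\<sigma>. \<forall>e. dirv s (dirv e f) z = 0"
      have "hess f (\<omega> j) z = 0" for j
      proof -
        have "\<omega> j ({0}, coset {0} z) = \<omega> j (\<sigma>, quot_map \<sigma> (coset {0} z))"
          using W(3)[of j] z zero_cone zero_face[OF \<sigma>(1)] unfolding const_towards_def emb_def by blast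
        also have "quot_map \<sigma> (coset {0} z) = coset \<sigma> z" using cone_zero[OF \<sigma>(1)] by (intro quot_map_coset) simp
        finally have e: "\<omega> j (emb z) = \<omega> j (\<sigma>, coset \<sigma> z)" by (simp add: emb_def)
        have "covector (CARD('n) - 1) (CARD('n) - 1) \<sigma> (\<omega> j (\<sigma>, coset \<sigma> z))"
          using lf[of j] \<sigma>(1) coset_trop_var[OF \<sigma>(1)] unfolding lagerberg_forms_iff[OF open_trop_var] by blast
        then show ?thesis using hess_zero[OF sf _ s] h s(1) e by metis
      qed
      then show "z \<notin> ?Z" by simp
    qed
  qed simp
  then obtain R where R: "\<And>z. z \<in> ?Z \<Longrightarrow> norm z \<le> R" unfolding bounded_iff by blast
  have hz: "hess f (\<omega> j) z = 0" if "norm z > R" for j z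
  proof (cases "emb z \<in> K")
    case True
    then show ?thesis using R[of z] that by fastforce
  next
    case False
    then show ?thesis by (simp add: hess_def cf_def supported_zero[OF K(2)])
  qed
  define H where "H x = (\<Sum>k<CARD('n). \<Sum>l<CARD('n). \<bar>dirv (bvec k) (dirv (bvec l) f) x\<bar>)" for x
  have Hc: "continuous_on UNIV H" unfolding H_def[abs_def]
    by (intro continuous_intros smooth_continuous smooth_dirv sf)
  have "bounded (H ` cball 0 R)"
    by (intro compact_imp_bounded compact_continuous_image continuous_on_subset[OF Hc]) auto
  then obtain B where B: "B > 0" "\<And>x. x \<in> cball 0 R \<Longrightarrow> \<bar>H x\<bar> \<le> B" unfolding bounded_pos by auto
  define V where "V = (LINT x|lebesgue. indicator (cball (0::real^'n) R) x * \<bar>1::real\<bar>)"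
  have V0: "V \<ge> 0" unfolding V_def by (intro Bochner_Integration.integral_nonneg) auto
  show ?thesis
  proof (rule LIMSEQ_I)
    fix e :: real assume e: "e > 0"
    \<comment> \<open>Coefficients below \<open>d\<close> give an integral of at most \<open>B * d * V < e\<close>.\<close>
    define d where "d = e / (2 * (B * (V + 1)))"
    have d: "d > 0" using e B(1) V0 by (simp add: d_def)
    have "eventually (\<lambda>j. \<forall>x. \<bar>cf (\<omega> j (emb x)) k l\<bar> < d) sequentially" for k l
    proof -
      have "uniform_limit UNIV (\<lambda>j. iter_deriv [] (\<lambda>x. \<omega> j (emb x) (omit k basis_list) (omit l basis_list))) (\<lambda>x::real^'n. 0) sequentially"
        using ns unfolding null_sequence_def by blast
      from uniform_limitD[OF this d] show ?thesis by (simp add: cf_def)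
    qed
    then have "eventually (\<lambda>j. \<forall>k\<in>{..<CARD('n)}. \<forall>l\<in>{..<CARD('n)}. \<forall>x. \<bar>cf (\<omega> j (emb x)) k l\<bar> < d) sequentially"
      by (intro eventually_ball_finite ballI finite_lessThan) auto
    then obtain N where N: "\<And>j k l x. j \<ge> N \<Longrightarrow> k < CARD('n) \<Longrightarrow> l < CARD('n) \<Longrightarrow> \<bar>cf (\<omega> j (emb x)) k l\<bar> < d"
      unfolding eventually_sequentially by blast
    have "norm ((LINT x|lebesgue. hess f (\<omega> j) x) - 0) < e" if j: "j \<ge> N" for j
    proof -
      have "\<bar>LINT x|lebesgue. 1 * hess f (\<omega> j) x\<bar> \<le> (B * d) * V"
        unfolding V_def
      proof (rule integrable_mult_bounded_support(2))
        show "locally_integrable (\<lambda>x::real^'n. 1::real)" by (rule continuous_locally_integrable) simp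
        show "hess f (\<omega> j) \<in> borel_measurable lebesgue"
          by (intro continuous_lebesgue_measurable smooth_continuous smooth_hess sf form_emb(2)[OF lf])
        show "hess f (\<omega> j) x = 0" if "R < norm x" for x by (rule hz[OF that])
        show "\<bar>hess f (\<omega> j) x\<bar> \<le> B * d" for x
        proof (cases "norm x > R")
          case False
          have "\<bar>hess f (\<omega> j) x\<bar> \<le> (\<Sum>k<CARD('n). \<Sum>l<CARD('n). \<bar>(-1) ^ (k + l) * dirv (bvec k) (dirv (bvec l) f) x * cf (\<omega> j (emb x)) k l\<bar>)"
            unfolding hess_def by (rule order_trans[OF sum_abs]) (intro sum_mono sum_abs)
          also have "\<dots> \<le> (\<Sum>k<CARD('n). \<Sum>l<CARD('n). \<bar>dirv (bvec k) (dirv (bvec l) f) x\<bar> * d)"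
          proof (intro sum_mono)
            fix k l assume "k \<in> {..<CARD('n)}" "l \<in> {..<CARD('n)}"
            then have "\<bar>cf (\<omega> j (emb x)) k l\<bar> \<le> d" using N[OF j, of k l x] by simp
            then show "\<bar>(-1) ^ (k + l) * dirv (bvec k) (dirv (bvec l) f) x * cf (\<omega> j (emb x)) k l\<bar> \<le> \<bar>dirv (bvec k) (dirv (bvec l) f) x\<bar> * d"
              by (simp add: abs_mult mult_left_mono)
          qed
          also have "\<dots> = H x * d" by (simp add: H_def sum_distrib_right)
          also have "\<dots> \<le> B * d" using B(2)[of x] False d by (intro mult_right_mono) auto
          finally show ?thesis .
        qed (use hz B(1) d in auto)
      qed
      also have "B * d = e / (2 * (V + 1))" using B(1) by (simp add: d_def)
      also have "e / (2 * (V + 1)) * V = e / 2 * (V / (V + 1))" by simp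
      also have "\<dots> \<le> e / 2 * 1" using e V0 by (intro mult_left_mono) auto
      also have "\<dots> < e" using e by simp
      finally show ?thesis by simp
    qed
    then show "\<exists>N. \<forall>j\<ge>N. norm ((LINT x|lebesgue. hess f (\<omega> j) x) - 0) < e" by blast
  qed
qed

lemma positive_hess:
  assumes w: "smooth w" "convex_on UNIV w"
    and pos: "positive_form \<Sigma> (trop_var \<Sigma>) (CARD('n) - 1) \<omega>"
  shows "0 \<le> sgn_top TYPE('n) * hess w \<omega> x"
proof -
  let ?s = "(-1::real) ^ ((CARD('n) - 1) * (CARD('n) - 1 - 1) div 2)"
  show ?thesis
    using pos unfolding positive_form_def
  proof (elim conjE exE)
  fix m :: nat and f \<alpha>
  assume fa: "\<forall>j<m. smooth_function \<Sigma> (trop_var \<Sigma>) (f j) \<and> (\<forall>P\<in>trop_var \<Sigma>. 0 \<le> f j P) \<and>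
          \<alpha> j \<in> lagerberg_forms \<Sigma> (trop_var \<Sigma>) (CARD('n) - 1) 0"
    and \<omega>: "\<omega> = (\<lambda>P vs ws. \<Sum>j<m. ?s * f j P * wedge_pure (\<alpha> j) (form_J (\<alpha> j)) P vs ws)"
  have f: "\<And>j P. j < m \<Longrightarrow> P \<in> trop_var \<Sigma> \<Longrightarrow> 0 \<le> f j P" using fa by blast
  define a where "a j k = \<alpha> j (emb x) (omit k basis_list) []" for j k
  define c where "c j = (\<Sum>k<CARD('n). ((-1) ^ k * a j k) *\<^sub>R (bvec k :: real^'n))" for j
  have cf: "cf (\<omega> (emb x)) k l = (\<Sum>j<m. ?s * f j (emb x) * (a j k * a j l))" for k l
    by (simp add: cf_def \<omega> wedge_pure_def form_J_def a_def)
  have "hess w \<omega> x = (\<Sum>k<CARD('n). \<Sum>l<CARD('n). \<Sum>j<m. ?s * f j (emb x) *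
      ((-1) ^ (k + l) * dirv (bvec k) (dirv (bvec l) w) x * (a j k * a j l)))"
    by (simp add: hess_def cf sum_distrib_left mult_ac)
  also have "\<dots> = (\<Sum>k<CARD('n). \<Sum>j<m. \<Sum>l<CARD('n). ?s * f j (emb x) *
      ((-1) ^ (k + l) * dirv (bvec k) (dirv (bvec l) w) x * (a j k * a j l)))"
    by (intro sum.cong refl sum.swap)
  also have "\<dots> = (\<Sum>j<m. \<Sum>k<CARD('n). \<Sum>l<CARD('n). ?s * f j (emb x) *
      ((-1) ^ (k + l) * dirv (bvec k) (dirv (bvec l) w) x * (a j k * a j l)))" by (rule sum.swap)
  also have "\<dots> = (\<Sum>j<m. ?s * (f j (emb x) * dirv (c j) (dirv (c j) w) x))"
  proof (intro sum.cong refl)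
    fix j
    show "(\<Sum>k<CARD('n). \<Sum>l<CARD('n). ?s * f j (emb x) *
        ((-1) ^ (k + l) * dirv (bvec k) (dirv (bvec l) w) x * (a j k * a j l))) =
      ?s * (f j (emb x) * dirv (c j) (dirv (c j) w) x)"
      unfolding sum_distrib_left[symmetric] hess_quadratic[OF w(1)] c_def by (rule mult.assoc)
  qed
  finally have "sgn_top TYPE('n) * hess w \<omega> x = (sgn_top TYPE('n) * ?s) * (\<Sum>j<m. f j (emb x) * dirv (c j) (dirv (c j) w) x)"
    by (simp add: sum_distrib_left mult.assoc)
  also have "\<dots> = (\<Sum>j<m. f j (emb x) * dirv (c j) (dirv (c j) w) x)" by (simp only: sgn_top_pos mult_1_left)
  also have "\<dots> \<ge> 0"
    using f emb_trop_var convex_second_derivative[OF w] by (intro sum_nonneg mult_nonneg_nonneg) auto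
  finally show ?thesis .
  qed
qed

text \<open>
  For a continuous function the limit superior over any set clustering at the point is its value there; the
  complement of \<open>E\<close> clusters at the point because its neighbourhoods contain balls of
  $N_{\mathbb R}$.
\<close>

lemma strongly_usc_ext:
  assumes "tame f" "continuous_on UNIV f"
  shows "strongly_usc \<Sigma> (\<lambda>P. ereal (ext f P))"
  unfolding strongly_usc_def
proof (intro ballI allI impI)
  fix P and E :: "'n pt set" assume P: "P \<in> trop_var \<Sigma>" and E: "{x. emb x \<in> E} \<in> null_sets lebesgue"
  let ?F = "inf (nhdsin (trop_topology \<Sigma>) P) (principal (- E))"
  have "(ext f \<longlongrightarrow> ext f P) (nhdsin (trop_topology \<Sigma>) P)"
  proof (rule tendstoI)
    fix e :: real assume "e > 0"
    from ext_continuous[OF assms P this] show "eventually (\<lambda>Q. dist (ext f Q) (ext f P) < e) (nhdsin (trop_topology \<Sigma>) P)"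
      unfolding eventually_nhdsin dist_real_def by blast
  qed
  then have "(ext f \<longlongrightarrow> ext f P) ?F" by (rule tendsto_mono[OF inf_le1])
  then have lim: "((\<lambda>P. ereal (ext f P)) \<longlongrightarrow> ereal (ext f P)) ?F" by (rule tendsto_ereal)
  have "?F \<noteq> bot"
  proof
    assume "?F = bot"
    then have "eventually (\<lambda>_. False) ?F" by simp
    then have "eventually (\<lambda>Q. Q \<in> - E \<longrightarrow> False) (nhdsin (trop_topology \<Sigma>) P)"
      unfolding eventually_inf_principal .
    then obtain W where W: "openin (trop_topology \<Sigma>) W" "P \<in> W" "W \<subseteq> E"
      unfolding eventually_nhdsin using P topspace_trop by auto
    obtain \<sigma> x where \<sigma>: "\<sigma> \<in> \<Sigma>" "P = (\<sigma>, coset \<sigma> x)" using P by (rule trop_var_cases)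
    obtain s0 r where r: "r > 0" "\<And>y s. y \<in> ball (x + s0) r \<Longrightarrow> s \<in> \<sigma> \<Longrightarrow> emb (y + s) \<in> W"
      using open_near_emb[OF W(1) W(2)[unfolded \<sigma>(2)] \<sigma>(1)] unfolding eventually_near[OF cone[OF \<sigma>(1)]] by blast
    have "ball (x + s0) r \<subseteq> {x. emb x \<in> E}" using r(2)[OF _ cone_zero[OF \<sigma>(1)]] W(3) by auto
    then have "negligible (ball (x + s0) r)" using E negligible_iff_null_sets negligible_subset by blast
    then show False using r(1) open_not_negligible[of "ball (x + s0) r"] by simp
  qed
  from lim_imp_Limsup[OF this lim] show "ereal (ext f P) = Limsup ?F (\<lambda>P. ereal (ext f P))" by simp
qed

end

section \<open>The curvature current of a Green function\<close>

locale green_setting = tropical_variety \<Sigma> for \<Sigma> :: "(real^'n) set set" +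
  fixes \<Psi> g0 :: "real^'n \<Rightarrow> real" and \<theta> :: "'n functional"
  assumes pl: "piecewise_linear \<Sigma> \<Psi>" and green: "smooth_green \<Sigma> \<Psi> g0" and c1: "is_c1 \<Sigma> \<Psi> g0 \<theta>"
begin

lemma slope_ex: "\<sigma> \<in> \<Sigma> \<Longrightarrow> \<exists>m. slope_on \<Psi> \<sigma> m"
  using pl unfolding piecewise_linear_def by blast

lemma green_ex: "\<sigma> \<in> \<Sigma> \<Longrightarrow> slope_on \<Psi> \<sigma> m \<Longrightarrow> \<exists>\<Omega> h. green_extension \<Sigma> g0 \<sigma> m \<Omega> h"
  using green unfolding smooth_green_def by blast

lemma g0_smooth: "smooth g0"
proof -
  \<comment> \<open>For the zero cone the domain of the extension contains all of the open stratum.\<close>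
  obtain m where m: "slope_on \<Psi> {0} m" using slope_ex[OF zero_cone] by blast
  obtain \<Omega> h where h: "green_extension \<Sigma> g0 {0} m \<Omega> h" using green_ex[OF zero_cone m] by blast
  then have "smooth (\<lambda>x. h (emb x))"
    by (intro smooth_function_smooth_open_stratum[of \<Omega>]) (auto simp: green_extension_def emb_def)
  then have "smooth (\<lambda>x. h (emb x) - m \<bullet> x)" by (rule smooth_diff[OF _ smooth_inner])
  moreover have "(\<lambda>x. h (emb x) - m \<bullet> x) = g0" using h by (simp add: fun_eq_iff green_extension_def emb_def)
  ultimately show ?thesis by simp
qed

lemma green_extension_near:
  assumes h: "green_extension \<Sigma> g0 \<sigma> m \<Omega> h" and t: "\<tau> \<in> \<Sigma>" "(\<tau>, coset \<tau> x) \<in> \<Omega>"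
  shows "eventually (\<lambda>z. \<forall>s\<in>\<tau>. g0 (z + s) + m \<bullet> (z + s) = g0 z + m \<bullet> z) (near \<tau> x)"
proof -
  have o: "openin (trop_topology \<Sigma>) \<Omega>" "smooth_function \<Sigma> \<Omega> h" "\<And>x. emb x \<in> \<Omega> \<Longrightarrow> h (emb x) = g0 x + m \<bullet> x"
    using h by (auto simp: green_extension_def)
  have "eventually (\<lambda>z. \<forall>s\<in>\<tau>. emb (z + s) \<in> \<Omega>) (near \<tau> x)"
    by (rule near_eventually_translates[OF cone[OF t(1)] open_near_emb[OF o(1) t(2,1)]])
  from eventually_conj[OF this smooth_function_near[OF o(2,1) t(2,1)]] show ?thesis
  proof (rule eventually_mono, elim conjE, intro ballI)
    fix z s assume z: "\<forall>s\<in>\<tau>. emb (z + s) \<in> \<Omega>" "\<forall>s\<in>\<tau>. h (emb (z + s)) = h (emb z)" and s: "s \<in> \<tau>"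
    have "emb z \<in> \<Omega>" using z(1) cone_zero[OF t(1)] by force
    then show "g0 (z + s) + m \<bullet> (z + s) = g0 z + m \<bullet> z" using z s o(3) by metis
  qed
qed

lemma green_near:
  assumes "\<sigma> \<in> \<Sigma>" "slope_on \<Psi> \<sigma> m"
  shows "eventually (\<lambda>z. \<forall>s\<in>\<sigma>. g0 (z + s) + m \<bullet> (z + s) = g0 z + m \<bullet> z) (near \<sigma> x)"
proof -
  obtain \<Omega> h where h: "green_extension \<Sigma> g0 \<sigma> m \<Omega> h" using green_ex[OF assms] by blast
  then have "(\<sigma>, coset \<sigma> x) \<in> \<Omega>" by (auto simp: green_extension_def)
  from green_extension_near[OF h assms(1) this] show ?thesis .
qed

lemma g0_hess_tame: "hess_tame g0"
  unfolding hess_tame_def using g0_smooth green_near slope_ex by blast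

lemma theta_linear: "\<omega> \<in> TF \<Longrightarrow> \<eta> \<in> TF \<Longrightarrow> \<theta> (\<lambda>P vs ws. a * \<omega> P vs ws + b * \<eta> P vs ws) = a * \<theta> \<omega> + b * \<theta> \<eta>"
  using c1 unfolding is_c1_def current_def by blast

text \<open>
  Near \<open>P\<close> the current \<open>\<theta>\<close> is \<open>d'd''[g0 + m]\<close>, where \<open>g0
  + m\<close> is constant towards the boundary, so integration by parts applies to test forms supported
  there; the linear function \<open>m\<close> does not contribute to the Hessian.
\<close>

lemma theta_cut_off:
  assumes P: "P \<in> trop_var \<Sigma>"
  shows "\<exists>b V. smooth_function \<Sigma> (trop_var \<Sigma>) b \<and> openin (trop_topology \<Sigma>) V \<and> P \<in> V \<and> (\<forall>Q\<in>V. b Q = 1) \<and>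
    (\<forall>\<omega>\<in>TF. \<theta> (\<lambda>P vs ws. b P * \<omega> P vs ws) = sgn_top TYPE('n) * (LINT x|lebesgue. hess g0 (\<lambda>P vs ws. b P * \<omega> P vs ws) x))"
proof -
  obtain \<sigma> x where \<sigma>: "\<sigma> \<in> \<Sigma>" "P = (\<sigma>, coset \<sigma> x)" using P by (rule trop_var_cases)
  obtain m where m: "slope_on \<Psi> \<sigma> m" using slope_ex[OF \<sigma>(1)] by blast
  obtain \<Omega> h where h: "green_extension \<Sigma> g0 \<sigma> m \<Omega> h" using green_ex[OF \<sigma>(1) m] by blast
  have \<Omega>: "openin (trop_topology \<Sigma>) \<Omega>" "P \<in> \<Omega>" using h \<sigma>(2) by (auto simp: green_extension_def)
  obtain b C V where b: "smooth_function \<Sigma> (trop_var \<Sigma>) b"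
    and C: "closedin (trop_topology \<Sigma>) C" "C \<subseteq> \<Omega>" "\<And>Q. Q \<in> trop_var \<Sigma> \<Longrightarrow> Q \<notin> C \<Longrightarrow> b Q = 0"
    and V: "openin (trop_topology \<Sigma>) V" "P \<in> V" "\<And>Q. Q \<in> V \<Longrightarrow> b Q = 1"
    by (rule bump_exists[OF \<Omega>]) blast
  have main: "\<theta> (\<lambda>P vs ws. b P * \<omega> P vs ws) = sgn_top TYPE('n) * (LINT x|lebesgue. hess g0 (\<lambda>P vs ws. b P * \<omega> P vs ws) x)"
    if w: "\<omega> \<in> TF" for \<omega>
  proof -
    let ?w = "\<lambda>P vs ws. b P * \<omega> P vs ws"
    let ?f = "\<lambda>x. g0 x + m \<bullet> x"
    have wl: "?w \<in> lagerberg_forms \<Sigma> (trop_var \<Sigma>) (CARD('n) - 1) (CARD('n) - 1)"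
      by (rule form_mult[OF b TF_D(1)[OF w]])
    obtain K where K: "compactin (trop_topology \<Sigma>) K" "supported_in \<omega> K" using TF_D(2)[OF w] by blast
    have wC: "?w Q = (\<lambda>vs ws. 0)" if "Q \<notin> C" for Q
    proof (cases "Q \<in> trop_var \<Sigma>")
      case True
      then show ?thesis using C(3)[OF True that] by simp
    next
      case False
      then have "\<omega> Q = (\<lambda>vs ws. 0)" using TF_D(1)[OF w] unfolding lagerberg_forms_iff[OF open_trop_var] by blast
      then show ?thesis by simp
    qed
    have K': "compactin (trop_topology \<Sigma>) (C \<inter> K)" by (rule closed_Int_compactin[OF C(1) K(1)])
    have wK': "supported_in ?w (C \<inter> K)"
      unfolding supported_in_def
    proof (intro allI impI)
      fix Q assume "Q \<notin> C \<inter> K"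
      then show "?w Q = (\<lambda>vs ws. 0)" using wC[of Q] supported_zero[OF K(2), of Q] by (cases "Q \<in> C") (auto simp: fun_eq_iff)
    qed
    have "?w \<in> lagerberg_forms \<Sigma> \<Omega> (CARD('n) - 1) (CARD('n) - 1)"
      by (rule form_restrict[OF wl \<Omega>(1)]) (use wC C(2) in blast)
    then have "?w \<in> test_forms \<Sigma> \<Omega> (CARD('n) - 1) (CARD('n) - 1)"
      unfolding test_forms_def using K' wK' C(2) by blast
    then have "\<theta> ?w = ddc \<Omega> ?f ?w"
      using c1 \<sigma>(1) m h unfolding is_c1_def by blast
    also have "\<dots> = sgn_top TYPE('n) * (LINT x|lebesgue. hess ?f ?w x)"
    proof (rule ddc_eq_hess[OF smooth_add[OF g0_smooth smooth_inner] wl K' wK'])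
      fix \<tau> x assume "\<tau> \<in> \<Sigma>" "(\<tau>, coset \<tau> x) \<in> C \<inter> K"
      then show "eventually (\<lambda>z. \<forall>s\<in>\<tau>. ?f (z + s) = ?f z) (near \<tau> x)"
        using green_extension_near[OF h] C(2) by blast
    next
      fix x :: "real^'n" assume x: "emb x \<notin> \<Omega>"
      have o: "openin (trop_topology \<Sigma>) (trop_var \<Sigma> - C)" using C(1) by (simp add: closedin_def topspace_trop)
      have "({0}, coset {0} x) \<in> trop_var \<Sigma> - C" using x C(2) emb_trop_var[of x] by (auto simp: emb_def)
      from open_near_emb[OF o this zero_cone]
      have "eventually (\<lambda>z. emb z \<in> trop_var \<Sigma> - C) (nhds x)" by (simp only: eventually_near_zero)
      then show "eventually (\<lambda>y. ?w (emb y) = (\<lambda>vs ws. 0)) (nhds x)"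
        by (rule eventually_mono) (use wC in blast)
    qed
    also have "hess ?f ?w = hess g0 ?w" by (simp add: fun_eq_iff hess_def dirv_dirv_inner[OF g0_smooth])
    finally show ?thesis .
  qed
  then show ?thesis using b V by blast
qed

text \<open>
  Localisation without a partition of unity. Finitely many open sets \<open>V P\<close>, on which the bump
  functions \<open>b P\<close> are 1, cover the support of \<open>\<omega>\<close>. Splitting off \<open>b P
  * \<omega>\<close>, to which \<open>theta_cut_off\<close> applies, leaves \<open>(1 - b P) *
  \<omega>\<close>, which vanishes on \<open>V P\<close>; so induction over the cover succeeds.
\<close>

lemma theta_hess:
  assumes "\<omega> \<in> TF" shows "\<theta> \<omega> = sgn_top TYPE('n) * (LINT x|lebesgue. hess g0 \<omega> x)"
proof -
  have "\<forall>P\<in>trop_var \<Sigma>. \<exists>b V. smooth_function \<Sigma> (trop_var \<Sigma>) b \<and> openin (trop_topology \<Sigma>) V \<and> P \<in> V \<and> (\<forall>Q\<in>V. b Q = 1) \<and>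
    (\<forall>\<omega>\<in>TF. \<theta> (\<lambda>P vs ws. b P * \<omega> P vs ws) = sgn_top TYPE('n) * (LINT x|lebesgue. hess g0 (\<lambda>P vs ws. b P * \<omega> P vs ws) x))"
    using theta_cut_off by blast
  from bchoice[OF this] obtain b where "\<forall>P\<in>trop_var \<Sigma>. \<exists>V. smooth_function \<Sigma> (trop_var \<Sigma>) (b P) \<and> openin (trop_topology \<Sigma>) V \<and> P \<in> V \<and> (\<forall>Q\<in>V. b P Q = 1) \<and>
    (\<forall>\<omega>\<in>TF. \<theta> (\<lambda>Q vs ws. b P Q * \<omega> Q vs ws) = sgn_top TYPE('n) * (LINT x|lebesgue. hess g0 (\<lambda>Q vs ws. b P Q * \<omega> Q vs ws) x))" ..
  from bchoice[OF this] obtain V where "\<forall>P\<in>trop_var \<Sigma>. smooth_function \<Sigma> (trop_var \<Sigma>) (b P) \<and> openin (trop_topology \<Sigma>) (V P) \<and> P \<in> V P \<and> (\<forall>Q\<in>V P. b P Q = 1) \<and>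
    (\<forall>\<omega>\<in>TF. \<theta> (\<lambda>Q vs ws. b P Q * \<omega> Q vs ws) = sgn_top TYPE('n) * (LINT x|lebesgue. hess g0 (\<lambda>Q vs ws. b P Q * \<omega> Q vs ws) x))" ..
  then have bV: "\<And>P. P \<in> trop_var \<Sigma> \<Longrightarrow> smooth_function \<Sigma> (trop_var \<Sigma>) (b P)"
    "\<And>P. P \<in> trop_var \<Sigma> \<Longrightarrow> openin (trop_topology \<Sigma>) (V P)" "\<And>P. P \<in> trop_var \<Sigma> \<Longrightarrow> P \<in> V P"
    "\<And>P Q. P \<in> trop_var \<Sigma> \<Longrightarrow> Q \<in> V P \<Longrightarrow> b P Q = 1"
    "\<And>P \<omega>. P \<in> trop_var \<Sigma> \<Longrightarrow> \<omega> \<in> TF \<Longrightarrow>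
       \<theta> (\<lambda>Q vs ws. b P Q * \<omega> Q vs ws) = sgn_top TYPE('n) * (LINT x|lebesgue. hess g0 (\<lambda>Q vs ws. b P Q * \<omega> Q vs ws) x)"
    by blast+
  have ind: "\<forall>\<omega>\<in>TF. (\<forall>Q. Q \<notin> (\<Union>P\<in>S. V P) \<longrightarrow> \<omega> Q = (\<lambda>vs ws. 0)) \<longrightarrow>
      \<theta> \<omega> = sgn_top TYPE('n) * (LINT x|lebesgue. hess g0 \<omega> x)" if "finite S" "S \<subseteq> trop_var \<Sigma>" for S
    using that
  proof (induction S rule: finite_induct)
    case empty
    show ?case
    proof (intro ballI impI)
      fix \<omega> assume w: "\<omega> \<in> TF" and z: "\<forall>Q. Q \<notin> (\<Union>P\<in>{}. V P) \<longrightarrow> \<omega> Q = (\<lambda>vs ws. 0)"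
      then have w0: "\<omega> = (\<lambda>Q vs ws. 0)" by auto
      have "\<theta> \<omega> = 0" using theta_linear[OF w w, of 0 0] w0 by simp
      moreover have "hess g0 \<omega> x = 0" for x by (simp add: hess_def cf_def w0)
      ultimately show "\<theta> \<omega> = sgn_top TYPE('n) * (LINT x|lebesgue. hess g0 \<omega> x)" by simp
    qed
  next
    case (insert P S)
    have P: "P \<in> trop_var \<Sigma>" using insert by blast
    show ?case
    proof (intro ballI impI)
      fix \<omega> assume w: "\<omega> \<in> TF" and z: "\<forall>Q. Q \<notin> (\<Union>P\<in>insert P S. V P) \<longrightarrow> \<omega> Q = (\<lambda>vs ws. 0)"
      let ?w1 = "\<lambda>Q vs ws. b P Q * \<omega> Q vs ws"
      let ?w2 = "\<lambda>Q vs ws. 1 * \<omega> Q vs ws + (-1) * ?w1 Q vs ws"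
      have w1: "?w1 \<in> TF" by (rule TF_mult[OF bV(1)[OF P] w])
      have w2: "?w2 \<in> TF" by (rule TF_lincomb[OF w w1])
      have "?w2 Q = (\<lambda>vs ws. 0)" if "Q \<notin> (\<Union>P\<in>S. V P)" for Q
      proof (cases "Q \<in> V P")
        case True
        then show ?thesis using bV(4)[OF P True] by simp
      next
        case False
        then have "\<omega> Q = (\<lambda>vs ws. 0)" using z that by blast
        then show ?thesis by simp
      qed
      note z2 = this
      have Ssub: "S \<subseteq> trop_var \<Sigma>" using insert.prems by blast
      have e2: "\<theta> ?w2 = sgn_top TYPE('n) * (LINT x|lebesgue. hess g0 ?w2 x)"
        by (rule insert.IH[OF Ssub, rule_format, OF w2]) (rule z2)
      have e1: "\<theta> ?w1 = sgn_top TYPE('n) * (LINT x|lebesgue. hess g0 ?w1 x)" by (rule bV(5)[OF P w])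
      have "\<theta> ?w2 = 1 * \<theta> \<omega> + (-1) * \<theta> ?w1" by (rule theta_linear[OF w w1])
      then have t: "\<theta> \<omega> = \<theta> ?w1 + \<theta> ?w2" by simp
      have "(LINT x|lebesgue. hess g0 ?w2 x) = 1 * (LINT x|lebesgue. hess g0 \<omega> x) + (-1) * (LINT x|lebesgue. hess g0 ?w1 x)"
        by (rule hess_integral_lincomb[OF g0_hess_tame w w1])
      then have l: "(LINT x|lebesgue. hess g0 \<omega> x) = (LINT x|lebesgue. hess g0 ?w1 x) + (LINT x|lebesgue. hess g0 ?w2 x)"
        by simp
      show "\<theta> \<omega> = sgn_top TYPE('n) * (LINT x|lebesgue. hess g0 \<omega> x)"
        unfolding t l e1 e2 distrib_left by (rule refl)
    qed
  qed
  obtain K where K: "compactin (trop_topology \<Sigma>) K" "supported_in \<omega> K" using TF_D(2)[OF assms] by blast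
  have Kt: "K \<subseteq> trop_var \<Sigma>" using K(1) topspace_trop by (auto simp: compactin_def)
  have "\<exists>F. finite F \<and> F \<subseteq> V ` K \<and> K \<subseteq> \<Union>F"
    by (rule K(1)[unfolded compactin_def, THEN conjunct2, rule_format]) (use bV(2,3) Kt in blast)
  then obtain F where F: "finite F" "F \<subseteq> V ` K" "K \<subseteq> \<Union>F" by blast
  obtain S where S: "finite S" "S \<subseteq> K" "F = V ` S" using finite_subset_image[OF F(1,2)] by blast
  have "\<omega> Q = (\<lambda>vs ws. 0)" if "Q \<notin> (\<Union>P\<in>S. V P)" for Q
    using K(2) F(3) S(3) that unfolding supported_in_def by blast
  note z = this
  have "S \<subseteq> trop_var \<Sigma>" using S(2) Kt by blast
  from ind[OF S(1) this] assms z show ?thesis by blast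
qed

text \<open>
  The two currents add up to integration of the Hessian of \<open>w\<close> against \<open>\<omega>\<close>:
  its symmetry gives the behaviour under \<open>form_J\<close>, and by convexity of \<open>w\<close> it is
  positive semidefinite.
\<close>

lemma theta_psh_of_convex:
  assumes w: "smooth w" "convex_on UNIV w" and t: "tame (\<lambda>x. w x - g0 x)"
  shows "theta_psh \<Sigma> \<theta> (\<lambda>P. ereal (ext (\<lambda>x. w x - g0 x) P))"
proof -
  let ?f = "\<lambda>x. w x - g0 x"
  have f: "smooth ?f" by (rule smooth_diff[OF w(1) g0_smooth])
  have fh: "hess_tame ?f" by (rule tame_hess_tame[OF t f])
  have fc: "continuous_on UNIV ?f" by (rule smooth_continuous[OF f])
  have simp_f: "(\<lambda>x. real_of_ereal (ereal (ext ?f (emb x)))) = ?f" by (simp add: ext_emb)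
  let ?T = "\<lambda>\<omega>. ddc (trop_var \<Sigma>) ?f \<omega> + \<theta> \<omega>"
  have hw: "hess w \<omega> x = hess ?f \<omega> x + hess g0 \<omega> x" for \<omega> x
    using hess_add[OF f g0_smooth, of \<omega> x] by simp
  have i: "integrable lebesgue (hess f \<omega>)" if "hess_tame f" "\<omega> \<in> TF" for f \<omega>
    using TF_D(2)[OF that(2)] hess_test_fun[OF that(1) TF_D(1)[OF that(2)]] test_fun_integrable by blast
  have T: "?T \<omega> = sgn_top TYPE('n) * (LINT x|lebesgue. hess w \<omega> x)" if "\<omega> \<in> TF" for \<omega>
    unfolding hw using ddc_tame[OF t f that] theta_hess[OF that] i[OF fh that] i[OF g0_hess_tame that]
    by (simp add: distrib_left)
  have cur: "current \<Sigma> (trop_var \<Sigma>) 1 1 ?T"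
    unfolding current_def
  proof (intro conjI ballI allI impI)
    fix \<omega> \<eta> a b assume we: "\<omega> \<in> TF" "\<eta> \<in> TF"
    show "?T (\<lambda>P vs ws. a * \<omega> P vs ws + b * \<eta> P vs ws) = a * ?T \<omega> + b * ?T \<eta>"
      using ddc_tame[OF t f we(1)] ddc_tame[OF t f we(2)] ddc_tame[OF t f TF_lincomb[OF we]]
        hess_integral_lincomb[OF fh we] theta_linear[OF we] by (simp add: algebra_simps)
  next
    fix \<omega> assume ns: "null_sequence \<Sigma> (trop_var \<Sigma>) (CARD('n) - 1) (CARD('n) - 1) \<omega>"
    obtain K where "compactin (trop_topology \<Sigma>) K" "\<And>k. supported_in (\<omega> k) K"
      "\<And>k. \<omega> k \<in> lagerberg_forms \<Sigma> (trop_var \<Sigma>) (CARD('n) - 1) (CARD('n) - 1)"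
      using ns unfolding null_sequence_def by blast
    then have wT: "\<omega> k \<in> TF" for k by (intro TF_I)
    have "(\<lambda>k. \<theta> (\<omega> k)) \<longlonglongrightarrow> 0" using c1 ns unfolding is_c1_def current_def by blast
    moreover have "(\<lambda>k. sgn_top TYPE('n) * (LINT x|lebesgue. hess ?f (\<omega> k) x)) \<longlonglongrightarrow> sgn_top TYPE('n) * 0"
      by (intro tendsto_mult_left hess_null_sequence[OF fh ns])
    ultimately show "(\<lambda>k. ?T (\<omega> k)) \<longlonglongrightarrow> 0"
      using tendsto_add_zero ddc_tame[OF t f wT] by fastforce
  qed (simp_all add: Suc_le_eq)
  have "positive_current \<Sigma> (trop_var \<Sigma>) 1 ?T"
    unfolding positive_current_def
  proof (intro conjI ballI impI cur)
    fix \<omega> assume w': "\<omega> \<in> TF"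
    show "?T (form_J \<omega>) = (-1) ^ (CARD('n) - 1) * ?T \<omega>"
      unfolding T[OF w'] T[OF form_J_TF[OF w']] hess_form_J[OF w(1)] by simp
    show "0 \<le> ?T \<omega>" if "positive_form \<Sigma> (trop_var \<Sigma>) (CARD('n) - 1) \<omega>"
    proof -
      have "0 \<le> (LINT x|lebesgue. sgn_top TYPE('n) * hess w \<omega> x)"
        by (intro integral_nonneg_AE always_eventually allI positive_hess[OF w that])
      then show ?thesis by (simp add: T[OF w'])
    qed
  qed
  then show ?thesis
    unfolding theta_psh_def simp_f
    using strongly_usc_ext[OF t fc] continuous_locally_integrable[OF fc] by simp
qed

end

section \<open>Contraction of the volume form\<close>

text \<open>
  Identifies the index type of vectors with the positions in \<open>basis_list\<close>, so that determinants
  apply to lists.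
\<close>

definition idx :: "'n::finite \<Rightarrow> nat" where
  "idx i = (SOME k. k < CARD('n) \<and> basis_list ! k = (axis i 1 :: real^'n))"

text \<open>
  The volume form as a function of lists, and its contraction with \<open>v\<close>.
\<close>

definition detl :: "(real^'n) list \<Rightarrow> real" where
  "detl L = det (\<chi> i. L ! idx i)"

definition ivol :: "real^'n \<Rightarrow> (real^'n) list \<Rightarrow> real" where
  "ivol v vs = (if length vs = CARD('n) - 1 then detl (v # vs) else 0)"

lemma idx:
  fixes i :: "'n::finite"
  shows "idx i < CARD('n)" "basis_list ! (idx i) = (axis i 1 :: real^'n)"
proof -
  have "(axis i 1 :: real^'n) \<in> set basis_list" unfolding basis_list(2) by (simp add: axis_in_Basis_iff)
  then have "\<exists>k. k < CARD('n) \<and> basis_list ! k = (axis i 1 :: real^'n)"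
    unfolding in_set_conv_nth basis_list(3) by blast
  from someI_ex[OF this] show "idx i < CARD('n)" "basis_list ! (idx i) = (axis i 1 :: real^'n)"
    unfolding idx_def by auto
qed

lemma idx_bij: "bij_betw (idx :: 'n::finite \<Rightarrow> nat) UNIV {..<CARD('n)}"
proof -
  have inj: "inj (idx :: 'n \<Rightarrow> nat)"
  proof (rule injI)
    fix i j :: 'n assume "idx i = idx j"
    then have "(axis i 1 :: real^'n) = axis j 1" using idx(2) by metis
    then show "i = j" by (simp add: axis_eq_axis)
  qed
  have "idx ` (UNIV :: 'n set) = {..<CARD('n)}"
    by (rule card_subset_eq) (use idx(1) card_image[OF inj] in auto)
  with inj show ?thesis by (simp add: bij_betw_def)
qed

lemma detl_alternating: "alternating CARD('n) (detl :: (real^'n) list \<Rightarrow> real)"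
  unfolding alternating_def
proof (intro conjI allI impI)
  fix vs :: "(real^'n) list" and k assume l: "length vs = CARD('n)" and k: "k < CARD('n)"
  obtain i :: 'n where i: "idx i = k" using idx_bij[where 'n = 'n] k unfolding bij_betw_def by (metis imageE lessThan_iff)
  have ji: "idx j = k \<longleftrightarrow> j = i" for j
  proof
    assume "idx j = k"
    then have "idx j = idx i" using i by simp
    then show "j = i" using idx_bij[where 'n = 'n] unfolding bij_betw_def by (simp add: inj_eq)
  qed (use i in simp)
  have "vs[k := v] ! idx j = (if j = i then v else vs ! idx j)" for v and j :: 'n
    using ji[of j] l idx(1)[of j] by (simp add: nth_list_update) (use i in auto)
  then have e: "detl (vs[k := v]) = det (\<chi> j. if j = i then v else vs ! idx j)" for v
    unfolding detl_def by simp
  show "linear (\<lambda>v. detl (vs[k := v]))"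
    unfolding e
  proof (rule linearI)
    fix a b :: "real^'n"
    show "det (\<chi> j. if j = i then a + b else vs ! idx j) = det (\<chi> j. if j = i then a else vs ! idx j) + det (\<chi> j. if j = i then b else vs ! idx j)"
      using det_row_add[of i "\<lambda>_. a" "\<lambda>_. b" "\<lambda>j. vs ! idx j"] by simp
    fix c
    show "det (\<chi> j. if j = i then c *\<^sub>R a else vs ! idx j) = c *\<^sub>R det (\<chi> j. if j = i then a else vs ! idx j)"
    proof -
      have sc: "c *\<^sub>R a = c *s a" by (simp add: vec_eq_iff)
      from det_row_mul[of i c "\<lambda>_. a" "\<lambda>j. vs ! idx j"] show ?thesis
        unfolding sc real_scaleR_def by simp
    qed
  qed
next
  fix vs :: "(real^'n) list" assume l: "length vs = CARD('n)" and nd: "\<not> distinct vs"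
  then obtain a b where ab: "a < CARD('n)" "b < CARD('n)" "a \<noteq> b" "vs ! a = vs ! b"
    by (auto simp: distinct_conv_nth)
  obtain i j :: 'n where ij: "idx i = a" "idx j = b" using idx_bij[where 'n = 'n] ab(1,2) unfolding bij_betw_def by (metis imageE lessThan_iff)
  have "i \<noteq> j" using ij ab(3) by auto
  then show "detl vs = 0"
    unfolding detl_def using ij ab(4)
    by (intro det_identical_rows[of i j]) (auto simp: row_def)
qed

lemma detl_basis: "detl (basis_list :: (real^'n) list) = 1"
proof -
  have "(\<chi> i. basis_list ! idx i) = (mat 1 :: real^'n^'n)"
    by (simp add: idx(2) vec_eq_iff mat_def axis_def eq_commute)
  then show ?thesis unfolding detl_def by simp
qed

lemma ivol_alternating: "alternating (CARD('n) - 1) (ivol (v :: real^'n))"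
  unfolding alternating_def
proof (intro conjI allI impI)
  fix vs :: "(real^'n) list" and k assume l: "length vs = CARD('n) - 1" "k < CARD('n) - 1"
  have "linear (\<lambda>w. detl ((v # vs)[Suc k := w]))"
    using detl_alternating[unfolded alternating_def, THEN conjunct1, rule_format, of "v # vs" "Suc k"] l by simp
  then show "linear (\<lambda>w. ivol v (vs[k := w]))" using l by (simp add: ivol_def)
next
  fix vs :: "(real^'n) list" assume l: "length vs = CARD('n) - 1" "\<not> distinct vs"
  then show "ivol v vs = 0"
    using detl_alternating[unfolded alternating_def, THEN conjunct2, rule_format, of "v # vs"] by (simp add: ivol_def)
qed

lemma ivol_omit:
  fixes v :: "real^'n" assumes k: "k < CARD('n)"
  shows "(-1) ^ k * ivol v (omit k basis_list) = v \<bullet> bvec k"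
proof -
  let ?es = "basis_list :: (real^'n) list"
  have len: "length ?es = CARD('n)" by (rule basis_list(3))
  have tk: "length (take k ?es) = k" using k len by simp
  have "detl ([] @ v # take k ?es @ drop (Suc k) ?es) = (-1) ^ length (take k ?es) * detl ([] @ take k ?es @ v # drop (Suc k) ?es)"
    by (rule alternating_move[OF detl_alternating]) (use k len in simp)
  moreover have "take k ?es @ v # drop (Suc k) ?es = ?es[k := v]"
    using k len by (simp add: upd_conv_take_nth_drop)
  ultimately have "ivol v (omit k ?es) = (-1) ^ k * detl (?es[k := v])"
    using k len tk by (simp add: ivol_def omit_def)
  also have "detl (?es[k := v]) = v \<bullet> bvec k"
    using alternating_expand_basis[OF detl_alternating k, of v] detl_basis[where 'n = 'n] by simp
  finally show ?thesis by (simp add: power_mult_distrib[symmetric] flip: mult.assoc power_add)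
qed

text \<open>
  The vector that \<open>hess_quadratic\<close> attaches to the contraction of the volume form with
  \<open>v\<close> is \<open>v\<close>.
\<close>

lemma vector_from_ivol:
  fixes v :: "real^'n"
  shows "(\<Sum>k<CARD('n). ((-1) ^ k * ivol v (omit k basis_list)) *\<^sub>R bvec k) = v"
proof -
  have "(\<Sum>k<CARD('n). ((-1) ^ k * ivol v (omit k basis_list)) *\<^sub>R bvec k) = (\<Sum>k<CARD('n). (v \<bullet> bvec k) *\<^sub>R bvec k)"
    by (intro sum.cong refl) (simp add: ivol_omit)
  also have "\<dots> = (\<Sum>b\<leftarrow>basis_list. (v \<bullet> b) *\<^sub>R b)"
    by (simp add: sum_list_sum_nth basis_list(3) atLeast0LessThan)
  also have "\<dots> = (\<Sum>b\<in>Basis. (v \<bullet> b) *\<^sub>R b)"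
    by (subst sum_list_distinct_conv_sum_set[OF basis_list(1)]) (simp add: basis_list(2))
  finally show ?thesis by (simp add: euclidean_representation)
qed

lemma ivol_length: "length vs \<noteq> CARD('n) - 1 \<Longrightarrow> ivol (v :: real^'n) vs = 0"
  by (simp add: ivol_def)

lemma alternating_zero:
  assumes "alternating m F" "length vs = m" "0 \<in> set vs" shows "F vs = 0"
proof -
  obtain k where k: "k < m" "vs ! k = 0" using assms by (auto simp: in_set_conv_nth)
  have "linear (\<lambda>v. F (vs[k := v]))" using assms k unfolding alternating_def by blast
  from linear_0[OF this] show ?thesis using k assms(2) by (metis list_update_id)
qed

lemma linear_zero_fun: "linear (\<lambda>v. 0 :: real)"
  by (simp add: linear_iff)

lemma ivol_linear: "k < length vs \<Longrightarrow> linear (\<lambda>w. ivol (v :: real^'n) (vs[k := w]))"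
  using ivol_alternating[of v, unfolded alternating_def, THEN conjunct1, rule_format, of vs k]
  by (cases "length vs = CARD('n) - 1") (simp_all add: ivol_length linear_zero_fun)

lemma ivol_zero: "0 \<in> set vs \<Longrightarrow> ivol (v :: real^'n) vs = 0"
  using alternating_zero[OF ivol_alternating] ivol_length by blast

lemma ivol_distinct: "\<not> distinct vs \<Longrightarrow> ivol (v :: real^'n) vs = 0"
  using ivol_alternating[of v, unfolded alternating_def, THEN conjunct2, rule_format, of vs] ivol_length by blast

lemma covector_ivol:
  "covector (CARD('n) - 1) 0 {0} (\<lambda>vs ws. if ws = [] then c * ivol (v :: real^'n) vs else 0)"
  unfolding covector_def
proof (intro conjI allI impI)
  fix vs ws :: "(real^'n) list" and k
  show "linear (\<lambda>w. if ws = [] then c * ivol v (vs[k := w]) else 0)" if "k < length vs"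
    using linear_lincomb[OF ivol_linear[OF that, of v] linear_zero_fun, of c 0]
    by (cases "ws = []") (simp_all add: linear_zero_fun)
  show "linear (\<lambda>w. if ws[k := w] = [] then c * ivol v vs else 0)" if "k < length ws"
    using that by (cases "ws = []") (simp_all add: linear_zero_fun)
qed (auto simp: ivol_length ivol_zero ivol_distinct span_insert_0)

lemma covector_ivol2:
  "covector (CARD('n) - 1) (CARD('n) - 1) {0} (\<lambda>vs ws. c * (ivol (v :: real^'n) vs * ivol v ws))"
  unfolding covector_def
proof (intro conjI allI impI)
  fix vs ws :: "(real^'n) list" and k
  show "linear (\<lambda>w. c * (ivol v (vs[k := w]) * ivol v ws))" if "k < length vs"
    using linear_lincomb[OF ivol_linear[OF that, of v] linear_zero_fun, of "c * ivol v ws" 0] by (simp add: mult_ac)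
  show "linear (\<lambda>w. c * (ivol v vs * ivol v (ws[k := w])))" if "k < length ws"
    using linear_lincomb[OF ivol_linear[OF that, of v] linear_zero_fun, of "c * ivol v vs" 0] by (simp add: mult_ac)
qed (auto simp: ivol_length ivol_zero ivol_distinct span_insert_0)

section \<open>Forms with compact support in the open stratum\<close>

text \<open>
  The form with given coefficients on the open stratum, extended by zero to the boundary.
\<close>

definition cform :: "(real^'n \<Rightarrow> 'n covec) \<Rightarrow> 'n form" where
  "cform A P = (if \<exists>x. P = emb x then A (SOME x. P = emb x) else (\<lambda>vs ws. 0))"

lemma emb_inj: "emb x = emb y \<longleftrightarrow> x = y"
  by (simp add: emb_eq)

lemma cform_emb: "cform A (emb x) = A x"
  by (auto simp: cform_def emb_inj)

lemma cform_zero: "\<sigma> \<noteq> {0} \<Longrightarrow> cform A (\<sigma>, D) = (\<lambda>vs ws. 0)"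
  by (simp add: cform_def emb_eq)

context tropical_variety
begin

lemma continuous_emb: "continuous_map euclidean (trop_topology \<Sigma>) (emb :: real^'n \<Rightarrow> 'n pt)"
  unfolding continuous_map_def
proof (intro conjI allI impI)
  show "emb \<in> topspace euclidean \<rightarrow> topspace (trop_topology \<Sigma>)" using emb_trop_var topspace_trop by simp
  fix U assume U: "openin (trop_topology \<Sigma>) U"
  have "open {x. emb x \<in> U}"
    unfolding open_subopen[of "{x. emb x \<in> U}"]
  proof
    fix x assume "x \<in> {x. emb x \<in> U}"
    then have "eventually (\<lambda>z. emb z \<in> U) (near {0} x)"
      by (intro open_near_emb[OF U _ zero_cone]) (simp add: emb_def)
    then show "\<exists>T. open T \<and> x \<in> T \<and> T \<subseteq> {x. emb x \<in> U}"
      unfolding eventually_near_zero eventually_nhds by blast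
  qed
  then show "openin euclidean {x \<in> topspace euclidean. emb x \<in> U}" by simp
qed

lemma compactin_emb: "compactin (trop_topology \<Sigma>) (emb ` cball (0::real^'n) R)"
  using image_compactin[OF _ continuous_emb, of "cball 0 R"] by simp

text \<open>
  Neighbourhoods of boundary points are far out in $N_{\mathbb R}$: moving along \<open>\<sigma>\<close> one
  leaves the cone \<open>{0}\<close>, even after translation by a bounded vector.
\<close>

lemma leave_ball:
  assumes "\<sigma> \<in> \<Sigma>" "\<sigma> \<noteq> {0}"
  shows "eventually (\<lambda>z. norm z > R) (near \<sigma> x)"
proof (rule near_of_deep[OF assms(1)])
  fix R1
  obtain t where t: "t \<in> \<sigma>" "t \<noteq> 0" using nonzero_cone_vector[OF assms] by blast
  obtain s0 where s0: "s0 \<in> \<sigma>" "\<And>z s. norm z \<le> R1 + R \<Longrightarrow> s \<in> \<sigma> \<Longrightarrow> z + s0 + s \<notin> {0}"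
    using avoid_cone[OF zero_cone assms(1) t(1), of "R1 + R"] t(2) by auto
  have "norm (z + s0 + s) > R" if "norm z \<le> R1" "s \<in> \<sigma>" for z s
  proof (rule ccontr)
    assume "\<not> norm (z + s0 + s) > R"
    then have "norm (z - (z + s0 + s)) \<le> R1 + R" using that(1) norm_triangle_ineq4[of z "z + s0 + s"] by linarith
    from s0(2)[OF this that(2)] show False by simp
  qed
  with s0(1) show "\<exists>s0\<in>\<sigma>. \<forall>z s. norm z \<le> R1 \<longrightarrow> s \<in> \<sigma> \<longrightarrow> R < norm (z + s0 + s)" by blast
qed

lemma cform_lagerberg:
  fixes A :: "real^'n \<Rightarrow> 'n covec"
  assumes cov: "\<And>x. covector p q {0} (A x)" and sm: "\<And>vs ws. smooth (\<lambda>x. A x vs ws)"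
    and R: "\<And>x. norm x > R \<Longrightarrow> A x = (\<lambda>vs ws. 0)"
  shows "cform A \<in> lagerberg_forms \<Sigma> (trop_var \<Sigma>) p q" and "supported_in (cform A) (emb ` cball 0 R)"
proof -
  show "supported_in (cform A) (emb ` cball 0 R)"
    unfolding supported_in_def
  proof (intro allI impI)
    fix P :: "'n pt" assume P: "P \<notin> emb ` cball 0 R"
    show "cform A P = (\<lambda>vs ws. 0)"
    proof (cases "\<exists>x. P = emb x")
      case True
      then obtain x where x: "P = emb x" by blast
      then have "norm x > R" using P by (auto simp: not_le[symmetric])
      then show ?thesis using R x by (simp add: cform_emb)
    qed (simp add: cform_def)
  qed
  show "cform A \<in> lagerberg_forms \<Sigma> (trop_var \<Sigma>) p q"
    unfolding lagerberg_forms_iff[OF open_trop_var]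
  proof (intro conjI ballI allI impI)
    fix P assume "P \<notin> trop_var \<Sigma>"
    then have "\<not> (\<exists>x. P = emb x)" using emb_trop_var by blast
    then show "cform A P = (\<lambda>vs ws. 0)" by (simp add: cform_def)
  next
    fix \<sigma> x assume "\<sigma> \<in> \<Sigma>"
    show "covector p q \<sigma> (cform A (\<sigma>, coset \<sigma> x))"
    proof (cases "\<sigma> = {0}")
      case True
      then show ?thesis using cov[of x] cform_emb[of A x] by (simp add: emb_def)
    qed (simp add: cform_zero covector_zero)
  next
    fix \<sigma> and vs ws :: "(real^'n) list" assume s: "\<sigma> \<in> \<Sigma>"
    have "smooth (\<lambda>x. cform A (\<sigma>, coset \<sigma> x) vs ws)"
    proof (cases "\<sigma> = {0}")
      case True
      have "cform A ({0}, coset {0} x) vs ws = A x vs ws" for x using cform_emb[of A x] by (simp add: emb_def)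
      then show ?thesis using True sm by simp
    qed (simp add: cform_zero smooth_const)
    then show "smooth_on {x. (\<sigma>, coset \<sigma> x) \<in> trop_var \<Sigma>} (\<lambda>x. cform A (\<sigma>, coset \<sigma> x) vs ws)"
      using coset_trop_var[OF s] by simp
  next
    fix \<sigma> x assume s: "\<sigma> \<in> \<Sigma>"
    show "\<forall>\<^sub>F z in near \<sigma> x. \<forall>\<tau>\<in>\<Sigma>. \<tau> face_of \<sigma> \<longrightarrow> cform A (\<tau>, coset \<tau> z) = cform A (\<sigma>, coset \<sigma> z)"
    proof (cases "\<sigma> = {0}")
      case True
      show ?thesis unfolding True using face_of_zero by (intro always_eventually) blast
    next
      case False
      from leave_ball[OF s False, of R] show ?thesis
      proof (rule eventually_mono, intro ballI impI)
        fix z :: "real^'n" and \<tau> assume z: "norm z > R" and t: "\<tau> \<in> \<Sigma>" "\<tau> face_of \<sigma>"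
        have "cform A (\<tau>, coset \<tau> z) = (\<lambda>vs ws. 0)"
          using R[OF z] cform_emb[of A z] cform_zero[of \<tau> A] by (cases "\<tau> = {0}") (simp_all add: emb_def)
        then show "cform A (\<tau>, coset \<tau> z) = cform A (\<sigma>, coset \<sigma> z)" using cform_zero[OF False] by metis
      qed
    qed
  qed
qed

lemma smooth_function_const: "smooth_function \<Sigma> (trop_var \<Sigma>) (\<lambda>P. c)"
  unfolding smooth_function_iff[OF open_trop_var] using coset_trop_var by (simp add: smooth_const)

end

section \<open>Convexity from second distributional derivatives\<close>

lemma convex_from_second_derivative:
  fixes G :: "real^'n \<Rightarrow> real"
  assumes G: "smooth G" and pos: "\<And>v y. 0 \<le> dirv v (dirv v G) y"
  shows "convex_on UNIV G"
proof (rule convex_onI)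
  fix t :: real and x y :: "real^'n" assume t: "0 < t" "t < 1"
  let ?v = "y - x"
  have "convex_on UNIV (\<lambda>t. G (x + t *\<^sub>R ?v))"
    by (rule f''_ge0_imp_convex[OF _ line_derivative[OF G] line_derivative[OF smooth_dirv[OF G]]]) (use pos in auto)
  from convex_onD[OF this, of t 0 1] t
  have "G (x + t *\<^sub>R ?v) \<le> (1 - t) * G x + t * G y" by simp
  moreover have "x + t *\<^sub>R ?v = (1 - t) *\<^sub>R x + t *\<^sub>R y" by (simp add: algebra_simps)
  ultimately show "G ((1 - t) *\<^sub>R x + t *\<^sub>R y) \<le> (1 - t) * G x + t * G y" by simp
qed simp

lemma flat_tendsto_1: "0 < t \<Longrightarrow> (\<lambda>j. flat (real j * t)) \<longlonglongrightarrow> 1"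
proof -
  assume t: "0 < t"
  have "(\<lambda>j. exp (- (1 / t * inverse (real (Suc j))))) \<longlonglongrightarrow> exp (- (1 / t * 0))"
    by (intro tendsto_intros LIMSEQ_inverse_real_of_nat)
  moreover have "flat (real (Suc j) * t) = exp (- (1 / t * inverse (real (Suc j))))" for j
    using t mult_pos_pos[of "real (Suc j)" t] by (simp add: flat_def not_le field_simps del: of_nat_Suc)
  ultimately have "(\<lambda>j. flat (real (Suc j) * t)) \<longlonglongrightarrow> 1" by simp
  then show ?thesis by (subst (asm) filterlim_sequentially_Suc)
qed

text \<open>
  Cut-off functions that increase to the indicator function of a box. The box is \<open>(-h,
  0)\<^sup>n\<close> since convolution at \<open>y\<close> evaluates them at \<open>y - x\<close>, which
  makes \<open>x\<close> range over the box with lower corner \<open>y\<close>.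
\<close>

lemma box_cutoff:
  fixes h :: real assumes h: "0 < h"
  shows "\<exists>\<kappa>::nat \<Rightarrow> real^'n \<Rightarrow> real. (\<forall>j. test_fun (\<kappa> j)) \<and> (\<forall>j x. 0 \<le> \<kappa> j x \<and> \<kappa> j x \<le> 1) \<and>
    (\<forall>j x. x \<notin> box (- h *\<^sub>R One) 0 \<longrightarrow> \<kappa> j x = 0) \<and>
    (\<forall>x\<in>box (- h *\<^sub>R One) 0. (\<lambda>j. \<kappa> j x) \<longlonglongrightarrow> 1)"
proof (intro exI conjI allI ballI impI)
  \<comment> \<open>The argument of \<open>flat\<close> is positive exactly for \<open>- h < x $ i < 0\<close>, and \<open>flat (j t) \<rightarrow> 1\<close> for \<open>t > 0\<close>.\<close>
  let ?k = "\<lambda>(j::nat) (x::real^'n). \<Prod>i\<in>UNIV. flat (real j * ((- x $ i) * (x $ i + h)))"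
  have box: "x \<in> box (- h *\<^sub>R One) 0 \<longleftrightarrow> (\<forall>i. - h < x $ i \<and> x $ i < 0)" for x :: "real^'n"
  proof -
    have "One $ i = (1::real)" for i :: 'n using inner_sum_Basis[of "axis i 1 :: real^'n"]
      by (simp add: inner_axis axis_in_Basis_iff flip: cart_eq_inner_axis)
    then show ?thesis by (auto simp: mem_box_cart)
  qed
  have out: "?k j x = 0" if "x \<notin> box (- h *\<^sub>R One) 0" for j and x :: "real^'n"
  proof -
    have "\<not> (\<forall>i. - h < x $ i \<and> x $ i < 0)" using that box by blast
    then obtain i where i: "\<not> (- h < x $ i \<and> x $ i < 0)" by blast
    have le: "(- x $ i) * (x $ i + h) \<le> 0"
    proof (cases "x $ i < 0")
      case True
      then show ?thesis using i by (intro mult_nonneg_nonpos) auto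
    next
      case False
      then show ?thesis using h by (intro mult_nonpos_nonneg) auto
    qed
    then have "flat (real j * ((- x $ i) * (x $ i + h))) = 0" using mult_nonneg_nonpos[OF _ le, of "real j"] by (intro flat_zero) auto
    then show ?thesis by (intro prod_zero) auto
  qed
  show "?k j x = 0" if "x \<notin> box (- h *\<^sub>R One) 0" for j and x :: "real^'n" using out[OF that] .
  show "0 \<le> ?k j x" for j and x :: "real^'n" by (intro prod_nonneg) (simp add: flat_nonneg)
  show "?k j x \<le> 1" for j and x :: "real^'n" by (intro prod_le_1) (simp add: flat_nonneg flat_le_1)
  show "(\<lambda>j. ?k j x) \<longlonglongrightarrow> 1" if "x \<in> box (- h *\<^sub>R One) 0" for x :: "real^'n"
  proof -
    have "(\<lambda>j. ?k j x) \<longlonglongrightarrow> (\<Prod>i\<in>(UNIV::'n set). 1)"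
    proof (intro tendsto_prod flat_tendsto_1)
      fix i
      have "- h < x $ i" "x $ i < 0" using that box[of x] by auto
      then show "0 < (- x $ i) * (x $ i + h)" by (intro mult_pos_pos) linarith+
    qed
    then show ?thesis by simp
  qed
  show "test_fun (?k j)" for j
    unfolding test_fun_def
  proof
    have neg: "smooth (\<lambda>x::real^'n. - x $ i)" for i using smooth_cmult[OF smooth_component[of i], of "-1"] by simp
    show "smooth (?k j)"
      by (intro smooth_prod smooth_flat smooth_mult smooth_const smooth_add smooth_component neg)
    have "{x. ?k j x \<noteq> 0} \<subseteq> box (- h *\<^sub>R One) 0" using out by blast
    then show "bounded {x. ?k j x \<noteq> 0}" using bounded_box bounded_subset by blast
  qed
qed

definition box_mean :: "(real^'n \<Rightarrow> real) \<Rightarrow> real \<Rightarrow> real^'n \<Rightarrow> real" where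
  "box_mean u h y = integral (cbox y (y + h *\<^sub>R One)) u"

lemma box_mean_limit:
  fixes u :: "real^'n \<Rightarrow> real"
  assumes u: "locally_integrable u" and h: "0 < h"
    and \<kappa>: "\<And>j. test_fun (\<kappa> j)" "\<And>j x. 0 \<le> \<kappa> j x \<and> \<kappa> j x \<le> 1" "\<And>j x. x \<notin> box (- h *\<^sub>R One) 0 \<Longrightarrow> \<kappa> j x = 0"
      "\<And>x. x \<in> box (- h *\<^sub>R One) 0 \<Longrightarrow> (\<lambda>j. \<kappa> j x) \<longlonglongrightarrow> 1"
  shows "(\<lambda>j. conv u (\<lambda>x. \<kappa> j x * \<kappa> j x) y) \<longlonglongrightarrow> box_mean u h y"
proof -
  let ?B = "box y (y + h *\<^sub>R One)" and ?C = "cbox y (y + h *\<^sub>R One)"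
  have b: "y - x \<in> box (- h *\<^sub>R One) 0 \<longleftrightarrow> x \<in> ?B" for x
    by (auto simp: mem_box inner_diff_left inner_add_left)
  have ci: "set_integrable lebesgue ?C u" using u by (simp add: locally_integrable_def)
  then have bi: "set_integrable lebesgue ?B u"
    by (rule set_integrable_subset) (auto simp: box_subset_cbox)
  have "(LINT x:?B|lebesgue. u x) = box_mean u h y"
    unfolding box_mean_def integral_open_interval[symmetric] by (rule set_lebesgue_integral_eq_integral(2)[OF bi])
  moreover have "(\<lambda>j. LINT x|lebesgue. u x * (\<kappa> j (y - x) * \<kappa> j (y - x))) \<longlonglongrightarrow> (LINT x|lebesgue. indicator ?B x *\<^sub>R u x)"
  proof (rule integral_dominated_convergence[where w = "\<lambda>x. \<bar>indicator ?B x *\<^sub>R u x\<bar>"])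
    show "(\<lambda>x. indicator ?B x *\<^sub>R u x) \<in> borel_measurable lebesgue"
      using bi unfolding set_integrable_def by (rule borel_measurable_integrable)
    show "(\<lambda>x. u x * (\<kappa> j (y - x) * \<kappa> j (y - x))) \<in> borel_measurable lebesgue" for j
      by (rule borel_measurable_integrable[OF integrable_mult_test_fun(1)[OF u]]) (intro test_fun_mult \<kappa>(1) test_fun_smooth)
    show "integrable lebesgue (\<lambda>x. \<bar>indicator ?B x *\<^sub>R u x\<bar>)"
      using bi unfolding set_integrable_def by (rule integrable_abs)
    show "AE x in lebesgue. (\<lambda>j. u x * (\<kappa> j (y - x) * \<kappa> j (y - x))) \<longlonglongrightarrow> indicator ?B x *\<^sub>R u x"
    proof (intro always_eventually allI)
      fix x
      show "(\<lambda>j. u x * (\<kappa> j (y - x) * \<kappa> j (y - x))) \<longlonglongrightarrow> indicator ?B x *\<^sub>R u x"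
      proof (cases "x \<in> ?B")
        case True
        then have "(\<lambda>j. \<kappa> j (y - x)) \<longlonglongrightarrow> 1" using \<kappa>(4) b by blast
        then have "(\<lambda>j. u x * (\<kappa> j (y - x) * \<kappa> j (y - x))) \<longlonglongrightarrow> u x * (1 * 1)" by (intro tendsto_intros)
        then show ?thesis using True by simp
      next
        case False
        then show ?thesis using \<kappa>(3) b by simp
      qed
    qed
    show "AE x in lebesgue. norm (u x * (\<kappa> j (y - x) * \<kappa> j (y - x))) \<le> \<bar>indicator ?B x *\<^sub>R u x\<bar>" for j
    proof (intro always_eventually allI)
      fix x
      have "\<kappa> j (y - x) * \<kappa> j (y - x) \<le> 1" "0 \<le> \<kappa> j (y - x) * \<kappa> j (y - x)" using \<kappa>(2)[of j "y - x"] by (auto intro: mult_le_one)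
      then show "norm (u x * (\<kappa> j (y - x) * \<kappa> j (y - x))) \<le> \<bar>indicator ?B x *\<^sub>R u x\<bar>"
        using \<kappa>(3)[of "y - x" j] b[of x] mult_left_mono[of "\<kappa> j (y - x) * \<kappa> j (y - x)" 1 "\<bar>u x\<bar>"]
        by (cases "x \<in> ?B") (auto simp: abs_mult)
    qed
  qed
  ultimately show ?thesis by (simp add: conv_def set_lebesgue_integral_def)
qed

lemma convex_ineq_limit:
  fixes F :: "nat \<Rightarrow> real^'n \<Rightarrow> real"
  assumes "\<And>j. convex_on UNIV (F j)" "\<And>y. y \<in> {a, b, (1 - t) *\<^sub>R a + t *\<^sub>R b} \<Longrightarrow> (\<lambda>j. F j y) \<longlonglongrightarrow> G y" "0 \<le> t" "t \<le> 1"
  shows "G ((1 - t) *\<^sub>R a + t *\<^sub>R b) \<le> (1 - t) * G a + t * G b"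
proof (rule LIMSEQ_le)
  show "(\<lambda>j. F j ((1 - t) *\<^sub>R a + t *\<^sub>R b)) \<longlonglongrightarrow> G ((1 - t) *\<^sub>R a + t *\<^sub>R b)" by (rule assms(2)) simp
  show "(\<lambda>j. (1 - t) * F j a + t * F j b) \<longlonglongrightarrow> (1 - t) * G a + t * G b"
    by (intro tendsto_intros assms(2)) auto
  show "\<exists>N. \<forall>j\<ge>N. F j ((1 - t) *\<^sub>R a + t *\<^sub>R b) \<le> (1 - t) * F j a + t * F j b"
    using convex_onD[OF assms(1)] assms(3,4) by blast
qed

text \<open>
  Differentiation under the integral makes the convolutions of \<open>u\<close> with squares of test
  functions convex; only squares are at hand because \<open>pos\<close> will come from forms $\alpha \wedge
  J\alpha$. The indicator function of a box is a limit of such squares, so box means are convex, and they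
  converge to \<open>u\<close> at Lebesgue points.
\<close>

lemma convex_almost_everywhere:
  fixes u :: "real^'n \<Rightarrow> real"
  assumes u: "locally_integrable u"
    and pos: "\<And>\<kappa> v. test_fun \<kappa> \<Longrightarrow> 0 \<le> (LINT x|lebesgue. u x * dirv v (dirv v (\<lambda>x. \<kappa> x * \<kappa> x)) x)"
  obtains N where "negligible N"
    and "\<And>a b t. 0 \<le> t \<Longrightarrow> t \<le> 1 \<Longrightarrow> a \<notin> N \<Longrightarrow> b \<notin> N \<Longrightarrow> (1 - t) *\<^sub>R a + t *\<^sub>R b \<notin> N \<Longrightarrow>
      u ((1 - t) *\<^sub>R a + t *\<^sub>R b) \<le> (1 - t) * u a + t * u b"
proof -
  have conv_convex: "convex_on UNIV (conv u (\<lambda>x. \<kappa> x * \<kappa> x))" if \<kappa>: "test_fun \<kappa>" for \<kappa>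
  proof (rule convex_from_second_derivative)
    let ?r = "\<lambda>x. \<kappa> x * \<kappa> x"
    have r: "test_fun ?r" by (intro test_fun_mult \<kappa> test_fun_smooth)
    have rs: "smooth ?r" by (rule test_fun_smooth[OF r])
    show "smooth (conv u ?r)" by (rule smooth_conv[OF u r])
    fix v y :: "real^'n"
    let ?k = "\<lambda>x. \<kappa> (y - x)"
    have k: "test_fun ?k"
    proof -
      obtain R where R: "\<And>x. \<kappa> x \<noteq> 0 \<Longrightarrow> norm x < R" using test_fun_zero_outside[OF \<kappa>] by blast
      have "{x. ?k x \<noteq> 0} \<subseteq> ball y R" using R by (auto simp: dist_norm)
      then have "bounded {x. ?k x \<noteq> 0}" using bounded_ball bounded_subset by blast
      then show ?thesis using smooth_reflect[OF test_fun_smooth[OF \<kappa>]] by (simp add: test_fun_def)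
    qed
    have d1: "dirv v (\<lambda>x. ?k x * ?k x) = (\<lambda>x. - 1 * dirv v ?r (y - x))"
      using dirv_reflect[OF rs, of v y] by (auto simp: fun_eq_iff)
    have "dirv v (\<lambda>x. - 1 * dirv v ?r (y - x)) x = dirv v (dirv v ?r) (y - x)" for x
      using dirv_cmult[OF smooth_reflect[OF smooth_dirv[OF rs]], of v "-1" v y x] dirv_reflect[OF smooth_dirv[OF rs], of v v y x] by simp
    then have "dirv v (dirv v (\<lambda>x. ?k x * ?k x)) = (\<lambda>x. dirv v (dirv v ?r) (y - x))" unfolding d1 by auto
    then have "0 \<le> conv u (dirv v (dirv v ?r)) y" using pos[OF k, of v] by (simp add: conv_def)
    then show "0 \<le> dirv v (dirv v (conv u ?r)) y"
      by (simp add: dirv_conv[OF u r] dirv_conv[OF u test_fun_dirv[OF r]])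
  qed
  have mean_convex: "box_mean u h ((1 - t) *\<^sub>R a + t *\<^sub>R b) \<le> (1 - t) * box_mean u h a + t * box_mean u h b"
    if h: "0 < h" and t: "0 \<le> t" "t \<le> 1" for h t a b
  proof -
    obtain \<kappa> :: "nat \<Rightarrow> real^'n \<Rightarrow> real" where \<kappa>: "\<And>j. test_fun (\<kappa> j)" "\<And>j x. 0 \<le> \<kappa> j x \<and> \<kappa> j x \<le> 1"
      "\<And>j x. x \<notin> box (- h *\<^sub>R One) 0 \<Longrightarrow> \<kappa> j x = 0" "\<And>x. x \<in> box (- h *\<^sub>R One) 0 \<Longrightarrow> (\<lambda>j. \<kappa> j x) \<longlonglongrightarrow> 1"
      using box_cutoff[OF h] by blast
    show ?thesis
      by (rule convex_ineq_limit[OF conv_convex[OF \<kappa>(1)] box_mean_limit[OF u h \<kappa>] t])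
  qed
  have "u integrable_on cbox a b" for a b
    by (rule set_lebesgue_integral_eq_integral(1)) (use u in \<open>simp add: locally_integrable_def\<close>)
  then obtain N where N: "negligible N" "\<And>x e. x \<notin> N \<Longrightarrow> 0 < e \<Longrightarrow>
      \<exists>d>0. \<forall>h. 0 < h \<and> h < d \<longrightarrow> norm (integral (cbox x (x + h *\<^sub>R One)) u /\<^sub>R h ^ DIM(real^'n) - u x) < e"
    by (rule integrable_ccontinuous_explicit) blast
  let ?h = "\<lambda>j. inverse (real (Suc j))"
  let ?m = "\<lambda>j y. box_mean u (?h j) y /\<^sub>R ?h j ^ DIM(real^'n)"
  have lim: "(\<lambda>j. ?m j x) \<longlonglongrightarrow> u x" if x: "x \<notin> N" for x
  proof (rule LIMSEQ_I)
    fix e :: real assume "0 < e"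
    from N(2)[OF x this] obtain d where d: "d > 0" "\<And>h. 0 < h \<Longrightarrow> h < d \<Longrightarrow>
      norm (integral (cbox x (x + h *\<^sub>R One)) u /\<^sub>R h ^ DIM(real^'n) - u x) < e" by blast
    from order_tendstoD(2)[OF LIMSEQ_inverse_real_of_nat d(1)] obtain K where K: "\<And>j. j \<ge> K \<Longrightarrow> ?h j < d"
      unfolding eventually_sequentially by blast
    have "norm (?m j x - u x) < e" if "j \<ge> K" for j
      unfolding box_mean_def by (rule d(2)[OF _ K[OF that]]) simp
    then show "\<exists>K. \<forall>j\<ge>K. norm (?m j x - u x) < e" by blast
  qed
  show ?thesis
  proof (rule that[OF N(1)])
    fix a b :: "real^'n" and t :: real
    assume t: "0 \<le> t" "t \<le> 1" and ab: "a \<notin> N" "b \<notin> N" "(1 - t) *\<^sub>R a + t *\<^sub>R b \<notin> N"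
    show "u ((1 - t) *\<^sub>R a + t *\<^sub>R b) \<le> (1 - t) * u a + t * u b"
    proof (rule convex_ineq_limit[where F = ?m, OF _ _ t])
      show "convex_on UNIV (?m j)" for j
      proof (rule convex_onI)
        fix s :: real and x y :: "real^'n" assume s: "0 < s" "s < 1"
        have "?m j ((1 - s) *\<^sub>R x + s *\<^sub>R y) \<le> ((1 - s) * box_mean u (?h j) x + s * box_mean u (?h j) y) /\<^sub>R ?h j ^ DIM(real^'n)"
          using mean_convex[of "?h j" s x y] s by (intro scaleR_left_mono) auto
        then show "?m j ((1 - s) *\<^sub>R x + s *\<^sub>R y) \<le> (1 - s) * ?m j x + s * ?m j y"
          by (simp add: algebra_simps)
      qed simp
    qed (use lim ab in auto)
  qed
qed

section \<open>Convexity and growth of psh functions\<close>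

text \<open>
  Translation between the neighbourhood filter of a point of $N_\Sigma$ and its trace on $N_{\mathbb R}$.
\<close>

lemma (in tropical_variety) near_nhdsin:
  assumes "\<sigma> \<in> \<Sigma>" "eventually P (near \<sigma> x)"
  shows "eventually (\<lambda>Q. \<forall>z. Q = emb z \<longrightarrow> P z) (nhdsin (trop_topology \<Sigma>) (\<sigma>, coset \<sigma> x))"
proof -
  obtain R where R: "openin (trop_topology \<Sigma>) {(\<tau>, coset \<tau> z) |\<tau> z. \<tau> \<in> \<Sigma> \<and> \<tau> face_of \<sigma> \<and> z \<in> R}"
    "(\<sigma>, coset \<sigma> x) \<in> {(\<tau>, coset \<tau> z) |\<tau> z. \<tau> \<in> \<Sigma> \<and> \<tau> face_of \<sigma> \<and> z \<in> R}"
    "\<And>z. z \<in> R \<Longrightarrow> P z"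
    by (rule near_open[OF assms]) blast
  have "P z" if z: "emb z \<in> {(\<tau>, coset \<tau> z) |\<tau> z. \<tau> \<in> \<Sigma> \<and> \<tau> face_of \<sigma> \<and> z \<in> R}" for z
  proof -
    obtain y where "{z} = coset {0} y" "y \<in> R" using z unfolding emb_eq by auto
    then show ?thesis using R(3) by (simp add: coset_zero)
  qed
  then show ?thesis unfolding eventually_nhdsin using R(1,2) by blast
qed

lemma (in tropical_variety) nhdsin_near:
  assumes "\<sigma> \<in> \<Sigma>" "eventually P (nhdsin (trop_topology \<Sigma>) (\<sigma>, coset \<sigma> x))"
  shows "eventually (\<lambda>z. P (emb z)) (near \<sigma> x)"
proof -
  obtain W where W: "openin (trop_topology \<Sigma>) W" "(\<sigma>, coset \<sigma> x) \<in> W" "\<forall>Q\<in>W. P Q"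
    using assms(2) coset_trop_var[OF assms(1)] unfolding eventually_nhdsin topspace_trop by blast
  from open_near_emb[OF W(1,2) assms(1)] show ?thesis by (rule eventually_mono) (use W(3) in blast)
qed

locale psh_setting = green_setting \<Sigma> \<Psi> g0 \<theta> for \<Sigma> :: "(real^'n) set set" and \<Psi> g0 \<theta> +
  fixes \<phi> :: "'n pt \<Rightarrow> ereal"
  assumes not_infty: "\<And>P. P \<in> trop_var \<Sigma> \<Longrightarrow> \<phi> P \<noteq> \<infinity>"
    and susc: "strongly_usc \<Sigma> \<phi>"
    and finite_open: "\<And>x. \<phi> (emb x) \<noteq> -\<infinity>"
    and locint: "locally_integrable (\<lambda>x. real_of_ereal (\<phi> (emb x)))"
    and pos: "positive_current \<Sigma> (trop_var \<Sigma>) 1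
      (\<lambda>\<omega>. ddc (trop_var \<Sigma>) (\<lambda>x. real_of_ereal (\<phi> (emb x))) \<omega> + \<theta> \<omega>)"
begin

definition f :: "real^'n \<Rightarrow> real" where "f x = real_of_ereal (\<phi> (emb x))"
definition u :: "real^'n \<Rightarrow> real" where "u x = f x + g0 x"

lemma phi_emb: "\<phi> (emb x) = ereal (f x)"
  using not_infty[OF emb_trop_var[of x]] finite_open[of x] by (cases "\<phi> (emb x)") (auto simp: f_def)

lemma g0_continuous: "continuous_on UNIV g0" by (rule smooth_continuous[OF g0_smooth])

lemma f_locint: "locally_integrable f" using locint by (simp add: f_def[abs_def])

lemma u_locint: "locally_integrable u"
  using f_locint continuous_locally_integrable[OF g0_continuous]
  unfolding locally_integrable_def u_def[abs_def] by (auto intro: set_integral_add)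

text \<open>
  Positivity is tested on $\alpha \wedge J\alpha$ where \<open>\<alpha>\<close> is \<open>\<kappa>\<close>
  times the contraction of the volume form with \<open>v\<close>; by \<open>vector_from_ivol\<close> the
  second differential of this form is, up to sign, the second derivative of \<open>\<kappa>\<^sup>2\<close>
  along \<open>v\<close>. Its support is compact in $N_{\mathbb R}$, so \<open>\<theta>\<close> is there
  \<open>d'd''[g0]\<close>.
\<close>

lemma positive_second_derivative:
  assumes \<kappa>: "test_fun \<kappa>"
  shows "0 \<le> (LINT x|lebesgue. u x * dirv v (dirv v (\<lambda>x. \<kappa> x * \<kappa> x)) x)"
proof -
  let ?r = "\<lambda>x. \<kappa> x * \<kappa> x"
  have r: "test_fun ?r" by (intro test_fun_mult \<kappa> test_fun_smooth)
  have rs: "smooth ?r" by (rule test_fun_smooth[OF r])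
  obtain R where R: "\<And>x. \<kappa> x \<noteq> 0 \<Longrightarrow> norm x < R" using test_fun_zero_outside[OF \<kappa>] by blast
  have R0: "\<kappa> x = 0" if "norm x > R" for x using R[of x] that by fastforce
  define s :: real where "s = (-1) ^ ((CARD('n) - 1) * (CARD('n) - 1 - 1) div 2)"
  define \<alpha> :: "'n form" where "\<alpha> = cform (\<lambda>x vs ws. if ws = [] then \<kappa> x * ivol v vs else 0)"
  define \<omega> :: "'n form" where "\<omega> = (\<lambda>P vs ws. \<Sum>j<1::nat. s * 1 * wedge_pure \<alpha> (form_J \<alpha>) P vs ws)"
  define a where "a k = ivol v (omit k basis_list)" for k
  have ivs: "smooth (\<lambda>x. if ws = [] then \<kappa> x * c else 0)" for c and ws :: "(real^'n) list"
    using smooth_mult[OF test_fun_smooth[OF \<kappa>] smooth_const[of c]] smooth_const[of 0] by (cases "ws = []") auto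
  have \<alpha>: "\<alpha> \<in> lagerberg_forms \<Sigma> (trop_var \<Sigma>) (CARD('n) - 1) 0"
    unfolding \<alpha>_def by (rule cform_lagerberg(1)[OF covector_ivol ivs, of R]) (simp add: R0 fun_eq_iff)
  have \<omega>c: "\<omega> = cform (\<lambda>x vs ws. (s * (\<kappa> x * \<kappa> x)) * (ivol v vs * ivol v ws))"
  proof (intro ext)
    fix P :: "'n pt" and vs ws
    show "\<omega> P vs ws = cform (\<lambda>x vs ws. (s * (\<kappa> x * \<kappa> x)) * (ivol v vs * ivol v ws)) P vs ws"
    proof (cases "\<exists>x. P = emb x")
      case True
      then obtain x where "P = emb x" by blast
      then show ?thesis by (simp add: \<omega>_def wedge_pure_def form_J_def \<alpha>_def cform_emb)
    next
      case False
      then show ?thesis by (simp add: \<omega>_def wedge_pure_def form_J_def \<alpha>_def cform_def)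
    qed
  qed
  have sm: "smooth (\<lambda>x. (s * (\<kappa> x * \<kappa> x)) * (ivol v vs * ivol v ws))" for vs ws
    by (intro smooth_mult smooth_const test_fun_smooth[OF \<kappa>])
  have \<omega>: "\<omega> \<in> lagerberg_forms \<Sigma> (trop_var \<Sigma>) (CARD('n) - 1) (CARD('n) - 1)"
    and supp: "supported_in \<omega> (emb ` cball 0 R)"
    unfolding \<omega>c using cform_lagerberg[OF covector_ivol2 sm, of R] R0 by (auto simp: fun_eq_iff)
  note K = compactin_emb[of R] supp
  have \<omega>T: "\<omega> \<in> TF" by (rule TF_I[OF \<omega> K])
  have pform: "positive_form \<Sigma> (trop_var \<Sigma>) (CARD('n) - 1) \<omega>"
    unfolding positive_form_def
  proof (intro conjI \<omega> exI)
    show "\<forall>j<1. smooth_function \<Sigma> (trop_var \<Sigma>) ((\<lambda>_ _. 1) j) \<and> (\<forall>P\<in>trop_var \<Sigma>. 0 \<le> (\<lambda>_ _. 1::real) j P) \<and>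
        (\<lambda>_. \<alpha>) j \<in> lagerberg_forms \<Sigma> (trop_var \<Sigma>) (CARD('n) - 1) 0"
      using smooth_function_const \<alpha> by simp
    show "\<omega> = (\<lambda>P vs ws. \<Sum>j<1::nat. (-1) ^ ((CARD('n) - 1) * (CARD('n) - 1 - 1) div 2) * (\<lambda>_ _. 1) j P *
        wedge_pure ((\<lambda>_. \<alpha>) j) (form_J ((\<lambda>_. \<alpha>) j)) P vs ws)"
      by (simp add: \<omega>_def s_def)
  qed
  define X where "X x = (\<Sum>l<CARD('n). (-1) ^ l * dirv (bvec l) (eta \<omega> l) x)" for x
  have cfw: "cf (\<omega> (emb x)) k l = (s * a k * a l) * ?r x" for x k l
    by (simp add: \<omega>c cform_emb cf_def a_def)
  have eta: "eta \<omega> l = (\<lambda>x. \<Sum>k<CARD('n). ((-1) ^ k * (s * a k * a l)) * dirv (bvec k) ?r x)" for l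
    unfolding eta_def[abs_def] cfw dirv_cmult[OF rs] by (simp add: mult.assoc)
  have "dirv (bvec l) (eta \<omega> l) x = (\<Sum>k<CARD('n). ((-1) ^ k * (s * a k * a l)) * dirv (bvec l) (dirv (bvec k) ?r) x)" for l x
    unfolding eta by (subst dirv_sum) (auto intro!: smooth_cmult smooth_dirv rs sum.cong dirv_cmult)
  then have "X x = s * (\<Sum>l<CARD('n). \<Sum>k<CARD('n). (-1) ^ (l + k) * dirv (bvec l) (dirv (bvec k) ?r) x * (a l * a k))" for x
    by (simp add: X_def sum_distrib_left power_add mult_ac)
  then have X: "X x = s * dirv v (dirv v ?r) x" for x
    unfolding hess_quadratic[OF rs] a_def vector_from_ivol by simp
  let ?D = "\<lambda>x. dirv v (dirv v ?r) x"
  have Dt: "test_fun ?D" by (intro test_fun_dirv r)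
  \<comment> \<open>The support meets no boundary stratum, so the hypothesis on \<open>g0\<close> at the boundary holds vacuously.\<close>
  have inv: "eventually (\<lambda>z. \<forall>s\<in>\<sigma>. g0 (z + s) = g0 z) (near \<sigma> x)" if "(\<sigma>, coset \<sigma> x) \<in> emb ` cball 0 R" for \<sigma> x
  proof -
    have "\<sigma> = {0}" using that by (auto simp: emb_eq)
    then show ?thesis by simp
  qed
  have "\<theta> \<omega> = ddc (trop_var \<Sigma>) g0 \<omega>"
    unfolding theta_hess[OF \<omega>T]
    by (rule ddc_eq_hess[OF g0_smooth \<omega> K, symmetric]) (use inv emb_trop_var in auto)
  also have "\<dots> = sgn_top TYPE('n) * (LINT x|lebesgue. g0 x * X x)"
    unfolding X_def by (rule ddc_formula) (use emb_trop_var in auto)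
  finally have t: "\<theta> \<omega> = sgn_top TYPE('n) * (LINT x|lebesgue. g0 x * X x)" .
  have d: "ddc (trop_var \<Sigma>) f \<omega> = sgn_top TYPE('n) * (LINT x|lebesgue. f x * X x)"
    unfolding X_def by (rule ddc_formula) (use emb_trop_var in auto)
  have "0 \<le> ddc (trop_var \<Sigma>) f \<omega> + \<theta> \<omega>"
    using pos \<omega>T pform unfolding positive_current_def f_def[abs_def] by blast
  also have "\<dots> = (sgn_top TYPE('n) * s) * ((LINT x|lebesgue. f x * ?D x) + (LINT x|lebesgue. g0 x * ?D x))"
    unfolding t d X by (simp add: mult.left_commute[of _ s] algebra_simps)
  also have "sgn_top TYPE('n) * s = 1" unfolding s_def by (rule sgn_top_pos)
  also have "(LINT x|lebesgue. f x * ?D x) + (LINT x|lebesgue. g0 x * ?D x) = (LINT x|lebesgue. u x * ?D x)"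
    using integrable_mult_test_fun(2)[OF f_locint Dt]
      integrable_mult_test_fun(2)[OF continuous_locally_integrable[OF g0_continuous] Dt]
    by (simp add: u_def distrib_right)
  finally show ?thesis by simp
qed

lemma phi_near_less:
  assumes "\<sigma> \<in> \<Sigma>" "\<phi> (\<sigma>, coset \<sigma> x) < ereal c"
  shows "eventually (\<lambda>z. f z < c) (near \<sigma> x)"
proof -
  have "{x::real^'n. emb x \<in> {}} \<in> null_sets lebesgue" by simp
  then have "\<phi> (\<sigma>, coset \<sigma> x) = Limsup (inf (nhdsin (trop_topology \<Sigma>) (\<sigma>, coset \<sigma> x)) (principal (- {}))) \<phi>"
    using susc coset_trop_var[OF assms(1)] unfolding strongly_usc_def by blast
  then have "Limsup (nhdsin (trop_topology \<Sigma>) (\<sigma>, coset \<sigma> x)) \<phi> < ereal c" using assms(2) by simp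
  from nhdsin_near[OF assms(1) Limsup_lessD[OF this]] show ?thesis by (simp add: phi_emb)
qed

text \<open>
  The exceptional set \<open>E\<close> may contain, besides the null set, the whole boundary of $N_\Sigma$;
  so boundary values of \<open>\<phi>\<close> are determined by its values almost everywhere on $N_{\mathbb
  R}$.
\<close>

lemma phi_le:
  assumes "\<sigma> \<in> \<Sigma>" "negligible N" "eventually (\<lambda>z. z \<notin> N \<longrightarrow> f z \<le> c) (near \<sigma> x)"
  shows "\<phi> (\<sigma>, coset \<sigma> x) \<le> ereal c"
proof -
  define E where "E = emb ` N \<union> - range (emb :: real^'n \<Rightarrow> 'n pt)"
  have "{x. emb x \<in> E} = N" by (auto simp: E_def emb_inj)
  then have "{x. emb x \<in> E} \<in> null_sets lebesgue" using assms(2) negligible_iff_null_sets by auto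
  then have "\<phi> (\<sigma>, coset \<sigma> x) = Limsup (inf (nhdsin (trop_topology \<Sigma>) (\<sigma>, coset \<sigma> x)) (principal (- E))) \<phi>"
    using susc coset_trop_var[OF assms(1)] unfolding strongly_usc_def by blast
  also have "\<dots> \<le> ereal c"
  proof (rule Limsup_bounded)
    have "eventually (\<lambda>Q. \<forall>z. Q = emb z \<longrightarrow> (z \<notin> N \<longrightarrow> f z \<le> c)) (nhdsin (trop_topology \<Sigma>) (\<sigma>, coset \<sigma> x))"
      by (rule near_nhdsin[OF assms(1,3)])
    then show "\<forall>\<^sub>F Q in inf (nhdsin (trop_topology \<Sigma>) (\<sigma>, coset \<sigma> x)) (principal (- E)). \<phi> Q \<le> ereal c"
      unfolding eventually_inf_principal
      by (rule eventually_mono) (auto simp: E_def phi_emb)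
  qed
  finally show ?thesis .
qed

lemma g0_tendsto: "(g0 \<longlongrightarrow> g0 x) (nhds x)"
  using g0_continuous by (simp add: continuous_on_eq_continuous_at isCont_def tendsto_nhds_iff)

lemma u_usc:
  assumes "u x < c" shows "eventually (\<lambda>z. u z < c) (nhds x)"
proof -
  define e where "e = (c - u x) / 2"
  have e: "e > 0" using assms by (simp add: e_def)
  have "\<phi> ({0}, coset {0} x) < ereal (f x + e)" using e phi_emb[of x] by (simp add: emb_def)
  from phi_near_less[OF zero_cone this] have "eventually (\<lambda>z. f z < f x + e) (nhds x)"
    unfolding eventually_near_zero .
  moreover have "eventually (\<lambda>z. g0 z < g0 x + e) (nhds x)"
    by (rule order_tendstoD(2)[OF g0_tendsto]) (use e in simp)
  ultimately show ?thesis
  proof eventually_elim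
    case (elim z)
    have "u z < u x + 2 * e" using elim by (simp add: u_def)
    moreover have "2 * e = c - u x" by (simp add: e_def)
    ultimately show ?case by linarith
  qed
qed

lemma u_strong:
  assumes "negligible N" "eventually (\<lambda>z. z \<notin> N \<longrightarrow> u z \<le> c) (nhds x)"
  shows "u x \<le> c"
proof (rule field_le_epsilon)
  fix e :: real assume e: "e > 0"
  have "eventually (\<lambda>z. g0 z > g0 x - e) (nhds x)"
    by (rule order_tendstoD(1)[OF g0_tendsto]) (use e in simp)
  with assms(2) have "eventually (\<lambda>z. z \<notin> N \<longrightarrow> f z \<le> c - g0 x + e) (nhds x)"
    by eventually_elim (auto simp: u_def)
  then have "eventually (\<lambda>z. z \<notin> N \<longrightarrow> f z \<le> c - g0 x + e) (near {0} x)" unfolding eventually_near_zero .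
  from phi_le[OF zero_cone assms(1) this] have "f x \<le> c - g0 x + e" using phi_emb[of x] by (simp add: emb_def)
  then show "u x \<le> c + e" by (simp add: u_def)
qed

lemma nhds_translate: "eventually P (nhds (x + d)) \<Longrightarrow> eventually (\<lambda>z. P (z + d)) (nhds (x :: real^'n))"
proof -
  have "((\<lambda>z. z + d) \<longlongrightarrow> x + d) (nhds x)" by (intro tendsto_intros filterlim_ident)
  then show "eventually P (nhds (x + d)) \<Longrightarrow> eventually (\<lambda>z. P (z + d)) (nhds x)"
    by (rule eventually_compose_filterlim[rotated])
qed

text \<open>
  For \<open>z\<close> near the intermediate point the translates \<open>z + p\<close> and \<open>z +
  q\<close> are near the end points, where upper semicontinuity bounds \<open>u\<close>. For almost all
  \<open>z\<close> the convexity inequality holds at these three points, and by strong upper semicontinuity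
  the resulting bound passes from almost all \<open>z\<close> to the intermediate point.
\<close>

lemma u_convex: "convex_on UNIV u"
proof (rule convex_onI)
  obtain N where N: "negligible N" "\<And>a b t. 0 \<le> t \<Longrightarrow> t \<le> 1 \<Longrightarrow> a \<notin> N \<Longrightarrow> b \<notin> N \<Longrightarrow> (1 - t) *\<^sub>R a + t *\<^sub>R b \<notin> N \<Longrightarrow>
      u ((1 - t) *\<^sub>R a + t *\<^sub>R b) \<le> (1 - t) * u a + t * u b"
    by (rule convex_almost_everywhere[OF u_locint positive_second_derivative], assumption, rule that)
  fix t :: real and x y :: "real^'n" assume t: "0 < t" "t < 1"
  let ?a = "(1 - t) *\<^sub>R x + t *\<^sub>R y"
  show "u ?a \<le> (1 - t) * u x + t * u y"
  proof (rule field_le_epsilon)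
    fix e :: real assume e: "e > 0"
    define p where "p = x - ?a"
    define q where "q = y - ?a"
    have "eventually (\<lambda>z. u z < u x + e) (nhds (?a + p))" "eventually (\<lambda>z. u z < u y + e) (nhds (?a + q))"
      using u_usc[of x "u x + e"] u_usc[of y "u y + e"] e by (auto simp: p_def q_def)
    then have ev: "eventually (\<lambda>z. u (z + p) < u x + e) (nhds ?a)" "eventually (\<lambda>z. u (z + q) < u y + e) (nhds ?a)"
      by (auto dest: nhds_translate)
    let ?N = "N \<union> ((+) (- p) ` N \<union> (+) (- q) ` N)"
    have neg: "negligible ?N" by (intro negligible_Un N(1) negligible_translation)
    show "u ?a \<le> (1 - t) * u x + t * u y + e"
    proof (rule u_strong[OF neg])
      from ev show "eventually (\<lambda>z. z \<notin> ?N \<longrightarrow> u z \<le> (1 - t) * u x + t * u y + e) (nhds ?a)"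
      proof eventually_elim
        case (elim z)
        show ?case
        proof
          assume z: "z \<notin> ?N"
          have zp: "z + p \<notin> N"
          proof
            assume "z + p \<in> N"
            then have "- p + (z + p) \<in> (+) (- p) ` N" by blast
            then show False using z by simp
          qed
          have zq: "z + q \<notin> N"
          proof
            assume "z + q \<in> N"
            then have "- q + (z + q) \<in> (+) (- q) ` N" by blast
            then show False using z by simp
          qed
          have pq: "(1 - t) *\<^sub>R p + t *\<^sub>R q = 0" by (simp add: p_def q_def algebra_simps)
          have "(1 - t) *\<^sub>R (z + p) + t *\<^sub>R (z + q) = z + ((1 - t) *\<^sub>R p + t *\<^sub>R q)" by (simp add: algebra_simps)
          then have zz: "(1 - t) *\<^sub>R (z + p) + t *\<^sub>R (z + q) = z" using pq by simp
          have "u z \<le> (1 - t) * u (z + p) + t * u (z + q)"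
            using N(2)[of t "z + p" "z + q"] t zp zq z unfolding zz by simp
          also have "\<dots> \<le> (1 - t) * (u x + e) + t * (u y + e)"
            using elim t by (intro add_mono mult_left_mono) auto
          finally show "u z \<le> (1 - t) * u x + t * u y + e" by (simp add: algebra_simps)
        qed
      qed
    qed
  qed
qed simp

lemma u_continuous: "continuous_on UNIV u"
  by (rule convex_on_continuous[OF open_UNIV u_convex])

text \<open>
  Since \<open>\<phi>\<close> is not \<open>\<infinity>\<close> at the point of $N(\sigma)$ below 0, it is
  bounded above near that point, so \<open>u\<close> is at most \<open>C - t (m \<bullet> s)\<close> on a
  ray \<open>s0 + t s\<close>. The point \<open>x + s\<close> is the limit of the points on the segments
  from \<open>x\<close> to \<open>s0 + j s\<close> that divide them in the ratio \<open>1 : j - 1\<close>;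
  convexity on these segments gives the claim in the limit.
\<close>

lemma u_growth:
  assumes s: "s \<in> \<sigma>" "\<sigma> \<in> \<Sigma>" and m: "slope_on \<Psi> \<sigma> m"
  shows "u (x + s) \<le> u x - m \<bullet> s"
proof -
  obtain c where c: "\<phi> (\<sigma>, coset \<sigma> 0) < ereal c"
    using not_infty[OF coset_trop_var[OF assms(2), of 0]] by (metis ereal_dense2 less_PInf_Ex_of_nat ereal_less_PInfty ereal_infty_less(1) not_le)
  have "eventually (\<lambda>z. f z < c \<and> (\<forall>s\<in>\<sigma>. g0 (z + s) + m \<bullet> (z + s) = g0 z + m \<bullet> z)) (near \<sigma> 0)"
    by (intro eventually_conj phi_near_less[OF assms(2) c] green_near[OF assms(2) m])
  from near_eventually_witness[OF cone[OF assms(2)] this] obtain s0 where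
    s0: "\<And>s. s \<in> \<sigma> \<Longrightarrow> f (s0 + s) < c" "\<And>s t. s \<in> \<sigma> \<Longrightarrow> t \<in> \<sigma> \<Longrightarrow> g0 (s0 + s + t) + m \<bullet> (s0 + s + t) = g0 (s0 + s) + m \<bullet> (s0 + s)"
    by auto
  define C where "C = c + g0 s0"
  have bound: "u (s0 + t *\<^sub>R s) \<le> C - t * (m \<bullet> s)" if "t \<ge> 0" for t
  proof -
    have ts: "t *\<^sub>R s \<in> \<sigma>" using cone_scale[OF assms(2) s(1) that] .
    have "g0 (s0 + t *\<^sub>R s) = g0 s0 - t * (m \<bullet> s)"
      using s0(2)[OF cone_zero[OF assms(2)] ts] by (simp add: inner_add_right)
    then show ?thesis using s0(1)[OF ts] by (simp add: u_def C_def)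
  qed
  let ?r = "\<lambda>j. inverse (real (Suc j))"
  let ?y = "\<lambda>j. (1 - ?r j) *\<^sub>R x + ?r j *\<^sub>R (s0 + real (Suc j) *\<^sub>R s)"
  have y: "?y j = x + s + ?r j *\<^sub>R (s0 - x)" for j
    by (simp add: algebra_simps del: of_nat_Suc)
  have le: "u (?y j) \<le> (1 - ?r j) * u x + ?r j * C - m \<bullet> s" for j
  proof -
    have r1: "0 \<le> ?r j" "?r j \<le> 1" by (auto simp: inverse_le_1_iff)
    have "u (?y j) \<le> (1 - ?r j) * u x + ?r j * u (s0 + real (Suc j) *\<^sub>R s)"
      using convex_onD[OF u_convex r1] by simp
    also have "\<dots> \<le> (1 - ?r j) * u x + ?r j * (C - real (Suc j) * (m \<bullet> s))"
      using r1 bound[of "real (Suc j)"] by (intro add_left_mono mult_left_mono) auto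
    also have "\<dots> = (1 - ?r j) * u x + ?r j * C - m \<bullet> s" by (simp add: right_diff_distrib del: of_nat_Suc)
    finally show ?thesis .
  qed
  have "(\<lambda>j. u (x + s + ?r j *\<^sub>R (s0 - x))) \<longlonglongrightarrow> u (x + s + 0 *\<^sub>R (s0 - x))"
  proof (rule continuous_on_tendsto_compose[OF u_continuous])
    show "(\<lambda>j. x + s + ?r j *\<^sub>R (s0 - x)) \<longlonglongrightarrow> x + s + 0 *\<^sub>R (s0 - x)"
      by (intro tendsto_intros LIMSEQ_inverse_real_of_nat)
  qed auto
  moreover have "(\<lambda>j. (1 - ?r j) * u x + ?r j * C - m \<bullet> s) \<longlonglongrightarrow> (1 - 0) * u x + 0 * C - m \<bullet> s"
    by (intro tendsto_intros LIMSEQ_inverse_real_of_nat)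
  ultimately have "u (x + s + 0 *\<^sub>R (s0 - x)) \<le> (1 - 0) * u x + 0 * C - m \<bullet> s"
    by (rule LIMSEQ_le) (use le[unfolded y] in blast)
  then show ?thesis by simp
qed

end

section \<open>Smoothing convex functions of given growth\<close>

context tropical_variety
begin

text \<open>
  Convex functions with recession function at most \<open>H\<close> that grow exactly like \<open>H\<close>
  far along each cone, uniformly on balls. When \<open>H = - \<Psi>\<close> such a function differs from
  \<open>g0\<close> by a function that extends to $N_\Sigma$.
\<close>

definition admissible :: "(real^'n \<Rightarrow> real) \<Rightarrow> (real^'n \<Rightarrow> real) \<Rightarrow> bool" where
  "admissible H v \<longleftrightarrow> convex_on UNIV v \<and> (\<forall>x s. v (x + s) \<le> v x + H s) \<and>
    (\<forall>\<sigma>\<in>\<Sigma>. \<forall>R. \<exists>s0\<in>\<sigma>. \<forall>z s. norm z \<le> R \<longrightarrow> s \<in> \<sigma> \<longrightarrow> v (z + s0 + s) = v (z + s0) + H s)"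

lemma admissible_add_const:
  assumes "admissible H v" shows "admissible H (\<lambda>x. v x + c)"
proof -
  have "convex_on UNIV (\<lambda>x. v x + c)"
  proof (rule convex_onI)
    fix t :: real and x y :: "real^'n" assume "0 < t" "t < 1"
    then have "v ((1 - t) *\<^sub>R x + t *\<^sub>R y) \<le> (1 - t) * v x + t * v y"
      using assms convex_onD[of UNIV v t x y] by (simp add: admissible_def)
    then show "v ((1 - t) *\<^sub>R x + t *\<^sub>R y) + c \<le> (1 - t) * (v x + c) + t * (v y + c)"
      by (simp add: algebra_simps)
  qed simp
  then show ?thesis using assms by (simp add: admissible_def algebra_simps)
qed

end

locale concave_setting = green_setting \<Sigma> \<Psi> g0 \<theta>
  for \<Sigma> :: "(real^'n) set set" and \<Psi> g0 \<theta> +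
  assumes concave: "concave_on UNIV \<Psi>"
begin

definition H :: "real^'n \<Rightarrow> real" where "H x = - \<Psi> x"

lemma H_slope: "slope_on \<Psi> \<sigma> m \<Longrightarrow> s \<in> \<sigma> \<Longrightarrow> H s = - (m \<bullet> s)"
  by (simp add: slope_on_def H_def)

lemma H_add_on_cone: "\<sigma> \<in> \<Sigma> \<Longrightarrow> x \<in> \<sigma> \<Longrightarrow> s \<in> \<sigma> \<Longrightarrow> H (x + s) = H x + H s"
proof -
  assume s: "\<sigma> \<in> \<Sigma>" "x \<in> \<sigma>" "s \<in> \<sigma>"
  obtain m where m: "slope_on \<Psi> \<sigma> m" using slope_ex[OF s(1)] by blast
  show "H (x + s) = H x + H s"
    using H_slope[OF m s(2)] H_slope[OF m s(3)] H_slope[OF m cone_add[OF s]] by (simp add: inner_add_right)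
qed

lemma H_scale: "0 \<le> c \<Longrightarrow> H (c *\<^sub>R x) = c * H x"
proof -
  assume c: "0 \<le> c"
  obtain \<sigma> where s: "\<sigma> \<in> \<Sigma>" "x \<in> \<sigma>" using complete_cover by blast
  obtain m where m: "slope_on \<Psi> \<sigma> m" using slope_ex[OF s(1)] by blast
  show "H (c *\<^sub>R x) = c * H x" using H_slope[OF m s(2)] H_slope[OF m cone_scale[OF s c]] by simp
qed

lemma H_convex: "convex_on UNIV H"
  using concave by (simp add: concave_on_def H_def[abs_def])

text \<open>
  Convexity at the midpoint of \<open>2 x\<close> and \<open>2 s\<close>, with positive homogeneity.
\<close>

lemma H_sublinear: "H (x + s) \<le> H x + H s"
proof -
  have "H ((1 - 1/2) *\<^sub>R (2 *\<^sub>R x) + (1/2) *\<^sub>R (2 *\<^sub>R s)) \<le> (1 - 1/2) * H (2 *\<^sub>R x) + (1/2) * H (2 *\<^sub>R s)"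
    by (rule convex_onD[OF H_convex]) auto
  then show ?thesis by (simp add: H_scale)
qed

lemma H_zero: "H 0 = 0" using H_scale[of 0 0] by simp

lemma H_bound: "\<exists>L\<ge>0. \<forall>x. \<bar>H x\<bar> \<le> L * norm x"
proof -
  have "\<forall>\<sigma>\<in>\<Sigma>. \<exists>m. slope_on \<Psi> \<sigma> m" using slope_ex by blast
  from bchoice[OF this] obtain m where m: "\<forall>\<sigma>\<in>\<Sigma>. slope_on \<Psi> \<sigma> (m \<sigma>)" ..
  let ?L = "\<Sum>\<sigma>\<in>\<Sigma>. norm (m \<sigma>)"
  have "\<bar>H x\<bar> \<le> ?L * norm x" for x
  proof -
    obtain \<sigma> where s: "\<sigma> \<in> \<Sigma>" "x \<in> \<sigma>" using complete_cover by blast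
    have "\<bar>H x\<bar> \<le> norm (m \<sigma>) * norm x" using H_slope[of \<sigma> "m \<sigma>" x] m s Cauchy_Schwarz_ineq2 by auto
    also have "norm (m \<sigma>) \<le> ?L" by (rule member_le_sum[OF s(1)]) (use finite_fan in auto)
    then have "norm (m \<sigma>) * norm x \<le> ?L * norm x" by (intro mult_right_mono) auto
    finally show ?thesis .
  qed
  then show ?thesis by (intro exI[of _ ?L]) (simp add: sum_nonneg)
qed

text \<open>
  Deep in direction \<open>\<sigma>\<close> all points lie in cones that contain \<open>\<sigma>\<close>,
  and there \<open>H\<close> is additive.
\<close>

lemma H_deep:
  assumes "\<sigma> \<in> \<Sigma>"
  shows "\<exists>s0\<in>\<sigma>. \<forall>z s. norm z \<le> R \<longrightarrow> s \<in> \<sigma> \<longrightarrow> H (z + s0 + s) = H (z + s0) + H s"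
proof -
  obtain s0 where s0: "s0 \<in> \<sigma>" "\<And>z. norm z \<le> R \<Longrightarrow> \<exists>\<tau>\<in>\<Sigma>. \<sigma> \<subseteq> \<tau> \<and> z + s0 \<in> \<tau>"
    using deep_point[OF assms, of R] by blast
  have "H (z + s0 + s) = H (z + s0) + H s" if "norm z \<le> R" "s \<in> \<sigma>" for z s
    using s0(2)[OF that(1)] H_add_on_cone that(2) by blast
  with s0(1) show ?thesis by blast
qed

lemma H_admissible: "admissible H H"
  unfolding admissible_def using H_convex H_sublinear H_deep by blast

lemma admissible_continuous: "admissible H v \<Longrightarrow> continuous_on UNIV v"
  by (rule convex_on_continuous[OF open_UNIV]) (simp add: admissible_def)

lemma admissible_near:
  assumes "admissible H w" "\<sigma> \<in> \<Sigma>"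
  shows "eventually (\<lambda>z. \<forall>s\<in>\<sigma>. w (z + s) = w z + H s) (near \<sigma> x)"
proof (rule near_of_deep[OF assms(2)])
  fix R
  obtain s0 where s0: "s0 \<in> \<sigma>" "\<And>z s. norm z \<le> R \<Longrightarrow> s \<in> \<sigma> \<Longrightarrow> w (z + s0 + s) = w (z + s0) + H s"
    using assms unfolding admissible_def by blast
  have "w (z + s0 + s + t) = w (z + s0 + s) + H t" if "norm z \<le> R" "s \<in> \<sigma>" "t \<in> \<sigma>" for z s t
    using s0(2)[OF that(1,2)] s0(2)[OF that(1) cone_add[OF assms(2) that(2,3)]]
      H_add_on_cone[OF assms(2) that(2,3)] by (simp add: add.assoc)
  with s0(1) show "\<exists>s0\<in>\<sigma>. \<forall>z s. norm z \<le> R \<longrightarrow> s \<in> \<sigma> \<longrightarrow> (\<forall>t\<in>\<sigma>. w (z + s0 + s + t) = w (z + s0 + s) + H t)" by blast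
qed

lemma admissible_tame:
  assumes "admissible H w" shows "tame (\<lambda>x. w x - g0 x)"
  unfolding tame_def
proof (intro ballI allI)
  fix \<sigma> x assume s: "\<sigma> \<in> \<Sigma>"
  obtain m where m: "slope_on \<Psi> \<sigma> m" using slope_ex[OF s] by blast
  from admissible_near[OF assms s] green_near[OF s m]
  show "eventually (\<lambda>z. \<forall>s\<in>\<sigma>. w (z + s) - g0 (z + s) = w z - g0 z) (near \<sigma> x)"
  proof eventually_elim
    case (elim z)
    show ?case
    proof
      fix t assume t: "t \<in> \<sigma>"
      have "w (z + t) = w z - m \<bullet> t" using elim(1) H_slope[OF m t] t by simp
      moreover have "g0 (z + t) = g0 z - m \<bullet> t" using bspec[OF elim(2) t] unfolding inner_add_right by linarith
      ultimately show "w (z + t) - g0 (z + t) = w z - g0 z" by simp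
    qed
  qed
qed

text \<open>
  Every condition in the definition of \<open>admissible\<close> is an inequality or identity between
  translates, so it passes to averages over translates. The bounds express that \<open>v\<close> changes by
  at most \<open>L * e\<close> over a distance \<open>e\<close>.
\<close>

lemma admissible_smoothing:
  assumes v: "admissible H v" and \<rho>: "mollifier e \<rho>"
    and L: "L \<ge> 0" "\<And>x. \<bar>H x\<bar> \<le> L * norm x"
  shows "smooth (conv v \<rho>)" "admissible H (conv v \<rho>)"
    "conv v \<rho> x \<le> v x + L * e" "v x - L * e \<le> conv v \<rho> x"
proof -
  have c: "continuous_on UNIV v" by (rule admissible_continuous[OF v])
  have m: "v \<in> borel_measurable borel" by (rule borel_measurable_continuous_onI[OF c])
  have li: "locally_integrable v" by (rule continuous_locally_integrable[OF c])
  have t: "test_fun \<rho>" and p: "\<And>x. 0 \<le> \<rho> x" using \<rho> by (auto simp: mollifier_def)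
  have gr: "v (x + s) \<le> v x + H s" for x s using v by (simp add: admissible_def)
  show "smooth (conv v \<rho>)" by (rule smooth_conv[OF li t])
  have He: "\<bar>H x\<bar> \<le> L * e" if "norm x < e" for x
    using L(2)[of x] mult_left_mono[of "norm x" e L] that L(1) by linarith
  show "conv v \<rho> x \<le> v x + L * e"
  proof (rule conv_bounds(1)[OF m li \<rho>])
    fix y :: "real^'n" assume "norm y < e"
    then show "v (x + y) \<le> v x + L * e" using gr[of x y] He[of y] by linarith
  qed
  show "v x - L * e \<le> conv v \<rho> x"
  proof (rule conv_bounds(2)[OF m li \<rho>])
    fix y :: "real^'n" assume "norm y < e"
    then show "v x - L * e \<le> v (x + y)" using gr[of "x + y" "-y"] He[of "-y"] by simp
  qed
  note alt = conv_alt[OF m li t]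
  have "convex_on UNIV (conv v \<rho>)"
  proof (rule convex_onI)
    fix s :: real and a b :: "real^'n" assume s: "0 < s" "s < 1"
    let ?c = "(1 - s) *\<^sub>R a + s *\<^sub>R b"
    have le: "v (?c - x) * \<rho> x \<le> (1 - s) * (v (a - x) * \<rho> x) + s * (v (b - x) * \<rho> x)" for x
    proof -
      have "?c - x = (1 - s) *\<^sub>R (a - x) + s *\<^sub>R (b - x)" by (simp add: algebra_simps)
      then have "v (?c - x) \<le> (1 - s) * v (a - x) + s * v (b - x)"
        using v s convex_onD[of UNIV v s "a - x" "b - x"] by (simp add: admissible_def)
      from mult_right_mono[OF this p[of x]] show ?thesis by (simp add: algebra_simps)
    qed
    have "conv v \<rho> ?c \<le> (LINT x|lebesgue. (1 - s) * (v (a - x) * \<rho> x) + s * (v (b - x) * \<rho> x))"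
      unfolding alt(1)[of ?c] by (rule integral_mono) (use alt(2) le in auto)
    also have "\<dots> = (1 - s) * conv v \<rho> a + s * conv v \<rho> b" using alt(2) by (simp add: alt(1))
    finally show "conv v \<rho> ?c \<le> (1 - s) * conv v \<rho> a + s * conv v \<rho> b" .
  qed simp
  moreover have "conv v \<rho> (x + s) \<le> conv v \<rho> x + H s" for x s
  proof (rule conv_le[OF m li \<rho>])
    fix y :: "real^'n"
    show "v (x + s + y) \<le> v (x + y) + H s" using gr[of "x + y" s] by (simp add: algebra_simps)
  qed
  moreover have "\<exists>s0\<in>\<sigma>. \<forall>z s. norm z \<le> R \<longrightarrow> s \<in> \<sigma> \<longrightarrow> conv v \<rho> (z + s0 + s) = conv v \<rho> (z + s0) + H s"
    if s: "\<sigma> \<in> \<Sigma>" for \<sigma> R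
  proof -
    obtain s0 where s0: "s0 \<in> \<sigma>" "\<And>z s. norm z \<le> R + e \<Longrightarrow> s \<in> \<sigma> \<Longrightarrow> v (z + s0 + s) = v (z + s0) + H s"
      using v s unfolding admissible_def by blast
    have "conv v \<rho> (z + s0 + s) = conv v \<rho> (z + s0) + H s" if "norm z \<le> R" "s \<in> \<sigma>" for z s
    proof (rule conv_translate[OF m li \<rho>])
      fix y :: "real^'n" assume "norm y < e"
      then have "norm (z + y) \<le> R + e" using that(1) norm_triangle_ineq[of z y] by linarith
      from s0(2)[OF this that(2)] show "v (z + s0 + s + y) = v (z + s0 + y) + H s" by (simp add: algebra_simps)
    qed
    with s0(1) show ?thesis by blast
  qed
  ultimately show "admissible H (conv v \<rho>)" unfolding admissible_def by blast
qed

lemma smooth_theta_psh: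
  assumes "admissible H w" "smooth w"
  shows "smooth_function \<Sigma> (trop_var \<Sigma>) (ext (\<lambda>x. w x - g0 x))"
    and "theta_psh \<Sigma> \<theta> (\<lambda>P. ereal (ext (\<lambda>x. w x - g0 x) P))"
  using ext_smooth[OF admissible_tame[OF assms(1)] smooth_diff[OF assms(2) g0_smooth]]
    theta_psh_of_convex[OF assms(2) _ admissible_tame[OF assms(1)]] assms(1)
  by (auto simp: admissible_def)

text \<open>
  Relations between tame functions that hold on $N_{\mathbb R}$ hold between their extensions, because both
  boundary values are attained at a common point.
\<close>

lemma ext_witness:
  assumes "tame f" "tame g" "P \<in> trop_var \<Sigma>"
  shows "\<exists>z. ext f P = f z \<and> ext g P = g z"
proof -
  obtain \<sigma> x where P: "\<sigma> \<in> \<Sigma>" "P = (\<sigma>, coset \<sigma> x)" using assms(3) by (rule trop_var_cases)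
  from near_eventually_witness[OF cone[OF P(1)] eventually_conj[OF tame_near_ext[OF assms(1) P(1)] tame_near_ext[OF assms(2) P(1)]]]
  obtain s0 where s0: "s0 \<in> \<sigma>" "\<And>s. s \<in> \<sigma> \<Longrightarrow> ext f (\<sigma>, coset \<sigma> (x + s0 + s)) = f (x + s0 + s) \<and> ext g (\<sigma>, coset \<sigma> (x + s0 + s)) = g (x + s0 + s)"
    using P(1) face_self[OF P(1)] by blast
  have "coset \<sigma> (x + s0) = coset \<sigma> x" using s0(1) by (simp add: coset_shift span_base)
  then show ?thesis using s0(2)[OF cone_zero[OF P(1)]] P(2) by (intro exI[of _ "x + s0"]) simp
qed

lemma ext_mono:
  assumes "tame f" "tame g" "\<And>x. f x \<le> g x" "P \<in> trop_var \<Sigma>" shows "ext f P \<le> ext g P"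
  using ext_witness[OF assms(1,2,4)] assms(3) by auto

text \<open>
  One smooth \<open>\<theta>\<close>-psh function exists, namely that of the mollified \<open>H\<close>;
  subtracting \<open>k\<close> from it gives a sequence that decreases to \<open>-\<infinity>\<close>.
\<close>

lemma approximation_minus_infinity:
  assumes "\<And>P. P \<in> trop_var \<Sigma> \<Longrightarrow> \<phi> P = -\<infinity>"
  shows "\<exists>h :: nat \<Rightarrow> 'n pt \<Rightarrow> real.
    (\<forall>k. smooth_function \<Sigma> (trop_var \<Sigma>) (h k) \<and> theta_psh \<Sigma> \<theta> (\<lambda>P. ereal (h k P))) \<and>
    (\<forall>k. \<forall>P \<in> trop_var \<Sigma>. h (Suc k) P \<le> h k P) \<and>
    (\<forall>P \<in> trop_var \<Sigma>. (\<lambda>k. ereal (h k P)) \<longlonglongrightarrow> \<phi> P)"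
proof -
  obtain \<rho> :: "real^'n \<Rightarrow> real" where \<rho>: "mollifier 1 \<rho>" using mollifier_exists[of 1] by auto
  obtain L where L: "L \<ge> 0" "\<And>x. \<bar>H x\<bar> \<le> L * norm x" using H_bound by blast
  note w = admissible_smoothing[OF H_admissible \<rho> L]
  define w where "w k x = conv H \<rho> x + (- real k)" for k x
  have ad: "admissible H (w k)" for k unfolding w_def by (rule admissible_add_const[OF w(2)])
  have sm: "smooth (w k)" for k unfolding w_def by (rule smooth_add[OF w(1) smooth_const])
  let ?h = "\<lambda>k. ext (\<lambda>x. w k x - g0 x)"
  have hk: "?h k P = ?h 0 P - real k" if P: "P \<in> trop_var \<Sigma>" for k P
    using ext_witness[OF admissible_tame[OF ad[of k]] admissible_tame[OF ad[of 0]] P] by (auto simp: w_def)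
  show ?thesis
  proof (intro exI[of _ ?h] conjI allI ballI)
    show "smooth_function \<Sigma> (trop_var \<Sigma>) (?h k)" "theta_psh \<Sigma> \<theta> (\<lambda>P. ereal (?h k P))" for k
      using smooth_theta_psh[OF ad sm] by auto
    show "?h (Suc k) P \<le> ?h k P" if "P \<in> trop_var \<Sigma>" for k P using hk[OF that, of k] hk[OF that, of "Suc k"] by simp
    show "(\<lambda>k. ereal (?h k P)) \<longlonglongrightarrow> \<phi> P" if P: "P \<in> trop_var \<Sigma>" for P
    proof -
      show ?thesis unfolding assms[OF P] tendsto_MInfty
      proof
        fix r
        show "\<forall>\<^sub>F k in sequentially. ereal (?h k P) < ereal r"
        proof (rule eventually_sequentiallyI[of "nat \<lceil>?h 0 P - r\<rceil> + 1"])
          fix k assume "nat \<lceil>?h 0 P - r\<rceil> + 1 \<le> k"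
          then have "?h 0 P - r < real k" by linarith
          then show "ereal (?h k P) < ereal r" using hk[OF P, of k] by simp
        qed
      qed
    qed
  qed
qed

end

section \<open>Decreasing approximation\<close>

locale concave_psh_setting = concave_setting \<Sigma> \<Psi> g0 \<theta> + psh_setting \<Sigma> \<Psi> g0 \<theta> \<phi>
  for \<Sigma> :: "(real^'n) set set" and \<Psi> g0 \<theta> \<phi>
begin

lemma u_le: "u (x + s) \<le> u x + H s"
proof -
  obtain \<sigma> where s: "\<sigma> \<in> \<Sigma>" "s \<in> \<sigma>" using complete_cover by blast
  obtain m where m: "slope_on \<Psi> \<sigma> m" using slope_ex[OF s(1)] by blast
  show ?thesis using u_growth[OF s(2,1) m, of x] H_slope[OF m s(2)] by simp
qed

text \<open>
  The infimal convolution of \<open>H\<close> with the restriction of \<open>u\<close> to a ball: the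
  largest function below \<open>u\<close> on that ball that grows at most like \<open>H\<close>. As
  \<open>u\<close> itself grows at most like \<open>H\<close>, the two agree on the ball.
\<close>

definition v :: "nat \<Rightarrow> real^'n \<Rightarrow> real" where
  "v k x = (INF y\<in>cball 0 (real k). u y + H (x - y))"

lemma v_lower: "u x \<le> u y + H (x - y)"
  using u_le[of y "x - y"] by simp

lemma v_bdd: "bdd_below ((\<lambda>y. u y + H (x - y)) ` cball 0 (real k))"
  using v_lower by (intro bdd_belowI2)

lemma v_le: "norm y \<le> real k \<Longrightarrow> v k x \<le> u y + H (x - y)"
  unfolding v_def by (rule cINF_lower[OF v_bdd]) simp

lemma v_greatest: "(\<And>y. norm y \<le> real k \<Longrightarrow> c \<le> u y + H (x - y)) \<Longrightarrow> c \<le> v k x"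
  unfolding v_def by (rule cINF_greatest) auto

lemma v_ge_u: "u x \<le> v k x" by (rule v_greatest) (rule v_lower)

lemma v_eq_u: "norm x \<le> real k \<Longrightarrow> v k x = u x"
  using v_le[of x k x] v_ge_u[of x k] by (simp add: H_zero)

lemma v_Suc: "v (Suc k) x \<le> v k x"
  by (rule v_greatest) (rule v_le, simp)

text \<open>
  Convexity, sublinear growth and exactness of the growth far along cones are inherited from
  \<open>H\<close>, the last because the centres \<open>y\<close> range over a bounded set; infimal
  convolution with the unrestricted \<open>u\<close> would lose it.
\<close>

lemma v_admissible: "admissible H (v k)"
  unfolding admissible_def
proof (intro conjI allI ballI)
  show "convex_on UNIV (v k)"
  proof (rule convex_onI)
    fix t :: real and a b :: "real^'n" assume t: "0 < t" "t < 1"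
    let ?c = "(1 - t) *\<^sub>R a + t *\<^sub>R b"
    have pair: "v k ?c \<le> (1 - t) * (u y + H (a - y)) + t * (u z + H (b - z))"
      if "norm y \<le> real k" "norm z \<le> real k" for y z :: "real^'n"
    proof -
      let ?y = "(1 - t) *\<^sub>R y + t *\<^sub>R z"
      have "?y \<in> cball 0 (real k)"
        using convex_cball[of "0::real^'n" "real k", unfolded convex_alt] that t by simp
      then have "v k ?c \<le> u ?y + H (?c - ?y)" by (intro v_le) simp
      also have "?c - ?y = (1 - t) *\<^sub>R (a - y) + t *\<^sub>R (b - z)" by (simp add: algebra_simps)
      also have "u ?y + H ((1 - t) *\<^sub>R (a - y) + t *\<^sub>R (b - z)) \<le>
          ((1 - t) * u y + t * u z) + ((1 - t) * H (a - y) + t * H (b - z))"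
        using convex_onD[OF u_convex, of t y z] convex_onD[OF H_convex, of t "a - y" "b - z"] t by (intro add_mono) auto
      finally show ?thesis by (simp add: algebra_simps)
    qed
    \<comment> \<open>The two infima are taken one after the other, after solving for the term with \<open>y\<close> and then for that with \<open>z\<close>.\<close>
    have step: "(v k ?c - t * (u z + H (b - z))) / (1 - t) \<le> v k a" if z: "norm z \<le> real k" for z :: "real^'n"
    proof (rule v_greatest)
      fix y :: "real^'n" assume "norm y \<le> real k"
      from pair[OF this z] show "(v k ?c - t * (u z + H (b - z))) / (1 - t) \<le> u y + H (a - y)"
        using t by (simp add: field_simps)
    qed
    have "(v k ?c - (1 - t) * v k a) / t \<le> v k b"
    proof (rule v_greatest)
      fix z :: "real^'n" assume "norm z \<le> real k"
      from step[OF this] show "(v k ?c - (1 - t) * v k a) / t \<le> u z + H (b - z)"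
        using t by (simp add: field_simps)
    qed
    then show "v k ?c \<le> (1 - t) * v k a + t * v k b" using t by (simp add: field_simps)
  qed simp
  show gr: "v k (x + s) \<le> v k x + H s" for x s
  proof -
    have "v k (x + s) - H s \<le> v k x"
    proof (rule v_greatest)
      fix y :: "real^'n" assume "norm y \<le> real k"
      then have "v k (x + s) \<le> u y + H (x + s - y)" by (rule v_le)
      also have "x + s - y = (x - y) + s" by simp
      finally show "v k (x + s) - H s \<le> u y + H (x - y)" using H_sublinear[of "x - y" s] by linarith
    qed
    then show ?thesis by simp
  qed
  fix \<sigma> R assume s: "\<sigma> \<in> \<Sigma>"
  obtain s0 where s0: "s0 \<in> \<sigma>" "\<And>z s. norm z \<le> R + real k \<Longrightarrow> s \<in> \<sigma> \<Longrightarrow> H (z + s0 + s) = H (z + s0) + H s"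
    using H_deep[OF s, of "R + real k"] by blast
  have "v k (z + s0 + s) = v k (z + s0) + H s" if z: "norm z \<le> R" and t: "s \<in> \<sigma>" for z s
  proof (rule antisym[OF gr], rule v_greatest)
    fix y :: "real^'n" assume y: "norm y \<le> real k"
    then have n: "norm (z - y) \<le> R + real k" using z norm_triangle_ineq4[of z y] by linarith
    have "v k (z + s0) + H s \<le> u y + H (z + s0 - y) + H s" using v_le[OF y] by simp
    also have "z + s0 - y = z - y + s0" by simp
    also have "u y + H (z - y + s0) + H s = u y + H (z - y + s0 + s)" using s0(2)[OF n t] by simp
    also have "z - y + s0 + s = z + s0 + s - y" by simp
    finally show "v k (z + s0) + H s \<le> u y + H (z + s0 + s - y)" .
  qed
  with s0(1) show "\<exists>s0\<in>\<sigma>. \<forall>z s. norm z \<le> R \<longrightarrow> s \<in> \<sigma> \<longrightarrow> v k (z + s0 + s) = v k (z + s0) + H s" by blast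
qed

text \<open>
  On $N_{\mathbb R}$ the functions \<open>w k\<close> decrease to \<open>u\<close>. At a boundary point the
  values stay above \<open>\<phi>\<close> by strong upper semicontinuity. For the upper bound, \<open>w k -
  g0\<close> does not increase along \<open>\<sigma>\<close> once \<open>g0\<close> is linear there, so the
  boundary value of the approximant is at most its value at a fixed deep point, where it converges to the
  value of \<open>\<phi>\<close>; and \<open>\<phi>\<close> is below \<open>c\<close> at deep points if it
  is below \<open>c\<close> at the boundary point.
\<close>

lemma approximation:
  shows "\<exists>h :: nat \<Rightarrow> 'n pt \<Rightarrow> real.
    (\<forall>k. smooth_function \<Sigma> (trop_var \<Sigma>) (h k) \<and> theta_psh \<Sigma> \<theta> (\<lambda>P. ereal (h k P))) \<and>
    (\<forall>k. \<forall>P \<in> trop_var \<Sigma>. h (Suc k) P \<le> h k P) \<and>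
    (\<forall>P \<in> trop_var \<Sigma>. (\<lambda>k. ereal (h k P)) \<longlonglongrightarrow> \<phi> P)"
proof -
  obtain L where L: "L \<ge> 0" "\<And>x. \<bar>H x\<bar> \<le> L * norm x" using H_bound by blast
  define e :: "nat \<Rightarrow> real" where "e k = (1/2) ^ k" for k
  have e: "e k > 0" for k by (simp add: e_def)
  have "\<forall>k. \<exists>\<rho>::real^'n \<Rightarrow> real. mollifier (e k) \<rho>" using mollifier_exists[OF e] by blast
  then obtain \<rho> :: "nat \<Rightarrow> real^'n \<Rightarrow> real" where \<rho>: "\<And>k. mollifier (e k) (\<rho> k)" by metis
  \<comment> \<open>Smoothing moves \<open>v k\<close> by at most \<open>L e\<^sub>k\<close>, so \<open>w k\<close> lies between \<open>v k + 2 L e\<^sub>k\<close> and \<open>v k + 4 L e\<^sub>k\<close>.  As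
    \<open>4 L e\<^sub>k\<^sub>+\<^sub>1 = 2 L e\<^sub>k\<close>, the sequence decreases.\<close>
  define w where "w k x = conv (v k) (\<rho> k) x + 3 * L * e k" for k x
  note sm = admissible_smoothing[OF v_admissible \<rho> L]
  have ad: "admissible H (w k)" for k unfolding w_def by (rule admissible_add_const[OF sm(2)])
  have smw: "smooth (w k)" for k unfolding w_def by (rule smooth_add[OF sm(1) smooth_const])
  have w_upper: "w k x \<le> v k x + 4 * L * e k" for k x
    using admissible_smoothing(3)[OF v_admissible[of k] \<rho>[of k] L, of x] by (simp add: w_def)
  have w_lower: "v k x + 2 * L * e k \<le> w k x" for k x
    using admissible_smoothing(4)[OF v_admissible[of k] \<rho>[of k] L, of x] by (simp add: w_def)
  have Le: "0 \<le> L * e k" for k using L(1) e[of k] by simp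
  have w_u: "u x \<le> w k x" for k x using w_lower[of k x] v_ge_u[of x k] Le[of k] by linarith
  have w_Suc: "w (Suc k) x \<le> w k x" for k x
  proof -
    have "4 * L * e (Suc k) = 2 * L * e k" by (simp add: e_def)
    then show ?thesis using w_upper[of "Suc k" x] w_lower[of k x] v_Suc[of k x] by linarith
  qed
  have w_lim: "(\<lambda>k. w k x) \<longlonglongrightarrow> u x" for x
  proof (rule tendsto_sandwich[of "\<lambda>k. u x" _ _ "\<lambda>k. u x + 4 * L * e k"])
    show "\<forall>\<^sub>F k in sequentially. u x \<le> w k x" using w_u by simp
    have "\<forall>\<^sub>F k in sequentially. norm x \<le> real k" by (rule eventually_sequentiallyI[of "nat \<lceil>norm x\<rceil>"]) linarith
    then show "\<forall>\<^sub>F k in sequentially. w k x \<le> u x + 4 * L * e k"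
      by (rule eventually_mono) (use w_upper v_eq_u in metis)
    have "(\<lambda>k. u x + 4 * L * e k) \<longlonglongrightarrow> u x + 4 * L * 0"
      unfolding e_def by (intro tendsto_intros LIMSEQ_power_zero) simp
    then show "(\<lambda>k. u x + 4 * L * e k) \<longlonglongrightarrow> u x" by simp
  qed simp
  define F where "F k = (\<lambda>x. w k x - g0 x)" for k
  have Ft: "tame (F k)" for k unfolding F_def by (rule admissible_tame[OF ad])
  have Fc: "continuous_on UNIV (F k)" for k
    unfolding F_def by (intro continuous_on_diff smooth_continuous smw g0_smooth)
  show ?thesis
  proof (intro exI[of _ "\<lambda>k. ext (F k)"] conjI allI ballI)
    show "smooth_function \<Sigma> (trop_var \<Sigma>) (ext (F k))" "theta_psh \<Sigma> \<theta> (\<lambda>P. ereal (ext (F k) P))" for k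
      unfolding F_def using smooth_theta_psh[OF ad smw] by auto
    show "ext (F (Suc k)) P \<le> ext (F k) P" if "P \<in> trop_var \<Sigma>" for k P
      by (rule ext_mono[OF Ft Ft _ that]) (simp add: F_def w_Suc)
    fix P assume "P \<in> trop_var \<Sigma>"
    then obtain \<sigma> x where P: "\<sigma> \<in> \<Sigma>" "P = (\<sigma>, coset \<sigma> x)" by (rule trop_var_cases)
    obtain m where m: "slope_on \<Psi> \<sigma> m" using slope_ex[OF P(1)] by blast
    have lower: "\<phi> P \<le> ereal (ext (F k) P)" for k
    proof (rule ereal_le_epsilon2)
      fix d :: real assume d: "0 < d"
      have "eventually (\<lambda>z. z \<notin> {} \<longrightarrow> f z \<le> ext (F k) P + d) (near \<sigma> x)"
        using near_ext_close[OF Ft Fc P(1) d, of k x]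
      proof (rule eventually_mono, intro impI)
        fix z assume "\<bar>F k z - ext (F k) (\<sigma>, coset \<sigma> x)\<bar> < d"
        moreover have "f z \<le> F k z" using w_u[of z k] by (simp add: F_def u_def)
        ultimately show "f z \<le> ext (F k) P + d" using P(2) by simp
      qed
      from phi_le[OF P(1) _ this] P(2) show "\<phi> P \<le> ereal (ext (F k) P) + ereal d" by simp
    qed
    have upper: "\<forall>\<^sub>F k in sequentially. ext (F k) P < c" if c: "\<phi> P < ereal c" for c
    proof -
      have "eventually (\<lambda>z. f z < c \<and> (\<forall>s\<in>\<sigma>. g0 (z + s) + m \<bullet> (z + s) = g0 z + m \<bullet> z)) (near \<sigma> x)"
        using c P(2) by (intro eventually_conj phi_near_less[OF P(1)] green_near[OF P(1) m]) simp
      from near_eventually_witness[OF cone[OF P(1)] this] obtain s0 where s0: "s0 \<in> \<sigma>" and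
        z: "f (x + s0) < c" "\<And>s. s \<in> \<sigma> \<Longrightarrow> g0 (x + s0 + s) + m \<bullet> (x + s0 + s) = g0 (x + s0) + m \<bullet> (x + s0)"
        using cone_zero[OF P(1)] by (metis add.right_neutral)
      have le: "ext (F k) P \<le> F k (x + s0)" for k
      proof -
        obtain s1 r where s1: "s1 \<in> \<sigma>" "r > 0" "\<forall>y\<in>ball (x + s0) r. \<forall>s\<in>\<sigma>. F k (y + s1 + s) = ext (F k) (\<sigma>, coset \<sigma> y)"
          using tame_deep[OF Ft P(1)] by blast
        have "ext (F k) P = F k (x + s0 + s1)"
          using s1(3)[rule_format, of "x + s0" 0] s1(2) cone_zero[OF P(1)] P(2) s0 by (simp add: coset_shift span_base)
        also have "\<dots> \<le> F k (x + s0)"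
        proof -
          have "w k (x + s0 + s1) \<le> w k (x + s0) - m \<bullet> s1"
            using ad[of k] H_slope[OF m s1(1)] unfolding admissible_def by (metis add_uminus_conv_diff)
          moreover have "g0 (x + s0 + s1) = g0 (x + s0) - m \<bullet> s1" using z(2)[OF s1(1)] by (simp add: inner_add_right)
          ultimately show ?thesis by (simp add: F_def)
        qed
        finally show ?thesis .
      qed
      have "(\<lambda>k. F k (x + s0)) \<longlonglongrightarrow> u (x + s0) - g0 (x + s0)"
        unfolding F_def by (intro tendsto_intros w_lim)
      moreover have "u (x + s0) - g0 (x + s0) < c" using z(1) by (simp add: u_def)
      ultimately have "\<forall>\<^sub>F k in sequentially. F k (x + s0) < c" by (rule order_tendstoD(2))
      then show ?thesis by (rule eventually_mono) (use le le_less_trans in blast)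
    qed
    show "(\<lambda>k. ereal (ext (F k) P)) \<longlonglongrightarrow> \<phi> P"
    proof (rule order_tendstoI)
      fix a assume "a < \<phi> P"
      then show "\<forall>\<^sub>F k in sequentially. a < ereal (ext (F k) P)" using lower less_le_trans by (intro always_eventually) blast
    next
      fix a assume "\<phi> P < a"
      then obtain c where c: "\<phi> P < ereal c" "ereal c < a" using ereal_dense2 by blast
      from upper[OF c(1)] show "\<forall>\<^sub>F k in sequentially. ereal (ext (F k) P) < a"
      proof (rule eventually_mono)
        fix k assume "ext (F k) P < c"
        then have "ereal (ext (F k) P) < ereal c" by simp
        then show "ereal (ext (F k) P) < a" using c(2) by (rule less_trans)
      qed
    qed
  qed
qed

end

theorem corollary5p4p5:
  fixes \<Sigma> :: "(real^'n) set set"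
    and \<Psi> g0 :: "real^'n \<Rightarrow> real"
    and \<theta> :: "'n functional"
    and \<phi> :: "'n pt \<Rightarrow> ereal"
  assumes "complete_fan \<Sigma>"
    and "piecewise_linear \<Sigma> \<Psi>"
    and "concave_on UNIV \<Psi>"
    and "smooth_green \<Sigma> \<Psi> g0"
    and "is_c1 \<Sigma> \<Psi> g0 \<theta>"
    and "theta_psh \<Sigma> \<theta> \<phi>"
  shows "\<exists>h :: nat \<Rightarrow> 'n pt \<Rightarrow> real.
    (\<forall>k. smooth_function \<Sigma> (trop_var \<Sigma>) (h k) \<and> theta_psh \<Sigma> \<theta> (\<lambda>P. ereal (h k P))) \<and>
    (\<forall>k. \<forall>P \<in> trop_var \<Sigma>. h (Suc k) P \<le> h k P) \<and>
    (\<forall>P \<in> trop_var \<Sigma>. (\<lambda>k. ereal (h k P)) \<longlonglongrightarrow> \<phi> P)"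
proof -
  interpret concave_setting \<Sigma> \<Psi> g0 \<theta>
    by unfold_locales (fact assms)+
  show ?thesis
  proof (cases "\<forall>P \<in> trop_var \<Sigma>. \<phi> P = -\<infinity>")
    case True
    then show ?thesis by (intro approximation_minus_infinity) blast
  next
    case False
    interpret concave_psh_setting \<Sigma> \<Psi> g0 \<theta> \<phi>
    proof unfold_locales
      have alt: "(\<forall>P \<in> trop_var \<Sigma>. \<phi> P \<noteq> \<infinity>)" "strongly_usc \<Sigma> \<phi>" "\<forall>x. \<phi> (emb x) \<noteq> -\<infinity>"
        "locally_integrable (\<lambda>x. real_of_ereal (\<phi> (emb x)))"
        "positive_current \<Sigma> (trop_var \<Sigma>) 1 (\<lambda>\<omega>. ddc (trop_var \<Sigma>) (\<lambda>x. real_of_ereal (\<phi> (emb x))) \<omega> + \<theta> \<omega>)"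
        using assms(6) False unfolding theta_psh_def by blast+
      show "\<phi> P \<noteq> \<infinity>" if "P \<in> trop_var \<Sigma>" for P using alt(1) that by blast
      show "strongly_usc \<Sigma> \<phi>" by (fact alt(2))
      show "\<phi> (emb x) \<noteq> -\<infinity>" for x using alt(3) by blast
      show "locally_integrable (\<lambda>x. real_of_ereal (\<phi> (emb x)))" by (fact alt(4))
      show "positive_current \<Sigma> (trop_var \<Sigma>) 1 (\<lambda>\<omega>. ddc (trop_var \<Sigma>) (\<lambda>x. real_of_ereal (\<phi> (emb x))) \<omega> + \<theta> \<omega>)"
        by (fact alt(5))
    qed
    show ?thesis by (rule approximation)
  qed
qed

end
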